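(* Let $(M,J,\omega)$ be an almost-Kähler manifold and let $\nabla$ be an affine connection on $M$, possibly with nontrivial torsion, which respects the almost-Kähler structure ($\nabla\omega=0$, $\nabla g=0$, $\nabla J=0$). With the notation of the context, there exists a unique element $r\in\mathcal{W}\otimes\Lambda$ such that $r^{(0)}=r^{(1)}=0$, $\deg_a(r)=1$, $\delta^{-1}r=0$, satisfying the equation $$\delta r = T+R+\nabla r-\frac{i}{\nu}\, r\circ r .$$ It can be calculated recursively with respect to the total degree $\mathrm{Deg}$ as follows: $$r^{(2)}=\delta^{-1}T,$$ $$r^{(3)}=\delta^{-1}\Bigl(R+\nabla r^{(2)}-\frac{i}{\nu}\,r^{(2)}\circ r^{(2)}\Bigr),$$ $$r^{(k+3)}=\delta^{-1}\Bigl(\nabla r^{(k+2)}-\frac{i}{\nu}\sum_{l=0}^{k} r^{(l+2)}\circ r^{(k-l+2)}\Bigr),\qquad k\ge 1.$$ Moreover, the Fedosov connection $D:=-\delta+\nabla-\frac{i}{\nu}\,\mathrm{ad}_{Wick}(r)$ is flat, i.e., $D^2=0$.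
   Context: An almost-Kähler manifold $(M,J,\omega)$ is a manifold $M$ with an almost-complex structure $J$ and a symplectic form $\omega$ such that $\omega(JX,JY)=\omega(X,Y)$ for all vector fields $X,Y$, and $g(X,Y)=\omega(JX,Y)$ is a Riemannian metric (in fact $g$ is only required to be nondegenerate, not necessarily positive definite). Local notation. In local coordinates $\{x^k\}$: $\partial_j=\partial/\partial x^j$, $\omega_{jk}=\omega(\partial_j,\partial_k)$, $g_{jk}=g(\partial_j,\partial_k)$, $J(\partial_j)=J_j^k\partial_k$; $(\omega^{jk})$ and $(g^{jk})$ are the inverse matrices of $(\omega_{jk})$ and $(g_{jk})$. Repeated indices are summed. $\Gamma^l_{jk}$ are the Christoffel symbols of $\nabla$ ($\nabla_{\partial_j}\partial_k=\Gamma^l_{jk}\partial_l$), $T^l_{jk}=\Gamma^l_{jk}-\Gamma^l_{kj}$ is the torsion, and $$R^s_{tkl}=\frac{\partial\Gamma^s_{lt}}{\partial x^k}-\frac{\partial\Gamma^s_{kt}}{\partial x^l}+\Gamma^s_{k\alpha}\Gamma^\alpha_{lt}-\Gamma^s_{l\alpha}\Gamma^\alpha_{kt}$$ is the curvature. $\{y^k\}$ are the fibre coordinates on $TM$ with respect to the frame $\{\partial_k\}$. Wick algebra bundle. Put $\Lambda^{jk}=\omega^{jk}-i g^{jk}$. For $x\in M$, $W_x$ is the space of formal series $a(\nu,y)=\sum_{r\ge0,|\alpha|\ge0}\nu^r a_{r,\alpha}y^\alpha$ (complex coefficients, $\alpha$ a multi-index) with the formal Wick product $$a\circ b\,(y)=\exp\Bigl(\frac{i\nu}{2}\Lambda^{jk}\frac{\partial^2}{\partial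 y^j\partial z^k}\Bigr)a(y)b(z)\Big|_{z=y}.$$ $W=\bigcup_x W_x$ is the resulting bundle of algebras, $\mathcal{W}$ its smooth sections, and $\mathcal{W}\otimes\Lambda$ the $W$-valued differential forms, with $\circ$ extended using the exterior product of scalar forms. Gradings. $\deg_\nu(\nu)=1$, $\deg_s(y^k)=1$, $\deg_a(dx^k)=1$, all other gradings of $\nu,y^k,dx^k$ being zero; $\mathrm{Deg}=2\deg_\nu+\deg_s$. The $\mathrm{Deg}$-homogeneous component of degree $k$ of $a$ is denoted $a^{(k)}$. $\mathrm{ad}_{Wick}(a)$ is the $\deg_a$-graded commutator with $a$ in $(\mathcal{W}\otimes\Lambda,\circ)$. Operators. $\nabla$ is extended to $\mathcal{W}\otimes\Lambda$ by $$\nabla(a\otimes\lambda)=\Bigl(\frac{\partial a}{\partial x^j}-\Gamma^l_{jk}y^k\frac{\partial a}{\partial y^l}\Bigr)\otimes(dx^j\wedge\lambda)+a\otimes d\lambda$$ for $a\in\mathcal{W}$ and a scalar form $\lambda$. Further $\delta(a)=dx^j\wedge\frac{\partial a}{\partial y^j}$, and for $a$ homogeneous with $\deg_s(a)=p$, $\deg_a(a)=q$, $\delta^{-1}a=\frac{1}{p+q}\,y^j\, i(\partial/\partial x^j)a$ if $p+q>0$ and $\delta^{-1}a=0$ if $p=q=0$ ($i(\cdot)$ is the interior product), extended linearly. Elements $T,R\in\mathcal{W}\otimes\Lambda$: $$T=\tfrac12\,\omega_{s\alpha}T^\alpha_{kl}\,y^s\,dx^k\wedge dx^l,\qquad R=\tfrac14\,\omega_{s\alpha}R^\alpha_{tkl}\,y^sy^t\,dx^k\wedge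 dx^l .$$ *)

theory Defs
  imports "HOL-Analysis.Analysis" "HOL-Library.Function_Algebras"
begin

section \<open>Smooth functions, charts and atlases\<close>

definition partial_deriv ::
  "'n::finite \<Rightarrow> (real^'n \<Rightarrow> 'b::real_normed_vector) \<Rightarrow> real^'n \<Rightarrow> 'b" where
  "partial_deriv j f x = frechet_derivative f (at x) (axis j 1)"

text \<open>Class \<open>C\<^sup>k\<close>, used for open sets \<open>S\<close> only.\<close>

primrec Ck_on ::
  "nat \<Rightarrow> (real^'n::finite) set \<Rightarrow> (real^'n \<Rightarrow> 'b::real_normed_vector) \<Rightarrow> bool" where
  "Ck_on 0 S f \<longleftrightarrow> continuous_on S f"
| "Ck_on (Suc k) S f \<longleftrightarrow> f differentiable_on S \<and> (\<forall>j. Ck_on k S (partial_deriv j f))"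

definition smooth_on ::
  "(real^'n::finite) set \<Rightarrow> (real^'n \<Rightarrow> 'b::real_normed_vector) \<Rightarrow> bool" where
  "smooth_on S f \<longleftrightarrow> (\<forall>k. Ck_on k S f)"

text \<open>A chart is a domain together with a coordinate map (irrelevant outside the domain).
  The manifold is the whole type \<open>'m\<close>; its dimension is \<open>CARD('n)\<close>.\<close>

type_synonym ('m, 'n) chart = "'m set \<times> ('m \<Rightarrow> real^'n)"

abbreviation dom_of :: "('m, 'n) chart \<Rightarrow> 'm set" where
  "dom_of c \<equiv> fst c"

abbreviation coords :: "('m, 'n) chart \<Rightarrow> 'm \<Rightarrow> real^'n" where
  "coords c \<equiv> snd c"

definition chart_image :: "('m, 'n) chart \<Rightarrow> (real^'n) set" where
  "chart_image c = coords c ` dom_of c"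

definition chart_inv :: "('m, 'n) chart \<Rightarrow> real^'n \<Rightarrow> 'm" where
  "chart_inv c = inv_into (dom_of c) (coords c)"

definition smooth_atlas ::
  "('m::{t2_space, second_countable_topology}, 'n::finite) chart set \<Rightarrow> bool" where
  "smooth_atlas A \<longleftrightarrow>
     (\<Union>c\<in>A. dom_of c) = UNIV \<and>
     (\<forall>c\<in>A. open (dom_of c) \<and> open (chart_image c) \<and>
        homeomorphism (dom_of c) (chart_image c) (coords c) (chart_inv c)) \<and>
     (\<forall>c\<in>A. \<forall>c'\<in>A.
        smooth_on (coords c ` (dom_of c \<inter> dom_of c')) (\<lambda>x. coords c' (chart_inv c x)))"

definition smooth_in_chart ::
  "('m, 'n::finite) chart \<Rightarrow> ('m \<Rightarrow> 'b::real_normed_vector) \<Rightarrow> bool" where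
  "smooth_in_chart c f \<longleftrightarrow> smooth_on (chart_image c) (\<lambda>x. f (chart_inv c x))"

text \<open>\<open>pd c j f p\<close> is \<open>\<partial>f/\<partial>x\<^sup>j\<close> at the point \<open>p\<close>, in the coordinates of \<open>c\<close>.\<close>

definition pd ::
  "('m, 'n::finite) chart \<Rightarrow> 'n \<Rightarrow> ('m \<Rightarrow> 'b::real_normed_vector) \<Rightarrow> 'm \<Rightarrow> 'b" where
  "pd c j f p = partial_deriv j (\<lambda>x. f (chart_inv c x)) (coords c p)"

text \<open>Entry \<open>(a, j)\<close> is \<open>\<partial>x'\<^sup>a/\<partial>x\<^sup>j\<close>, where \<open>x\<close>, \<open>x'\<close> are the coordinates of \<open>c\<close>, \<open>c'\<close>.\<close>

definition jac :: "('m, 'n::finite) chart \<Rightarrow> ('m, 'n) chart \<Rightarrow> 'm \<Rightarrow> real^'n^'n" where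
  "jac c c' p = (\<chi> a j. pd c j (\<lambda>q. coords c' q $ a) p)"

section \<open>Tensor fields, connections and almost-Kaehler structures\<close>

text \<open>A tensor field is the family of its components with respect to all charts of the atlas,
  subject to the tensorial transformation law; likewise a connection is the family of its
  Christoffel symbols. Conventions: \<open>\<omega> c p $ j $ k\<close> is \<open>\<omega>\<^sub>j\<^sub>k\<close>; \<open>J c p $ j $ k\<close> is \<open>J\<^sub>j\<^sup>k\<close>, i.e. the
  first index is the lower one, \<open>J(\<partial>\<^sub>j) = J\<^sub>j\<^sup>k \<partial>\<^sub>k\<close>; \<open>\<Gamma> c p l j k\<close> is \<open>\<Gamma>\<^sup>l\<^sub>j\<^sub>k\<close>, where
  \<open>\<nabla>\<close> of \<open>\<partial>\<^sub>k\<close> along \<open>\<partial>\<^sub>j\<close> is \<open>\<Gamma>\<^sup>l\<^sub>j\<^sub>k \<partial>\<^sub>l\<close>.\<close>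

type_synonym ('m, 'n) tensor2 = "('m, 'n) chart \<Rightarrow> 'm \<Rightarrow> real^'n^'n"
type_synonym ('m, 'n) christoffel = "('m, 'n) chart \<Rightarrow> 'm \<Rightarrow> 'n \<Rightarrow> 'n \<Rightarrow> 'n \<Rightarrow> real"

definition covariant_tensor2 ::
  "('m, 'n::finite) chart set \<Rightarrow> ('m, 'n) tensor2 \<Rightarrow> bool" where
  "covariant_tensor2 A h \<longleftrightarrow>
     (\<forall>c\<in>A. \<forall>j k. smooth_in_chart c (\<lambda>p. h c p $ j $ k)) \<and>
     (\<forall>c\<in>A. \<forall>c'\<in>A. \<forall>p \<in> dom_of c \<inter> dom_of c'. \<forall>j k.
        h c p $ j $ k =
          (\<Sum>a\<in>UNIV. \<Sum>b\<in>UNIV. jac c c' p $ a $ j * jac c c' p $ b $ k * h c' p $ a $ b))"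

definition endomorphism_field ::
  "('m, 'n::finite) chart set \<Rightarrow> ('m, 'n) tensor2 \<Rightarrow> bool" where
  "endomorphism_field A J \<longleftrightarrow>
     (\<forall>c\<in>A. \<forall>j k. smooth_in_chart c (\<lambda>p. J c p $ j $ k)) \<and>
     (\<forall>c\<in>A. \<forall>c'\<in>A. \<forall>p \<in> dom_of c \<inter> dom_of c'. \<forall>j b.
        (\<Sum>k\<in>UNIV. J c p $ j $ k * jac c c' p $ b $ k) =
        (\<Sum>a\<in>UNIV. jac c c' p $ a $ j * J c' p $ a $ b))"

definition almost_complex ::
  "('m, 'n::finite) chart set \<Rightarrow> ('m, 'n) tensor2 \<Rightarrow> bool" where
  "almost_complex A J \<longleftrightarrow> endomorphism_field A J \<and>
     (\<forall>c\<in>A. \<forall>p \<in> dom_of c. J c p ** J c p = - mat 1)"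

definition symplectic_form ::
  "('m, 'n::finite) chart set \<Rightarrow> ('m, 'n) tensor2 \<Rightarrow> bool" where
  "symplectic_form A \<omega> \<longleftrightarrow> covariant_tensor2 A \<omega> \<and>
     (\<forall>c\<in>A. \<forall>p \<in> dom_of c.
        (\<forall>j k. \<omega> c p $ k $ j = - \<omega> c p $ j $ k) \<and>
        invertible (\<omega> c p) \<and>
        (\<forall>j k l. pd c j (\<lambda>q. \<omega> c q $ k $ l) p + pd c k (\<lambda>q. \<omega> c q $ l $ j) p
                 + pd c l (\<lambda>q. \<omega> c q $ j $ k) p = 0))"

definition pseudo_riemannian ::
  "('m, 'n::finite) chart set \<Rightarrow> ('m, 'n) tensor2 \<Rightarrow> bool" where
  "pseudo_riemannian A g \<longleftrightarrow> covariant_tensor2 A g \<and>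
     (\<forall>c\<in>A. \<forall>p \<in> dom_of c. (\<forall>j k. g c p $ k $ j = g c p $ j $ k) \<and> invertible (g c p))"

text \<open>\<open>g(X,Y) = \<omega>(JX,Y)\<close>.\<close>

definition metric ::
  "('m, 'n::finite) tensor2 \<Rightarrow> ('m, 'n) tensor2 \<Rightarrow> ('m, 'n) tensor2" where
  "metric J \<omega> c p = (\<chi> j k. \<Sum>a\<in>UNIV. J c p $ j $ a * \<omega> c p $ a $ k)"

text \<open>No positivity of the metric is required.\<close>

definition almost_kaehler ::
  "('m::{t2_space, second_countable_topology}, 'n::finite) chart set \<Rightarrow>
   ('m, 'n) tensor2 \<Rightarrow> ('m, 'n) tensor2 \<Rightarrow> bool" where
  "almost_kaehler A J \<omega> \<longleftrightarrow>
     smooth_atlas A \<and> almost_complex A J \<and> symplectic_form A \<omega> \<and>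
     (\<forall>c\<in>A. \<forall>p \<in> dom_of c. \<forall>j k.
        (\<Sum>a\<in>UNIV. \<Sum>b\<in>UNIV. J c p $ j $ a * J c p $ k $ b * \<omega> c p $ a $ b) = \<omega> c p $ j $ k) \<and>
     pseudo_riemannian A (metric J \<omega>)"

definition affine_connection ::
  "('m, 'n::finite) chart set \<Rightarrow> ('m, 'n) christoffel \<Rightarrow> bool" where
  "affine_connection A \<Gamma> \<longleftrightarrow>
     (\<forall>c\<in>A. \<forall>l j k. smooth_in_chart c (\<lambda>p. \<Gamma> c p l j k)) \<and>
     (\<forall>c\<in>A. \<forall>c'\<in>A. \<forall>p \<in> dom_of c \<inter> dom_of c'. \<forall>a j k.
        (\<Sum>l\<in>UNIV. \<Gamma> c p l j k * jac c c' p $ a $ l) =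
        pd c j (\<lambda>q. jac c c' q $ a $ k) p +
        (\<Sum>b\<in>UNIV. \<Sum>d\<in>UNIV. \<Gamma> c' p a b d * jac c c' p $ b $ j * jac c c' p $ d $ k))"

text \<open>\<open>\<nabla>h = 0\<close> for a covariant two-tensor, and \<open>\<nabla>J = 0\<close> for an endomorphism field.\<close>

definition parallel_tensor2 ::
  "('m, 'n::finite) chart set \<Rightarrow> ('m, 'n) christoffel \<Rightarrow> ('m, 'n) tensor2 \<Rightarrow> bool" where
  "parallel_tensor2 A \<Gamma> h \<longleftrightarrow>
     (\<forall>c\<in>A. \<forall>p \<in> dom_of c. \<forall>j k l.
        pd c j (\<lambda>q. h c q $ k $ l) p
        - (\<Sum>m\<in>UNIV. \<Gamma> c p m j k * h c p $ m $ l)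
        - (\<Sum>m\<in>UNIV. \<Gamma> c p m j l * h c p $ k $ m) = 0)"

definition parallel_endomorphism ::
  "('m, 'n::finite) chart set \<Rightarrow> ('m, 'n) christoffel \<Rightarrow> ('m, 'n) tensor2 \<Rightarrow> bool" where
  "parallel_endomorphism A \<Gamma> J \<longleftrightarrow>
     (\<forall>c\<in>A. \<forall>p \<in> dom_of c. \<forall>j k l.
        pd c j (\<lambda>q. J c q $ k $ l) p
        + (\<Sum>m\<in>UNIV. \<Gamma> c p l j m * J c p $ k $ m)
        - (\<Sum>m\<in>UNIV. \<Gamma> c p m j k * J c p $ m $ l) = 0)"

definition respects_almost_kaehler ::
  "('m, 'n::finite) chart set \<Rightarrow> ('m, 'n) tensor2 \<Rightarrow> ('m, 'n) tensor2 \<Rightarrow>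
   ('m, 'n) christoffel \<Rightarrow> bool" where
  "respects_almost_kaehler A J \<omega> \<Gamma> \<longleftrightarrow>
     parallel_tensor2 A \<Gamma> \<omega> \<and> parallel_tensor2 A \<Gamma> (metric J \<omega>) \<and> parallel_endomorphism A \<Gamma> J"

definition torsion :: "('m, 'n::finite) christoffel \<Rightarrow> ('m, 'n) christoffel" where
  "torsion \<Gamma> c p l j k = \<Gamma> c p l j k - \<Gamma> c p l k j"

text \<open>\<open>curvature \<Gamma> c p s t k l\<close> is \<open>R\<^sup>s\<^sub>t\<^sub>k\<^sub>l\<close>.\<close>

definition curvature ::
  "('m, 'n::finite) christoffel \<Rightarrow> ('m, 'n) chart \<Rightarrow> 'm \<Rightarrow> 'n \<Rightarrow> 'n \<Rightarrow> 'n \<Rightarrow> 'n \<Rightarrow> real" where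
  "curvature \<Gamma> c p s t k l =
     pd c k (\<lambda>q. \<Gamma> c q s l t) p - pd c l (\<lambda>q. \<Gamma> c q s k t) p
     + (\<Sum>\<alpha>\<in>UNIV. \<Gamma> c p s k \<alpha> * \<Gamma> c p \<alpha> l t)
     - (\<Sum>\<alpha>\<in>UNIV. \<Gamma> c p s l \<alpha> * \<Gamma> c p \<alpha> k t)"

section \<open>The fibres of the Wick algebra bundle tensored with forms\<close>

text \<open>\<open>a r \<alpha> I\<close> is the coefficient of \<open>\<nu>\<^sup>r y\<^sup>\<alpha> dx\<^sup>I\<close>, where \<open>dx\<^sup>I\<close> is the wedge product of the
  \<open>dx\<^sup>i\<close>, \<open>i \<in> I\<close>, in increasing order of the indices. The linear order on the index type \<open>'n\<close>
  serves only to fix this basis. Addition, subtraction and zero are pointwise.\<close>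

type_synonym 'n wform = "nat \<Rightarrow> ('n \<Rightarrow> nat) \<Rightarrow> 'n set \<Rightarrow> complex"

definition wscale :: "complex \<Rightarrow> 'n wform \<Rightarrow> 'n wform" where
  "wscale z a = (\<lambda>r \<alpha> I. z * a r \<alpha> I)"

definition wone :: "'n wform" where
  "wone = (\<lambda>r \<alpha> I. if r = 0 \<and> \<alpha> = (\<lambda>_. 0) \<and> I = {} then 1 else 0)"

definition nu_mult :: "'n wform \<Rightarrow> 'n wform" where
  "nu_mult a = (\<lambda>r \<alpha> I. case r of 0 \<Rightarrow> 0 | Suc s \<Rightarrow> a s \<alpha> I)"

text \<open>Multiplication by \<open>1/\<nu>\<close>; specified only for multiples of \<open>\<nu>\<close>.\<close>

definition nu_div :: "'n wform \<Rightarrow> 'n wform" where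
  "nu_div a = (THE b. nu_mult b = a)"

definition dy :: "'n \<Rightarrow> 'n wform \<Rightarrow> 'n wform" where
  "dy j a = (\<lambda>r \<alpha> I. of_nat (\<alpha> j + 1) * a r (\<alpha>(j := \<alpha> j + 1)) I)"

definition y_mult :: "'n \<Rightarrow> 'n wform \<Rightarrow> 'n wform" where
  "y_mult j a = (\<lambda>r \<alpha> I. if \<alpha> j = 0 then 0 else a r (\<alpha>(j := \<alpha> j - 1)) I)"

text \<open>\<open>dx_wedge j a = dx\<^sup>j \<and> a\<close> and \<open>dx_contract j a = i(\<partial>/\<partial>x\<^sup>j) a\<close>.\<close>

definition dx_wedge :: "'n::{finite, linorder} \<Rightarrow> 'n wform \<Rightarrow> 'n wform" where
  "dx_wedge j a = (\<lambda>r \<alpha> I. if j \<in> I then (- 1) ^ card {i \<in> I. i < j} * a r \<alpha> (I - {j}) else 0)"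

definition dx_contract :: "'n::{finite, linorder} \<Rightarrow> 'n wform \<Rightarrow> 'n wform" where
  "dx_contract j a = (\<lambda>r \<alpha> I. if j \<notin> I then (- 1) ^ card {i \<in> I. i < j} * a r \<alpha> (insert j I) else 0)"

text \<open>The undeformed product: product of series in \<open>\<nu>\<close>, \<open>y\<close> and wedge product of forms, with
  \<open>dx\<^sup>K \<and> dx\<^sup>L = wedge_sign K L dx\<^sup>K\<^sup>\<union>\<^sup>L\<close> for disjoint \<open>K\<close>, \<open>L\<close>.\<close>

definition wedge_sign :: "'n::{finite, linorder} set \<Rightarrow> 'n set \<Rightarrow> complex" where
  "wedge_sign K L = (- 1) ^ card {(k, l). k \<in> K \<and> l \<in> L \<and> l < k}"

definition wmult :: "'n::{finite, linorder} wform \<Rightarrow> 'n wform \<Rightarrow> 'n wform" where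
  "wmult a b = (\<lambda>r \<alpha> I. \<Sum>s\<le>r. \<Sum>\<beta> | \<forall>i. \<beta> i \<le> \<alpha> i. \<Sum>K\<in>Pow I.
      wedge_sign K (I - K) * a s \<beta> K * b (r - s) (\<lambda>i. \<alpha> i - \<beta> i) (I - K))"

text \<open>The \<open>m\<close>-th power of \<open>L\<^sup>j\<^sup>k \<partial>\<^sup>2/\<partial>y\<^sup>j\<partial>z\<^sup>k\<close>, applied to \<open>a(y) b(z)\<close> and restricted to \<open>z = y\<close>.\<close>

primrec bidiff ::
  "('n::{finite, linorder} \<Rightarrow> 'n \<Rightarrow> complex) \<Rightarrow> nat \<Rightarrow> 'n wform \<Rightarrow> 'n wform \<Rightarrow> 'n wform" where
  "bidiff L 0 a b = wmult a b"
| "bidiff L (Suc m) a b =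
     (\<Sum>j\<in>UNIV. \<Sum>k\<in>UNIV. wscale (L j k) (bidiff L m (dy j a) (dy k b)))"

text \<open>The exponential series: its \<open>m\<close>-th term carries the factor \<open>\<nu>\<^sup>m\<close>, so only \<open>m \<le> r\<close> contributes
  to the coefficient of \<open>\<nu>\<^sup>r\<close>.\<close>

definition wick ::
  "('n::{finite, linorder} \<Rightarrow> 'n \<Rightarrow> complex) \<Rightarrow> 'n wform \<Rightarrow> 'n wform \<Rightarrow> 'n wform" where
  "wick L a b = (\<lambda>r \<alpha> I. \<Sum>m\<le>r. (\<i> / 2) ^ m / fact m * bidiff L m a b (r - m) \<alpha> I)"

definition ydeg :: "('n::finite \<Rightarrow> nat) \<Rightarrow> nat" where
  "ydeg \<alpha> = (\<Sum>i\<in>UNIV. \<alpha> i)"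

definition Deg_part :: "nat \<Rightarrow> 'n::finite wform \<Rightarrow> 'n wform" where
  "Deg_part k a = (\<lambda>r \<alpha> I. if 2 * r + ydeg \<alpha> = k then a r \<alpha> I else 0)"

definition form_part :: "nat \<Rightarrow> 'n wform \<Rightarrow> 'n wform" where
  "form_part q a = (\<lambda>r \<alpha> I. if card I = q then a r \<alpha> I else 0)"

definition fib_delta :: "'n::{finite, linorder} wform \<Rightarrow> 'n wform" where
  "fib_delta a = (\<Sum>j\<in>UNIV. dx_wedge j (dy j a))"

text \<open>The factor \<open>1/(p+q)\<close> is put on each homogeneous component before applying \<open>y\<^sup>j i(\<partial>/\<partial>x\<^sup>j)\<close>.
  The component with \<open>p = q = 0\<close> is killed (division by zero yields zero).\<close>

definition fib_delta_inv :: "'n::{finite, linorder} wform \<Rightarrow> 'n wform" where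
  "fib_delta_inv a =
     (\<Sum>j\<in>UNIV. y_mult j (dx_contract j (\<lambda>r \<alpha> I. a r \<alpha> I / of_nat (ydeg \<alpha> + card I))))"

definition graded_commutator ::
  "('n::{finite, linorder} \<Rightarrow> 'n \<Rightarrow> complex) \<Rightarrow> 'n wform \<Rightarrow> 'n wform \<Rightarrow> 'n wform" where
  "graded_commutator L a b =
     (\<Sum>p\<le>CARD('n). \<Sum>q\<le>CARD('n).
        wick L (form_part p a) (form_part q b)
        - wscale ((- 1) ^ (p * q)) (wick L (form_part q b) (form_part p a)))"

section \<open>Sections\<close>

text \<open>A section of the bundle is the family of its local expressions in the charts of the
  atlas; local expressions are set to zero where they are meaningless, so that equality of
  families is equality of sections.\<close>

type_synonym ('m, 'n) wsection = "('m, 'n) chart \<Rightarrow> 'm \<Rightarrow> 'n wform"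

definition on_charts :: "('m, 'n) chart set \<Rightarrow> ('m, 'n) wsection \<Rightarrow> ('m, 'n) wsection" where
  "on_charts A a = (\<lambda>c p. if c \<in> A \<and> p \<in> dom_of c then a c p else 0)"

text \<open>\<open>dx\<^sup>I\<close> evaluated on the tangent vectors \<open>ws\<close> (with \<open>length ws = card I\<close>).\<close>

definition dx_eval :: "'n::{finite, linorder} set \<Rightarrow> (real^'n::{finite, linorder}) list \<Rightarrow> real" where
  "dx_eval I ws = (\<Sum>\<pi> | \<pi> permutes {..<length ws}.
      of_int (sign \<pi>) * (\<Prod>i<length ws. (ws ! \<pi> i) $ (sorted_list_of_set I ! i)))"

text \<open>The part of \<open>a\<close> with \<open>deg\<^sub>\<nu> = r\<close>, \<open>deg\<^sub>s = k\<close> and \<open>deg\<^sub>a = length ws\<close> is a homogeneous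
  polynomial on the tangent space with values in alternating forms; it is evaluated here at the
  tangent vector with fibre coordinates \<open>v\<close> and on the tangent vectors \<open>ws\<close>.\<close>

definition wvalue ::
  "'n::{finite, linorder} wform \<Rightarrow> nat \<Rightarrow> nat \<Rightarrow> real^'n::{finite, linorder} \<Rightarrow> (real^'n::{finite, linorder}) list \<Rightarrow> complex" where
  "wvalue a r k v ws =
     (\<Sum>\<alpha> | ydeg \<alpha> = k. \<Sum>I | card I = length ws.
        a r \<alpha> I * of_real ((\<Prod>i\<in>UNIV. v $ i ^ \<alpha> i) * dx_eval I ws))"

text \<open>Local expressions in two charts define the same element of the fibre iff their values on
  tangent vectors agree, the components of tangent vectors being related by the Jacobian.\<close>

definition wick_forms ::
  "('m, 'n::{finite, linorder}) chart set \<Rightarrow> ('m, 'n) wsection set" where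
  "wick_forms A = {a.
     on_charts A a = a \<and>
     (\<forall>c\<in>A. \<forall>r \<alpha> I. smooth_in_chart c (\<lambda>p. a c p r \<alpha> I)) \<and>
     (\<forall>c\<in>A. \<forall>c'\<in>A. \<forall>p \<in> dom_of c \<inter> dom_of c'. \<forall>r k v ws.
        wvalue (a c p) r k v ws =
        wvalue (a c' p) r k (jac c c' p *v v) (map (\<lambda>w. jac c c' p *v w) ws))}"

definition Lam ::
  "('m, 'n::finite) tensor2 \<Rightarrow> ('m, 'n) tensor2 \<Rightarrow> ('m, 'n) chart \<Rightarrow> 'm \<Rightarrow> 'n \<Rightarrow> 'n \<Rightarrow> complex" where
  "Lam J \<omega> c p j k =
     of_real (matrix_inv (\<omega> c p) $ j $ k) - \<i> * of_real (matrix_inv (metric J \<omega> c p) $ j $ k)"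

definition wick_prod ::
  "('m, 'n::{finite, linorder}) tensor2 \<Rightarrow> ('m, 'n) tensor2 \<Rightarrow>
   ('m, 'n) wsection \<Rightarrow> ('m, 'n) wsection \<Rightarrow> ('m, 'n) wsection" where
  "wick_prod J \<omega> a b = (\<lambda>c p. wick (Lam J \<omega> c p) (a c p) (b c p))"

definition ad_wick ::
  "('m, 'n::{finite, linorder}) tensor2 \<Rightarrow> ('m, 'n) tensor2 \<Rightarrow>
   ('m, 'n) wsection \<Rightarrow> ('m, 'n) wsection \<Rightarrow> ('m, 'n) wsection" where
  "ad_wick J \<omega> a b = (\<lambda>c p. graded_commutator (Lam J \<omega> c p) (a c p) (b c p))"

definition i_over_nu :: "('m, 'n) wsection \<Rightarrow> ('m, 'n) wsection" where
  "i_over_nu a = (\<lambda>c p. wscale \<i> (nu_div (a c p)))"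

definition Deg_comp :: "nat \<Rightarrow> ('m, 'n::finite) wsection \<Rightarrow> ('m, 'n) wsection" where
  "Deg_comp k a = (\<lambda>c p. Deg_part k (a c p))"

definition has_deg_a :: "nat \<Rightarrow> ('m, 'n) wsection \<Rightarrow> bool" where
  "has_deg_a q a \<longleftrightarrow> (\<forall>c p. form_part q (a c p) = a c p)"

definition delta :: "('m, 'n::{finite, linorder}) wsection \<Rightarrow> ('m, 'n) wsection" where
  "delta a = (\<lambda>c p. fib_delta (a c p))"

definition delta_inv :: "('m, 'n::{finite, linorder}) wsection \<Rightarrow> ('m, 'n) wsection" where
  "delta_inv a = (\<lambda>c p. fib_delta_inv (a c p))"

text \<open>Since local expressions are expanded in the basis \<open>dx\<^sup>I\<close>, which consists of closed forms, the
  summand \<open>a \<otimes> d\<lambda>\<close> of the defining formula does not occur.\<close>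

definition nabla ::
  "('m, 'n::{finite, linorder}) chart set \<Rightarrow> ('m, 'n) christoffel \<Rightarrow>
   ('m, 'n) wsection \<Rightarrow> ('m, 'n) wsection" where
  "nabla A \<Gamma> a = on_charts A (\<lambda>c p.
     \<Sum>j\<in>UNIV. dx_wedge j
       ((\<lambda>r \<alpha> I. pd c j (\<lambda>q. a c q r \<alpha> I) p)
        - (\<Sum>k\<in>UNIV. \<Sum>l\<in>UNIV. wscale (of_real (\<Gamma> c p l j k)) (y_mult k (dy l (a c p))))))"

definition T_elem ::
  "('m, 'n::{finite, linorder}) chart set \<Rightarrow> ('m, 'n) tensor2 \<Rightarrow> ('m, 'n) christoffel \<Rightarrow>
   ('m, 'n) wsection" where
  "T_elem A \<omega> \<Gamma> = on_charts A (\<lambda>c p.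
     \<Sum>s\<in>UNIV. \<Sum>\<alpha>\<in>UNIV. \<Sum>k\<in>UNIV. \<Sum>l\<in>UNIV.
       wscale (of_real (1/2 * \<omega> c p $ s $ \<alpha> * torsion \<Gamma> c p \<alpha> k l))
         (y_mult s (dx_wedge k (dx_wedge l wone))))"

definition R_elem ::
  "('m, 'n::{finite, linorder}) chart set \<Rightarrow> ('m, 'n) tensor2 \<Rightarrow> ('m, 'n) christoffel \<Rightarrow>
   ('m, 'n) wsection" where
  "R_elem A \<omega> \<Gamma> = on_charts A (\<lambda>c p.
     \<Sum>s\<in>UNIV. \<Sum>\<alpha>\<in>UNIV. \<Sum>t\<in>UNIV. \<Sum>k\<in>UNIV. \<Sum>l\<in>UNIV.
       wscale (of_real (1/4 * \<omega> c p $ s $ \<alpha> * curvature \<Gamma> c p \<alpha> t k l))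
         (y_mult s (y_mult t (dx_wedge k (dx_wedge l wone)))))"

text \<open>The normalisation conditions and the equation characterising the element \<open>r\<close>.\<close>

definition fedosov_solution ::
  "('m, 'n::{finite, linorder}) chart set \<Rightarrow> ('m, 'n) tensor2 \<Rightarrow> ('m, 'n) tensor2 \<Rightarrow>
   ('m, 'n) christoffel \<Rightarrow> ('m, 'n) wsection \<Rightarrow> bool" where
  "fedosov_solution A J \<omega> \<Gamma> r \<longleftrightarrow>
     r \<in> wick_forms A \<and>
     Deg_comp 0 r = 0 \<and> Deg_comp 1 r = 0 \<and> has_deg_a 1 r \<and> delta_inv r = 0 \<and>
     delta r = T_elem A \<omega> \<Gamma> + R_elem A \<omega> \<Gamma> + nabla A \<Gamma> r - i_over_nu (wick_prod J \<omega> r r)"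

definition fedosov_D ::
  "('m, 'n::{finite, linorder}) chart set \<Rightarrow> ('m, 'n) tensor2 \<Rightarrow> ('m, 'n) tensor2 \<Rightarrow>
   ('m, 'n) christoffel \<Rightarrow> ('m, 'n) wsection \<Rightarrow> ('m, 'n) wsection \<Rightarrow> ('m, 'n) wsection" where
  "fedosov_D A J \<omega> \<Gamma> r a = - delta a + nabla A \<Gamma> a - i_over_nu (ad_wick J \<omega> r a)"

end

theory Submission
  imports Defs
begin

text \<open>By the Hodge decomposition \<open>\<delta>\<delta>\<^sup>-\<^sup>1 + \<delta>\<^sup>-\<^sup>1\<delta> = id\<close> on forms of positive degree, a solution is a fixed
  point of \<open>r \<mapsto> \<delta>\<^sup>-\<^sup>1(T + R + \<nabla>r - (i/\<nu>) r \<circ> r)\<close>. This map raises the total degree of differences of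
  elements without components of degree below two, so it has exactly one fixed point, which is
  the limit of the iterates of \<open>0\<close>; comparing components gives the recursion.

  Conversely, let \<open>r\<close> be the fixed point and \<open>Z = \<delta>r - (T + R + \<nabla>r - (i/\<nu>) r \<circ> r)\<close>. Then \<open>\<delta>\<^sup>-\<^sup>1Z = 0\<close>, and
  the relations \<open>\<delta>\<nabla> + \<nabla>\<delta> = (i/\<nu>) ad T\<close>, \<open>\<nabla>\<^sup>2 = -(i/\<nu>) ad R\<close> with the Bianchi identities \<open>\<delta>T = 0\<close>,
  \<open>\<delta>R = \<nabla>T\<close>, \<open>\<nabla>R = 0\<close> yield \<open>\<delta>Z = \<nabla>Z - (i/\<nu>)[r, Z]\<close>. Therefore \<open>Z = \<delta>\<^sup>-\<^sup>1(\<nabla>Z - (i/\<nu>)[r, Z])\<close>, which forces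
  \<open>Z = 0\<close> degree by degree. Since \<open>D\<^sup>2 = (i/\<nu>) ad Z\<close>, the connection \<open>D\<close> is flat.

  All this takes place in one chart. That the iterates are sections is checked on the values of
  their components at tangent vectors, where the transformation law is composition with the
  Jacobian.\<close>

text \<open>Two conventions shape the calculus. Signs: \<open>parity\<close> multiplies a form of
  degree q by (-1)^q, so that \<delta>, \<nabla> and the Wick product obey Leibniz rules for
  inhomogeneous forms, and graded commutators are only ever taken with an even or an odd element
  (\<open>wick_comm\<close>, \<open>odd_comm\<close>). Division: \<open>nu_div\<close> is specified
  for multiples of \<nu> only. Everything divided below is a graded commutator or comes from the
  square of a one-form, and its \<nu>^0 part vanishes because the undeformed product is graded
  commutative.

  The degree count is this: \<delta>^-1 raises \<open>Deg\<close> by one, \<nabla> keeps it, the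
  product is graded and 1/\<nu> lowers it by two; a factor r that starts in degree two makes up for
  exactly this loss.

  Of the Bianchi identities only \<delta>T = 0 is computed with Christoffel symbols, and there
  d\<omega> = 0 enters. The other obstacle is invariance: monomials and the basis dx^I have clumsy
  transformation laws, whereas a value at a tangent vector can be differentiated in that vector,
  which handles \<partial>/\<partial>y directly.\<close>

lemma sum_apply: "(\<Sum>x\<in>X. f x) y = (\<Sum>x\<in>X. f x y)"
  by (induct X rule: infinite_finite_induct) auto

section \<open>Linear operators on the coefficients\<close>

definition parity :: "'n wform \<Rightarrow> 'n wform" where
  "parity a = (\<lambda>r \<alpha> I. (- 1) ^ card I * a r \<alpha> I)"

text \<open>Division by \<open>\<nu>\<close> made total: the part of degree zero in \<open>\<nu>\<close> is dropped. It agrees with \<open>nu_div\<close>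
  where the latter is specified.\<close>

definition nu_shift :: "'n wform \<Rightarrow> 'n wform" where
  "nu_shift a = (\<lambda>r. a (Suc r))"

text \<open>The locale \<open>additive\<close> yields the rules for sums, differences, negatives,
  zero and finite sums at once; they are collected in \<open>additive_simps\<close>.\<close>

interpretation wscale: additive "wscale z" for z
  by unfold_locales (auto simp: wscale_def fun_eq_iff algebra_simps)
interpretation nu_mult: additive "nu_mult"
  by unfold_locales (auto simp: nu_mult_def fun_eq_iff algebra_simps split: nat.splits)
interpretation nu_shift: additive "nu_shift"
  by unfold_locales (auto simp: nu_shift_def fun_eq_iff algebra_simps)
interpretation parity: additive "parity"
  by unfold_locales (auto simp: parity_def fun_eq_iff algebra_simps)
interpretation dy: additive "dy j" for j
  by unfold_locales (auto simp: dy_def fun_eq_iff algebra_simps)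
interpretation y_mult: additive "y_mult j" for j
  by unfold_locales (auto simp: y_mult_def fun_eq_iff algebra_simps)
interpretation dx_wedge: additive "dx_wedge j" for j
  by unfold_locales (auto simp: dx_wedge_def fun_eq_iff algebra_simps)
interpretation dx_contract: additive "dx_contract j" for j
  by unfold_locales (auto simp: dx_contract_def fun_eq_iff algebra_simps)
interpretation Deg_part: additive "Deg_part j" for j
  by unfold_locales (auto simp: Deg_part_def fun_eq_iff algebra_simps)
interpretation form_part: additive "form_part j" for j
  by unfold_locales (auto simp: form_part_def fun_eq_iff algebra_simps)

lemmas additive_simps =
  wscale.add wscale.diff wscale.minus wscale.zero wscale.sum
  nu_mult.add nu_mult.diff nu_mult.minus nu_mult.zero nu_mult.sum
  nu_shift.add nu_shift.diff nu_shift.minus nu_shift.zero nu_shift.sum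
  parity.add parity.diff parity.minus parity.zero parity.sum
  dy.add dy.diff dy.minus dy.zero dy.sum
  y_mult.add y_mult.diff y_mult.minus y_mult.zero y_mult.sum
  dx_wedge.add dx_wedge.diff dx_wedge.minus dx_wedge.zero dx_wedge.sum
  dx_contract.add dx_contract.diff dx_contract.minus dx_contract.zero dx_contract.sum
  Deg_part.add Deg_part.diff Deg_part.minus Deg_part.zero Deg_part.sum
  form_part.add form_part.diff form_part.minus form_part.zero form_part.sum

lemma wscale_wscale [simp]: "wscale z (wscale w a) = wscale (z * w) a"
  and wscale_one [simp]: "wscale 1 a = a"
  and wscale_0 [simp]: "wscale 0 a = 0"
  and wscale_add_left: "wscale (z + w) a = wscale z a + wscale w a"
  and wscale_diff_left: "wscale (z - w) a = wscale z a - wscale w a"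
  and wscale_uminus_left: "wscale (- z) a = - wscale z a"
  by (auto simp: wscale_def fun_eq_iff algebra_simps)

lemma wscale_sum_left: "wscale (\<Sum>x\<in>X. f x) a = (\<Sum>x\<in>X. wscale (f x) a)"
  by (induct X rule: infinite_finite_induct) (auto simp: wscale_add_left)

lemma wscale_out:
  "nu_mult (wscale z a) = wscale z (nu_mult a)"
  "nu_shift (wscale z a) = wscale z (nu_shift a)"
  "parity (wscale z a) = wscale z (parity a)"
  "dy j (wscale z a) = wscale z (dy j a)"
  "y_mult j (wscale z a) = wscale z (y_mult j a)"
  "Deg_part k (wscale z a) = wscale z (Deg_part k a)"
  "form_part k (wscale z a) = wscale z (form_part k a)"
  by (auto simp: wscale_def nu_mult_def nu_shift_def parity_def dy_def y_mult_def
      Deg_part_def form_part_def fun_eq_iff split: nat.splits)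

lemma wscale_out_dx:
  "dx_wedge j (wscale z a) = wscale z (dx_wedge j a)"
  "dx_contract j (wscale z a) = wscale z (dx_contract j a)"
  by (auto simp: wscale_def dx_wedge_def dx_contract_def fun_eq_iff)

lemmas wscale_simps = wscale_out wscale_out_dx

section \<open>Commutation relations of \<open>y_mult\<close>, \<open>dy\<close>,
  \<open>dx_wedge\<close> and \<open>dx_contract\<close>\<close>

lemma dy_commute: "dy j (dy k a) = dy k (dy j a)"
  by (cases "j = k") (auto simp: dy_def fun_eq_iff fun_upd_twist)

lemma y_mult_commute: "y_mult j (y_mult k a) = y_mult k (y_mult j a)"
  by (cases "j = k") (auto simp: y_mult_def fun_eq_iff fun_upd_twist)

lemma dy_y_mult: "dy j (y_mult k a) = y_mult k (dy j a) + (if j = k then a else 0)"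
proof (cases "j = k")
  case True
  have "(\<alpha> j + 1) * a r \<alpha> I = \<alpha> j * a r \<alpha> I + a r \<alpha> I" for r \<alpha> I
    by (simp add: algebra_simps)
  then show ?thesis using True
    by (auto simp: dy_def y_mult_def fun_eq_iff algebra_simps)
next
  case False
  then show ?thesis
    by (auto simp: dy_def y_mult_def fun_eq_iff fun_upd_twist)
qed

text \<open>Moving dx^j past the smaller indices of I to its place in the increasing product costs
  one transposition each; wedge and contraction share this sign.\<close>

definition dx_sign :: "'n::{finite, linorder} \<Rightarrow> 'n set \<Rightarrow> complex" where
  "dx_sign j I = (- 1) ^ card {i \<in> I. i < j}"

lemma dx_sign_insert:
  assumes "k \<notin> I"
  shows "dx_sign j (insert k I) = (if k < j then - dx_sign j I else dx_sign j I)"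
proof (cases "k < j")
  case True
  then have "{i \<in> insert k I. i < j} = insert k {i \<in> I. i < j}" by auto
  with assms True show ?thesis by (simp add: dx_sign_def)
next
  case False
  then have "{i \<in> insert k I. i < j} = {i \<in> I. i < j}" by auto
  with False show ?thesis by (simp add: dx_sign_def)
qed

lemma dx_sign_remove:
  "dx_sign j (I - {k}) = (if k \<in> I \<and> k < j then - dx_sign j I else dx_sign j I)"
proof (cases "k \<in> I")
  case True
  have "dx_sign j (insert k (I - {k})) = (if k < j then - dx_sign j (I - {k}) else dx_sign j (I - {k}))"
    by (rule dx_sign_insert) auto
  with True show ?thesis by (auto simp: insert_absorb)
qed simp

lemma dx_sign_square [simp]: "dx_sign j I * dx_sign j I = 1" "dx_sign j I * (dx_sign j I * z) = z"
  by (auto simp: dx_sign_def simp flip: mult.assoc power_add)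

lemma dx_wedge_altdef: "dx_wedge j a r \<alpha> I = (if j \<in> I then dx_sign j I * a r \<alpha> (I - {j}) else 0)"
  by (simp add: dx_wedge_def dx_sign_def)

lemma dx_contract_altdef:
  "dx_contract j a r \<alpha> I = (if j \<notin> I then dx_sign j I * a r \<alpha> (insert j I) else 0)"
  by (simp add: dx_contract_def dx_sign_def)

text \<open>Adding or removing an index changes the sign of another index exactly when it is the
  smaller of the two. As j and k are distinct, exactly one of the two signs flips.\<close>

lemma dx_sign_swap:
  assumes "j \<noteq> k"
  shows "j \<in> I \<Longrightarrow> k \<in> I \<Longrightarrow> dx_sign j I * dx_sign k (I - {j}) = - (dx_sign k I * dx_sign j (I - {k}))"
    and "j \<notin> I \<Longrightarrow> k \<notin> I \<Longrightarrow> dx_sign j I * dx_sign k (insert j I) = - (dx_sign k I * dx_sign j (insert k I))"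
    and "j \<in> I \<Longrightarrow> k \<notin> I \<Longrightarrow> dx_sign k I * dx_sign j (insert k I) = - (dx_sign j I * dx_sign k (I - {j}))"
proof -
  have "j < k \<or> k < j" using assms by auto
  then show "j \<in> I \<Longrightarrow> k \<in> I \<Longrightarrow> dx_sign j I * dx_sign k (I - {j}) = - (dx_sign k I * dx_sign j (I - {k}))"
    and "j \<notin> I \<Longrightarrow> k \<notin> I \<Longrightarrow> dx_sign j I * dx_sign k (insert j I) = - (dx_sign k I * dx_sign j (insert k I))"
    and "j \<in> I \<Longrightarrow> k \<notin> I \<Longrightarrow> dx_sign k I * dx_sign j (insert k I) = - (dx_sign j I * dx_sign k (I - {j}))"
    by (auto simp: dx_sign_remove dx_sign_insert)
qed

lemma dx_wedge_anticommute: "dx_wedge j (dx_wedge k a) = - dx_wedge k (dx_wedge j a)"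
proof (cases "j = k")
  case True
  then show ?thesis by (auto simp: fun_eq_iff dx_wedge_altdef)
next
  case False
  show ?thesis
  proof (intro ext)
    fix r \<alpha> I
    show "dx_wedge j (dx_wedge k a) r \<alpha> I = (- dx_wedge k (dx_wedge j a)) r \<alpha> I"
    proof (cases "j \<in> I \<and> k \<in> I")
      case True
      have "I - {j} - {k} = I - {k} - {j}" by blast
      with True False show ?thesis
        using arg_cong[OF dx_sign_swap(1)[of j k I], of "\<lambda>z. z * a r \<alpha> (I - {k} - {j})"]
        by (simp add: dx_wedge_altdef mult.assoc)
    qed (use False in \<open>auto simp: dx_wedge_altdef\<close>)
  qed
qed

lemma dx_contract_anticommute: "dx_contract j (dx_contract k a) = - dx_contract k (dx_contract j a)"
proof (cases "j = k")
  case True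
  then show ?thesis by (auto simp: fun_eq_iff dx_contract_altdef)
next
  case False
  then have "j < k \<or> k < j" by auto
  then show ?thesis using False
    by (elim disjE) (auto simp: fun_eq_iff dx_contract_altdef dx_sign_insert insert_commute)
qed

text \<open>The canonical anticommutation relation of the exterior algebra. For i = j the two
  products live on disjoint sets of coefficients: those with i not in I and those with i in
  I.\<close>

lemma dx_contract_wedge:
  "dx_contract i (dx_wedge j a) = (if i = j then a else 0) - dx_wedge j (dx_contract i a)"
proof (cases "i = j")
  case True
  then show ?thesis
    by (auto simp: fun_eq_iff dx_contract_altdef dx_wedge_altdef dx_sign_insert dx_sign_remove insert_absorb)
next
  case False
  show ?thesis
  proof (intro ext)
    fix r \<alpha> I
    show "dx_contract i (dx_wedge j a) r \<alpha> I = ((if i = j then a else 0) - dx_wedge j (dx_contract i a)) r \<alpha> I"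
    proof (cases "j \<in> I \<and> i \<notin> I")
      case True
      have "insert i I - {j} = insert i (I - {j})" using False by blast
      with True False show ?thesis
        using arg_cong[OF dx_sign_swap(3)[of j i I], of "\<lambda>z. z * a r \<alpha> (insert i (I - {j}))"]
        by (simp add: dx_wedge_altdef dx_contract_altdef mult.assoc)
    qed (use False in \<open>auto simp: dx_wedge_altdef dx_contract_altdef\<close>)
  qed
qed

lemma dx_dy_commute:
  "dy j (dx_wedge k a) = dx_wedge k (dy j a)"
  "dy j (dx_contract k a) = dx_contract k (dy j a)"
  "y_mult j (dx_wedge k a) = dx_wedge k (y_mult j a)"
  "y_mult j (dx_contract k a) = dx_contract k (y_mult j a)"
  by (auto simp: dy_def y_mult_def dx_contract_def dx_wedge_def fun_eq_iff)

lemma nu_commute: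
  "nu_shift (dy j a) = dy j (nu_shift a)" "nu_shift (y_mult j a) = y_mult j (nu_shift a)"
  "nu_shift (parity a) = parity (nu_shift a)"
  by (auto simp: nu_shift_def dy_def y_mult_def parity_def fun_eq_iff)

lemma nu_commute_dx:
  "nu_shift (dx_wedge j a) = dx_wedge j (nu_shift a)"
  "nu_shift (dx_contract j a) = dx_contract j (nu_shift a)"
  by (auto simp: nu_shift_def dx_wedge_def dx_contract_def fun_eq_iff)

lemma parity_commute:
  "parity (dy j a) = dy j (parity a)" "parity (y_mult j a) = y_mult j (parity a)"
  by (auto simp: nu_shift_def dy_def y_mult_def parity_def fun_eq_iff)

lemma parity_dx_wedge: fixes j :: "'a::{finite, linorder}" shows "parity (dx_wedge j a) = - dx_wedge j (parity a)"
proof -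
  have "(- 1 :: complex) ^ card I = - ((- 1) ^ card (I - {j}))" if "j \<in> I" for I :: "'a::{finite, linorder} set"
    using card_Suc_Diff1[OF _ that] by (metis finite mult_minus1 power_Suc)
  then show ?thesis by (auto simp: fun_eq_iff parity_def dx_wedge_def simp del: card_Diff_insert)
qed

lemma parity_parity [simp]: "parity (parity a) = a"
  by (auto simp: parity_def fun_eq_iff simp flip: mult.assoc power_add)

text \<open>The number operator of the dx^j. Together with its analogue \<open>y_degree_sum\<close>
  for the y^j it is the origin of the p + q in \<delta>^-1.\<close>

lemma form_degree_sum:
  "(\<Sum>j\<in>UNIV. dx_wedge j (dx_contract j a)) = (\<lambda>r \<alpha> I. of_nat (card I) * a r \<alpha> I)"
proof (intro ext)
  fix r \<alpha> and I :: "'a set"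
  have "(\<Sum>j\<in>UNIV. dx_wedge j (dx_contract j a)) r \<alpha> I = (\<Sum>j\<in>UNIV. if j \<in> I then a r \<alpha> I else 0)"
    unfolding sum_apply
    by (intro sum.cong) (auto simp: dx_wedge_altdef dx_contract_altdef dx_sign_remove insert_absorb)
  also have "\<dots> = of_nat (card I) * a r \<alpha> I" by (simp add: sum.If_cases)
  finally show "(\<Sum>j\<in>UNIV. dx_wedge j (dx_contract j a)) r \<alpha> I = of_nat (card I) * a r \<alpha> I" .
qed

lemma y_degree_sum:
  "(\<Sum>j\<in>UNIV. y_mult j (dy j a)) = (\<lambda>r \<alpha> I. of_nat (ydeg \<alpha>) * a r \<alpha> I)"
proof (intro ext)
  fix r and \<alpha> :: "'a \<Rightarrow> nat" and I
  have "(\<Sum>j\<in>UNIV. y_mult j (dy j a)) r \<alpha> I = (\<Sum>j\<in>UNIV. of_nat (\<alpha> j) * a r \<alpha> I)"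
    unfolding sum_apply by (intro sum.cong) (auto simp: y_mult_def dy_def)
  then show "(\<Sum>j\<in>UNIV. y_mult j (dy j a)) r \<alpha> I = of_nat (ydeg \<alpha>) * a r \<alpha> I"
    by (simp add: ydeg_def sum_distrib_right)
qed

section \<open>The Hodge decomposition\<close>

text \<open>\<delta>^-1 without its division by p + q, which is split off as \<open>deg_inv\<close>:
  the bare operator has a clean anticommutator with \<delta>, and the division commutes with
  both.\<close>

definition koszul :: "'n::{finite, linorder} wform \<Rightarrow> 'n wform" where
  "koszul a = (\<Sum>j\<in>UNIV. y_mult j (dx_contract j a))"

definition deg_inv :: "'n::{finite, linorder} wform \<Rightarrow> 'n wform" where
  "deg_inv a = (\<lambda>r \<alpha> I. a r \<alpha> I / of_nat (ydeg \<alpha> + card I))"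

interpretation koszul: additive koszul
  by unfold_locales (simp add: koszul_def additive_simps sum.distrib)
interpretation deg_inv: additive deg_inv
  by unfold_locales (simp add: deg_inv_def fun_eq_iff add_divide_distrib)
interpretation fib_delta: additive fib_delta
  by unfold_locales (simp add: fib_delta_def additive_simps sum.distrib)

lemma fib_delta_inv_altdef: "fib_delta_inv a = koszul (deg_inv a)"
  by (simp add: fib_delta_inv_def koszul_def deg_inv_def)

interpretation fib_delta_inv: additive fib_delta_inv
  by unfold_locales (simp add: fib_delta_inv_altdef koszul.add deg_inv.add)

text \<open>S = -S gives S = 0 after passing to the complex coefficients, where 2 is
  invertible.\<close>

lemma sum_antisymmetric_zero:
  fixes f :: "'a::finite \<Rightarrow> 'a \<Rightarrow> 'n wform"
  assumes "\<And>j k. f j k = - f k j"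
  shows "(\<Sum>j\<in>UNIV. \<Sum>k\<in>UNIV. f j k) = 0"
proof -
  define S where "S = (\<Sum>j\<in>UNIV. \<Sum>k\<in>UNIV. f j k)"
  have "S = (\<Sum>j\<in>UNIV. \<Sum>k\<in>UNIV. - f k j)"
    unfolding S_def by (intro sum.cong refl assms)
  also have "\<dots> = - S" unfolding S_def by (subst sum.swap) (simp add: sum_negf)
  finally have S: "S = - S" .
  have "S r \<alpha> I = 0" for r \<alpha> I
    using fun_cong[OF fun_cong[OF fun_cong[OF S]], of r \<alpha> I] by simp
  then show ?thesis by (simp add: fun_eq_iff S_def)
qed

lemma fib_delta_fib_delta: "fib_delta (fib_delta a) = 0"
proof -
  have "fib_delta (fib_delta a) = (\<Sum>j\<in>UNIV. \<Sum>k\<in>UNIV. dx_wedge j (dx_wedge k (dy j (dy k a))))"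
    unfolding fib_delta_def by (simp add: additive_simps dx_dy_commute)
  also have "\<dots> = 0"
  proof (rule sum_antisymmetric_zero)
    fix j k
    show "dx_wedge j (dx_wedge k (dy j (dy k a))) = - dx_wedge k (dx_wedge j (dy k (dy j a)))"
      by (subst dx_wedge_anticommute) (simp add: additive_simps dy_commute[of j k])
  qed
  finally show ?thesis .
qed

lemma koszul_koszul: "koszul (koszul a) = 0"
proof -
  have "koszul (koszul a) = (\<Sum>j\<in>UNIV. \<Sum>k\<in>UNIV. y_mult j (y_mult k (dx_contract j (dx_contract k a))))"
    unfolding koszul_def by (simp add: additive_simps dx_dy_commute)
  also have "\<dots> = 0"
  proof (rule sum_antisymmetric_zero)
    fix j k
    show "y_mult j (y_mult k (dx_contract j (dx_contract k a))) = - y_mult k (y_mult j (dx_contract k (dx_contract j a)))"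
      by (subst dx_contract_anticommute) (simp add: additive_simps y_mult_commute[of j k])
  qed
  finally show ?thesis .
qed

text \<open>Exchanging \<open>dy\<close> with \<open>y_mult\<close> and contraction with wedge
  leaves one Kronecker delta each; these give the two number operators, and the terms with all four
  operators cancel.\<close>

lemma koszul_fib_delta:
  "fib_delta (koszul a) + koszul (fib_delta a) = (\<lambda>r \<alpha> I. of_nat (ydeg \<alpha> + card I) * a r \<alpha> I)"
proof -
  have "fib_delta (koszul a) = (\<Sum>j\<in>UNIV. \<Sum>k\<in>UNIV. dx_wedge j (dx_contract k (dy j (y_mult k a))))"
    unfolding fib_delta_def koszul_def by (simp add: additive_simps dx_dy_commute)
  also have "\<dots> = (\<Sum>j\<in>UNIV. \<Sum>k\<in>UNIV. dx_wedge j (dx_contract k (y_mult k (dy j a))))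
      + (\<Sum>j\<in>UNIV. \<Sum>k\<in>UNIV. if j = k then dx_wedge j (dx_contract k a) else 0)"
  proof -
    have "dx_wedge j (dx_contract k (dy j (y_mult k a))) = dx_wedge j (dx_contract k (y_mult k (dy j a)))
      + (if j = k then dx_wedge j (dx_contract k a) else 0)" for j k
      by (simp add: dy_y_mult additive_simps)
    then show ?thesis by (simp only: sum.distrib)
  qed
  finally have 1: "fib_delta (koszul a) =
     (\<Sum>j\<in>UNIV. \<Sum>k\<in>UNIV. dx_wedge j (dx_contract k (y_mult k (dy j a))))
      + (\<Sum>j\<in>UNIV. dx_wedge j (dx_contract j a))" by simp
  have "koszul (fib_delta a) = (\<Sum>k\<in>UNIV. \<Sum>j\<in>UNIV. dx_contract k (dx_wedge j (y_mult k (dy j a))))"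
    unfolding fib_delta_def koszul_def by (simp add: additive_simps dx_dy_commute)
  also have "\<dots> = (\<Sum>k\<in>UNIV. \<Sum>j\<in>UNIV. if k = j then y_mult k (dy j a) else 0)
      - (\<Sum>k\<in>UNIV. \<Sum>j\<in>UNIV. dx_wedge j (dx_contract k (y_mult k (dy j a))))"
    by (simp add: dx_contract_wedge sum_subtractf)
  finally have 2: "koszul (fib_delta a) = (\<Sum>k\<in>UNIV. y_mult k (dy k a))
      - (\<Sum>j\<in>UNIV. \<Sum>k\<in>UNIV. dx_wedge j (dx_contract k (y_mult k (dy j a))))"
    using sum.swap[of "\<lambda>k j. dx_wedge j (dx_contract k (y_mult k (dy j a)))" UNIV UNIV] by simp
  show ?thesis unfolding 1 2 form_degree_sum y_degree_sum
    by (auto simp: fun_eq_iff algebra_simps)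
qed

lemma ydeg_update: "ydeg (\<alpha>(j := Suc (\<alpha> j))) = Suc (ydeg \<alpha>)"
proof -
  have "ydeg (\<alpha>(j := Suc (\<alpha> j))) = (\<Sum>i\<in>UNIV. \<alpha> i + (if i = j then 1 else 0))"
    unfolding ydeg_def by (intro sum.cong) auto
  then show ?thesis by (simp add: sum.distrib ydeg_def)
qed

lemma ydeg_update_minus: "\<alpha> j \<noteq> 0 \<Longrightarrow> Suc (ydeg (\<alpha>(j := \<alpha> j - Suc 0))) = ydeg \<alpha>"
  using ydeg_update[of "\<alpha>(j := \<alpha> j - 1)" j] by simp

text \<open>\<delta> trades a y for a dx, so it keeps the sum p + q by which \<open>deg_inv\<close>
  divides; \<open>koszul\<close> trades them back.\<close>

lemma fib_delta_deg_inv: "fib_delta (deg_inv a) = deg_inv (fib_delta a)"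
proof -
  have "dx_wedge j (dy j (deg_inv a)) = deg_inv (dx_wedge j (dy j a))" for j
  proof (intro ext)
    fix r \<alpha> I
    have "ydeg (\<alpha>(j := Suc (\<alpha> j))) + card (I - {j}) = ydeg \<alpha> + card I" if "j \<in> I"
      using that card_Suc_Diff1[of I j] by (simp add: ydeg_update del: card_Diff_insert)
    then show "dx_wedge j (dy j (deg_inv a)) r \<alpha> I = deg_inv (dx_wedge j (dy j a)) r \<alpha> I"
      by (simp add: deg_inv_def dx_wedge_def dy_def del: of_nat_add card_Diff_insert)
  qed
  then show ?thesis by (simp add: fib_delta_def deg_inv.sum)
qed

lemma koszul_deg_inv: "koszul (deg_inv a) = deg_inv (koszul a)"
proof -
  have "y_mult j (dx_contract j (deg_inv a)) = deg_inv (y_mult j (dx_contract j a))" for j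
  proof (intro ext)
    fix r \<alpha> I
    have "ydeg (\<alpha>(j := \<alpha> j - 1)) + card (insert j I) = ydeg \<alpha> + card I" if "j \<notin> I" "\<alpha> j \<noteq> 0"
      using that ydeg_update_minus[of \<alpha> j] by simp
    then show "y_mult j (dx_contract j (deg_inv a)) r \<alpha> I = deg_inv (y_mult j (dx_contract j a)) r \<alpha> I"
      by (simp add: deg_inv_def dx_contract_def y_mult_def del: of_nat_add card_insert_disjoint)
  qed
  then show ?thesis by (simp add: koszul_def deg_inv.sum)
qed

lemma fib_delta_inv_twice: "fib_delta_inv (fib_delta_inv a) = 0"
  by (simp add: fib_delta_inv_altdef koszul_deg_inv koszul_koszul deg_inv.zero)

text \<open>Positive form degree excludes p = q = 0, the one case in which dividing by p + q and
  multiplying back is not the identity.\<close>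

lemma hodge:
  assumes "form_part (Suc q) a = a"
  shows "fib_delta (fib_delta_inv a) + fib_delta_inv (fib_delta a) = a"
proof -
  have "a r \<alpha> {} = 0" for r \<alpha>
    using fun_cong[OF fun_cong[OF fun_cong[OF assms, of r], of \<alpha>], of "{}"] by (simp add: form_part_def)
  then have "of_nat (ydeg \<alpha> + card I) * deg_inv a r \<alpha> I = a r \<alpha> I" for r \<alpha> I
    by (cases "I = {}") (auto simp: deg_inv_def simp del: of_nat_add)
  then show ?thesis
    by (simp add: fib_delta_inv_altdef fib_delta_deg_inv[symmetric] koszul_fib_delta del: of_nat_add)
qed

section \<open>The undeformed product\<close>

text \<open>Both parts of every splitting are recorded, so that associativity and commutation of the
  product become bijections of index sets.\<close>

definition splits :: "nat \<Rightarrow> ('n \<Rightarrow> nat) \<Rightarrow> 'n set \<Rightarrow> (nat \<times> nat \<times> ('n \<Rightarrow> nat) \<times> ('n \<Rightarrow> nat) \<times> 'n set \<times> 'n set) set" where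
  "splits r \<alpha> I = {(s, s', \<beta>, \<beta>', K, K'). s + s' = r \<and> \<beta> + \<beta>' = \<alpha> \<and> K \<union> K' = I \<and> K \<inter> K' = {}}"

lemma finite_le_fun: "finite {\<beta>. \<forall>i. \<beta> i \<le> \<alpha> i}" for \<alpha> :: "'n::finite \<Rightarrow> nat"
proof -
  have "{\<beta>. \<forall>i. \<beta> i \<le> \<alpha> i} = (\<Pi>\<^sub>E i\<in>UNIV. {..\<alpha> i})" by (auto simp: PiE_def Pi_def)
  then show ?thesis by (simp add: finite_PiE)
qed

lemma splits_image:
  "splits r \<alpha> I = (\<lambda>(s, \<beta>, K). (s, r - s, \<beta>, (\<lambda>i. \<alpha> i - \<beta> i), K, I - K)) ` ({..r} \<times> {\<beta>. \<forall>i. \<beta> i \<le> \<alpha> i} \<times> Pow I)"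
proof (intro equalityI subsetI)
  fix t assume "t \<in> splits r \<alpha> I"
  then obtain s s' \<beta> \<beta>' K K' where t: "t = (s, s', \<beta>, \<beta>', K, K')"
    "s + s' = r" "\<beta> + \<beta>' = \<alpha>" "K \<union> K' = I" "K \<inter> K' = {}" by (auto simp: splits_def)
  then show "t \<in> (\<lambda>(s, \<beta>, K). (s, r - s, \<beta>, (\<lambda>i. \<alpha> i - \<beta> i), K, I - K)) ` ({..r} \<times> {\<beta>. \<forall>i. \<beta> i \<le> \<alpha> i} \<times> Pow I)"
    by (intro image_eqI[where x = "(s, \<beta>, K)"]) auto
qed (auto simp: splits_def fun_eq_iff)

lemma finite_splits [simp]: "finite (splits r \<alpha> I)" for I :: "'n::finite set"
  unfolding splits_image by (intro finite_imageI finite_cartesian_product finite_le_fun) auto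

lemma wmult_splits:
  "wmult a b r \<alpha> I =
    (\<Sum>(s, s', \<beta>, \<beta>', K, K')\<in>splits r \<alpha> I. wedge_sign K K' * a s \<beta> K * b s' \<beta>' K')"
proof -
  have "wmult a b r \<alpha> I = (\<Sum>(s, \<beta>, K)\<in>{..r} \<times> {\<beta>. \<forall>i. \<beta> i \<le> \<alpha> i} \<times> Pow I.
      wedge_sign K (I - K) * a s \<beta> K * b (r - s) (\<lambda>i. \<alpha> i - \<beta> i) (I - K))"
    by (simp add: wmult_def sum.cartesian_product)
  also have "\<dots> = (\<Sum>(s, s', \<beta>, \<beta>', K, K')\<in>splits r \<alpha> I. wedge_sign K K' * a s \<beta> K * b s' \<beta>' K')"
    apply (rule sum.reindex_bij_witness[where j = "\<lambda>(s, \<beta>, K). (s, r - s, \<beta>, (\<lambda>i. \<alpha> i - \<beta> i), K, I - K)"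
          and i = "\<lambda>(s, s', \<beta>, \<beta>', K, K'). (s, \<beta>, K)"])
    by (auto simp: splits_def)
  finally show ?thesis .
qed

interpretation wmult_left: additive "\<lambda>a. wmult a b" for b
  by unfold_locales
     (auto simp: wmult_splits fun_eq_iff algebra_simps case_prod_unfold simp flip: sum.distrib)
interpretation wmult_right: additive "wmult a" for a
  by unfold_locales
     (auto simp: wmult_splits fun_eq_iff algebra_simps case_prod_unfold simp flip: sum.distrib)

lemma wmult_wscale:
  "wmult (wscale z a) b = wscale z (wmult a b)"
  "wmult a (wscale z b) = wscale z (wmult a b)"
  by (auto simp: wmult_splits fun_eq_iff wscale_def case_prod_unfold sum_distrib_left algebra_simps)

lemma wedge_sign_Un_left:
  fixes K :: "'n::{finite, linorder} set"
  assumes "K \<inter> K' = {}"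
  shows "wedge_sign (K \<union> K') L = wedge_sign K L * wedge_sign K' L"
proof -
  have "{(k, l). k \<in> K \<union> K' \<and> l \<in> L \<and> l < k} =
      {(k, l). k \<in> K \<and> l \<in> L \<and> l < k} \<union> {(k, l). k \<in> K' \<and> l \<in> L \<and> l < k}" by auto
  moreover have "card \<dots> = card {(k, l). k \<in> K \<and> l \<in> L \<and> l < k} + card {(k, l). k \<in> K' \<and> l \<in> L \<and> l < k}"
    using assms by (intro card_Un_disjoint) auto
  ultimately show ?thesis by (simp add: wedge_sign_def power_add)
qed

lemma wedge_sign_Un_right:
  fixes K :: "'n::{finite, linorder} set"
  assumes "L \<inter> L' = {}"
  shows "wedge_sign K (L \<union> L') = wedge_sign K L * wedge_sign K L'"
proof -
  have "{(k, l). k \<in> K \<and> l \<in> L \<union> L' \<and> l < k} =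
      {(k, l). k \<in> K \<and> l \<in> L \<and> l < k} \<union> {(k, l). k \<in> K \<and> l \<in> L' \<and> l < k}" by auto
  moreover have "card \<dots> = card {(k, l). k \<in> K \<and> l \<in> L \<and> l < k} + card {(k, l). k \<in> K \<and> l \<in> L' \<and> l < k}"
    using assms by (intro card_Un_disjoint) auto
  ultimately show ?thesis by (simp add: wedge_sign_def power_add)
qed

text \<open>For disjoint K and L each pair of K x L is an inversion in exactly one of the two
  orders, so the two counts add up to |K| |L|.\<close>

lemma wedge_sign_swap:
  fixes K :: "'n::{finite, linorder} set"
  assumes "K \<inter> L = {}"
  shows "wedge_sign L K = (- 1) ^ (card K * card L) * wedge_sign K L"
proof -
  let ?A = "{(k, l). k \<in> K \<and> l \<in> L \<and> l < k}" and ?B = "{(l, k). l \<in> L \<and> k \<in> K \<and> k < l}"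
  have "K \<times> L = ?A \<union> prod.swap ` ?B"
    using assms by (auto simp: image_iff linorder_neq_iff)
  moreover have "card \<dots> = card ?A + card (prod.swap ` ?B)"
    by (intro card_Un_disjoint) auto
  moreover have "card (prod.swap ` ?B) = card ?B"
    by (intro card_image inj_onI) auto
  ultimately have "card K * card L = card ?A + card ?B" by (simp flip: card_cartesian_product)
  then have "(- 1 :: complex) ^ (card K * card L) * (- 1) ^ card ?A = (- 1) ^ card ?B"
    by (simp add: power_add)
  then show ?thesis by (simp add: wedge_sign_def)
qed

lemma wedge_sign_singleton [simp]: "wedge_sign {j} L = dx_sign j L"
proof -
  have "{(k, l). k \<in> {j} \<and> l \<in> L \<and> l < k} = Pair j ` {l \<in> L. l < j}" by auto
  then show ?thesis by (simp add: wedge_sign_def dx_sign_def card_image inj_on_def)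
qed

lemma wedge_sign_empty [simp]: "wedge_sign {} L = 1" "wedge_sign K {} = 1"
  by (simp_all add: wedge_sign_def)

text \<open>Both sides sum over the splittings of exponents and index set into three pieces, nested
  to the left or to the right. The signs agree because inversions are additive over disjoint unions
  in either argument.\<close>

lemma wmult_assoc: "wmult (wmult a b) c = wmult a (wmult b c)"
proof (intro ext)
  fix r :: nat and \<alpha> :: "'a \<Rightarrow> nat" and I :: "'a set"
  let ?L = "SIGMA x:splits r \<alpha> I. (case x of (s, s3, \<beta>, \<beta>3, K, K3) \<Rightarrow> splits s \<beta> K)"
  let ?R = "SIGMA x:splits r \<alpha> I. (case x of (s1, s, \<beta>1, \<beta>, K1, K) \<Rightarrow> splits s \<beta> K)"
  have "wmult (wmult a b) c r \<alpha> I =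
      (\<Sum>x\<in>splits r \<alpha> I. \<Sum>y\<in>(case x of (s, s3, \<beta>, \<beta>3, K, K3) \<Rightarrow> splits s \<beta> K).
        case x of (s, s3, \<beta>, \<beta>3, K, K3) \<Rightarrow> case y of (s1, s2, \<beta>1, \<beta>2, K1, K2) \<Rightarrow>
          wedge_sign K K3 * wedge_sign K1 K2 * (a s1 \<beta>1 K1 * b s2 \<beta>2 K2 * c s3 \<beta>3 K3))"
    unfolding wmult_splits by (intro sum.cong refl)
      (auto simp: sum_distrib_left sum_distrib_right algebra_simps case_prod_unfold intro!: sum.cong)
  also have "\<dots> = (\<Sum>(x, y)\<in>?L. case x of (s, s3, \<beta>, \<beta>3, K, K3) \<Rightarrow> case y of (s1, s2, \<beta>1, \<beta>2, K1, K2) \<Rightarrow>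
          wedge_sign K K3 * wedge_sign K1 K2 * (a s1 \<beta>1 K1 * b s2 \<beta>2 K2 * c s3 \<beta>3 K3))"
    by (subst sum.Sigma) auto
  also have "\<dots> = (\<Sum>(x, y)\<in>?R. case x of (s1, s, \<beta>1, \<beta>, K1, K) \<Rightarrow> case y of (s2, s3, \<beta>2, \<beta>3, K2, K3) \<Rightarrow>
          wedge_sign K1 K * wedge_sign K2 K3 * (a s1 \<beta>1 K1 * b s2 \<beta>2 K2 * c s3 \<beta>3 K3))"
    by (rule sum.reindex_bij_witness[where
        j = "\<lambda>((s, s3, \<beta>, \<beta>3, K, K3), (s1, s2, \<beta>1, \<beta>2, K1, K2)).
              ((s1, s2 + s3, \<beta>1, \<beta>2 + \<beta>3, K1, K2 \<union> K3), (s2, s3, \<beta>2, \<beta>3, K2, K3))" and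
        i = "\<lambda>((s1, s, \<beta>1, \<beta>, K1, K), (s2, s3, \<beta>2, \<beta>3, K2, K3)).
              ((s1 + s2, s3, \<beta>1 + \<beta>2, \<beta>3, K1 \<union> K2, K3), (s1, s2, \<beta>1, \<beta>2, K1, K2))"])
      (auto simp: splits_def add.assoc Un_assoc Int_Un_distrib Int_Un_distrib2
        wedge_sign_Un_left wedge_sign_Un_right)
  also have "\<dots> = (\<Sum>x\<in>splits r \<alpha> I. \<Sum>y\<in>(case x of (s1, s, \<beta>1, \<beta>, K1, K) \<Rightarrow> splits s \<beta> K).
        case x of (s1, s, \<beta>1, \<beta>, K1, K) \<Rightarrow> case y of (s2, s3, \<beta>2, \<beta>3, K2, K3) \<Rightarrow>
          wedge_sign K1 K * wedge_sign K2 K3 * (a s1 \<beta>1 K1 * b s2 \<beta>2 K2 * c s3 \<beta>3 K3))"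
    by (subst sum.Sigma) auto
  also have "\<dots> = wmult a (wmult b c) r \<alpha> I"
    unfolding wmult_splits by (intro sum.cong refl)
      (auto simp: sum_distrib_left sum_distrib_right algebra_simps case_prod_unfold intro!: sum.cong)
  finally show "wmult (wmult a b) c r \<alpha> I = wmult a (wmult b c) r \<alpha> I" .
qed

text \<open>Applied to \<open>dx_wedge j wone\<close> and \<open>y_mult j wone\<close>, this
  exhibits \<open>dx_wedge j\<close> and \<open>y_mult j\<close> as left multiplications.\<close>

lemma wmult_monomial_left:
  fixes a b :: "'n::{finite, linorder} wform"
  assumes "\<And>s \<beta> K. (s, \<beta>, K) \<noteq> (s0, \<beta>0, K0) \<Longrightarrow> a s \<beta> K = 0"
  shows "wmult a b r \<alpha> I = (if s0 \<le> r \<and> (\<forall>i. \<beta>0 i \<le> \<alpha> i) \<and> K0 \<subseteq> I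
    then wedge_sign K0 (I - K0) * a s0 \<beta>0 K0 * b (r - s0) (\<lambda>i. \<alpha> i - \<beta>0 i) (I - K0) else 0)"
proof -
  let ?f = "\<lambda>(s, \<beta>, K). wedge_sign K (I - K) * a s \<beta> K * b (r - s) (\<lambda>i. \<alpha> i - \<beta> i) (I - K)"
  let ?S = "{..r} \<times> {\<beta>. \<forall>i. \<beta> i \<le> \<alpha> i} \<times> Pow I"
  have "wmult a b r \<alpha> I = sum ?f ?S"
    by (simp add: wmult_def sum.cartesian_product)
  also have "\<dots> = sum ?f (?S \<inter> {(s0, \<beta>0, K0)})"
  proof (intro sum.mono_neutral_right ballI)
    fix t assume t: "t \<in> ?S - ?S \<inter> {(s0, \<beta>0, K0)}"
    obtain s \<beta> K where "t = (s, \<beta>, K)" by (cases t) auto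
    with t have "(s, \<beta>, K) \<noteq> (s0, \<beta>0, K0)" by auto
    then have "a s \<beta> K = 0" by (rule assms)
    then show "?f t = 0" using \<open>t = _\<close> by simp
  next
    show "finite ?S" by (intro finite_cartesian_product finite_le_fun) auto
  qed auto
  also have "?S \<inter> {(s0, \<beta>0, K0)} = (if s0 \<le> r \<and> (\<forall>i. \<beta>0 i \<le> \<alpha> i) \<and> K0 \<subseteq> I then {(s0, \<beta>0, K0)} else {})"
    by auto
  finally show ?thesis by simp
qed

lemma wmult_wone_left [simp]: "wmult wone c = c"
  by (intro ext, subst wmult_monomial_left[where ?s0.0 = 0 and ?\<beta>0.0 = "\<lambda>_. 0" and ?K0.0 = "{}"])
     (auto simp: wone_def)

lemma dx_sign_singleton [simp]: "dx_sign j {j} = 1"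
proof -
  have "{i \<in> {j}. i < j} = {}" by auto
  then show ?thesis unfolding dx_sign_def by (simp only: card.empty power_0)
qed

lemma dx_wedge_wone: "dx_wedge j wone s \<beta> K = (if s = 0 \<and> \<beta> = (\<lambda>_. 0) \<and> K = {j} then 1 else 0)"
proof (cases "K = {j}")
  case True
  then show ?thesis by (simp add: dx_wedge_altdef wone_def)
next
  case False
  then have "\<not> (j \<in> K \<and> K - {j} = {})" by auto
  with False show ?thesis by (auto simp: dx_wedge_altdef wone_def)
qed

text \<open>\<open>dx_wedge j\<close> is left multiplication by dx^j, so this is
  associativity.\<close>

lemma wmult_dx_wedge_left: "wmult (dx_wedge j a) b = dx_wedge j (wmult a b)"
proof -
  have *: "wmult (dx_wedge j wone) c = dx_wedge j c" for c :: "'a wform"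
    by (intro ext, subst wmult_monomial_left[where ?s0.0 = 0 and ?\<beta>0.0 = "\<lambda>_. 0" and ?K0.0 = "{j}"])
       (auto simp: dx_wedge_wone dx_wedge_altdef[of j c] dx_sign_remove)
  show ?thesis by (metis * wmult_assoc)
qed

lemma wmult_y_mult_left: "wmult (y_mult j a) b = y_mult j (wmult a b)"
proof -
  have *: "wmult (y_mult j wone) c = y_mult j c" for c :: "'a wform"
  proof (intro ext)
    fix r :: nat and \<alpha> :: "'a \<Rightarrow> nat" and I :: "'a set"
    let ?e = "(\<lambda>_. 0)(j := 1)"
    have "y_mult j wone s \<beta> K = (if (s, \<beta>, K) = (0, ?e, {}) then 1 else 0)" for s \<beta> K
    proof -
      have "\<beta> = ?e \<longleftrightarrow> \<beta> j \<noteq> 0 \<and> \<beta>(j := \<beta> j - 1) = (\<lambda>_. 0)"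
        by (auto simp: fun_eq_iff)
      then show ?thesis by (auto simp: y_mult_def wone_def)
    qed
    moreover have "(\<lambda>i. \<alpha> i - ?e i) = \<alpha>(j := \<alpha> j - 1)" by auto
    moreover have "(\<forall>i. ?e i \<le> \<alpha> i) \<longleftrightarrow> \<alpha> j \<noteq> 0" by auto
    ultimately show "wmult (y_mult j wone) c r \<alpha> I = y_mult j c r \<alpha> I"
      by (subst wmult_monomial_left[where ?s0.0 = 0 and ?\<beta>0.0 = ?e and ?K0.0 = "{}"])
         (simp_all add: y_mult_def del: fun_upd_apply)
  qed
  show ?thesis by (metis * wmult_assoc)
qed

text \<open>Only odd |K'| contributes, and then (-1)^(|K| |K'|) = (-1)^|K| is the sign that
  \<open>parity\<close> puts on the other factor.\<close>

lemma wmult_parity_right: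
  assumes "\<And>r \<alpha> I. even (card I) \<Longrightarrow> b r \<alpha> I = 0"
  shows "wmult a b = wmult b (parity a)"
proof (intro ext)
  fix r \<alpha> I
  show "wmult a b r \<alpha> I = wmult b (parity a) r \<alpha> I"
    unfolding wmult_splits
  proof (rule sum.reindex_bij_witness[where
      i = "\<lambda>(s, s', \<beta>, \<beta>', K, K'). (s', s, \<beta>', \<beta>, K', K)" and
      j = "\<lambda>(s, s', \<beta>, \<beta>', K, K'). (s', s, \<beta>', \<beta>, K', K)"])
    fix t assume "t \<in> splits r \<alpha> I"
    then obtain s s' \<beta> \<beta>' K K' where t: "t = (s, s', \<beta>, \<beta>', K, K')" "K \<inter> K' = {}"
      by (auto simp: splits_def)
    show "(case case t of (s, s', \<beta>, \<beta>', K, K') \<Rightarrow> (s', s, \<beta>', \<beta>, K', K) of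
            (s, s', \<beta>, \<beta>', K, K') \<Rightarrow> wedge_sign K K' * b s \<beta> K * parity a s' \<beta>' K') =
          (case t of (s, s', \<beta>, \<beta>', K, K') \<Rightarrow> wedge_sign K K' * a s \<beta> K * b s' \<beta>' K')"
    proof (cases "even (card K')")
      case True
      then show ?thesis using t assms by simp
    next
      case False
      then have "(- 1 :: complex) ^ (card K * card K') = (- 1) ^ card K"
        by (simp add: power_mult uminus_power_if)
      then show ?thesis using t
        by (simp add: wedge_sign_swap[of K K'] parity_def)
    qed
  qed (auto simp: splits_def add.commute)
qed

lemma wmult_commute:
  assumes "\<And>r \<alpha> I. odd (card I) \<Longrightarrow> b r \<alpha> I = 0"
  shows "wmult a b = wmult b a"
proof (intro ext)
  fix r \<alpha> I
  show "wmult a b r \<alpha> I = wmult b a r \<alpha> I"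
    unfolding wmult_splits
  proof (rule sum.reindex_bij_witness[where
      i = "\<lambda>(s, s', \<beta>, \<beta>', K, K'). (s', s, \<beta>', \<beta>, K', K)" and
      j = "\<lambda>(s, s', \<beta>, \<beta>', K, K'). (s', s, \<beta>', \<beta>, K', K)"])
    fix t assume "t \<in> splits r \<alpha> I"
    then obtain s s' \<beta> \<beta>' K K' where t: "t = (s, s', \<beta>, \<beta>', K, K')" "K \<inter> K' = {}"
      by (auto simp: splits_def)
    show "(case case t of (s, s', \<beta>, \<beta>', K, K') \<Rightarrow> (s', s, \<beta>', \<beta>, K', K) of
            (s, s', \<beta>, \<beta>', K, K') \<Rightarrow> wedge_sign K K' * b s \<beta> K * a s' \<beta>' K') =
          (case t of (s, s', \<beta>, \<beta>', K, K') \<Rightarrow> wedge_sign K K' * a s \<beta> K * b s' \<beta>' K')"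
    proof (cases "odd (card K')")
      case True
      then show ?thesis using t assms by simp
    next
      case False
      then show ?thesis using t
        by (simp add: wedge_sign_swap[of K K'])
    qed
  qed (auto simp: splits_def add.commute)
qed

lemma wmult_dx_wedge_right: "wmult a (dx_wedge j b) = dx_wedge j (wmult (parity a) b)"
proof -
  have "wmult a (dx_wedge j b) = wmult a (wmult (dx_wedge j wone) b)"
    by (simp add: wmult_dx_wedge_left)
  also have "\<dots> = wmult (wmult a (dx_wedge j wone)) b" by (simp add: wmult_assoc)
  also have "wmult a (dx_wedge j wone) = wmult (dx_wedge j wone) (parity a)"
    by (rule wmult_parity_right) (auto simp: dx_wedge_altdef wone_def subset_singleton_iff)
  also have "\<dots> = dx_wedge j (parity a)" by (simp add: wmult_dx_wedge_left)
  finally show ?thesis by (simp add: wmult_dx_wedge_left)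
qed

lemma wmult_y_mult_right: "wmult a (y_mult j b) = y_mult j (wmult a b)"
proof -
  have "wmult a (y_mult j b) = wmult a (wmult (y_mult j wone) b)"
    by (simp add: wmult_y_mult_left)
  also have "\<dots> = wmult (wmult a (y_mult j wone)) b" by (simp add: wmult_assoc)
  also have "wmult a (y_mult j wone) = wmult (y_mult j wone) a"
    by (rule wmult_commute) (auto simp: y_mult_def wone_def)
  also have "\<dots> = y_mult j a" by (simp add: wmult_y_mult_left)
  finally show ?thesis by (simp add: wmult_y_mult_left)
qed

text \<open>The factor \<open>\<alpha> j + 1\<close> is the sum of the j-th exponents of the two
  factors, which distributes it over them; summands with exponent zero drop out and the rest are
  shifted down by one.\<close>

lemma dy_wmult: "dy j (wmult a b) = wmult (dy j a) b + wmult a (dy j b)"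
proof (intro ext)
  fix r :: nat and \<alpha> :: "'a \<Rightarrow> nat" and I :: "'a set"
  let ?up = "\<lambda>\<alpha>. \<alpha>(j := Suc (\<alpha> j))"
  let ?dn = "\<lambda>\<alpha>. \<alpha>(j := \<alpha> j - 1)"
  let ?w = "\<lambda>(s, s', \<beta>, \<beta>', K, K'). wedge_sign K K' * a s \<beta> K * b s' \<beta>' K'"
  let ?S = "splits r (?up \<alpha>) I"
  have "dy j (wmult a b) r \<alpha> I = (\<Sum>t\<in>?S. of_nat (Suc (\<alpha> j)) * ?w t)"
    by (simp add: dy_def wmult_splits sum_distrib_left)
  also have "\<dots> = (\<Sum>t\<in>?S. (case t of (s, s', \<beta>, \<beta>', K, K') \<Rightarrow> of_nat (\<beta> j)) * ?w t
                        + (case t of (s, s', \<beta>, \<beta>', K, K') \<Rightarrow> of_nat (\<beta>' j)) * ?w t)"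
  proof (intro sum.cong refl)
    fix t assume "t \<in> ?S"
    then obtain s s' \<beta> \<beta>' K K' where t: "t = (s, s', \<beta>, \<beta>', K, K')" "\<beta> + \<beta>' = ?up \<alpha>"
      by (auto simp: splits_def)
    have "Suc (\<alpha> j) = \<beta> j + \<beta>' j" using fun_cong[OF t(2), of j] by simp
    then show "of_nat (Suc (\<alpha> j)) * ?w t = (case t of (s, s', \<beta>, \<beta>', K, K') \<Rightarrow> of_nat (\<beta> j)) * ?w t
                        + (case t of (s, s', \<beta>, \<beta>', K, K') \<Rightarrow> of_nat (\<beta>' j)) * ?w t"
      using t by (simp add: algebra_simps del: of_nat_Suc)
  qed
  also have "\<dots> = (\<Sum>t\<in>?S. (case t of (s, s', \<beta>, \<beta>', K, K') \<Rightarrow> of_nat (\<beta> j)) * ?w t)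
                        + (\<Sum>t\<in>?S. (case t of (s, s', \<beta>, \<beta>', K, K') \<Rightarrow> of_nat (\<beta>' j)) * ?w t)"
    by (rule sum.distrib)
  also have "(\<Sum>t\<in>?S. (case t of (s, s', \<beta>, \<beta>', K, K') \<Rightarrow> of_nat (\<beta> j)) * ?w t)
     = (\<Sum>t\<in>{t\<in>?S. case t of (s, s', \<beta>, \<beta>', K, K') \<Rightarrow> \<beta> j \<noteq> 0}. (case t of (s, s', \<beta>, \<beta>', K, K') \<Rightarrow> of_nat (\<beta> j)) * ?w t)"
    by (rule sum.mono_neutral_right) auto
  also have "\<dots> = wmult (dy j a) b r \<alpha> I"
    unfolding wmult_splits
    by (rule sum.reindex_bij_witness[where
        j = "\<lambda>(s, s', \<beta>, \<beta>', K, K'). (s, s', ?dn \<beta>, \<beta>', K, K')" and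
        i = "\<lambda>(s, s', \<beta>, \<beta>', K, K'). (s, s', ?up \<beta>, \<beta>', K, K')"])
      (auto simp: splits_def fun_eq_iff dy_def split: if_splits)
  also have "(\<Sum>t\<in>?S. (case t of (s, s', \<beta>, \<beta>', K, K') \<Rightarrow> of_nat (\<beta>' j)) * ?w t)
     = (\<Sum>t\<in>{t\<in>?S. case t of (s, s', \<beta>, \<beta>', K, K') \<Rightarrow> \<beta>' j \<noteq> 0}. (case t of (s, s', \<beta>, \<beta>', K, K') \<Rightarrow> of_nat (\<beta>' j)) * ?w t)"
    by (rule sum.mono_neutral_right) auto
  also have "\<dots> = wmult a (dy j b) r \<alpha> I"
    unfolding wmult_splits
    by (rule sum.reindex_bij_witness[where
        j = "\<lambda>(s, s', \<beta>, \<beta>', K, K'). (s, s', \<beta>, ?dn \<beta>', K, K')" and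
        i = "\<lambda>(s, s', \<beta>, \<beta>', K, K'). (s, s', \<beta>, ?up \<beta>', K, K')"])
      (auto simp: splits_def fun_eq_iff dy_def split: if_splits)
  finally show "dy j (wmult a b) r \<alpha> I = (wmult (dy j a) b + wmult a (dy j b)) r \<alpha> I" by simp
qed

lemma parity_wmult: "parity (wmult a b) = wmult (parity a) (parity b)"
proof (intro ext)
  fix r :: nat and \<alpha> :: "'a \<Rightarrow> nat" and I :: "'a set"
  have "(- 1 :: complex) ^ card I = (- 1) ^ card K * (- 1) ^ card K'" if "K \<union> K' = I" "K \<inter> K' = {}" for K K'
    using that by (auto simp: card_Un_disjoint power_add)
  then show "parity (wmult a b) r \<alpha> I = wmult (parity a) (parity b) r \<alpha> I"
    unfolding parity_def wmult_splits sum_distrib_left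
    by (intro sum.cong) (auto simp: splits_def)
qed

section \<open>The Wick product\<close>

lemma bidiff_add_left: "bidiff L m (a + a') b = bidiff L m a b + bidiff L m a' b"
  by (induct m arbitrary: a a' b) (simp_all add: wmult_left.add additive_simps sum.distrib)

lemma bidiff_add_right: "bidiff L m a (b + b') = bidiff L m a b + bidiff L m a b'"
  by (induct m arbitrary: a b b') (simp_all add: wmult_right.add additive_simps sum.distrib)

interpretation bidiff_left: additive "\<lambda>a. bidiff L m a b" for L m b
  by unfold_locales (rule bidiff_add_left)
interpretation bidiff_right: additive "bidiff L m a" for L m a
  by unfold_locales (rule bidiff_add_right)

lemma bidiff_wscale:
  "bidiff L m (wscale z a) b = wscale z (bidiff L m a b)"
  "bidiff L m a (wscale z b) = wscale z (bidiff L m a b)"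
  by (induct m arbitrary: a b) (simp_all add: wmult_wscale wscale_simps additive_simps mult.commute)

lemmas bidiff_simps = bidiff_left.add bidiff_left.diff bidiff_left.minus bidiff_left.zero bidiff_left.sum
  bidiff_right.add bidiff_right.diff bidiff_right.minus bidiff_right.zero bidiff_right.sum bidiff_wscale

text \<open>The coefficients L do not depend on y, and derivatives in y commute.\<close>

lemma dy_bidiff: "dy j (bidiff L m a b) = bidiff L m (dy j a) b + bidiff L m a (dy j b)"
  by (induct m arbitrary: a b)
     (simp_all add: dy_wmult additive_simps wscale_simps sum.distrib dy_commute[of j])

lemma bidiff_dx_wedge_left: "bidiff L m (dx_wedge j a) b = dx_wedge j (bidiff L m a b)"
  by (induct m arbitrary: a b)
     (simp_all add: wmult_dx_wedge_left additive_simps wscale_simps dx_dy_commute)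

lemma bidiff_dx_wedge_right: "bidiff L m a (dx_wedge j b) = dx_wedge j (bidiff L m (parity a) b)"
  by (induct m arbitrary: a b)
     (simp_all add: wmult_dx_wedge_right additive_simps wscale_simps dx_dy_commute parity_commute)

lemma parity_bidiff: "parity (bidiff L m a b) = bidiff L m (parity a) (parity b)"
  by (induct m arbitrary: a b) (simp_all add: parity_wmult additive_simps wscale_simps parity_commute)

text \<open>\<open>nu_series X\<close> is the sum of the series with terms \<open>\<nu>\<^sup>m X\<^sub>m\<close>.\<close>

definition nu_series :: "(nat \<Rightarrow> 'n wform) \<Rightarrow> 'n wform" where
  "nu_series X = (\<lambda>r \<alpha> I. \<Sum>m\<le>r. X m (r - m) \<alpha> I)"

text \<open>With the coefficient of the exponential included, the terms satisfy the recursion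
  \<open>bidiff_exp_Suc\<close>, which replaces binomial coefficients in the proof of
  associativity.\<close>

definition bidiff_exp :: "('n::{finite, linorder} \<Rightarrow> 'n \<Rightarrow> complex) \<Rightarrow> nat \<Rightarrow> 'n wform \<Rightarrow> 'n wform \<Rightarrow> 'n wform" where
  "bidiff_exp L m a b = wscale ((\<i> / 2) ^ m / fact m) (bidiff L m a b)"

lemma wick_nu_series: "wick L a b = nu_series (\<lambda>m. bidiff_exp L m a b)"
  by (simp add: wick_def nu_series_def bidiff_exp_def wscale_def)

lemma nu_series_add: "nu_series (\<lambda>m. X m + Y m) = nu_series X + nu_series Y"
  by (simp add: nu_series_def fun_eq_iff sum.distrib)

lemma nu_series_zero [simp]: "nu_series (\<lambda>m. 0) = 0"
  by (simp add: nu_series_def fun_eq_iff)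

lemma nu_series_sum: "nu_series (\<lambda>m. \<Sum>x\<in>S. X m x) = (\<Sum>x\<in>S. nu_series (\<lambda>m. X m x))"
  by (induct S rule: infinite_finite_induct) (simp_all only: sum.infinite sum.empty sum.insert nu_series_add nu_series_zero not_False_eq_True)

lemma nu_series_wscale: "nu_series (\<lambda>m. wscale z (X m)) = wscale z (nu_series X)"
  by (simp add: nu_series_def fun_eq_iff wscale_def sum_distrib_left)

lemma nu_series_dy: "nu_series (\<lambda>m. dy j (X m)) = dy j (nu_series X)"
  and nu_series_parity: "nu_series (\<lambda>m. parity (X m)) = parity (nu_series X)"
  by (simp_all add: nu_series_def fun_eq_iff dy_def parity_def sum_distrib_left)

lemma nu_series_dx_wedge: "nu_series (\<lambda>m. dx_wedge j (X m)) = dx_wedge j (nu_series X)"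
  by (simp add: nu_series_def fun_eq_iff dx_wedge_def sum_distrib_left)

text \<open>Both sides run over the triples of numbers with sum r, grouped by the last entry on the
  left and by the first on the right. It is the associativity of convolution in powers of
  \<nu>.\<close>

lemma sum_atMost_shift: "(\<Sum>s\<le>r. \<Sum>n\<le>s. f n (s - n) (r - s)) = (\<Sum>n\<le>r. \<Sum>s\<le>r - n. f n s (r - n - s))"
  for f :: "nat \<Rightarrow> nat \<Rightarrow> nat \<Rightarrow> 'a::comm_monoid_add"
proof -
  have "(\<Sum>s\<le>r. \<Sum>n\<le>s. f n (s - n) (r - s)) = (\<Sum>(s, n)\<in>(SIGMA s:{..r}. {..s}). f n (s - n) (r - s))"
    by (subst sum.Sigma) auto
  also have "\<dots> = (\<Sum>(n, s)\<in>(SIGMA n:{..r}. {..r - n}). f n s (r - n - s))"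
    by (rule sum.reindex_bij_witness[where j = "\<lambda>(s, n). (n, s - n)" and i = "\<lambda>(n, s). (n + s, n)"]) auto
  also have "\<dots> = (\<Sum>n\<le>r. \<Sum>s\<le>r - n. f n s (r - n - s))"
    by (subst sum.Sigma) auto
  finally show ?thesis .
qed

lemma sum_rotate: "(\<Sum>x\<in>A. \<Sum>y\<in>B. \<Sum>n\<in>N. f n x y) = (\<Sum>n\<in>N. \<Sum>x\<in>A. \<Sum>y\<in>B. f n x y)"
proof -
  have "(\<Sum>x\<in>A. \<Sum>y\<in>B. \<Sum>n\<in>N. f n x y) = (\<Sum>x\<in>A. \<Sum>n\<in>N. \<Sum>y\<in>B. f n x y)"
    by (intro sum.cong refl sum.swap)
  also have "\<dots> = (\<Sum>n\<in>N. \<Sum>x\<in>A. \<Sum>y\<in>B. f n x y)" by (rule sum.swap)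
  finally show ?thesis .
qed

lemma wmult_nu_series_left: "wmult (nu_series X) c = nu_series (\<lambda>n. wmult (X n) c)"
proof (intro ext)
  fix r :: nat and \<alpha> :: "'a \<Rightarrow> nat" and I :: "'a set"
  let ?g = "\<lambda>n s t. \<Sum>\<beta> | \<forall>i. \<beta> i \<le> \<alpha> i. \<Sum>K\<in>Pow I.
      wedge_sign K (I - K) * X n s \<beta> K * c t (\<lambda>i. \<alpha> i - \<beta> i) (I - K)"
  have "wmult (nu_series X) c r \<alpha> I = (\<Sum>s\<le>r. \<Sum>n\<le>s. ?g n (s - n) (r - s))"
    unfolding wmult_def nu_series_def sum_distrib_left sum_distrib_right
    by (intro sum.cong refl sum_rotate)
  also have "\<dots> = nu_series (\<lambda>n. wmult (X n) c) r \<alpha> I"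
    by (simp add: sum_atMost_shift[of ?g] nu_series_def wmult_def)
  finally show "wmult (nu_series X) c r \<alpha> I = nu_series (\<lambda>n. wmult (X n) c) r \<alpha> I" .
qed

lemma wmult_nu_series_right: "wmult a (nu_series X) = nu_series (\<lambda>n. wmult a (X n))"
proof (intro ext)
  fix r :: nat and \<alpha> :: "'a \<Rightarrow> nat" and I :: "'a set"
  let ?g = "\<lambda>n s t. \<Sum>\<beta> | \<forall>i. \<beta> i \<le> \<alpha> i. \<Sum>K\<in>Pow I.
      wedge_sign K (I - K) * a s \<beta> K * X n t (\<lambda>i. \<alpha> i - \<beta> i) (I - K)"
  have "wmult a (nu_series X) r \<alpha> I = (\<Sum>s\<le>r. \<Sum>n\<le>r - s. ?g n s (r - s - n))"
    unfolding wmult_def nu_series_def sum_distrib_left sum_distrib_right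
    by (intro sum.cong refl sum_rotate)
  also have "\<dots> = (\<Sum>(s, n)\<in>(SIGMA s:{..r}. {..r - s}). ?g n s (r - s - n))"
    by (subst sum.Sigma) auto
  also have "\<dots> = (\<Sum>(n, s)\<in>(SIGMA n:{..r}. {..r - n}). ?g n s (r - n - s))"
    by (rule sum.reindex_bij_witness[where j = prod.swap and i = prod.swap]) (auto simp: diff_diff_left add.commute)
  also have "\<dots> = (\<Sum>n\<le>r. \<Sum>s\<le>r - n. ?g n s (r - n - s))"
    by (subst sum.Sigma) auto
  also have "\<dots> = nu_series (\<lambda>n. wmult a (X n)) r \<alpha> I"
    by (simp add: nu_series_def wmult_def)
  finally show "wmult a (nu_series X) r \<alpha> I = nu_series (\<lambda>n. wmult a (X n)) r \<alpha> I" .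
qed

lemma bidiff_nu_series:
  "bidiff L m (nu_series X) c = nu_series (\<lambda>n. bidiff L m (X n) c)"
  "bidiff L m c (nu_series X) = nu_series (\<lambda>n. bidiff L m c (X n))"
  by (induct m arbitrary: c X)
     (simp_all add: wmult_nu_series_left wmult_nu_series_right nu_series_sum nu_series_wscale
       flip: nu_series_dy)

text \<open>The differential equation of exp(tP) as a series in t, read off at order m: (m + 1)
  E_(m+1) = P E_m.\<close>

lemma bidiff_exp_Suc:
  "wscale (of_nat (Suc m)) (bidiff_exp L (Suc m) a b) =
     (\<Sum>j\<in>UNIV. \<Sum>k\<in>UNIV. wscale (\<i> / 2 * L j k) (bidiff_exp L m (dy j a) (dy k b)))"
proof -
  have "of_nat (Suc m) * ((\<i> / 2) ^ Suc m / fact (Suc m)) = \<i> / 2 * ((\<i> / 2) ^ m / fact m)"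
    by (simp add: field_simps del: of_nat_Suc)
  then show ?thesis
    by (simp add: bidiff_exp_def additive_simps mult_ac del: of_nat_Suc)
qed

lemma bidiff_exp_0 [simp]: "bidiff_exp L 0 a b = wmult a b"
  by (simp add: bidiff_exp_def)

lemma bidiff_exp_simps:
  "bidiff_exp L m (a + a') b = bidiff_exp L m a b + bidiff_exp L m a' b"
  "bidiff_exp L m a (b + b') = bidiff_exp L m a b + bidiff_exp L m a b'"
  "bidiff_exp L m (\<Sum>x\<in>S. f x) b = (\<Sum>x\<in>S. bidiff_exp L m (f x) b)"
  "bidiff_exp L m a (\<Sum>x\<in>S. f x) = (\<Sum>x\<in>S. bidiff_exp L m a (f x))"
  "bidiff_exp L m (wscale z a) b = wscale z (bidiff_exp L m a b)"
  "bidiff_exp L m a (wscale z b) = wscale z (bidiff_exp L m a b)"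
  "dy j (bidiff_exp L m a b) = bidiff_exp L m (dy j a) b + bidiff_exp L m a (dy j b)"
  by (simp_all add: bidiff_exp_def bidiff_simps additive_simps mult.commute wscale_simps dy_bidiff)

lemma bidiff_exp_parity: "parity (bidiff_exp L m a b) = bidiff_exp L m (parity a) (parity b)"
  and bidiff_exp_dx_wedge_left: "bidiff_exp L m (dx_wedge j a) b = dx_wedge j (bidiff_exp L m a b)"
  and bidiff_exp_dx_wedge_right: "bidiff_exp L m a (dx_wedge j b) = dx_wedge j (bidiff_exp L m (parity a) b)"
  by (simp_all add: bidiff_exp_def parity_bidiff wscale_simps bidiff_dx_wedge_left bidiff_dx_wedge_right)

lemma bidiff_exp_nu_series:
  "bidiff_exp L m (nu_series X) c = nu_series (\<lambda>n. bidiff_exp L m (X n) c)"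
  "bidiff_exp L m c (nu_series X) = nu_series (\<lambda>n. bidiff_exp L m c (X n))"
  by (simp_all add: bidiff_exp_def bidiff_nu_series nu_series_wscale)

lemma wscale_cancel: "z \<noteq> 0 \<Longrightarrow> wscale z a = wscale z b \<Longrightarrow> a = b"
  by (auto simp: wscale_def fun_eq_iff)

text \<open>Each weight N + 1 is written as m + (N + 1 - m): the product rule for the derivative of
  a product of two power series, coefficient by coefficient. The term with weight zero drops out of
  either sum.\<close>

lemma sum_atMost_Suc_weighted:
  fixes f :: "nat \<Rightarrow> nat \<Rightarrow> 'n wform"
  shows "wscale (of_nat (Suc N)) (\<Sum>m\<le>Suc N. f m (Suc N - m)) =
    (\<Sum>m\<le>N. wscale (of_nat (Suc m)) (f (Suc m) (N - m))) + (\<Sum>m\<le>N. wscale (of_nat (Suc (N - m))) (f m (Suc (N - m))))"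
proof -
  have "wscale (of_nat (Suc N)) (\<Sum>m\<le>Suc N. f m (Suc N - m)) =
     (\<Sum>m\<le>Suc N. wscale (of_nat m) (f m (Suc N - m)) + wscale (of_nat (Suc N - m)) (f m (Suc N - m)))"
    unfolding wscale.sum
    by (intro sum.cong refl) (simp add: of_nat_diff flip: wscale_add_left)
  also have "\<dots> = (\<Sum>m\<le>Suc N. wscale (of_nat m) (f m (Suc N - m)))
       + (\<Sum>m\<le>Suc N. wscale (of_nat (Suc N - m)) (f m (Suc N - m)))"
    by (rule sum.distrib)
  also have "(\<Sum>m\<le>Suc N. wscale (of_nat m) (f m (Suc N - m))) = (\<Sum>m\<le>N. wscale (of_nat (Suc m)) (f (Suc m) (N - m)))"
    by (subst sum.atMost_Suc_shift) simp
  also have "(\<Sum>m\<le>Suc N. wscale (of_nat (Suc N - m)) (f m (Suc N - m)))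
      = (\<Sum>m\<le>N. wscale (of_nat (Suc (N - m))) (f m (Suc (N - m))))"
    by (simp add: Suc_diff_le del: of_nat_Suc of_nat_diff)
  finally show ?thesis .
qed

text \<open>After multiplication by N + 1 both sides become the operator L_12 + L_13 + L_23 on three
  factors, applied to the expressions for N. The induction varies a, b, c because the derivatives
  move into the arguments.\<close>

lemma bidiff_exp_assoc:
  "(\<Sum>m\<le>N. bidiff_exp L m (bidiff_exp L (N - m) a b) c) = (\<Sum>m\<le>N. bidiff_exp L m a (bidiff_exp L (N - m) b c))"
proof (induct N arbitrary: a b c)
  case 0
  show ?case by (simp add: wmult_assoc)
next
  case (Suc N)
  let ?z = "\<lambda>j k. \<i> / 2 * L j k"
  let ?P = "\<lambda>N a b c. \<Sum>m\<le>N. bidiff_exp L m (bidiff_exp L (N - m) a b) c"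
  let ?Q = "\<lambda>N a b c. \<Sum>m\<le>N. bidiff_exp L m a (bidiff_exp L (N - m) b c)"
  have "wscale (of_nat (Suc N)) (?P (Suc N) a b c) =
     (\<Sum>m\<le>N. wscale (of_nat (Suc m)) (bidiff_exp L (Suc m) (bidiff_exp L (N - m) a b) c)) +
     (\<Sum>m\<le>N. bidiff_exp L m (wscale (of_nat (Suc (N - m))) (bidiff_exp L (Suc (N - m)) a b)) c)"
    by (subst sum_atMost_Suc_weighted) (simp add: bidiff_exp_simps)
  also have "\<dots> = (\<Sum>j\<in>UNIV. \<Sum>k\<in>UNIV. wscale (?z j k)
      (?P N (dy j a) b (dy k c) + ?P N a (dy j b) (dy k c) + ?P N (dy j a) (dy k b) c))"
    unfolding bidiff_exp_Suc bidiff_exp_simps additive_simps sum.distrib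
    by (simp add: sum.swap[of _ _ "{..N}"])
  finally have P: "wscale (of_nat (Suc N)) (?P (Suc N) a b c) = (\<Sum>j\<in>UNIV. \<Sum>k\<in>UNIV. wscale (?z j k)
      (?P N (dy j a) b (dy k c) + ?P N a (dy j b) (dy k c) + ?P N (dy j a) (dy k b) c))" .
  have "wscale (of_nat (Suc N)) (?Q (Suc N) a b c) =
     (\<Sum>m\<le>N. wscale (of_nat (Suc m)) (bidiff_exp L (Suc m) a (bidiff_exp L (N - m) b c))) +
     (\<Sum>m\<le>N. bidiff_exp L m a (wscale (of_nat (Suc (N - m))) (bidiff_exp L (Suc (N - m)) b c)))"
    by (subst sum_atMost_Suc_weighted) (simp add: bidiff_exp_simps)
  also have "\<dots> = (\<Sum>j\<in>UNIV. \<Sum>k\<in>UNIV. wscale (?z j k)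
      (?Q N (dy j a) b (dy k c) + ?Q N a (dy j b) (dy k c) + ?Q N (dy j a) (dy k b) c))"
    unfolding bidiff_exp_Suc bidiff_exp_simps additive_simps sum.distrib
    by (simp add: sum.swap[of _ _ "{..N}"] add_ac)
  finally have Q: "wscale (of_nat (Suc N)) (?Q (Suc N) a b c) = (\<Sum>j\<in>UNIV. \<Sum>k\<in>UNIV. wscale (?z j k)
      (?Q N (dy j a) b (dy k c) + ?Q N a (dy j b) (dy k c) + ?Q N (dy j a) (dy k b) c))" .
  show ?case
    by (rule wscale_cancel[of "of_nat (Suc N)"], simp del: of_nat_Suc, unfold P Q)
       (simp only: Suc.hyps)
qed

lemma wick_assoc: "wick L (wick L a b) c = wick L a (wick L b c)"
proof (intro ext)
  fix r :: nat and \<alpha> I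
  have "wick L (wick L a b) c r \<alpha> I = (\<Sum>m\<le>r. \<Sum>n\<le>r - m. bidiff_exp L m (bidiff_exp L n a b) c (r - m - n) \<alpha> I)"
    by (simp add: wick_nu_series bidiff_exp_nu_series) (simp add: nu_series_def)
  also have "\<dots> = (\<Sum>N\<le>r. \<Sum>m\<le>N. bidiff_exp L m (bidiff_exp L (N - m) a b) c (r - N) \<alpha> I)"
    by (rule sum_atMost_shift[symmetric])
  also have "\<dots> = (\<Sum>N\<le>r. (\<Sum>m\<le>N. bidiff_exp L m (bidiff_exp L (N - m) a b) c) (r - N) \<alpha> I)"
    by (simp add: sum_apply)
  also have "\<dots> = (\<Sum>N\<le>r. (\<Sum>m\<le>N. bidiff_exp L m a (bidiff_exp L (N - m) b c)) (r - N) \<alpha> I)"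
    by (simp only: bidiff_exp_assoc)
  also have "\<dots> = (\<Sum>N\<le>r. \<Sum>m\<le>N. bidiff_exp L m a (bidiff_exp L (N - m) b c) (r - N) \<alpha> I)"
    by (simp add: sum_apply)
  also have "\<dots> = (\<Sum>m\<le>r. \<Sum>n\<le>r - m. bidiff_exp L m a (bidiff_exp L n b c) (r - m - n) \<alpha> I)"
    by (rule sum_atMost_shift)
  also have "\<dots> = wick L a (wick L b c) r \<alpha> I"
    by (simp add: wick_nu_series bidiff_exp_nu_series) (simp add: nu_series_def)
  finally show "wick L (wick L a b) c r \<alpha> I = wick L a (wick L b c) r \<alpha> I" .
qed

interpretation wick_left: additive "\<lambda>a. wick L a b" for L b
  by unfold_locales (simp add: wick_nu_series bidiff_exp_simps nu_series_add)
interpretation wick_right: additive "wick L a" for L a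
  by unfold_locales (simp add: wick_nu_series bidiff_exp_simps nu_series_add)

lemma wick_wscale:
  "wick L (wscale z a) b = wscale z (wick L a b)"
  "wick L a (wscale z b) = wscale z (wick L a b)"
  by (simp_all add: wick_nu_series bidiff_exp_simps nu_series_wscale)

lemmas wick_simps = wick_left.add wick_left.diff wick_left.minus wick_left.zero wick_left.sum
  wick_right.add wick_right.diff wick_right.minus wick_right.zero wick_right.sum wick_wscale

lemma dy_wick: "dy j (wick L a b) = wick L (dy j a) b + wick L a (dy j b)"
  by (simp add: wick_nu_series bidiff_exp_simps nu_series_add flip: nu_series_dy)

lemma wick_dx_wedge_left: "wick L (dx_wedge j a) b = dx_wedge j (wick L a b)"
  by (simp add: wick_nu_series bidiff_exp_dx_wedge_left nu_series_dx_wedge)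

lemma wick_dx_wedge_right: "wick L a (dx_wedge j b) = dx_wedge j (wick L (parity a) b)"
  by (simp add: wick_nu_series bidiff_exp_dx_wedge_right nu_series_dx_wedge)

lemma parity_wick: "parity (wick L a b) = wick L (parity a) (parity b)"
  by (simp add: wick_nu_series bidiff_exp_parity flip: nu_series_parity)

section \<open>Multiplication by \<nu>, and Wick products with a fibre coordinate\<close>

lemma nu_mult_nu_series: "nu_mult a = nu_series (\<lambda>m. if m = 1 then a else 0)"
proof (intro ext)
  fix r \<alpha> I
  have "nu_series (\<lambda>m. if m = 1 then a else 0) r \<alpha> I = (\<Sum>m\<le>r. if m = 1 then a (r - 1) \<alpha> I else 0)"
    unfolding nu_series_def by (intro sum.cong) auto
  then show "nu_mult a r \<alpha> I = nu_series (\<lambda>m. if m = 1 then a else 0) r \<alpha> I"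
    by (cases r) (auto simp: nu_mult_def)
qed

text \<open>Multiplication by \<nu> is a series with a single term, so it inherits the compatibility
  of \<open>bidiff_exp\<close> with series.\<close>

lemma bidiff_exp_nu_mult:
  "bidiff_exp L m (nu_mult a) b = nu_mult (bidiff_exp L m a b)"
  "bidiff_exp L m b (nu_mult a) = nu_mult (bidiff_exp L m b a)"
  unfolding nu_mult_nu_series bidiff_exp_nu_series
  by (rule arg_cong[where f = nu_series]; simp add: fun_eq_iff bidiff_exp_def bidiff_simps additive_simps)+

lemma nu_series_nu_mult: "nu_series (\<lambda>m. nu_mult (X m)) = nu_mult (nu_series X)"
proof (intro ext)
  fix r :: nat and \<alpha> I
  show "nu_series (\<lambda>m. nu_mult (X m)) r \<alpha> I = nu_mult (nu_series X) r \<alpha> I"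
    by (cases r) (auto simp: nu_series_def nu_mult_def Suc_diff_le)
qed

lemma wick_nu_mult: "wick L (nu_mult a) b = nu_mult (wick L a b)" "wick L a (nu_mult b) = nu_mult (wick L a b)"
  by (simp_all add: wick_nu_series bidiff_exp_nu_mult nu_series_nu_mult)

lemma nu_series_linear:
  "nu_series (\<lambda>m. if m = 0 then A else if m = 1 then B else 0) = A + nu_mult B"
proof -
  have "(\<lambda>m::nat. if m = 0 then A else if m = 1 then B else 0) = (\<lambda>m. (if m = 0 then A else 0) + (if m = 1 then B else 0))"
    by (auto simp: fun_eq_iff)
  moreover have "nu_series (\<lambda>m. if m = 0 then A else 0) r \<alpha> I = (\<Sum>m\<le>r. if m = 0 then A (r - m) \<alpha> I else 0)" for r \<alpha> I
    unfolding nu_series_def by (intro sum.cong) auto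
  then have "nu_series (\<lambda>m. if m = 0 then A else 0) = A" by (simp add: fun_eq_iff)
  ultimately show ?thesis by (simp only: nu_series_add nu_mult_nu_series)
qed

lemma wmult_wone_right [simp]: "wmult a wone = a"
proof -
  have "wmult a wone = wmult wone a" by (rule wmult_commute) (auto simp: wone_def)
  then show ?thesis by simp
qed

lemma dy_wone [simp]: "dy j wone = 0"
  by (auto simp: dy_def wone_def fun_eq_iff)

lemma bidiff_wone:
  "bidiff L m wone b = (if m = 0 then b else 0)" "bidiff L m b wone = (if m = 0 then b else 0)"
  by (cases m; simp add: bidiff_simps additive_simps)+

lemma wick_wone [simp]: "wick L wone b = b" "wick L b wone = b"
proof -
  have "bidiff_exp L m wone b = (if m = 0 then b else if m = 1 then 0 else 0)"
    "bidiff_exp L m b wone = (if m = 0 then b else if m = 1 then 0 else 0)" for m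
    by (simp_all add: bidiff_exp_def bidiff_wone additive_simps)
  then show "wick L wone b = b" "wick L b wone = b"
    by (simp_all only: wick_nu_series nu_series_linear additive_simps) simp_all
qed

abbreviation yvar :: "'n::{finite, linorder} \<Rightarrow> 'n wform" where
  "yvar s \<equiv> y_mult s wone"

lemma dy_yvar: "dy j (yvar s) = (if j = s then wone else 0)"
  by (simp add: dy_y_mult additive_simps)

lemma bidiff_yvar:
  "bidiff L (Suc m) (yvar s) b = (if m = 0 then \<Sum>k\<in>UNIV. wscale (L s k) (dy k b) else 0)"
  "bidiff L (Suc m) b (yvar s) = (if m = 0 then \<Sum>k\<in>UNIV. wscale (L k s) (dy k b) else 0)"
proof -
  have "bidiff L (Suc m) (yvar s) b = (\<Sum>j\<in>UNIV. if j = s then \<Sum>k\<in>UNIV. wscale (L s k) (bidiff L m wone (dy k b)) else 0)"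
    unfolding bidiff.simps by (intro sum.cong refl) (auto simp: dy_yvar bidiff_simps additive_simps)
  then show "bidiff L (Suc m) (yvar s) b = (if m = 0 then \<Sum>k\<in>UNIV. wscale (L s k) (dy k b) else 0)"
    by (simp add: bidiff_wone additive_simps)
  have "bidiff L (Suc m) b (yvar s) = (\<Sum>j\<in>UNIV. \<Sum>k\<in>UNIV. if k = s then wscale (L j s) (bidiff L m (dy j b) wone) else 0)"
    unfolding bidiff.simps by (intro sum.cong refl) (auto simp: dy_yvar bidiff_simps additive_simps)
  then show "bidiff L (Suc m) b (yvar s) = (if m = 0 then \<Sum>k\<in>UNIV. wscale (L k s) (dy k b) else 0)"
    by (simp add: bidiff_wone additive_simps)
qed

lemma wmult_yvar: "wmult (yvar s) b = y_mult s b" "wmult b (yvar s) = y_mult s b"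
  by (simp_all add: wmult_y_mult_left wmult_y_mult_right)

text \<open>The exponential breaks off after the first order because y^s is linear. The two products
  differ only in the order of the indices of L, which is what commutators with y^s detect.\<close>

lemma wick_yvar:
  "wick L (yvar s) b = y_mult s b + nu_mult (\<Sum>k\<in>UNIV. wscale (\<i> / 2 * L s k) (dy k b))"
  "wick L b (yvar s) = y_mult s b + nu_mult (\<Sum>k\<in>UNIV. wscale (\<i> / 2 * L k s) (dy k b))"
proof -
  have "bidiff_exp L m (yvar s) b = (if m = 0 then y_mult s b else
      if m = 1 then (\<Sum>k\<in>UNIV. wscale (\<i> / 2 * L s k) (dy k b)) else 0)"
    "bidiff_exp L m b (yvar s) = (if m = 0 then y_mult s b else
      if m = 1 then (\<Sum>k\<in>UNIV. wscale (\<i> / 2 * L k s) (dy k b)) else 0)" for m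
    by (cases m; simp add: bidiff_exp_def bidiff_yvar wmult_yvar additive_simps del: bidiff.simps(2))+
  then show "wick L (yvar s) b = y_mult s b + nu_mult (\<Sum>k\<in>UNIV. wscale (\<i> / 2 * L s k) (dy k b))"
    "wick L b (yvar s) = y_mult s b + nu_mult (\<Sum>k\<in>UNIV. wscale (\<i> / 2 * L k s) (dy k b))"
    by (simp_all only: wick_nu_series nu_series_linear)
qed

lemma nu_shift_nu_mult [simp]: "nu_shift (nu_mult a) = a"
  by (simp add: nu_shift_def nu_mult_def)

lemma nu_mult_nu_shift: "a 0 = 0 \<Longrightarrow> nu_mult (nu_shift a) = a"
  by (auto simp: nu_shift_def nu_mult_def fun_eq_iff split: nat.splits)

text \<open>The description in \<open>nu_div\<close> has at most one solution since
  \<open>nu_shift\<close> is a left inverse of \<open>nu_mult\<close>; the vanishing \<nu>^0 part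
  supplies one.\<close>

lemma nu_div_nu_shift:
  assumes "a 0 = 0" shows "nu_div a = nu_shift a"
  unfolding nu_div_def
  by (rule the_equality) (use assms nu_mult_nu_shift in auto)

lemma wick_0: "wick L a b 0 = wmult a b 0"
  by (simp add: wick_def fun_eq_iff)

lemma nu_shift_wick:
  assumes "a 0 = 0"
  shows "nu_shift (wick L a b) = wick L (nu_shift a) b" "nu_shift (wick L b a) = wick L b (nu_shift a)"
  using wick_nu_mult(1)[of L "nu_shift a" b] wick_nu_mult(2)[of L b "nu_shift a"]
  by (simp_all add: nu_mult_nu_shift assms)

section \<open>Degrees\<close>

definition is_form :: "nat \<Rightarrow> 'n wform \<Rightarrow> bool" where
  "is_form q a \<longleftrightarrow> (\<forall>r \<alpha> I. card I \<noteq> q \<longrightarrow> a r \<alpha> I = 0)"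

lemma form_part_is_form: "form_part q a = a \<longleftrightarrow> is_form q a"
  by (auto simp: form_part_def is_form_def fun_eq_iff)

lemma is_form_add: "is_form q a \<Longrightarrow> is_form q b \<Longrightarrow> is_form q (a + b)"
  and is_form_diff: "is_form q a \<Longrightarrow> is_form q b \<Longrightarrow> is_form q (a - b)"
  and is_form_zero: "is_form q 0"
  and is_form_wscale: "is_form q a \<Longrightarrow> is_form q (wscale z a)"
  and is_form_dy: "is_form q a \<Longrightarrow> is_form q (dy j a)"
  and is_form_y_mult: "is_form q a \<Longrightarrow> is_form q (y_mult j a)"
  and is_form_nu_shift: "is_form q a \<Longrightarrow> is_form q (nu_shift a)"
  by (auto simp: is_form_def wscale_def dy_def y_mult_def nu_shift_def)

lemma is_form_sum: "(\<And>x. x \<in> S \<Longrightarrow> is_form q (f x)) \<Longrightarrow> is_form q (\<Sum>x\<in>S. f x)"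
  by (induct S rule: infinite_finite_induct) (auto intro: is_form_add is_form_zero)

lemma is_form_dx_wedge: "is_form q a \<Longrightarrow> is_form (Suc q) (dx_wedge j a)"
  by (auto simp: is_form_def dx_wedge_def) (metis card_Suc_Diff1 finite)

lemma is_form_dx_contract: "is_form (Suc q) a \<Longrightarrow> is_form q (dx_contract j a)"
  by (auto simp: is_form_def dx_contract_def)

lemma is_form_wone: "is_form 0 wone"
  by (auto simp: is_form_def wone_def)

lemma is_form_wmult:
  fixes a b :: "'n::{finite, linorder} wform"
  assumes "is_form p a" "is_form q b"
  shows "is_form (p + q) (wmult a b)"
  unfolding is_form_def
proof (intro allI impI)
  fix r \<alpha> and I :: "'n set"
  assume "card I \<noteq> p + q"
  then have "card K \<noteq> p \<or> card (I - K) \<noteq> q" if "K \<subseteq> I" for K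
    using that card_mono[of I K] by (auto simp: card_Diff_subset)
  then have "a s \<beta> K = 0 \<or> b s' \<beta>' (I - K) = 0" if "K \<subseteq> I" for K s s' \<beta> \<beta>'
    using that assms by (metis is_form_def)
  then show "wmult a b r \<alpha> I = 0"
    unfolding wmult_def by (intro sum.neutral ballI) (metis (no_types, lifting) PowD mult_zero_left mult_zero_right)
qed

lemma is_form_bidiff: "is_form p a \<Longrightarrow> is_form q b \<Longrightarrow> is_form (p + q) (bidiff L m a b)"
  by (induct m arbitrary: a b) (auto intro!: is_form_wmult is_form_sum is_form_wscale intro: is_form_dy)

lemma is_form_wick: "is_form p a \<Longrightarrow> is_form q b \<Longrightarrow> is_form (p + q) (wick L a b)"
  using is_form_bidiff[of p a q b L] by (auto simp: is_form_def wick_def)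

lemma parity_is_form: "is_form q a \<Longrightarrow> parity a = (if even q then a else - a)"
proof (intro ext)
  fix r \<alpha> I assume "is_form q a"
  then show "parity a r \<alpha> I = (if even q then a else - a) r \<alpha> I"
    by (cases "card I = q") (auto simp: is_form_def parity_def)
qed

text \<open>At order \<nu>^0 the Wick product is the undeformed one, which is graded commutative.
  This is what makes (i/\<nu>) times a commutator meaningful.\<close>

lemma wick_graded_commute_0:
  assumes "is_form q a"
  shows "odd q \<Longrightarrow> (wick L a b - wick L (parity b) a) 0 = 0"
    and "even q \<Longrightarrow> (wick L a b - wick L b a) 0 = 0"
proof -
  show "(wick L a b - wick L (parity b) a) 0 = 0" if "odd q"
  proof -
    have "wmult (parity b) a = wmult a (parity (parity b))"
      by (rule wmult_parity_right) (use assms that in \<open>unfold is_form_def, metis\<close>)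
    then show ?thesis by (simp add: wick_0)
  qed
  show "(wick L a b - wick L b a) 0 = 0" if "even q"
  proof -
    have "wmult b a = wmult a b"
      by (rule wmult_commute) (use assms that in \<open>unfold is_form_def, metis\<close>)
    then show ?thesis by (simp add: wick_0)
  qed
qed

text \<open>For a one-form the graded commutator with itself is twice its square.\<close>

lemma wick_self_0: "is_form 1 a \<Longrightarrow> wick L a a 0 = 0"
proof -
  assume a: "is_form 1 a"
  have "(wick L a a + wick L a a) 0 = 0"
    using wick_graded_commute_0(1)[OF a, of L a] by (simp add: parity_is_form[OF a] wick_simps)
  then show ?thesis by (auto simp: fun_eq_iff)
qed

text \<open>The double sum over form degrees reduces to p = 1; the signs (-1)^q left in the second
  product recombine to \<open>parity b\<close>.\<close>

lemma graded_commutator_odd: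
  fixes a b :: "'n::{finite, linorder} wform"
  assumes "is_form 1 a"
  shows "graded_commutator L a b = wick L a b - wick L (parity b) a"
proof -
  have a: "form_part p a = (if p = 1 then a else 0)" for p
    using assms by (auto simp: form_part_def is_form_def fun_eq_iff)
  have c: "card I \<le> CARD('n)" for I :: "'n set" by (simp add: card_mono)
  have 1: "(\<Sum>q\<le>CARD('n). form_part q b) = b"
    using c by (auto simp: fun_eq_iff sum_apply form_part_def)
  have 2: "(\<Sum>q\<le>CARD('n). wscale ((- 1) ^ q) (form_part q b)) = parity b"
    using c by (auto simp: fun_eq_iff sum_apply form_part_def wscale_def parity_def if_distrib cong: if_cong)
  have "graded_commutator L a b =
     (\<Sum>p\<le>CARD('n). if p = 1 then (\<Sum>q\<le>CARD('n). wick L a (form_part q b)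
        - wscale ((- 1) ^ q) (wick L (form_part q b) a)) else 0)"
    unfolding graded_commutator_def
    by (intro sum.cong refl) (auto simp: a wick_simps additive_simps)
  also have "\<dots> = (\<Sum>q\<le>CARD('n). wick L a (form_part q b)
        - wscale ((- 1) ^ q) (wick L (form_part q b) a))"
    by (simp add: Suc_le_eq)
  also have "\<dots> = wick L a b - wick L (parity b) a"
    by (simp add: sum_subtractf flip: wick_simps(5,10,11,12)) (simp add: 1 2)
  finally show ?thesis .
qed

lemma dy_Deg_part: "Deg_part k (dy j a) = dy j (Deg_part (Suc k) a)"
  by (auto simp: Deg_part_def dy_def ydeg_update fun_eq_iff)

lemma dy_Deg_part_0: "dy j (Deg_part 0 a) = 0"
  by (auto simp: Deg_part_def dy_def ydeg_update fun_eq_iff)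

lemma ydeg_add: "ydeg (\<alpha> + \<beta>) = ydeg \<alpha> + ydeg \<beta>"
  by (simp add: ydeg_def sum.distrib)

lemma Deg_part_wmult: "Deg_part k (wmult a b) = (\<Sum>i\<le>k. wmult (Deg_part i a) (Deg_part (k - i) b))"
proof (intro ext)
  fix r :: nat and \<alpha> :: "'a \<Rightarrow> nat" and I :: "'a set"
  have *: "(\<Sum>i\<le>k. w * (if d = i then x else 0) * (if d' = k - i then y else 0)) = (if d + d' = k then w * x * y else 0)"
    for w x y :: complex and d d' :: nat
  proof -
    have "(\<Sum>i\<le>k. w * (if d = i then x else 0) * (if d' = k - i then y else 0)) =
       (\<Sum>i\<le>k. if i = d then (if d' = k - d then w * x * y else 0) else 0)"
      by (intro sum.cong) auto
    then show ?thesis by auto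
  qed
  have "(\<Sum>i\<le>k. wmult (Deg_part i a) (Deg_part (k - i) b)) r \<alpha> I =
    (\<Sum>(s, s', \<beta>, \<beta>', K, K')\<in>splits r \<alpha> I. if 2 * s + ydeg \<beta> + (2 * s' + ydeg \<beta>') = k
        then wedge_sign K K' * a s \<beta> K * b s' \<beta>' K' else 0)"
    unfolding sum_apply wmult_splits by (subst sum.swap) (simp add: case_prod_unfold Deg_part_def *)
  also have "\<dots> = Deg_part k (wmult a b) r \<alpha> I"
  proof -
    have "2 * s + ydeg \<beta> + (2 * s' + ydeg \<beta>') = 2 * r + ydeg \<alpha>" if "(s, s', \<beta>, \<beta>', K, K') \<in> splits r \<alpha> I" for s s' \<beta> \<beta>' K K'
      using that ydeg_add[of \<beta> \<beta>'] by (auto simp: splits_def)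
    then show ?thesis
      unfolding wmult_splits Deg_part_def
      by (cases "2 * r + ydeg \<alpha> = k") (auto intro!: sum.cong sum.neutral)
  qed
  finally show "Deg_part k (wmult a b) r \<alpha> I = (\<Sum>i\<le>k. wmult (Deg_part i a) (Deg_part (k - i) b)) r \<alpha> I" by simp
qed

text \<open>Every derivative lowers \<open>Deg\<close> by one and annihilates degree zero. If i + j
  < 2m, one of i, j is below m and is used up by the m derivatives.\<close>

lemma bidiff_Deg_part_zero: "i + j < 2 * m \<Longrightarrow> bidiff L m (Deg_part i a) (Deg_part j b) = 0"
proof (induct m arbitrary: i j a b)
  case (Suc m)
  have "bidiff L m (dy u (Deg_part i a)) (dy v (Deg_part j b)) = 0" for u v
  proof (cases "i = 0 \<or> j = 0")
    case True
    then show ?thesis by (auto simp: dy_Deg_part_0 bidiff_simps)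
  next
    case False
    then obtain i' j' where "i = Suc i'" "j = Suc j'" by (metis not0_implies_Suc)
    with Suc.prems have "i' + j' < 2 * m" by simp
    from Suc.hyps[OF this, of "dy u a" "dy v b"] show ?thesis
      by (simp only: dy_Deg_part \<open>i = Suc i'\<close> \<open>j = Suc j'\<close>)
  qed
  then show ?case by (simp add: additive_simps)
qed simp

text \<open>The m pairs of derivatives lower \<open>Deg\<close> by 2m. In the induction step the sum
  gains its two end terms, in which a derivative hits a part of degree zero.\<close>

lemma Deg_part_bidiff:
  "Deg_part k (bidiff L m a b) = (\<Sum>i\<le>k + 2 * m. bidiff L m (Deg_part i a) (Deg_part (k + 2 * m - i) b))"
proof (induct m arbitrary: a b)
  case 0
  show ?case by (simp add: Deg_part_wmult)
next
  case (Suc m)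
  have *: "Deg_part k (bidiff L m (dy u a) (dy v b)) =
    (\<Sum>i\<le>k + 2 * Suc m. bidiff L m (dy u (Deg_part i a)) (dy v (Deg_part (k + 2 * Suc m - i) b)))" for u v
  proof -
    have "(\<Sum>i\<le>k + 2 * Suc m. bidiff L m (dy u (Deg_part i a)) (dy v (Deg_part (k + 2 * Suc m - i) b)))
       = (\<Sum>i\<le>Suc (k + 2 * m). bidiff L m (dy u (Deg_part (Suc i) a)) (dy v (Deg_part (Suc (k + 2 * m) - i) b)))"
      by (simp add: sum.atMost_Suc_shift dy_Deg_part_0 bidiff_simps del: sum.atMost_Suc)
    also have "\<dots> = (\<Sum>i\<le>k + 2 * m. bidiff L m (dy u (Deg_part (Suc i) a)) (dy v (Deg_part (Suc (k + 2 * m - i)) b)))"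
      by (simp add: dy_Deg_part_0 bidiff_simps Suc_diff_le)
    finally show ?thesis by (simp add: Suc dy_Deg_part)
  qed
  show ?case
    unfolding bidiff.simps Deg_part.sum wscale_simps *
    by (subst sum_rotate[symmetric]) (simp only: wscale.sum)
qed

lemma Deg_part_nu_series:
  "Deg_part k (nu_series X) = nu_series (\<lambda>m. if 2 * m \<le> k then Deg_part (k - 2 * m) (X m) else 0)"
  by (auto simp: Deg_part_def nu_series_def fun_eq_iff intro!: sum.neutral sum.cong)

text \<open>The m-th term takes 2m derivatives and carries \<nu>^m of degree 2m, so losses and gains
  cancel and the product is graded by \<open>Deg\<close>. For 2m > k both sides of the termwise
  identity vanish.\<close>

lemma Deg_part_wick: "Deg_part k (wick L a b) = (\<Sum>i\<le>k. wick L (Deg_part i a) (Deg_part (k - i) b))"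
proof -
  have "(if 2 * m \<le> k then Deg_part (k - 2 * m) (bidiff_exp L m a b) else 0) =
    (\<Sum>i\<le>k. bidiff_exp L m (Deg_part i a) (Deg_part (k - i) b))" for m
    by (auto simp: bidiff_exp_def wscale_simps Deg_part_bidiff bidiff_Deg_part_zero additive_simps)
  then show ?thesis by (simp add: wick_nu_series Deg_part_nu_series nu_series_sum)
qed

lemma Deg_part_nu_shift: "Deg_part k (nu_shift a) = nu_shift (Deg_part (Suc (Suc k)) a)"
  by (auto simp: Deg_part_def nu_shift_def fun_eq_iff)

lemma Deg_part_y_mult:
  "Deg_part (Suc k) (y_mult s a) = y_mult s (Deg_part k a)" "Deg_part 0 (y_mult s a) = 0"
proof -
  show "Deg_part (Suc k) (y_mult s a) = y_mult s (Deg_part k a)"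
  proof (intro ext)
    fix r \<alpha> I
    show "Deg_part (Suc k) (y_mult s a) r \<alpha> I = y_mult s (Deg_part k a) r \<alpha> I"
      using ydeg_update_minus[of \<alpha> s] by (auto simp: Deg_part_def y_mult_def)
  qed
  show "Deg_part 0 (y_mult s a) = 0"
    by (auto simp: Deg_part_def y_mult_def fun_eq_iff ydeg_def)
qed

text \<open>Contraction and division leave \<open>Deg\<close> alone and y^j raises it by one; every
  induction over the degree lives on this gain.\<close>

lemma Deg_part_fib_delta_inv_Suc: "Deg_part (Suc k) (fib_delta_inv a) = fib_delta_inv (Deg_part k a)"
proof -
  have "Deg_part k (dx_contract j b) = dx_contract j (Deg_part k b)" for j and b :: "'a wform"
    by (auto simp: Deg_part_def dx_contract_def fun_eq_iff)
  moreover have "Deg_part k (deg_inv b) = deg_inv (Deg_part k b)" for b :: "'a wform"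
    by (auto simp: Deg_part_def deg_inv_def fun_eq_iff)
  ultimately show ?thesis by (simp add: fib_delta_inv_altdef koszul_def Deg_part.sum Deg_part_y_mult)
qed

lemma Deg_part_fib_delta_inv_0: "Deg_part 0 (fib_delta_inv a) = 0"
  by (simp add: fib_delta_inv_altdef koszul_def Deg_part.sum Deg_part_y_mult)

lemma Deg_part_eqI: "(\<And>k. Deg_part k a = Deg_part k b) \<Longrightarrow> a = b"
  by (auto simp: Deg_part_def fun_eq_iff) metis

section \<open>Calculus\<close>

lemma partial_deriv_eq: "(f has_derivative f') (at x) \<Longrightarrow> partial_deriv j f x = f' (axis j 1)"
  using frechet_derivative_at[of f f' x] by (simp add: partial_deriv_def)

lemma has_derivative_cong_open:
  assumes "open S" "x \<in> S" "\<And>y. y \<in> S \<Longrightarrow> f y = g y"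
  shows "(f has_derivative f') (at x) \<longleftrightarrow> (g has_derivative f') (at x)"
  using has_derivative_transform_within_open[OF _ assms(1,2)] assms(3) by metis

lemma partial_deriv_cong:
  assumes "open S" "x \<in> S" "\<And>y. y \<in> S \<Longrightarrow> f y = g y"
  shows "partial_deriv j f x = partial_deriv j g x"
  by (simp add: partial_deriv_def frechet_derivative_def has_derivative_cong_open[OF assms])

lemma Ck_on_cong:
  assumes "open S" "\<And>y. y \<in> S \<Longrightarrow> f y = g y"
  shows "Ck_on k S f \<longleftrightarrow> Ck_on k S g"
  using assms(2)
proof (induct k arbitrary: f g)
  case 0
  then show ?case by (simp cong: continuous_on_cong)
next
  case (Suc k)
  have "Ck_on k S (partial_deriv j f) \<longleftrightarrow> Ck_on k S (partial_deriv j g)" for j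
    by (rule Suc.hyps) (rule partial_deriv_cong[OF assms(1) _ Suc.prems])
  moreover have "f differentiable_on S \<longleftrightarrow> g differentiable_on S"
    unfolding differentiable_on_eq_differentiable_at[OF assms(1)] differentiable_def
    by (simp add: has_derivative_cong_open[OF assms(1) _ Suc.prems])
  ultimately show ?case by simp
qed

lemma smooth_on_cong:
  assumes "open S" "\<And>y. y \<in> S \<Longrightarrow> f y = g y"
  shows "smooth_on S f \<longleftrightarrow> smooth_on S g"
  using Ck_on_cong[OF assms] by (simp add: smooth_on_def)

lemma Ck_on_Suc_imp: "Ck_on (Suc k) S f \<Longrightarrow> Ck_on k S f"
proof (induct k arbitrary: f)
  case 0
  then show ?case by (simp add: differentiable_imp_continuous_on)
qed auto

lemma Ck_on_differentiable: "open S \<Longrightarrow> x \<in> S \<Longrightarrow> Ck_on (Suc k) S f \<Longrightarrow> f differentiable (at x)"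
  by (auto simp: differentiable_on_eq_differentiable_at)

lemma partial_deriv_linear:
  assumes "bounded_linear h" "f differentiable (at x)"
  shows "partial_deriv j (\<lambda>x. h (f x)) x = h (partial_deriv j f x)"
    and "(\<lambda>x. h (f x)) differentiable (at x)"
proof -
  have f: "(f has_derivative frechet_derivative f (at x)) (at x)"
    using assms(2) by (simp add: frechet_derivative_works)
  have "((\<lambda>x. h (f x)) has_derivative (\<lambda>v. h (frechet_derivative f (at x) v))) (at x)"
    by (rule bounded_linear.has_derivative[OF assms(1) f])
  then show "partial_deriv j (\<lambda>x. h (f x)) x = h (partial_deriv j f x)" "(\<lambda>x. h (f x)) differentiable (at x)"
    by (auto dest: partial_deriv_eq intro: differentiableI simp: partial_deriv_def[of j f])
qed

lemma partial_deriv_bilinear: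
  assumes "bounded_bilinear B" "f differentiable (at x)" "g differentiable (at x)"
  shows "partial_deriv j (\<lambda>x. B (f x) (g x)) x = B (f x) (partial_deriv j g x) + B (partial_deriv j f x) (g x)"
    and "(\<lambda>x. B (f x) (g x)) differentiable (at x)"
proof -
  have fg: "(f has_derivative frechet_derivative f (at x)) (at x)" "(g has_derivative frechet_derivative g (at x)) (at x)"
    using assms(2,3) by (simp_all add: frechet_derivative_works)
  note * = bounded_bilinear.FDERIV[OF assms(1) fg]
  show "partial_deriv j (\<lambda>x. B (f x) (g x)) x = B (f x) (partial_deriv j g x) + B (partial_deriv j f x) (g x)"
    using partial_deriv_eq[OF *] by (simp add: partial_deriv_def)
  show "(\<lambda>x. B (f x) (g x)) differentiable (at x)"
    using * by (rule differentiableI)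
qed

lemma partial_deriv_add:
  assumes "f differentiable (at x)" "g differentiable (at x)"
  shows "partial_deriv j (\<lambda>x. f x + g x) x = partial_deriv j f x + partial_deriv j g x"
proof -
  have fg: "(f has_derivative frechet_derivative f (at x)) (at x)" "(g has_derivative frechet_derivative g (at x)) (at x)"
    using assms by (simp_all add: frechet_derivative_works)
  show ?thesis using partial_deriv_eq[OF has_derivative_add[OF fg]] by (simp add: partial_deriv_def)
qed

lemma partial_deriv_const [simp]: "partial_deriv j (\<lambda>x. z) x = 0"
  by (rule partial_deriv_eq[of _ "\<lambda>_. 0"]) simp

lemma Ck_on_const: "Ck_on k S (\<lambda>x. z)"
proof (induct k arbitrary: z)
  case (Suc k)
  have "partial_deriv j (\<lambda>x. z) = (\<lambda>x. 0)" for j :: 'a by (simp add: fun_eq_iff)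
  with Suc[of 0] show ?case by simp
qed simp

lemma Ck_on_linear:
  assumes "bounded_linear h" "open S" "Ck_on k S f"
  shows "Ck_on k S (\<lambda>x. h (f x))"
  using assms(3)
proof (induct k arbitrary: f)
  case 0
  then show ?case using bounded_linear.continuous_on[OF assms(1)] by auto
next
  case (Suc k)
  have d: "f differentiable (at x)" if "x \<in> S" for x
    using Suc.prems that assms(2) by (rule_tac Ck_on_differentiable)
  have "Ck_on k S (partial_deriv j (\<lambda>x. h (f x)))" for j
  proof -
    have "Ck_on k S (\<lambda>x. h (partial_deriv j f x))" using Suc by simp
    then show ?thesis
      by (subst Ck_on_cong[OF assms(2) partial_deriv_linear(1)[OF assms(1) d]])
  qed
  then show ?case using partial_deriv_linear(2)[OF assms(1) d]
    by (auto simp: differentiable_on_def differentiable_at_withinI)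
qed

lemma Ck_on_add:
  assumes "open S" "Ck_on k S f" "Ck_on k S g"
  shows "Ck_on k S (\<lambda>x. f x + g x)"
  using assms(2,3)
proof (induct k arbitrary: f g)
  case 0
  then show ?case by (simp add: continuous_on_add)
next
  case (Suc k)
  have d: "f differentiable (at x)" "g differentiable (at x)" if "x \<in> S" for x
    using Suc.prems that assms(1) by (auto simp: differentiable_on_eq_differentiable_at)
  have "Ck_on k S (partial_deriv j (\<lambda>x. f x + g x))" for j
  proof -
    have "Ck_on k S (\<lambda>x. partial_deriv j f x + partial_deriv j g x)" using Suc by simp
    then show ?thesis
      by (subst Ck_on_cong[OF assms(1) partial_deriv_add[OF d]])
  qed
  then show ?case using Suc.prems by simp
qed

lemma Ck_on_bilinear:
  assumes "bounded_bilinear B" "open S" "Ck_on k S f" "Ck_on k S g"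
  shows "Ck_on k S (\<lambda>x. B (f x) (g x))"
  using assms(3,4)
proof (induct k arbitrary: f g)
  case 0
  then show ?case using bounded_bilinear.continuous_on[OF assms(1)] by auto
next
  case (Suc k)
  have d: "f differentiable (at x)" "g differentiable (at x)" if "x \<in> S" for x
    using Suc.prems that assms(2) by (auto simp: differentiable_on_eq_differentiable_at)
  have "Ck_on k S (partial_deriv j (\<lambda>x. B (f x) (g x)))" for j
  proof -
    have "Ck_on k S (\<lambda>x. B (f x) (partial_deriv j g x) + B (partial_deriv j f x) (g x))"
      using Suc.prems by (intro Ck_on_add[OF assms(2)] Suc.hyps) (auto intro: Ck_on_Suc_imp)
    then show ?thesis
      by (subst Ck_on_cong[OF assms(2) partial_deriv_bilinear(1)[OF assms(1) d]])
  qed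
  then show ?case using partial_deriv_bilinear(2)[OF assms(1) d]
    by (auto simp: differentiable_on_def differentiable_at_withinI)
qed

lemma Ck_on_inverse:
  fixes f :: "real^'n::finite \<Rightarrow> real"
  assumes "open S" "Ck_on k S f" "\<And>x. x \<in> S \<Longrightarrow> f x \<noteq> 0"
  shows "Ck_on k S (\<lambda>x. inverse (f x))"
  using assms(2)
proof (induct k)
  case 0
  then show ?case using assms(3) by (auto intro: continuous_on_inverse)
next
  case (Suc k)
  have d: "f differentiable (at x)" if "x \<in> S" for x
    using Suc.prems that assms(1) by (auto simp: differentiable_on_eq_differentiable_at)
  have *: "((\<lambda>x. inverse (f x)) has_derivative (\<lambda>v. - (inverse (f x) * frechet_derivative f (at x) v * inverse (f x)))) (at x)"
    if "x \<in> S" for x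
    by (rule Deriv.has_derivative_inverse) (use d[OF that] assms(3)[OF that] in \<open>auto simp: frechet_derivative_works\<close>)
  have p: "partial_deriv j (\<lambda>x. inverse (f x)) x = - 1 * (inverse (f x) * partial_deriv j f x * inverse (f x))" if "x \<in> S" for x j
    using partial_deriv_eq[OF *[OF that]] by (simp add: partial_deriv_def)
  have "Ck_on k S (partial_deriv j (\<lambda>x. inverse (f x)))" for j
  proof -
    have i: "Ck_on k S (\<lambda>x. inverse (f x))" using Suc Ck_on_Suc_imp by blast
    have "Ck_on k S (\<lambda>x. - 1 * (inverse (f x) * partial_deriv j f x * inverse (f x)))"
      using Suc.prems
      by (intro Ck_on_bilinear[OF bounded_bilinear_mult assms(1)] i Ck_on_const) simp
    then show ?thesis
      by (subst Ck_on_cong[OF assms(1) p])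
  qed
  then show ?case using *
    by (auto simp: differentiable_on_def intro: differentiable_at_withinI differentiableI)
qed

text \<open>The difference quotient is symmetric in i and j while the right side is not; comparing
  the two choices gives the symmetry of second derivatives. The radius 2h comes from moving x by at
  most h along each of two unit vectors.\<close>

lemma mixed_difference:
  fixes f :: "real^'n::finite \<Rightarrow> real"
  assumes S: "open S" "Ck_on 2 S f" and h: "0 < h" and sub: "cball x (2 * h) \<subseteq> S"
  shows "\<exists>y. dist x y \<le> 2 * h \<and>
    f (x + h *\<^sub>R axis i 1 + h *\<^sub>R axis j 1) - f (x + h *\<^sub>R axis i 1) - f (x + h *\<^sub>R axis j 1) + f x =
    h * (h * partial_deriv j (partial_deriv i f) y)"
proof -
  have S2: "Ck_on (Suc (Suc 0)) S f" using S(2) by (simp add: numeral_2_eq_2)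
  let ?P = "\<lambda>s t. x + s *\<^sub>R axis i 1 + t *\<^sub>R axis j (1::real)"
  have dist: "dist x (?P s t) \<le> 2 * h" if "0 \<le> s" "s \<le> h" "0 \<le> t" "t \<le> h" for s t
  proof -
    have "dist x (?P s t) = norm (s *\<^sub>R axis i 1 + t *\<^sub>R axis j (1::real) :: real^'n)"
      by (simp add: dist_norm norm_minus_commute algebra_simps)
    also have "\<dots> \<le> s + t"
      using norm_triangle_ineq[of "s *\<^sub>R axis i 1" "t *\<^sub>R axis j (1::real) :: real^'n"] that by simp
    finally show ?thesis using that by simp
  qed
  then have inS: "?P s t \<in> S" if "0 \<le> s" "s \<le> h" "0 \<le> t" "t \<le> h" for s t
    using that sub by (meson mem_cball subsetD)
  have d1: "(f has_derivative frechet_derivative f (at y)) (at y)" if "y \<in> S" for y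
    using Ck_on_differentiable[OF S(1) that S2] by (simp add: frechet_derivative_works)
  have d2: "(partial_deriv i f has_derivative frechet_derivative (partial_deriv i f) (at y)) (at y)" if "y \<in> S" for y
    using Ck_on_differentiable[OF S(1) that, of 0 "partial_deriv i f"] S2 by (simp add: frechet_derivative_works)
  have line: "((\<lambda>s. g (z + s *\<^sub>R axis k 1)) has_real_derivative partial_deriv k g (z + s *\<^sub>R axis k 1)) (at s)"
    if g: "(g has_derivative frechet_derivative g (at (z + s *\<^sub>R axis k 1))) (at (z + s *\<^sub>R axis k 1))"
    for g :: "real^'n \<Rightarrow> real" and z k s
  proof -
    have "((\<lambda>s. z + s *\<^sub>R axis k 1) has_derivative (\<lambda>u. u *\<^sub>R axis k (1::real))) (at s)"
      by (auto intro!: derivative_eq_intros)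
    from has_derivative_compose[OF this g]
    have "((\<lambda>s. g (z + s *\<^sub>R axis k 1)) has_derivative (\<lambda>u. frechet_derivative g (at (z + s *\<^sub>R axis k 1)) (u *\<^sub>R axis k 1))) (at s)" .
    moreover have "frechet_derivative g (at (z + s *\<^sub>R axis k 1)) (u *\<^sub>R axis k 1) = partial_deriv k g (z + s *\<^sub>R axis k 1) * u" for u
      using linear_scale[OF has_derivative_linear[OF g]] by (simp add: partial_deriv_def)
    ultimately show ?thesis by (simp add: has_field_derivative_def mult_commute_abs)
  qed
  let ?\<phi> = "\<lambda>s. f (?P s h) - f (?P s 0)"
  \<comment> \<open>Mean value theorem in direction i, for the difference of f between two points
    that lie h apart in direction j; afterwards the same in direction j.\<close>
  have "\<exists>s. 0 < s \<and> s < h \<and> ?\<phi> h - ?\<phi> 0 = (h - 0) * (partial_deriv i f (?P s h) - partial_deriv i f (?P s 0))"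
  proof (rule MVT2[OF h])
    fix s assume "0 \<le> s" "s \<le> h"
    have e: "(x + t *\<^sub>R axis j 1) + s *\<^sub>R axis i 1 = ?P s t" for s t by (simp add: algebra_simps)
    have "((\<lambda>s. f (?P s h)) has_real_derivative partial_deriv i f (?P s h)) (at s)"
      "((\<lambda>s. f (?P s 0)) has_real_derivative partial_deriv i f (?P s 0)) (at s)"
      using line[of f "x + h *\<^sub>R axis j 1" s i] line[of f "x + 0 *\<^sub>R axis j 1" s i]
        d1[OF inS[of s h]] d1[OF inS[of s 0]] h \<open>0 \<le> s\<close> \<open>s \<le> h\<close> unfolding e by auto
    then show "(?\<phi> has_real_derivative partial_deriv i f (?P s h) - partial_deriv i f (?P s 0)) (at s)"
      by (rule DERIV_diff)
  qed
  then obtain s where s: "0 < s" "s < h" "?\<phi> h - ?\<phi> 0 = h * (partial_deriv i f (?P s h) - partial_deriv i f (?P s 0))"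
    by auto
  have "\<exists>t. 0 < t \<and> t < h \<and> partial_deriv i f (?P s h) - partial_deriv i f (?P s 0) = (h - 0) * partial_deriv j (partial_deriv i f) (?P s t)"
  proof (rule MVT2[OF h])
    fix t assume "0 \<le> t" "t \<le> h"
    then show "((\<lambda>t. partial_deriv i f (?P s t)) has_real_derivative partial_deriv j (partial_deriv i f) (?P s t)) (at t)"
      using s by (intro line d2 inS) auto
  qed
  then obtain t where t: "0 < t" "t < h"
    "partial_deriv i f (?P s h) - partial_deriv i f (?P s 0) = h * partial_deriv j (partial_deriv i f) (?P s t)"
    by auto
  show ?thesis
    using s t dist[of s t] by (intro exI[of _ "?P s t"]) (simp add: algebra_simps)
qed

lemma partial_deriv_commute_real:
  fixes f :: "real^'n::finite \<Rightarrow> real"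
  assumes S: "open S" "Ck_on 2 S f" "x \<in> S"
  shows "partial_deriv i (partial_deriv j f) x = partial_deriv j (partial_deriv i f) x"
proof (rule ccontr)
  let ?A = "partial_deriv j (partial_deriv i f)" and ?B = "partial_deriv i (partial_deriv j f)"
  assume ne: "\<not> ?thesis"
  \<comment> \<open>Half the gap: a number cannot lie within e of both values.\<close>
  define e where "e = \<bar>?A x - ?B x\<bar> / 2"
  have e: "e > 0" using ne by (simp add: e_def)
  have "continuous (at x) ?A" "continuous (at x) ?B"
    using S by (auto simp: numeral_2_eq_2 continuous_on_eq_continuous_at)
  then obtain d1 d2 where d: "d1 > 0" "d2 > 0"
    "\<And>y. dist y x < d1 \<Longrightarrow> dist (?A y) (?A x) < e" "\<And>y. dist y x < d2 \<Longrightarrow> dist (?B y) (?B x) < e"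
    unfolding continuous_at_eps_delta using e by metis
  obtain d3 where d3: "d3 > 0" "cball x d3 \<subseteq> S" using S(1,3) open_contains_cball by metis
  \<comment> \<open>A quarter of the least radius, so that points at distance at most 2h stay inside
    all three balls.\<close>
  define h where "h = min d1 (min d2 d3) / 4"
  have h: "h > 0" "2 * h < d1" "2 * h < d2" "2 * h \<le> d3" using d(1,2) d3(1) by (auto simp: h_def min_def)
  then have sub: "cball x (2 * h) \<subseteq> S" using d3(2) by auto
  obtain y where y: "dist x y \<le> 2 * h"
    "f (x + h *\<^sub>R axis i 1 + h *\<^sub>R axis j 1) - f (x + h *\<^sub>R axis i 1) - f (x + h *\<^sub>R axis j 1) + f x = h * (h * ?A y)"
    using mixed_difference[OF S(1,2) h(1) sub, of i j] by blast
  obtain z where z: "dist x z \<le> 2 * h"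
    "f (x + h *\<^sub>R axis j 1 + h *\<^sub>R axis i 1) - f (x + h *\<^sub>R axis j 1) - f (x + h *\<^sub>R axis i 1) + f x = h * (h * ?B z)"
    using mixed_difference[OF S(1,2) h(1) sub, of j i] by blast
  have "x + h *\<^sub>R axis j 1 + h *\<^sub>R axis i 1 = x + h *\<^sub>R axis i 1 + h *\<^sub>R axis j (1::real)" by (simp add: algebra_simps)
  with y(2) z(2) have "h * (h * ?A y) = h * (h * ?B z)" by (simp add: algebra_simps)
  then have "?A y = ?B z" using h(1) by simp
  moreover have "dist (?A y) (?A x) < e" "dist (?B z) (?B x) < e"
    using y(1) z(1) h d(3)[of y] d(4)[of z] by (auto simp: dist_commute)
  ultimately show False by (simp add: dist_real_def e_def abs_if split: if_splits)
qed

text \<open>Inner products with basis vectors are linear, hence commute with derivatives and reduce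
  the claim to real functions.\<close>

lemma partial_deriv_commute:
  fixes f :: "real^'n::finite \<Rightarrow> 'b::euclidean_space"
  assumes S: "open S" "Ck_on 2 S f" "x \<in> S"
  shows "partial_deriv i (partial_deriv j f) x = partial_deriv j (partial_deriv i f) x"
proof (rule euclidean_eqI)
  fix b :: 'b
  have S2: "Ck_on (Suc (Suc 0)) S f" using S(2) by (simp add: numeral_2_eq_2)
  have bl: "bounded_linear (\<lambda>v. v \<bullet> b)" by (rule bounded_linear_inner_left)
  have 1: "partial_deriv j (\<lambda>x. f x \<bullet> b) y = partial_deriv j f y \<bullet> b" if "y \<in> S" for j y
    by (rule partial_deriv_linear(1)[OF bl Ck_on_differentiable[OF S(1) that S2]])
  have 2: "partial_deriv i (partial_deriv j (\<lambda>x. f x \<bullet> b)) x = partial_deriv i (partial_deriv j f) x \<bullet> b" for i j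
  proof -
    have "partial_deriv i (partial_deriv j (\<lambda>x. f x \<bullet> b)) x = partial_deriv i (\<lambda>x. partial_deriv j f x \<bullet> b) x"
      by (rule partial_deriv_cong[OF S(1,3) 1])
    also have "\<dots> = partial_deriv i (partial_deriv j f) x \<bullet> b"
      by (rule partial_deriv_linear(1)[OF bl Ck_on_differentiable[OF S(1,3), of 0]]) (use S2 in simp)
    finally show ?thesis .
  qed
  have "Ck_on 2 S (\<lambda>x. f x \<bullet> b)" by (rule Ck_on_linear[OF bl S(1,2)])
  from partial_deriv_commute_real[OF S(1) this S(3), of i j]
  show "partial_deriv i (partial_deriv j f) x \<bullet> b = partial_deriv j (partial_deriv i f) x \<bullet> b"
    by (simp only: 2)
qed

section \<open>Calculus in a chart\<close>

locale chart =
  fixes c :: "('m, 'n::finite) chart"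
  assumes open_image: "open (chart_image c)"
    and inj: "inj_on (coords c) (dom_of c)"
begin

lemma chart_inv_coords [simp]: "p \<in> dom_of c \<Longrightarrow> chart_inv c (coords c p) = p"
  by (simp add: chart_inv_def inj)

lemma coords_chart_inv [simp]: "x \<in> chart_image c \<Longrightarrow> coords c (chart_inv c x) = x"
  by (auto simp: chart_image_def inj)

lemma chart_inv_dom [simp]: "x \<in> chart_image c \<Longrightarrow> chart_inv c x \<in> dom_of c"
  by (auto simp: chart_image_def inj)

lemma coords_image [simp]: "p \<in> dom_of c \<Longrightarrow> coords c p \<in> chart_image c"
  by (simp add: chart_image_def)

lemma smooth_in_chart_cong: "(\<And>p. p \<in> dom_of c \<Longrightarrow> f p = g p) \<Longrightarrow> smooth_in_chart c f = smooth_in_chart c g"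
  unfolding smooth_in_chart_def by (rule smooth_on_cong[OF open_image]) simp

lemma pd_cong: "(\<And>q. q \<in> dom_of c \<Longrightarrow> f q = g q) \<Longrightarrow> p \<in> dom_of c \<Longrightarrow> pd c j f p = pd c j g p"
  unfolding pd_def by (rule partial_deriv_cong[OF open_image]) simp_all

lemma smooth_differentiable:
  "smooth_in_chart c f \<Longrightarrow> p \<in> dom_of c \<Longrightarrow> (\<lambda>x. f (chart_inv c x)) differentiable (at (coords c p))"
  by (rule Ck_on_differentiable[OF open_image]) (auto simp: smooth_in_chart_def smooth_on_def)

lemma smooth_const: "smooth_in_chart c (\<lambda>p. z)"
  by (simp add: smooth_in_chart_def smooth_on_def Ck_on_const)

lemma smooth_add: "smooth_in_chart c f \<Longrightarrow> smooth_in_chart c g \<Longrightarrow> smooth_in_chart c (\<lambda>p. f p + g p)"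
  by (simp add: smooth_in_chart_def smooth_on_def Ck_on_add[OF open_image])

lemma smooth_linear: "bounded_linear h \<Longrightarrow> smooth_in_chart c f \<Longrightarrow> smooth_in_chart c (\<lambda>p. h (f p))"
  by (simp add: smooth_in_chart_def smooth_on_def Ck_on_linear[OF _ open_image, of h])

lemma smooth_mult:
  fixes f g :: "'m \<Rightarrow> 'b::real_normed_algebra"
  shows "smooth_in_chart c f \<Longrightarrow> smooth_in_chart c g \<Longrightarrow> smooth_in_chart c (\<lambda>p. f p * g p)"
  by (simp add: smooth_in_chart_def smooth_on_def Ck_on_bilinear[OF bounded_bilinear_mult open_image])

lemma smooth_of_real: "smooth_in_chart c f \<Longrightarrow> smooth_in_chart c (\<lambda>p. of_real (f p) :: complex)"
  by (rule smooth_linear[OF bounded_linear_of_real])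

lemma smooth_minus: "smooth_in_chart c f \<Longrightarrow> smooth_in_chart c (\<lambda>p. - f p)"
  by (rule smooth_linear[OF bounded_linear_minus[OF bounded_linear_ident]])

lemma smooth_diff: "smooth_in_chart c f \<Longrightarrow> smooth_in_chart c g \<Longrightarrow> smooth_in_chart c (\<lambda>p. f p - g p)"
  using smooth_add[OF _ smooth_minus, of f g] by simp

lemma smooth_inverse:
  fixes f :: "'m \<Rightarrow> real"
  shows "smooth_in_chart c f \<Longrightarrow> (\<And>p. p \<in> dom_of c \<Longrightarrow> f p \<noteq> 0) \<Longrightarrow> smooth_in_chart c (\<lambda>p. inverse (f p))"
  by (simp add: smooth_in_chart_def smooth_on_def Ck_on_inverse[OF open_image])

lemma smooth_sum: "(\<And>x. x \<in> S \<Longrightarrow> smooth_in_chart c (f x)) \<Longrightarrow> smooth_in_chart c (\<lambda>p. \<Sum>x\<in>S. f x p)"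
  by (induct S rule: infinite_finite_induct) (auto intro: smooth_add smooth_const)

lemma smooth_prod:
  fixes f :: "'x \<Rightarrow> 'm \<Rightarrow> real"
  shows "(\<And>x. x \<in> S \<Longrightarrow> smooth_in_chart c (f x)) \<Longrightarrow> smooth_in_chart c (\<lambda>p. \<Prod>x\<in>S. f x p)"
  by (induct S rule: infinite_finite_induct) (auto intro: smooth_mult smooth_const)

lemma smooth_pd: "smooth_in_chart c f \<Longrightarrow> smooth_in_chart c (pd c j f)"
proof -
  assume f: "smooth_in_chart c f"
  have "Ck_on k (chart_image c) (partial_deriv j (\<lambda>x. f (chart_inv c x)))" for k
    using f unfolding smooth_in_chart_def smooth_on_def by (metis Ck_on.simps(2))
  then have "smooth_on (chart_image c) (partial_deriv j (\<lambda>x. f (chart_inv c x)))"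
    by (simp add: smooth_on_def)
  then show ?thesis unfolding smooth_in_chart_def
    by (rule smooth_on_cong[OF open_image, THEN iffD2, rotated]) (simp add: pd_def)
qed

lemmas smooth_intros = smooth_const smooth_add smooth_mult smooth_of_real smooth_minus smooth_diff
  smooth_sum smooth_pd

lemma pd_const [simp]: "pd c j (\<lambda>p. z) p = 0"
  by (simp add: pd_def)

lemma pd_add:
  "smooth_in_chart c f \<Longrightarrow> smooth_in_chart c g \<Longrightarrow> p \<in> dom_of c \<Longrightarrow>
    pd c j (\<lambda>p. f p + g p) p = pd c j f p + pd c j g p"
  by (simp add: pd_def partial_deriv_add smooth_differentiable)

lemma pd_linear:
  "bounded_linear h \<Longrightarrow> smooth_in_chart c f \<Longrightarrow> p \<in> dom_of c \<Longrightarrow> pd c j (\<lambda>p. h (f p)) p = h (pd c j f p)"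
  by (simp add: pd_def partial_deriv_linear(1)[of h] smooth_differentiable)

lemma pd_mult:
  fixes f g :: "'m \<Rightarrow> 'b::real_normed_algebra"
  shows "smooth_in_chart c f \<Longrightarrow> smooth_in_chart c g \<Longrightarrow> p \<in> dom_of c \<Longrightarrow>
    pd c j (\<lambda>p. f p * g p) p = f p * pd c j g p + pd c j f p * g p"
  by (simp add: pd_def partial_deriv_bilinear[OF bounded_bilinear_mult] smooth_differentiable)

lemma pd_of_real:
  "smooth_in_chart c f \<Longrightarrow> p \<in> dom_of c \<Longrightarrow> pd c j (\<lambda>p. of_real (f p) :: complex) p = of_real (pd c j f p)"
  by (rule pd_linear[OF bounded_linear_of_real])

lemma pd_minus: "smooth_in_chart c f \<Longrightarrow> p \<in> dom_of c \<Longrightarrow> pd c j (\<lambda>p. - f p) p = - pd c j f p"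
  by (rule pd_linear[OF bounded_linear_minus[OF bounded_linear_ident]])

lemma pd_diff:
  "smooth_in_chart c f \<Longrightarrow> smooth_in_chart c g \<Longrightarrow> p \<in> dom_of c \<Longrightarrow>
    pd c j (\<lambda>p. f p - g p) p = pd c j f p - pd c j g p"
  using pd_add[of f "\<lambda>p. - g p" p j] by (simp add: pd_minus smooth_minus)

lemma pd_sum:
  "(\<And>x. x \<in> S \<Longrightarrow> smooth_in_chart c (f x)) \<Longrightarrow> p \<in> dom_of c \<Longrightarrow>
    pd c j (\<lambda>p. \<Sum>x\<in>S. f x p) p = (\<Sum>x\<in>S. pd c j (f x) p)"
  by (induct S rule: infinite_finite_induct) (auto simp: pd_add smooth_sum)

lemma pd_cmult:
  fixes f :: "'m \<Rightarrow> 'b::real_normed_algebra"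
  shows "smooth_in_chart c f \<Longrightarrow> p \<in> dom_of c \<Longrightarrow> pd c j (\<lambda>p. z * f p) p = z * pd c j f p"
  by (simp add: pd_mult smooth_const)

lemma pd_commute:
  fixes f :: "'m \<Rightarrow> 'b::euclidean_space"
  assumes "smooth_in_chart c f" "p \<in> dom_of c"
  shows "pd c i (pd c j f) p = pd c j (pd c i f) p"
proof -
  let ?f = "\<lambda>x. f (chart_inv c x)"
  have *: "pd c i (pd c j f) p = partial_deriv i (partial_deriv j ?f) (coords c p)" for i j
    unfolding pd_def[of c i] using assms(2)
    by (intro partial_deriv_cong[OF open_image]) (simp_all add: pd_def)
  show ?thesis unfolding *
    using assms by (intro partial_deriv_commute[OF open_image]) (auto simp: smooth_in_chart_def smooth_on_def)
qed

end

section \<open>Inverse matrices: symmetry, smoothness and derivatives\<close>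

lemma matrix_inv_inverse:
  assumes "invertible (A :: real^'n::finite^'n)"
  shows "A ** matrix_inv A = mat 1" "matrix_inv A ** A = mat 1"
  using someI_ex[OF assms[unfolded invertible_def]] by (auto simp: matrix_inv_def)

text \<open>Cramer's rule turns the entries of the inverse into quotients of determinants, whence
  their smoothness in \<open>smooth_matrix_inv\<close>.\<close>

lemma matrix_inv_cramer:
  assumes "invertible (A :: real^'n::finite^'n)"
  shows "matrix_inv A $ i $ j = det (\<chi> a b. if b = i then axis j 1 $ a else A $ a $ b) / det A"
proof -
  have "A *v (matrix_inv A *v axis j 1) = axis j 1"
    by (simp add: matrix_vector_mul_assoc matrix_inv_inverse[OF assms])
  then have "matrix_inv A *v axis j 1 = (\<chi> k. det (\<chi> a b. if b = k then axis j 1 $ a else A $ a $ b) / det A)"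
    using assms by (simp add: cramer invertible_det_nz)
  moreover have "(matrix_inv A *v axis j 1) $ i = matrix_inv A $ i $ j"
    by (simp add: matrix_vector_mult_def axis_def if_distrib cong: if_cong)
  ultimately show ?thesis by simp
qed

lemma matrix_inv_antisym:
  assumes A: "invertible (A :: real^'n::finite^'n)" and anti: "\<And>j k. A $ k $ j = - A $ j $ k"
  shows "matrix_inv A $ k $ j = - matrix_inv A $ j $ k"
proof -
  let ?H = "matrix_inv A"
  have "transpose A $ a $ b = (- A) $ a $ b" for a b
    using anti[of a b] by (simp add: transpose_def)
  then have t: "transpose A = - A" by (simp add: vec_eq_iff)
  have "transpose (A ** ?H) = mat 1" by (simp add: matrix_inv_inverse[OF A])
  then have "transpose ?H ** (- A) = mat 1" by (simp add: matrix_transpose_mul t)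
  then have "(transpose ?H ** (- A)) ** ?H = ?H" by simp
  then have "transpose ?H ** ((- A) ** ?H) = ?H" by (simp add: matrix_mul_assoc)
  moreover have "(- A) ** ?H = - mat 1"
    using matrix_inv_inverse(1)[OF A] by (simp add: vec_eq_iff matrix_matrix_mult_def sum_negf)
  moreover have "transpose ?H ** (- mat 1) = - transpose ?H"
    by (simp add: vec_eq_iff matrix_matrix_mult_def sum_negf mat_def if_distrib cong: if_cong)
  ultimately have "- transpose ?H = ?H" by simp
  then have "(- transpose ?H) $ k $ j = ?H $ k $ j" by simp
  then show ?thesis by (simp add: transpose_def)
qed

lemma matrix_inv_sym:
  assumes A: "invertible (A :: real^'n::finite^'n)" and sym: "\<And>j k. A $ k $ j = A $ j $ k"
  shows "matrix_inv A $ k $ j = matrix_inv A $ j $ k"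
proof -
  let ?H = "matrix_inv A"
  have t: "transpose A = A" using sym by (simp add: vec_eq_iff transpose_def)
  have "transpose (A ** ?H) = mat 1" by (simp add: matrix_inv_inverse[OF A])
  then have "transpose ?H ** A = mat 1" by (simp add: matrix_transpose_mul t)
  then have "(transpose ?H ** A) ** ?H = ?H" by simp
  then have "transpose ?H = ?H" by (simp add: matrix_inv_inverse[OF A] flip: matrix_mul_assoc)
  then show ?thesis by (simp add: vec_eq_iff transpose_def)
qed

lemma matrix_add_rdistrib: "(A + B) ** C = A ** C + B ** C" for A B :: "real^'n^'m" and C :: "real^'k^'n"
  by (simp add: vec_eq_iff matrix_matrix_mult_def algebra_simps sum.distrib)

context chart
begin

lemma smooth_det:
  fixes M :: "'m \<Rightarrow> real^'a::finite^'a"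
  assumes "\<And>a b. smooth_in_chart c (\<lambda>p. M p $ a $ b)"
  shows "smooth_in_chart c (\<lambda>p. det (M p))"
  unfolding det_def using assms by (intro smooth_sum smooth_mult smooth_const smooth_prod)

lemma smooth_matrix_inv:
  fixes h :: "'m \<Rightarrow> real^'a::finite^'a"
  assumes "\<And>a b. smooth_in_chart c (\<lambda>p. h p $ a $ b)" "\<And>p. p \<in> dom_of c \<Longrightarrow> invertible (h p)"
  shows "smooth_in_chart c (\<lambda>p. matrix_inv (h p) $ i $ j)"
proof -
  have "smooth_in_chart c (\<lambda>p. (\<chi> a b. if b = i then axis j 1 $ a else h p $ a $ b) $ a $ b)" for a b
    using assms(1) by (cases "b = i") (auto intro: smooth_const)
  then have "smooth_in_chart c (\<lambda>p. det (\<chi> a b. if b = i then axis j 1 $ a else h p $ a $ b) * inverse (det (h p)))"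
    using assms by (intro smooth_mult smooth_inverse smooth_det) (auto simp: invertible_det_nz)
  then show ?thesis
    by (rule smooth_in_chart_cong[THEN iffD1, rotated])
       (simp add: matrix_inv_cramer assms(2) divide_inverse)
qed

text \<open>Differentiating H h = 1 gives dH = - H dh H, and parallelism reads dh = M^T h + h M with
  M the connection matrix; the factors H h and h H then cancel.\<close>

lemma matrix_inv_parallel:
  fixes h :: "'m \<Rightarrow> real^'n::finite^'n"
  assumes sm: "\<And>a b. smooth_in_chart c (\<lambda>p. h p $ a $ b)"
    and inv: "\<And>p. p \<in> dom_of c \<Longrightarrow> invertible (h p)"
    and p: "p \<in> dom_of c"
    and par: "\<And>k l. pd c j (\<lambda>q. h q $ k $ l) p - (\<Sum>m\<in>UNIV. G m k * h p $ m $ l) - (\<Sum>m\<in>UNIV. G m l * h p $ k $ m) = 0"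
  shows "pd c j (\<lambda>q. matrix_inv (h q) $ u $ v) p =
    - (\<Sum>l\<in>UNIV. G u l * matrix_inv (h p) $ l $ v) - (\<Sum>l\<in>UNIV. G v l * matrix_inv (h p) $ u $ l)"
proof -
  define H where "H = matrix_inv (h p)"
  define dH :: "real^'n^'n" where "dH = (\<chi> a b. pd c j (\<lambda>q. matrix_inv (h q) $ a $ b) p)"
  define dh :: "real^'n^'n" where "dh = (\<chi> a b. pd c j (\<lambda>q. h q $ a $ b) p)"
  define M :: "real^'n^'n" where "M = (\<chi> a b. G a b)"
  have smH: "smooth_in_chart c (\<lambda>p. matrix_inv (h p) $ a $ b)" for a b
    by (rule smooth_matrix_inv[OF sm inv])
  have "dH ** h p + H ** dh = 0"
  proof -
    have "(dH ** h p + H ** dh) $ a $ b = pd c j (\<lambda>q. \<Sum>w\<in>UNIV. matrix_inv (h q) $ a $ w * h q $ w $ b) p" for a b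
      using smH sm p
      by (simp add: pd_sum pd_mult smooth_mult matrix_matrix_mult_def dH_def dh_def H_def sum.distrib)
    also have "\<dots> a b = pd c j (\<lambda>q. (mat 1 :: real^'n^'n) $ a $ b) p" for a b
      by (rule pd_cong[OF _ p])
         (simp add: matrix_inv_inverse(2)[OF inv, symmetric], simp add: matrix_matrix_mult_def)
    finally show ?thesis by (simp add: vec_eq_iff)
  qed
  then have "(dH ** h p + H ** dh) ** H = 0" by simp
  then have "dH ** (h p ** H) = - (H ** dh ** H)"
    by (simp add: matrix_add_rdistrib matrix_mul_assoc eq_neg_iff_add_eq_0)
  then have 1: "dH = - (H ** dh ** H)" by (simp add: H_def matrix_inv_inverse[OF inv[OF p]])
  have "dh = transpose M ** h p + h p ** M"
    using par by (simp add: vec_eq_iff dh_def M_def transpose_def matrix_matrix_mult_def algebra_simps)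
  then have "H ** dh ** H = (H ** transpose M) ** (h p ** H) + (H ** h p) ** M ** H"
    by (simp add: matrix_add_ldistrib matrix_add_rdistrib matrix_mul_assoc)
  then have "H ** dh ** H = H ** transpose M + M ** H"
    by (simp add: H_def matrix_inv_inverse[OF inv[OF p]])
  with 1 have "dH $ u $ v = - (H ** transpose M + M ** H) $ u $ v" by simp
  then show ?thesis
    by (simp add: dH_def H_def M_def transpose_def matrix_matrix_mult_def algebra_simps)
qed

section \<open>Local sections\<close>

definition smooth_section :: "('m \<Rightarrow> 'k::{finite, linorder} wform) \<Rightarrow> bool" where
  "smooth_section a \<longleftrightarrow> (\<forall>r \<alpha> I. smooth_in_chart c (\<lambda>p. a p r \<alpha> I))"

definition pdw :: "'n \<Rightarrow> ('m \<Rightarrow> 'k::{finite, linorder} wform) \<Rightarrow> 'm \<Rightarrow> 'k wform" where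
  "pdw j a p = (\<lambda>r \<alpha> I. pd c j (\<lambda>q. a q r \<alpha> I) p)"

lemma smooth_if: "(P \<Longrightarrow> smooth_in_chart c f) \<Longrightarrow> (\<not> P \<Longrightarrow> smooth_in_chart c g) \<Longrightarrow>
    smooth_in_chart c (\<lambda>p. if P then f p else g p)"
  by (cases P) simp_all

lemma smooth_section_const: "smooth_section (\<lambda>p. z)"
  and smooth_section_add: "smooth_section a \<Longrightarrow> smooth_section b \<Longrightarrow> smooth_section (\<lambda>p. a p + b p)"
  and smooth_section_diff: "smooth_section a \<Longrightarrow> smooth_section b \<Longrightarrow> smooth_section (\<lambda>p. a p - b p)"
  and smooth_section_wscale: "smooth_in_chart c f \<Longrightarrow> smooth_section a \<Longrightarrow> smooth_section (\<lambda>p. wscale (f p) (a p))"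
  and smooth_section_pdw: "smooth_section a \<Longrightarrow> smooth_section (pdw j a)"
  and smooth_section_nu_shift: "smooth_section a \<Longrightarrow> smooth_section (\<lambda>p. nu_shift (a p))"
  and smooth_section_dy: "smooth_section a \<Longrightarrow> smooth_section (\<lambda>p. dy k (a p))"
  and smooth_section_parity: "smooth_section a \<Longrightarrow> smooth_section (\<lambda>p. parity (a p))"
  by (auto simp: smooth_section_def wscale_def pdw_def nu_shift_def dy_def parity_def
      intro!: smooth_intros)

lemma smooth_section_y_mult: "smooth_section a \<Longrightarrow> smooth_section (\<lambda>p. y_mult k (a p))"
  and smooth_section_dx_wedge: "smooth_section a \<Longrightarrow> smooth_section (\<lambda>p. dx_wedge k (a p))"
  and smooth_section_dx_contract: "smooth_section a \<Longrightarrow> smooth_section (\<lambda>p. dx_contract k (a p))"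
  by (auto simp: smooth_section_def y_mult_def dx_wedge_def dx_contract_def intro!: smooth_intros smooth_if)

lemma smooth_section_deg_inv: "smooth_section a \<Longrightarrow> smooth_section (\<lambda>p. deg_inv (a p))"
  by (auto simp: smooth_section_def deg_inv_def divide_inverse simp del: of_nat_add intro!: smooth_intros)

lemma smooth_section_sum: "(\<And>x. x \<in> S \<Longrightarrow> smooth_section (f x)) \<Longrightarrow> smooth_section (\<lambda>p. \<Sum>x\<in>S. f x p)"
  by (induct S rule: infinite_finite_induct) (auto intro: smooth_section_add smooth_section_const)

lemma smooth_section_wmult: "smooth_section a \<Longrightarrow> smooth_section b \<Longrightarrow> smooth_section (\<lambda>p. wmult (a p) (b p))"
  by (auto simp: smooth_section_def wmult_def intro!: smooth_intros)

lemma smooth_section_bidiff: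
  assumes "\<And>j k. smooth_in_chart c (\<lambda>p. L p j k)"
  shows "smooth_section a \<Longrightarrow> smooth_section b \<Longrightarrow> smooth_section (\<lambda>p. bidiff (L p) m (a p) (b p))"
  by (induct m arbitrary: a b)
     (auto intro!: smooth_section_wmult smooth_section_sum smooth_section_wscale assms intro: smooth_section_dy)

lemma smooth_section_nu_series: "(\<And>m. smooth_section (X m)) \<Longrightarrow> smooth_section (\<lambda>p. nu_series (\<lambda>m. X m p))"
  by (auto simp: smooth_section_def nu_series_def intro!: smooth_intros)

lemma smooth_section_bidiff_exp:
  assumes "\<And>j k. smooth_in_chart c (\<lambda>p. L p j k)" "smooth_section a" "smooth_section b"
  shows "smooth_section (\<lambda>p. bidiff_exp (L p) m (a p) (b p))"
  unfolding bidiff_exp_def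
  by (intro smooth_section_wscale smooth_const smooth_section_bidiff assms)

lemma smooth_section_wick:
  assumes "\<And>j k. smooth_in_chart c (\<lambda>p. L p j k)" "smooth_section a" "smooth_section b"
  shows "smooth_section (\<lambda>p. wick (L p) (a p) (b p))"
  unfolding wick_nu_series
  by (intro smooth_section_nu_series smooth_section_bidiff_exp assms)

lemmas smooth_section_intros = smooth_section_const smooth_section_add smooth_section_diff
  smooth_section_wscale smooth_section_pdw smooth_section_nu_shift
  smooth_section_dy smooth_section_parity smooth_section_y_mult smooth_section_dx_wedge
  smooth_section_dx_contract smooth_section_deg_inv smooth_section_sum

lemma pdw_cong: "(\<And>q. q \<in> dom_of c \<Longrightarrow> a q = b q) \<Longrightarrow> p \<in> dom_of c \<Longrightarrow> pdw j a p = pdw j b p"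
  by (auto simp: pdw_def fun_eq_iff intro!: pd_cong)

lemma smooth_section_cong: "(\<And>q. q \<in> dom_of c \<Longrightarrow> a q = b q) \<Longrightarrow> smooth_section a \<longleftrightarrow> smooth_section b"
  unfolding smooth_section_def by (intro iff_allI smooth_in_chart_cong) simp

context
  fixes p assumes p: "p \<in> dom_of c"
begin

lemma pdw_const: "pdw j (\<lambda>q. z) p = 0"
  by (simp add: pdw_def fun_eq_iff)

lemma pdw_add: "smooth_section a \<Longrightarrow> smooth_section b \<Longrightarrow> pdw j (\<lambda>q. a q + b q) p = pdw j a p + pdw j b p"
  and pdw_diff: "smooth_section a \<Longrightarrow> smooth_section b \<Longrightarrow> pdw j (\<lambda>q. a q - b q) p = pdw j a p - pdw j b p"
  and pdw_minus: "smooth_section a \<Longrightarrow> pdw j (\<lambda>q. - a q) p = - pdw j a p"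
  and pdw_wscale: "smooth_in_chart c f \<Longrightarrow> smooth_section a \<Longrightarrow>
      pdw j (\<lambda>q. wscale (f q) (a q)) p = wscale (pd c j f p) (a p) + wscale (f p) (pdw j a p)"
  and pdw_cscale: "smooth_section a \<Longrightarrow> pdw j (\<lambda>q. wscale z (a q)) p = wscale z (pdw j a p)"
  and pdw_nu_shift: "pdw j (\<lambda>q. nu_shift (a q)) p = nu_shift (pdw j a p)"
  and pdw_dy: "smooth_section a \<Longrightarrow> pdw j (\<lambda>q. dy k (a q)) p = dy k (pdw j a p)"
  and pdw_parity: "smooth_section a \<Longrightarrow> pdw j (\<lambda>q. parity (a q)) p = parity (pdw j a p)"
  and pdw_y_mult: "pdw j (\<lambda>q. y_mult k (a q)) p = y_mult k (pdw j a p)"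
  and pdw_dx_wedge: "smooth_section a \<Longrightarrow> pdw j (\<lambda>q. dx_wedge k (a q)) p = dx_wedge k (pdw j a p)"
  by (auto simp: smooth_section_def pdw_def fun_eq_iff pd_add pd_diff pd_minus pd_mult pd_cmult p
      wscale_def nu_shift_def dy_def parity_def y_mult_def dx_wedge_def)

lemma pdw_sum: "(\<And>x. x \<in> S \<Longrightarrow> smooth_section (f x)) \<Longrightarrow> pdw j (\<lambda>q. \<Sum>x\<in>S. f x q) p = (\<Sum>x\<in>S. pdw j (f x) p)"
  by (induct S rule: infinite_finite_induct) (auto simp: pdw_add pdw_const smooth_section_sum)

lemma pdw_nu_series: "(\<And>m. smooth_section (X m)) \<Longrightarrow>
    pdw j (\<lambda>q. nu_series (\<lambda>m. X m q)) p = nu_series (\<lambda>m. pdw j (X m) p)"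
  by (auto simp: smooth_section_def pdw_def fun_eq_iff nu_series_def pd_sum p)

lemma pdw_wmult:
  assumes "smooth_section a" "smooth_section b"
  shows "pdw j (\<lambda>q. wmult (a q) (b q)) p = wmult (pdw j a p) (b p) + wmult (a p) (pdw j b p)"
proof (intro ext)
  fix r \<alpha> I
  have [intro!]: "smooth_in_chart c (\<lambda>p. a p r \<alpha> I)" "smooth_in_chart c (\<lambda>p. b p r \<alpha> I)" for r \<alpha> I
    using assms by (auto simp: smooth_section_def)
  show "pdw j (\<lambda>q. wmult (a q) (b q)) p r \<alpha> I = (wmult (pdw j a p) (b p) + wmult (a p) (pdw j b p)) r \<alpha> I"
    unfolding pdw_def wmult_def plus_fun_apply
    by (simp add: pd_sum pd_mult pd_cmult smooth_intros p \<open>\<And>r \<alpha> I. smooth_in_chart c (\<lambda>p. a p r \<alpha> I)\<close>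
         \<open>\<And>r \<alpha> I. smooth_in_chart c (\<lambda>p. b p r \<alpha> I)\<close> sum.distrib algebra_simps)
qed

lemma pdw_pdw_commute:
  fixes a :: "'m \<Rightarrow> 'k::{finite, linorder} wform"
  shows "smooth_section a \<Longrightarrow> pdw j (pdw k a) p = pdw k (pdw j a) p"
  by (simp add: pdw_def fun_eq_iff smooth_section_def pd_commute p)

end

end

section \<open>Linear vector fields on the fibres\<close>

lemmas pointwise = plus_fun_apply minus_apply uminus_apply zero_fun_apply

declare pointwise [simp del]

text \<open>The vector field \<open>M^l_k y^k \<partial>/\<partial>y^l\<close> on the fibres. A
  connection acts on the fibre algebra through such a field, and so does its curvature.\<close>

definition fib_vf :: "('n \<Rightarrow> 'n \<Rightarrow> complex) \<Rightarrow> 'n::{finite, linorder} wform \<Rightarrow> 'n wform" where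
  "fib_vf M b = (\<Sum>k\<in>UNIV. \<Sum>l\<in>UNIV. wscale (M l k) (y_mult k (dy l b)))"

interpretation fib_vf: additive "fib_vf M" for M
  by unfold_locales (simp add: fib_vf_def additive_simps sum.distrib)

lemma fib_vf_wscale: "fib_vf M (wscale z b) = wscale z (fib_vf M b)"
  by (simp add: fib_vf_def wscale_simps additive_simps mult.commute)

lemma fib_vf_diff_left: "fib_vf (\<lambda>l k. M l k - N l k) b = fib_vf M b - fib_vf N b"
  and fib_vf_add_left: "fib_vf (\<lambda>l k. M l k + N l k) b = fib_vf M b + fib_vf N b"
  by (simp_all add: fib_vf_def wscale_diff_left wscale_add_left sum_subtractf sum.distrib)

lemma fib_vf_commute:
  "fib_vf M (parity b) = parity (fib_vf M b)"
  "fib_vf M (nu_shift b) = nu_shift (fib_vf M b)"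
  "fib_vf M (dx_wedge j b) = dx_wedge j (fib_vf M b)"
  by (simp_all add: fib_vf_def wscale_simps additive_simps parity_commute nu_commute dx_dy_commute)

lemma fib_vf_nu_series: "fib_vf M (nu_series X) = nu_series (\<lambda>m. fib_vf M (X m))"
proof -
  have "nu_series (\<lambda>m. y_mult k (X m)) = y_mult k (nu_series X)" for k and X :: "nat \<Rightarrow> 'a wform"
    by (auto simp: nu_series_def fun_eq_iff y_mult_def)
  then show ?thesis
    by (simp add: fib_vf_def nu_series_sum nu_series_wscale nu_series_dy)
qed

lemma fib_vf_wmult: "fib_vf M (wmult a b) = wmult (fib_vf M a) b + wmult a (fib_vf M b)"
  by (simp add: fib_vf_def dy_wmult additive_simps wmult_left.sum wmult_right.sum wmult_wscale
      wmult_y_mult_left wmult_y_mult_right sum.distrib)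

lemma dy_fib_vf: "dy u (fib_vf M b) = fib_vf M (dy u b) + (\<Sum>l\<in>UNIV. wscale (M l u) (dy l b))"
proof -
  have "dy u (fib_vf M b) = (\<Sum>k\<in>UNIV. \<Sum>l\<in>UNIV. wscale (M l k) (y_mult k (dy l (dy u b))))
      + (\<Sum>k\<in>UNIV. if k = u then \<Sum>l\<in>UNIV. wscale (M l u) (dy l b) else 0)"
    unfolding fib_vf_def additive_simps wscale_simps sum.distrib[symmetric]
    by (intro sum.cong refl) (auto simp: dy_y_mult additive_simps dy_commute[of u] simp flip: sum.distrib)
  then show ?thesis by (simp add: fib_vf_def)
qed

text \<open>The second-order terms cancel by symmetry and a linear field remains. Its matrix is NM -
  MN, not MN - NM, because linear fields act on coordinate functions from the other side.\<close>

lemma fib_vf_commutator: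
  "fib_vf M (fib_vf N b) - fib_vf N (fib_vf M b) =
    fib_vf (\<lambda>u t. (\<Sum>s\<in>UNIV. N u s * M s t) - (\<Sum>s\<in>UNIV. M u s * N s t)) b"
proof -
  let ?Q = "\<lambda>M N. \<Sum>t\<in>UNIV. \<Sum>s\<in>UNIV. \<Sum>v\<in>UNIV. \<Sum>u\<in>UNIV. wscale (M s t * N u v) (y_mult t (y_mult v (dy u (dy s b))))"
  have *: "fib_vf M (fib_vf N b) = ?Q M N + fib_vf (\<lambda>u t. \<Sum>s\<in>UNIV. N u s * M s t) b" for M N
  proof -
    have "fib_vf M (fib_vf N b) = (\<Sum>t\<in>UNIV. \<Sum>s\<in>UNIV. wscale (M s t) (y_mult t (dy s (fib_vf N b))))"
      by (rule fib_vf_def)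
    also have "\<dots> = ?Q M N + (\<Sum>t\<in>UNIV. \<Sum>s\<in>UNIV. \<Sum>u\<in>UNIV. wscale (M s t * N u s) (y_mult t (dy u b)))"
      unfolding dy_fib_vf by (simp add: fib_vf_def additive_simps wscale_simps sum.distrib)
    also have "(\<Sum>t\<in>UNIV. \<Sum>s\<in>UNIV. \<Sum>u\<in>UNIV. wscale (M s t * N u s) (y_mult t (dy u b))) =
        fib_vf (\<lambda>u t. \<Sum>s\<in>UNIV. N u s * M s t) b"
      unfolding fib_vf_def wscale_sum_left
      by (rule sum.cong[OF refl], subst sum.swap) (simp add: mult.commute)
    finally show ?thesis .
  qed
  have "?Q M N = (\<Sum>t\<in>UNIV. \<Sum>v\<in>UNIV. \<Sum>s\<in>UNIV. \<Sum>u\<in>UNIV. wscale (M s t * N u v) (y_mult t (y_mult v (dy u (dy s b)))))"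
    by (rule sum.cong[OF refl], rule sum.swap)
  also have "\<dots> = (\<Sum>v\<in>UNIV. \<Sum>t\<in>UNIV. \<Sum>u\<in>UNIV. \<Sum>s\<in>UNIV. wscale (M s t * N u v) (y_mult t (y_mult v (dy u (dy s b)))))"
    by (rule trans[OF sum.swap], rule sum.cong[OF refl], rule sum.cong[OF refl], rule sum.swap)
  also have "\<dots> = (\<Sum>v\<in>UNIV. \<Sum>u\<in>UNIV. \<Sum>t\<in>UNIV. \<Sum>s\<in>UNIV. wscale (M s t * N u v) (y_mult t (y_mult v (dy u (dy s b)))))"
    by (rule sum.cong[OF refl], rule sum.swap)
  also have "\<dots> = ?Q N M"
  proof (intro sum.cong refl)
    fix v u t s
    show "wscale (M s t * N u v) (y_mult t (y_mult v (dy u (dy s b)))) = wscale (N u v * M s t) (y_mult v (y_mult t (dy s (dy u b))))"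
      by (simp only: mult.commute[of "M s t"] y_mult_commute[of t v] dy_commute[of u s])
  qed
  finally show ?thesis unfolding * fib_vf_diff_left by simp
qed

lemma sum_swap_outer: "(\<Sum>x\<in>A. \<Sum>y\<in>B. \<Sum>z\<in>C. f x y z) = (\<Sum>z\<in>C. \<Sum>y\<in>B. \<Sum>x\<in>A. f x y z)"
proof -
  have "(\<Sum>x\<in>A. \<Sum>y\<in>B. \<Sum>z\<in>C. f x y z) = (\<Sum>z\<in>C. \<Sum>x\<in>A. \<Sum>y\<in>B. f x y z)" by (rule sum_rotate)
  also have "\<dots> = (\<Sum>z\<in>C. \<Sum>y\<in>B. \<Sum>x\<in>A. f x y z)" by (rule sum.cong[OF refl], rule sum.swap)
  finally show ?thesis .
qed

text \<open>The wedge of dx^k and dx^l sees only the antisymmetric part of the coefficients. This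
  converts Christoffel symbols to torsion and second covariant derivatives to curvature.\<close>

lemma sum_dx_dx_antisym:
  fixes B :: "'n::{finite, linorder} \<Rightarrow> 'n \<Rightarrow> 'n wform"
  shows "(\<Sum>k\<in>UNIV. \<Sum>l\<in>UNIV. dx_wedge k (dx_wedge l (B k l))) =
    (\<Sum>k\<in>UNIV. \<Sum>l\<in>UNIV. dx_wedge k (dx_wedge l (wscale (1/2) (B k l - B l k))))"
proof -
  let ?S = "\<Sum>k\<in>UNIV. \<Sum>l\<in>UNIV. dx_wedge k (dx_wedge l (B k l))"
  have "(\<Sum>k\<in>UNIV. \<Sum>l\<in>UNIV. dx_wedge k (dx_wedge l (B l k))) = (\<Sum>l\<in>UNIV. \<Sum>k\<in>UNIV. dx_wedge k (dx_wedge l (B l k)))"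
    by (rule sum.swap)
  also have "\<dots> = (\<Sum>l\<in>UNIV. \<Sum>k\<in>UNIV. - dx_wedge l (dx_wedge k (B l k)))"
    by (intro sum.cong refl dx_wedge_anticommute)
  finally have "(\<Sum>k\<in>UNIV. \<Sum>l\<in>UNIV. dx_wedge k (dx_wedge l (B l k))) = - ?S"
    by (simp only: sum_negf)
  moreover have "(\<Sum>k\<in>UNIV. \<Sum>l\<in>UNIV. dx_wedge k (dx_wedge l (wscale (1/2) (B k l - B l k)))) =
      wscale (1/2) ?S - wscale (1/2) (\<Sum>k\<in>UNIV. \<Sum>l\<in>UNIV. dx_wedge k (dx_wedge l (B l k)))"
    by (simp add: additive_simps wscale_simps sum_subtractf)
  ultimately show ?thesis
    by (simp only: wscale.minus diff_minus_eq_add wscale_add_left[symmetric]) simp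
qed

text \<open>The graded commutator when the first argument has even form degree, as T, R and Z do;
  \<open>odd_comm\<close> is the version for one-forms such as r.\<close>

definition wick_comm :: "('n::{finite, linorder} \<Rightarrow> 'n \<Rightarrow> complex) \<Rightarrow> 'n wform \<Rightarrow> 'n wform \<Rightarrow> 'n wform" where
  "wick_comm L a b = wick L a b - wick L b a"

lemma wick_comm_dx_dx: "wick_comm L (dx_wedge k (dx_wedge l a)) b = dx_wedge k (dx_wedge l (wick_comm L a b))"
  by (simp add: wick_comm_def wick_dx_wedge_left wick_dx_wedge_right parity_dx_wedge wick_simps additive_simps)

lemma wick_comm_simps:
  "wick_comm L (\<Sum>x\<in>S. f x) b = (\<Sum>x\<in>S. wick_comm L (f x) b)"
  "wick_comm L (wscale z a) b = wscale z (wick_comm L a b)"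
  "wick_comm L (a + a') b = wick_comm L a b + wick_comm L a' b"
  by (simp_all add: wick_comm_def wick_simps sum_subtractf additive_simps)

lemma wick_comm_yvar:
  "wick_comm L (yvar s) b = nu_mult (\<Sum>m\<in>UNIV. wscale (\<i> / 2 * (L s m - L m s)) (dy m b))"
  by (simp add: wick_comm_def wick_yvar nu_mult.diff[symmetric] sum_subtractf[symmetric]
      right_diff_distrib wscale_diff_left)

lemma wick_comm_wick: "wick_comm L (wick L a b) d = wick L a (wick_comm L b d) + wick L (wick_comm L a d) b"
  by (simp add: wick_comm_def wick_simps wick_assoc)

text \<open>The products y^s y^t and y^s \<circ> y^t differ by a constant multiple of \<nu>, which
  is central, and a commutator is a derivation in its first argument.\<close>

lemma wick_comm_yvar_yvar:
  "wick_comm L (y_mult s (yvar t)) b =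
     wick L (yvar s) (wick_comm L (yvar t) b) + wick L (wick_comm L (yvar s) b) (yvar t)"
proof -
  have "wick L (yvar s) (yvar t) = y_mult s (yvar t) + nu_mult (wscale (\<i> / 2 * L s t) wone)"
    by (simp add: wick_yvar(1) dy_yvar if_distrib additive_simps cong: if_cong)
  then have "y_mult s (yvar t) = wick L (yvar s) (yvar t) - nu_mult (wscale (\<i> / 2 * L s t) wone)" by simp
  then show ?thesis
    by (simp add: wick_comm_wick[symmetric]) (simp add: wick_comm_def wick_simps wick_nu_mult)
qed

section \<open>Connections in a chart\<close>

text \<open>\<open>W\<close>, \<open>G\<close> and \<open>\<Gamma>\<close> are \<omega>, g and the
  Christoffel symbols in a single chart, with their symmetry, closedness and parallelism as
  identities of components.\<close>

locale kaehler_chart = chart c for c :: "('m, 'n::{finite, linorder}) chart" +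
  fixes W G :: "'m \<Rightarrow> ((real, 'n) vec, 'n) vec" and \<Gamma> :: "'m \<Rightarrow> 'n \<Rightarrow> 'n \<Rightarrow> 'n \<Rightarrow> real"
  assumes smooth_W: "smooth_in_chart c (\<lambda>p. W p $ j $ k)"
    and smooth_G: "smooth_in_chart c (\<lambda>p. G p $ j $ k)"
    and smooth_\<Gamma>: "smooth_in_chart c (\<lambda>p. \<Gamma> p l j k)"
    and inv_W: "p \<in> dom_of c \<Longrightarrow> invertible (W p)"
    and inv_G: "p \<in> dom_of c \<Longrightarrow> invertible (G p)"
    and anti_W: "p \<in> dom_of c \<Longrightarrow> W p $ k $ j = - W p $ j $ k"
    and sym_G: "p \<in> dom_of c \<Longrightarrow> G p $ k $ j = G p $ j $ k"
    and closed_W: "p \<in> dom_of c \<Longrightarrow> pd c j (\<lambda>q. W q $ k $ l) p + pd c k (\<lambda>q. W q $ l $ j) p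
                 + pd c l (\<lambda>q. W q $ j $ k) p = 0"
    and parallel_W: "p \<in> dom_of c \<Longrightarrow> pd c j (\<lambda>q. W q $ k $ l) p
        - (\<Sum>m\<in>UNIV. \<Gamma> p m j k * W p $ m $ l) - (\<Sum>m\<in>UNIV. \<Gamma> p m j l * W p $ k $ m) = 0"
    and parallel_G: "p \<in> dom_of c \<Longrightarrow> pd c j (\<lambda>q. G q $ k $ l) p
        - (\<Sum>m\<in>UNIV. \<Gamma> p m j k * G p $ m $ l) - (\<Sum>m\<in>UNIV. \<Gamma> p m j l * G p $ k $ m) = 0"
begin

definition L :: "'m \<Rightarrow> 'n \<Rightarrow> 'n \<Rightarrow> complex" where
  "L p j k = of_real (matrix_inv (W p) $ j $ k) - \<i> * of_real (matrix_inv (G p) $ j $ k)"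

lemma smooth_L: "smooth_in_chart c (\<lambda>p. L p j k)"
  unfolding L_def
  by (intro smooth_intros smooth_matrix_inv smooth_W smooth_G inv_W inv_G)

lemma smooth_section_wick_L: "smooth_section a \<Longrightarrow> smooth_section b \<Longrightarrow> smooth_section (\<lambda>p. wick (L p) (a p) (b p))"
  by (rule smooth_section_wick[OF smooth_L])

lemmas smooth_secs = smooth_section_intros smooth_section_wick_L smooth_L smooth_\<Gamma> smooth_W smooth_G smooth_intros

text \<open>The metric part of \<Lambda> is symmetric and drops out, so commutators with the y^s see
  only the inverse of \<omega>.\<close>

lemma L_antisym: "p \<in> dom_of c \<Longrightarrow> L p s m - L p m s = 2 * of_real (matrix_inv (W p) $ s $ m)"
  using matrix_inv_antisym[OF inv_W anti_W, of p s m] matrix_inv_sym[OF inv_G sym_G, of p s m]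
  by (simp add: L_def)

lemma L_parallel:
  assumes p: "p \<in> dom_of c"
  shows "pd c j (\<lambda>q. L q u v) p + (\<Sum>l\<in>UNIV. of_real (\<Gamma> p u j l) * L p l v) + (\<Sum>l\<in>UNIV. of_real (\<Gamma> p v j l) * L p u l) = 0"
proof -
  have 1: "pd c j (\<lambda>q. matrix_inv (W q) $ u $ v) p =
    - (\<Sum>l\<in>UNIV. \<Gamma> p u j l * matrix_inv (W p) $ l $ v) - (\<Sum>l\<in>UNIV. \<Gamma> p v j l * matrix_inv (W p) $ u $ l)"
    by (rule matrix_inv_parallel[OF smooth_W inv_W p]) (use parallel_W[OF p] in simp_all)
  have 2: "pd c j (\<lambda>q. matrix_inv (G q) $ u $ v) p =
    - (\<Sum>l\<in>UNIV. \<Gamma> p u j l * matrix_inv (G p) $ l $ v) - (\<Sum>l\<in>UNIV. \<Gamma> p v j l * matrix_inv (G p) $ u $ l)"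
    by (rule matrix_inv_parallel[OF smooth_G inv_G p]) (use parallel_G[OF p] in simp_all)
  have s: "smooth_in_chart c (\<lambda>p. matrix_inv (W p) $ u $ v)" "smooth_in_chart c (\<lambda>p. matrix_inv (G p) $ u $ v)"
    by (intro smooth_matrix_inv smooth_W smooth_G inv_W inv_G; assumption)+
  have "pd c j (\<lambda>q. L q u v) p = of_real (pd c j (\<lambda>q. matrix_inv (W q) $ u $ v) p) - \<i> * of_real (pd c j (\<lambda>q. matrix_inv (G q) $ u $ v) p)"
    unfolding L_def using p s by (simp add: pd_diff pd_cmult pd_of_real smooth_intros)
  then show ?thesis unfolding 1 2 L_def
    by (simp add: right_diff_distrib sum_subtractf sum_distrib_left algebra_simps)
qed

definition Gam :: "'n \<Rightarrow> 'm \<Rightarrow> 'n \<Rightarrow> 'n \<Rightarrow> complex" where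
  "Gam j p l k = of_real (\<Gamma> p l j k)"

lemma smooth_Gam: "smooth_in_chart c (\<lambda>p. Gam j p l k)"
  unfolding Gam_def by (intro smooth_of_real smooth_\<Gamma>)

text \<open>\<nabla> in direction \<open>\<partial>_j\<close>, acting on the y^k alone: the dx^I
  count as constants. Hence torsion is invisible in \<nabla>^2 and appears in \<delta>\<nabla> +
  \<nabla>\<delta> instead.\<close>

definition cov :: "'n \<Rightarrow> ('m \<Rightarrow> 'n wform) \<Rightarrow> 'm \<Rightarrow> 'n wform" where
  "cov j a p = pdw j a p - fib_vf (Gam j p) (a p)"

lemma smooth_section_fib_vf:
  "(\<And>l k. smooth_in_chart c (\<lambda>p. M p l k)) \<Longrightarrow> smooth_section a \<Longrightarrow> smooth_section (\<lambda>p. fib_vf (M p) (a p))"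
  unfolding fib_vf_def by (intro smooth_section_intros)

lemma smooth_section_cov: "smooth_section a \<Longrightarrow> smooth_section (cov j a)"
  unfolding cov_def by (intro smooth_section_intros smooth_section_fib_vf smooth_Gam)

definition Rc :: "'m \<Rightarrow> 'n \<Rightarrow> 'n \<Rightarrow> 'n \<Rightarrow> 'n \<Rightarrow> real" where
  "Rc p s t k l =
     pd c k (\<lambda>q. \<Gamma> q s l t) p - pd c l (\<lambda>q. \<Gamma> q s k t) p
     + (\<Sum>\<alpha>\<in>UNIV. \<Gamma> p s k \<alpha> * \<Gamma> p \<alpha> l t) - (\<Sum>\<alpha>\<in>UNIV. \<Gamma> p s l \<alpha> * \<Gamma> p \<alpha> k t)"

context
  fixes p assumes p: "p \<in> dom_of c"
begin

lemma cov_cong: "(\<And>q. q \<in> dom_of c \<Longrightarrow> a q = b q) \<Longrightarrow> cov j a p = cov j b p"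
  using pdw_cong[of a b p j] p by (simp add: cov_def)

lemma cov_add: "smooth_section a \<Longrightarrow> smooth_section b \<Longrightarrow> cov j (\<lambda>q. a q + b q) p = cov j a p + cov j b p"
  and cov_diff: "smooth_section a \<Longrightarrow> smooth_section b \<Longrightarrow> cov j (\<lambda>q. a q - b q) p = cov j a p - cov j b p"
  and cov_minus: "smooth_section a \<Longrightarrow> cov j (\<lambda>q. - a q) p = - cov j a p"
  and cov_wscale: "smooth_in_chart c f \<Longrightarrow> smooth_section a \<Longrightarrow>
      cov j (\<lambda>q. wscale (f q) (a q)) p = wscale (pd c j f p) (a p) + wscale (f p) (cov j a p)"
  and cov_cscale: "smooth_section a \<Longrightarrow> cov j (\<lambda>q. wscale z (a q)) p = wscale z (cov j a p)"
  and cov_nu_shift: "cov j (\<lambda>q. nu_shift (a q)) p = nu_shift (cov j a p)"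
  and cov_parity: "smooth_section a \<Longrightarrow> cov j (\<lambda>q. parity (a q)) p = parity (cov j a p)"
  and cov_dx_wedge: "smooth_section a \<Longrightarrow> cov j (\<lambda>q. dx_wedge k (a q)) p = dx_wedge k (cov j a p)"
  by (simp_all add: cov_def pdw_add pdw_diff pdw_minus pdw_wscale pdw_cscale pdw_nu_shift pdw_parity
      pdw_dx_wedge p fib_vf.add fib_vf.diff fib_vf.minus fib_vf_wscale fib_vf_commute additive_simps)

lemma cov_sum: "(\<And>x. x \<in> S \<Longrightarrow> smooth_section (f x)) \<Longrightarrow> cov j (\<lambda>q. \<Sum>x\<in>S. f x q) p = (\<Sum>x\<in>S. cov j (f x) p)"
  by (simp add: cov_def pdw_sum p fib_vf.sum sum_subtractf)

text \<open>The frame \<partial>/\<partial>y^u need not be parallel; the extra term is its covariant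
  derivative.\<close>

lemma cov_dy: "smooth_section a \<Longrightarrow> cov j (\<lambda>q. dy u (a q)) p = dy u (cov j a p) + (\<Sum>l\<in>UNIV. wscale (Gam j p l u) (dy l (a p)))"
  by (simp add: cov_def pdw_dy p additive_simps dy_fib_vf)

text \<open>Differentiating the coefficients L and moving \<open>cov\<close> through the two
  y-derivatives yields three corrections, whose sum is the covariant derivative of L and vanishes by
  \<open>L_parallel\<close>.\<close>

lemma cov_bidiff:
  "smooth_section a \<Longrightarrow> smooth_section b \<Longrightarrow>
    cov j (\<lambda>q. bidiff (L q) m (a q) (b q)) p = bidiff (L p) m (cov j a p) (b p) + bidiff (L p) m (a p) (cov j b p)"
proof (induct m arbitrary: a b)
  case 0
  then show ?case
    by (simp only: cov_def bidiff.simps pdw_wmult[OF p] fib_vf_wmult wmult_left.diff wmult_right.diff)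
       (simp only: add_diff_eq diff_add_eq diff_diff_eq add_ac)
next
  case (Suc m)
  let ?B = "\<lambda>u v. bidiff (L p) m (dy u (a p)) (dy v (b p))"
  let ?C = "\<lambda>u v. bidiff (L p) m (dy u (cov j a p)) (dy v (b p)) + bidiff (L p) m (dy u (a p)) (dy v (cov j b p))"
  have sm: "smooth_section (\<lambda>p. dy u (a p))" "smooth_section (\<lambda>p. dy v (b p))" for u v
    using Suc.prems by (auto intro: smooth_section_dy)
  have smB: "smooth_section (\<lambda>q. bidiff (L q) m (dy u (a q)) (dy v (b q)))" for u v
    by (intro smooth_section_bidiff smooth_L sm)
  have "cov j (\<lambda>q. bidiff (L q) (Suc m) (a q) (b q)) p =
     (\<Sum>u\<in>UNIV. \<Sum>v\<in>UNIV. cov j (\<lambda>q. wscale (L q u v) (bidiff (L q) m (dy u (a q)) (dy v (b q)))) p)"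
    unfolding bidiff.simps by (subst cov_sum, intro smooth_section_sum smooth_section_wscale smooth_L smB,
      intro sum.cong refl cov_sum smooth_section_wscale smooth_L smB)
  also have "\<dots> = (\<Sum>u\<in>UNIV. \<Sum>v\<in>UNIV. wscale (pd c j (\<lambda>q. L q u v) p) (?B u v) + wscale (L p u v) (?C u v
       + (\<Sum>l\<in>UNIV. wscale (Gam j p l u) (?B l v)) + (\<Sum>l\<in>UNIV. wscale (Gam j p l v) (?B u l))))"
    by (intro sum.cong refl)
       (simp add: cov_wscale smooth_L smB Suc.hyps[OF sm] cov_dy Suc.prems bidiff_simps add_ac)
  also have "\<dots> = (\<Sum>u\<in>UNIV. \<Sum>v\<in>UNIV. wscale (pd c j (\<lambda>q. L q u v) p) (?B u v)) + (\<Sum>u\<in>UNIV. \<Sum>v\<in>UNIV. wscale (L p u v) (?C u v))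
      + (\<Sum>u\<in>UNIV. \<Sum>v\<in>UNIV. \<Sum>l\<in>UNIV. wscale (L p u v * Gam j p l u) (?B l v))
      + (\<Sum>u\<in>UNIV. \<Sum>v\<in>UNIV. \<Sum>l\<in>UNIV. wscale (L p u v * Gam j p l v) (?B u l))"
    by (simp add: additive_simps sum.distrib add_ac)
  also have "(\<Sum>u\<in>UNIV. \<Sum>v\<in>UNIV. \<Sum>l\<in>UNIV. wscale (L p u v * Gam j p l u) (?B l v)) =
      (\<Sum>u\<in>UNIV. \<Sum>v\<in>UNIV. wscale (\<Sum>l\<in>UNIV. of_real (\<Gamma> p u j l) * L p l v) (?B u v))"
    unfolding wscale_sum_left Gam_def by (subst sum_swap_outer) (simp add: mult.commute)
  also have "(\<Sum>u\<in>UNIV. \<Sum>v\<in>UNIV. \<Sum>l\<in>UNIV. wscale (L p u v * Gam j p l v) (?B u l)) =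
      (\<Sum>u\<in>UNIV. \<Sum>v\<in>UNIV. wscale (\<Sum>l\<in>UNIV. of_real (\<Gamma> p v j l) * L p u l) (?B u v))"
    unfolding wscale_sum_left Gam_def by (rule sum.cong[OF refl], subst sum.swap) (simp add: mult.commute)
  finally have "cov j (\<lambda>q. bidiff (L q) (Suc m) (a q) (b q)) p = (\<Sum>u\<in>UNIV. \<Sum>v\<in>UNIV. wscale (L p u v) (?C u v))
      + (\<Sum>u\<in>UNIV. \<Sum>v\<in>UNIV. wscale (pd c j (\<lambda>q. L q u v) p + (\<Sum>l\<in>UNIV. of_real (\<Gamma> p u j l) * L p l v) + (\<Sum>l\<in>UNIV. of_real (\<Gamma> p v j l) * L p u l)) (?B u v))"
    by (simp add: wscale_add_left sum.distrib add_ac)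
  then show ?case by (simp add: L_parallel[OF p] additive_simps sum.distrib)
qed

lemma cov_wick:
  assumes "smooth_section a" "smooth_section b"
  shows "cov j (\<lambda>q. wick (L q) (a q) (b q)) p = wick (L p) (cov j a p) (b p) + wick (L p) (a p) (cov j b p)"
proof -
  have sm: "smooth_section (\<lambda>q. bidiff (L q) m (a q) (b q))" for m
    by (intro smooth_section_bidiff smooth_L assms)
  have "cov j (\<lambda>q. wick (L q) (a q) (b q)) p = nu_series (\<lambda>m. cov j (\<lambda>q. bidiff_exp (L q) m (a q) (b q)) p)"
    unfolding cov_def wick_nu_series
    by (simp add: pdw_nu_series[OF p smooth_section_bidiff_exp[OF smooth_L assms]] fib_vf_nu_series)
       (simp add: nu_series_def fun_eq_iff sum_subtractf pointwise)
  also have "\<dots> = nu_series (\<lambda>m. bidiff_exp (L p) m (cov j a p) (b p) + bidiff_exp (L p) m (a p) (cov j b p))"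
    unfolding bidiff_exp_def by (simp add: cov_cscale sm cov_bidiff assms additive_simps)
  finally show ?thesis by (simp add: wick_nu_series nu_series_add)
qed

lemma pdw_fib_vf:
  assumes "\<And>l k. smooth_in_chart c (\<lambda>p. M p l k)" "smooth_section a"
  shows "pdw j (\<lambda>q. fib_vf (M q) (a q)) p = fib_vf (\<lambda>l k. pd c j (\<lambda>q. M q l k) p) (a p) + fib_vf (M p) (pdw j a p)"
  unfolding fib_vf_def
  by (simp add: pdw_sum pdw_wscale pdw_y_mult pdw_dy p assms smooth_section_intros sum.distrib)

text \<open>Second base derivatives commute and the mixed terms cancel, leaving the derivative of
  \<Gamma> and a commutator of linear fields. The reversed order in \<open>fib_vf_commutator\<close>
  gives the quadratic part the same minus sign as the derivative part.\<close>

lemma cov_commutator: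
  assumes a: "smooth_section a"
  shows "cov k (cov l a) p - cov l (cov k a) p = - fib_vf (\<lambda>s t. of_real (Rc p s t k l)) (a p)"
proof -
  let ?d = "\<lambda>k l s t. pd c k (\<lambda>q. Gam l q s t) p"
  have *: "cov k (cov l a) p = pdw k (pdw l a) p - fib_vf (?d k l) (a p) - fib_vf (Gam l p) (pdw k a p)
     - fib_vf (Gam k p) (pdw l a p) + fib_vf (Gam k p) (fib_vf (Gam l p) (a p))" for k l
  proof -
    have "pdw k (cov l a) p = pdw k (\<lambda>q. pdw l a q - fib_vf (Gam l q) (a q)) p"
      by (rule arg_cong[where f = "\<lambda>f. pdw k f p"]) (simp add: cov_def fun_eq_iff)
    also have "\<dots> = pdw k (pdw l a) p - fib_vf (?d k l) (a p) - fib_vf (Gam l p) (pdw k a p)"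
      by (subst pdw_diff) (simp_all add: p a smooth_section_pdw smooth_section_fib_vf smooth_Gam pdw_fib_vf algebra_simps)
    finally have "cov k (cov l a) p = \<dots> - fib_vf (Gam k p) (cov l a p)" by (simp add: cov_def[of k])
    then show ?thesis by (simp add: cov_def[of l] fib_vf.diff)
  qed
  have "cov k (cov l a) p - cov l (cov k a) p = - (fib_vf (?d k l) (a p) - fib_vf (?d l k) (a p)) +
      (fib_vf (Gam k p) (fib_vf (Gam l p) (a p)) - fib_vf (Gam l p) (fib_vf (Gam k p) (a p)))"
    unfolding * by (simp add: pdw_pdw_commute[OF p a, of k l])
  also have "\<dots> = - fib_vf (\<lambda>s t. (?d k l s t - ?d l k s t)
        + ((\<Sum>x\<in>UNIV. Gam k p s x * Gam l p x t) - (\<Sum>x\<in>UNIV. Gam l p s x * Gam k p x t))) (a p)"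
    unfolding fib_vf_commutator fib_vf_diff_left fib_vf_add_left by simp
  also have "(\<lambda>s t. (?d k l s t - ?d l k s t)
        + ((\<Sum>x\<in>UNIV. Gam k p s x * Gam l p x t) - (\<Sum>x\<in>UNIV. Gam l p s x * Gam k p x t))) = (\<lambda>s t. of_real (Rc p s t k l))"
    by (simp add: fun_eq_iff Rc_def Gam_def pd_of_real smooth_\<Gamma> p)
  finally show ?thesis .
qed

end

end

section \<open>Leibniz rules, and the filtration by \<open>Deg\<close>\<close>

lemma fib_delta_wick: "fib_delta (wick L a b) = wick L (fib_delta a) b + wick L (parity a) (fib_delta b)"
  by (simp add: fib_delta_def dy_wick additive_simps wick_simps wick_dx_wedge_left wick_dx_wedge_right sum.distrib)

lemma fib_delta_parity: "fib_delta (parity a) = - parity (fib_delta a)"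
  by (simp add: fib_delta_def additive_simps parity_dx_wedge parity_commute sum_negf)

lemma fib_delta_nu_shift: "fib_delta (nu_shift a) = nu_shift (fib_delta a)"
  by (simp add: fib_delta_def additive_simps nu_commute nu_commute_dx)

lemma fib_delta_wscale: "fib_delta (wscale z a) = wscale z (fib_delta a)"
  by (simp add: fib_delta_def additive_simps wscale_simps)

definition odd_comm :: "('n::{finite, linorder} \<Rightarrow> 'n \<Rightarrow> complex) \<Rightarrow> 'n wform \<Rightarrow> 'n wform \<Rightarrow> 'n wform" where
  "odd_comm L a b = wick L a b - wick L (parity b) a"

lemma fib_delta_wick_comm:
  "parity X = X \<Longrightarrow> fib_delta (wick_comm L X a) = odd_comm L (fib_delta X) a + wick_comm L X (fib_delta a)"
  by (simp add: wick_comm_def odd_comm_def fib_delta.diff fib_delta_wick)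

lemma fib_delta_odd_comm:
  "parity r = - r \<Longrightarrow> fib_delta (odd_comm L r a) = wick_comm L (fib_delta r) a - odd_comm L r (fib_delta a)"
  by (simp add: wick_comm_def odd_comm_def fib_delta.diff fib_delta_wick fib_delta_parity wick_simps)

text \<open>Since \<open>parity\<close> is an involution and r is odd, the two middle terms r
  \<circ> \<open>parity a\<close> \<circ> r cancel.\<close>

lemma odd_comm_odd_comm: "parity r = - r \<Longrightarrow> odd_comm L r (odd_comm L r a) = wick_comm L (wick L r r) a"
  by (simp add: odd_comm_def wick_comm_def wick_simps additive_simps parity_wick wick_assoc)

lemma sum_rotate5:
  "(\<Sum>s\<in>S. \<Sum>a\<in>A. \<Sum>t\<in>T. \<Sum>k\<in>K. \<Sum>l\<in>M. f s a t k l) = (\<Sum>k\<in>K. \<Sum>l\<in>M. \<Sum>s\<in>S. \<Sum>a\<in>A. \<Sum>t\<in>T. f s a t k l)"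
proof -
  have "(\<Sum>s\<in>S. \<Sum>a\<in>A. \<Sum>t\<in>T. \<Sum>k\<in>K. \<Sum>l\<in>M. f s a t k l) = (\<Sum>s\<in>S. \<Sum>a\<in>A. \<Sum>k\<in>K. \<Sum>l\<in>M. \<Sum>t\<in>T. f s a t k l)"
    by (rule sum.cong[OF refl], rule sum.cong[OF refl], rule sum_rotate[symmetric])
  also have "\<dots> = (\<Sum>s\<in>S. \<Sum>k\<in>K. \<Sum>l\<in>M. \<Sum>a\<in>A. \<Sum>t\<in>T. f s a t k l)"
    by (rule sum.cong[OF refl], rule sum_rotate[symmetric])
  also have "\<dots> = (\<Sum>k\<in>K. \<Sum>l\<in>M. \<Sum>s\<in>S. \<Sum>a\<in>A. \<Sum>t\<in>T. f s a t k l)"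
    by (rule sum_rotate[symmetric])
  finally show ?thesis .
qed

lemma sum_rotate4:
  "(\<Sum>s\<in>S. \<Sum>a\<in>A. \<Sum>k\<in>K. \<Sum>l\<in>M. f s a k l) = (\<Sum>k\<in>K. \<Sum>l\<in>M. \<Sum>a\<in>A. \<Sum>s\<in>S. f s a k l)"
proof -
  have "(\<Sum>s\<in>S. \<Sum>a\<in>A. \<Sum>k\<in>K. \<Sum>l\<in>M. f s a k l) = (\<Sum>a\<in>A. \<Sum>s\<in>S. \<Sum>k\<in>K. \<Sum>l\<in>M. f s a k l)"
    by (rule sum.swap)
  also have "\<dots> = (\<Sum>a\<in>A. \<Sum>k\<in>K. \<Sum>l\<in>M. \<Sum>s\<in>S. f s a k l)"
    by (rule sum.cong[OF refl], rule sum_rotate[symmetric])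
  also have "\<dots> = (\<Sum>k\<in>K. \<Sum>l\<in>M. \<Sum>a\<in>A. \<Sum>s\<in>S. f s a k l)"
    by (rule sum_rotate[symmetric])
  finally show ?thesis .
qed

text \<open>Vanishing at y = 0, so that the y-derivatives determine the element; see
  \<open>dy_all_zero\<close>.\<close>

definition no_constant :: "'n wform \<Rightarrow> bool" where
  "no_constant a \<longleftrightarrow> (\<forall>r I. a r (\<lambda>_. 0) I = 0)"

lemma no_constant_intros:
  "no_constant 0" "no_constant (y_mult s a)"
  "no_constant a \<Longrightarrow> no_constant (wscale z a)"
  "no_constant a \<Longrightarrow> no_constant (dx_wedge j a)"
  "no_constant a \<Longrightarrow> no_constant b \<Longrightarrow> no_constant (a + b)"
  "no_constant a \<Longrightarrow> no_constant b \<Longrightarrow> no_constant (a - b)"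
  by (auto simp: no_constant_def y_mult_def wscale_def dx_wedge_def pointwise)

lemma no_constant_sum:
  fixes f :: "'x \<Rightarrow> 'n::{finite, linorder} wform"
  shows "(\<And>x. x \<in> S \<Longrightarrow> no_constant (f x)) \<Longrightarrow> no_constant (\<Sum>x\<in>S. f x)"
  by (induct S rule: infinite_finite_induct) (simp_all add: no_constant_intros)

lemma dy_all_zero:
  assumes "\<And>m. dy m a = 0" "no_constant a" shows "a = 0"
proof (intro ext)
  fix r \<alpha> I
  show "a r \<alpha> I = 0 r \<alpha> I"
  proof (cases "\<alpha> = (\<lambda>_. 0)")
    case True
    then show ?thesis using assms(2) by (simp add: no_constant_def pointwise)
  next
    case False
    then obtain m where m: "\<alpha> m \<noteq> 0" by auto
    have "dy m a r (\<alpha>(m := \<alpha> m - 1)) I = 0" using assms(1)[of m] by (simp add: pointwise)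
    with m show ?thesis by (simp add: dy_def pointwise)
  qed
qed

text \<open>The filtration \<open>Deg\<close> \<ge> n. It is separated (\<open>low_all\<close>), so
  an equation that gains a degree with every application forces zero.\<close>

definition low :: "nat \<Rightarrow> 'n::finite wform \<Rightarrow> bool" where
  "low n a \<longleftrightarrow> (\<forall>k<n. Deg_part k a = 0)"

lemma low_iff: "low n a \<longleftrightarrow> (\<forall>r \<alpha> I. 2 * r + ydeg \<alpha> < n \<longrightarrow> a r \<alpha> I = 0)"
  by (auto simp: low_def Deg_part_def fun_eq_iff pointwise)

lemma low_wick:
  assumes "low m a" "low n b" shows "low (m + n) (wick L a b)"
  unfolding low_def
proof (intro allI impI)
  fix k assume "k < m + n"
  then have "wick L (Deg_part i a) (Deg_part (k - i) b) = 0" if "i \<le> k" for i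
    using assms that by (cases "i < m") (auto simp: low_def wick_simps)
  then show "Deg_part k (wick L a b) = 0" by (simp add: Deg_part_wick)
qed

lemma low_nu_shift: "low (Suc (Suc n)) a \<Longrightarrow> low n (nu_shift a)"
  by (simp add: low_def Deg_part_nu_shift nu_shift.zero)

lemma low_fib_delta_inv: "low n a \<Longrightarrow> low (Suc n) (fib_delta_inv a)"
  by (auto simp: low_def Deg_part_fib_delta_inv_Suc Deg_part_fib_delta_inv_0 less_Suc_eq_0_disj fib_delta_inv.zero)

lemma low_diff: "low n a \<Longrightarrow> low n b \<Longrightarrow> low n (a - b)"
  and low_wscale: "low n a \<Longrightarrow> low n (wscale z a)"
  by (auto simp: low_def additive_simps wscale_simps)

lemma low_all: "(\<And>n. low n a) \<Longrightarrow> a = 0"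
  by (rule Deg_part_eqI) (simp add: low_def Deg_part.zero, blast)

section \<open>The connection and the elements T and R in a chart\<close>

context kaehler_chart
begin

definition nab :: "('m \<Rightarrow> 'n wform) \<Rightarrow> 'm \<Rightarrow> 'n wform" where
  "nab a p = (\<Sum>j\<in>UNIV. dx_wedge j (cov j a p))"

definition T :: "'m \<Rightarrow> 'n wform" where
  "T p = (\<Sum>s\<in>UNIV. \<Sum>\<alpha>\<in>UNIV. \<Sum>k\<in>UNIV. \<Sum>l\<in>UNIV.
       wscale (of_real (1/2 * W p $ s $ \<alpha> * (\<Gamma> p \<alpha> k l - \<Gamma> p \<alpha> l k)))
         (y_mult s (dx_wedge k (dx_wedge l wone))))"

definition R :: "'m \<Rightarrow> 'n wform" where
  "R p = (\<Sum>s\<in>UNIV. \<Sum>\<alpha>\<in>UNIV. \<Sum>t\<in>UNIV. \<Sum>k\<in>UNIV. \<Sum>l\<in>UNIV.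
       wscale (of_real (1/4 * W p $ s $ \<alpha> * Rc p \<alpha> t k l))
         (y_mult s (y_mult t (dx_wedge k (dx_wedge l wone)))))"

lemma smooth_section_nab: "smooth_section a \<Longrightarrow> smooth_section (nab a)"
  unfolding nab_def by (intro smooth_section_intros smooth_section_cov)

lemma smooth_T: "smooth_section T"
  unfolding T_def by (intro smooth_secs)

lemma smooth_R: "smooth_section R"
  unfolding R_def Rc_def by (intro smooth_secs)

lemma is_form_T: "is_form 2 (T p)"
  unfolding T_def numeral_2_eq_2
  by (intro is_form_sum is_form_wscale is_form_y_mult is_form_dx_wedge is_form_wone)

lemma is_form_R: "is_form 2 (R p)"
  unfolding R_def numeral_2_eq_2
  by (intro is_form_sum is_form_wscale is_form_y_mult is_form_dx_wedge is_form_wone)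

lemma parity_T: "parity (T p) = T p" and parity_R: "parity (R p) = R p"
  using parity_is_form[OF is_form_T] parity_is_form[OF is_form_R] by simp_all

text \<open>Both matrices are contracted in their first index, so the antisymmetric inverse has to
  be transposed once, which gives the minus sign.\<close>

lemma H_W:
  assumes p: "p \<in> dom_of c"
  shows "(\<Sum>s\<in>UNIV. W p $ s $ \<alpha> * matrix_inv (W p) $ s $ m) = (if \<alpha> = m then - 1 else 0)"
proof -
  have "(\<Sum>s\<in>UNIV. W p $ s $ \<alpha> * matrix_inv (W p) $ s $ m) = - (\<Sum>s\<in>UNIV. matrix_inv (W p) $ m $ s * W p $ s $ \<alpha>)"
    unfolding sum_negf[symmetric]
    by (intro sum.cong refl) (simp add: matrix_inv_antisym[OF inv_W[OF p] anti_W[OF p], of _ m])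
  also have "\<dots> = - (matrix_inv (W p) ** W p) $ m $ \<alpha>" by (simp add: matrix_matrix_mult_def)
  finally show ?thesis by (auto simp: matrix_inv_inverse[OF inv_W[OF p]] mat_def)
qed

context
  fixes p assumes p: "p \<in> dom_of c"
begin

lemma nab_cong: "(\<And>q. q \<in> dom_of c \<Longrightarrow> a q = b q) \<Longrightarrow> nab a p = nab b p"
  unfolding nab_def using cov_cong[OF p, of a b] by simp

lemma nab_add: "smooth_section a \<Longrightarrow> smooth_section b \<Longrightarrow> nab (\<lambda>q. a q + b q) p = nab a p + nab b p"
  and nab_diff: "smooth_section a \<Longrightarrow> smooth_section b \<Longrightarrow> nab (\<lambda>q. a q - b q) p = nab a p - nab b p"
  and nab_minus: "smooth_section a \<Longrightarrow> nab (\<lambda>q. - a q) p = - nab a p"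
  and nab_cscale: "smooth_section a \<Longrightarrow> nab (\<lambda>q. wscale z (a q)) p = wscale z (nab a p)"
  and nab_nu_shift: "nab (\<lambda>q. nu_shift (a q)) p = nu_shift (nab a p)"
  by (simp_all add: nab_def cov_add cov_diff cov_minus cov_cscale cov_nu_shift p additive_simps
      wscale_simps nu_commute_dx sum.distrib sum_subtractf sum_negf)

lemma nab_parity: "smooth_section a \<Longrightarrow> nab (\<lambda>q. parity (a q)) p = - parity (nab a p)"
  by (simp add: nab_def cov_parity p additive_simps parity_dx_wedge sum_negf)

lemma nab_wick:
  "smooth_section a \<Longrightarrow> smooth_section b \<Longrightarrow>
    nab (\<lambda>q. wick (L q) (a q) (b q)) p = wick (L p) (nab a p) (b p) + wick (L p) (parity (a p)) (nab b p)"
  by (simp add: nab_def cov_wick p additive_simps wick_simps wick_dx_wedge_left wick_dx_wedge_right sum.distrib)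

lemma nab_wick_comm:
  "smooth_section X \<Longrightarrow> smooth_section a \<Longrightarrow> (\<And>q. parity (X q) = X q) \<Longrightarrow>
    nab (\<lambda>q. wick_comm (L q) (X q) (a q)) p = odd_comm (L p) (nab X p) (a p) + wick_comm (L p) (X p) (nab a p)"
  by (simp add: wick_comm_def odd_comm_def nab_diff nab_wick smooth_section_wick_L)

lemma nab_odd_comm:
  "smooth_section r \<Longrightarrow> smooth_section a \<Longrightarrow> (\<And>q. parity (r q) = - r q) \<Longrightarrow>
    nab (\<lambda>q. odd_comm (L q) (r q) (a q)) p = wick_comm (L p) (nab r p) (a p) - odd_comm (L p) (r p) (nab a p)"
  by (simp add: wick_comm_def odd_comm_def nab_diff nab_wick smooth_section_wick_L smooth_section_parity
      nab_parity wick_simps)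

lemma is_form_nab:
  assumes "\<And>q. q \<in> dom_of c \<Longrightarrow> is_form n (a q)" shows "is_form (Suc n) (nab a p)"
proof -
  \<comment> \<open>A coefficient that vanishes on the whole chart domain has zero derivative
    there.\<close>
  have "is_form n (pdw j a p)" for j
    unfolding is_form_def pdw_def
    using pd_cong[of "\<lambda>q. a q r \<alpha> I" "\<lambda>q. 0" p j for r \<alpha> I] assms p by (auto simp: is_form_def)
  then show ?thesis
    unfolding nab_def cov_def fib_vf_def
    by (intro is_form_sum is_form_dx_wedge is_form_diff is_form_wscale is_form_y_mult is_form_dy assms[OF p])
qed

text \<open>Base derivatives keep the degrees in \<nu> and y, and each Christoffel term exchanges
  one y for another. The hypothesis concerns the whole domain because the coefficients are
  differentiated.\<close>

lemma low_nab:
  assumes "\<And>q. q \<in> dom_of c \<Longrightarrow> low n (a q)" shows "low n (nab a p)"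
proof -
  have 1: "low n (pdw j a p)" for j
    unfolding low_iff pdw_def
    using pd_cong[of "\<lambda>q. a q r \<alpha> I" "\<lambda>q. 0" p j for r \<alpha> I] assms p by (auto simp: low_iff)
  have "ydeg ((\<alpha>(k := \<alpha> k - 1))(l := Suc ((\<alpha>(k := \<alpha> k - 1)) l))) = ydeg \<alpha>" if "\<alpha> k \<noteq> 0" for \<alpha> :: "'n \<Rightarrow> nat" and k l
    using that ydeg_update[of "\<alpha>(k := \<alpha> k - 1)" l] ydeg_update_minus[of \<alpha> k] by simp
  then have 2: "low n (y_mult k (dy l (a p)))" for k l
    using assms[OF p] by (auto simp: low_iff y_mult_def dy_def)
  have 3: "low n (\<Sum>x\<in>S. f x)" if "\<And>x. low n (f x)" for f and S :: "'n set"
    using that by (simp add: low_def additive_simps)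
  have 4: "low n (dx_wedge j b)" if "low n b" for j b
    using that by (auto simp: low_iff dx_wedge_def)
  show ?thesis
    unfolding nab_def cov_def fib_vf_def by (intro 3 4 low_diff 1 low_wscale 2)
qed

lemma no_constant_nab:
  assumes "\<And>q. q \<in> dom_of c \<Longrightarrow> no_constant (a q)" shows "no_constant (nab a p)"
proof -
  have "no_constant (pdw j a p)" for j
    unfolding no_constant_def pdw_def
    using pd_cong[of "\<lambda>q. a q r (\<lambda>_. 0) I" "\<lambda>q. 0" p j for r I] assms p by (auto simp: no_constant_def)
  then show ?thesis
    unfolding nab_def cov_def fib_vf_def
    by (intro no_constant_sum no_constant_intros)
qed

text \<open>The commutator with y^s is i\<nu> times the inverse of \<omega> applied to the
  \<partial>/\<partial>y^m; contraction with \<omega> inverts this. The sign is that of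
  \<open>H_W\<close>.\<close>

lemma wick_comm_W:
  "(\<Sum>s\<in>UNIV. wscale (of_real (W p $ s $ \<alpha>)) (wick_comm (L p) (yvar s) b)) = wscale (- \<i>) (nu_mult (dy \<alpha> b))"
proof -
  let ?H = "\<lambda>s m. matrix_inv (W p) $ s $ m"
  have "wick_comm (L p) (yvar s) b = nu_mult (\<Sum>m\<in>UNIV. wscale (\<i> * of_real (?H s m)) (dy m b))" for s
    unfolding wick_comm_yvar by (simp add: L_antisym p)
  then have "(\<Sum>s\<in>UNIV. wscale (of_real (W p $ s $ \<alpha>)) (wick_comm (L p) (yvar s) b)) =
     nu_mult (\<Sum>s\<in>UNIV. \<Sum>m\<in>UNIV. wscale (\<i> * of_real (W p $ s $ \<alpha> * ?H s m)) (dy m b))"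
    by (simp add: additive_simps mult_ac wscale_simps(1)[symmetric] del: wscale_simps(1))
  also have "\<dots> = nu_mult (\<Sum>m\<in>UNIV. wscale (\<i> * of_real (\<Sum>s\<in>UNIV. W p $ s $ \<alpha> * ?H s m)) (dy m b))"
    by (subst sum.swap) (simp add: wscale_sum_left sum_distrib_left)
  also have "\<dots> = nu_mult (\<Sum>m\<in>UNIV. if \<alpha> = m then wscale (- \<i>) (dy m b) else 0)"
    unfolding H_W[OF p] by (intro arg_cong[where f = nu_mult] sum.cong) auto
  finally show ?thesis by (simp add: wscale_simps)
qed

text \<open>T is linear in y, so its commutator is a combination of the \<partial>/\<partial>y^m
  with half the torsion as coefficients. That is the antisymmetric part of \<Gamma>, and under the
  wedge \<Gamma> itself may stand in its place.\<close>

lemma ad_T: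
  "wscale \<i> (nu_shift (wick_comm (L p) (T p) b)) =
    (\<Sum>k\<in>UNIV. \<Sum>l\<in>UNIV. dx_wedge k (dx_wedge l (\<Sum>m\<in>UNIV. wscale (of_real (\<Gamma> p m k l)) (dy m b))))"
proof -
  let ?B = "\<lambda>k l. \<Sum>m\<in>UNIV. wscale (of_real (\<Gamma> p m k l)) (dy m b)"
  have i_cancel: "\<i> * (z * - \<i>) = z" "\<i> * z * - \<i> = z" for z by (simp_all add: mult_ac)
  have "wick_comm (L p) (T p) b = (\<Sum>s\<in>UNIV. \<Sum>\<alpha>\<in>UNIV. \<Sum>k\<in>UNIV. \<Sum>l\<in>UNIV.
       wscale (of_real (1/2 * (\<Gamma> p \<alpha> k l - \<Gamma> p \<alpha> l k))) (dx_wedge k (dx_wedge l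
          (wscale (of_real (W p $ s $ \<alpha>)) (wick_comm (L p) (yvar s) b)))))"
    unfolding T_def by (simp add: wick_comm_simps dx_dy_commute wick_comm_dx_dx wscale_simps mult_ac)
  also have "\<dots> = (\<Sum>k\<in>UNIV. \<Sum>l\<in>UNIV. \<Sum>\<alpha>\<in>UNIV. \<Sum>s\<in>UNIV.
       wscale (of_real (1/2 * (\<Gamma> p \<alpha> k l - \<Gamma> p \<alpha> l k))) (dx_wedge k (dx_wedge l
          (wscale (of_real (W p $ s $ \<alpha>)) (wick_comm (L p) (yvar s) b)))))"
    by (rule sum_rotate4)
  also have "\<dots> = (\<Sum>k\<in>UNIV. \<Sum>l\<in>UNIV. \<Sum>\<alpha>\<in>UNIV.
       wscale (of_real (1/2 * (\<Gamma> p \<alpha> k l - \<Gamma> p \<alpha> l k))) (dx_wedge k (dx_wedge l (wscale (- \<i>) (nu_mult (dy \<alpha> b))))))"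
    by (simp only: wscale.sum[symmetric] dx_wedge.sum[symmetric] wick_comm_W)
  finally have "wscale \<i> (nu_shift (wick_comm (L p) (T p) b)) = (\<Sum>k\<in>UNIV. \<Sum>l\<in>UNIV. \<Sum>\<alpha>\<in>UNIV.
       wscale (of_real (1/2 * (\<Gamma> p \<alpha> k l - \<Gamma> p \<alpha> l k))) (dx_wedge k (dx_wedge l (dy \<alpha> b))))"
    by (simp only: additive_simps wscale_simps nu_commute_dx nu_shift_nu_mult wscale_wscale i_cancel)
  also have "\<dots> = (\<Sum>k\<in>UNIV. \<Sum>l\<in>UNIV. dx_wedge k (dx_wedge l (wscale (1/2) (?B k l - ?B l k))))"
    by (simp add: additive_simps wscale_simps wscale_diff_left sum_subtractf right_diff_distrib)
  also have "\<dots> = (\<Sum>k\<in>UNIV. \<Sum>l\<in>UNIV. dx_wedge k (dx_wedge l (?B k l)))"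
    by (rule sum_dx_dx_antisym[symmetric])
  finally show ?thesis .
qed

text \<open>If \<open>dy\<close> commuted with \<open>cov\<close>, the two sums would cancel by the
  antisymmetry of the wedge; what survives is the frame term of \<open>cov_dy\<close>.\<close>

lemma delta_nab:
  assumes a: "smooth_section a"
  shows "fib_delta (nab a p) + nab (\<lambda>q. fib_delta (a q)) p = wscale \<i> (nu_shift (wick_comm (L p) (T p) (a p)))"
proof -
  have A: "nab (\<lambda>q. fib_delta (a q)) p = (\<Sum>j\<in>UNIV. \<Sum>i\<in>UNIV. dx_wedge j (dx_wedge i
      (dy i (cov j a p) + (\<Sum>l\<in>UNIV. wscale (of_real (\<Gamma> p l j i)) (dy l (a p))))))"
    unfolding nab_def fib_delta_def
    by (simp add: cov_sum cov_dx_wedge cov_dy p a smooth_section_intros additive_simps Gam_def)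
  have "fib_delta (nab a p) = (\<Sum>i\<in>UNIV. \<Sum>j\<in>UNIV. dx_wedge i (dx_wedge j (dy i (cov j a p))))"
    unfolding nab_def fib_delta_def by (simp add: additive_simps dx_dy_commute)
  also have "\<dots> = (\<Sum>j\<in>UNIV. \<Sum>i\<in>UNIV. dx_wedge i (dx_wedge j (dy i (cov j a p))))"
    by (rule sum.swap)
  also have "\<dots> = (\<Sum>j\<in>UNIV. \<Sum>i\<in>UNIV. - dx_wedge j (dx_wedge i (dy i (cov j a p))))"
    by (intro sum.cong refl dx_wedge_anticommute)
  finally have B: "fib_delta (nab a p) = (\<Sum>j\<in>UNIV. \<Sum>i\<in>UNIV. - dx_wedge j (dx_wedge i (dy i (cov j a p))))" .
  show ?thesis unfolding A B ad_T by (simp add: additive_simps sum_negf sum.distrib)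
qed

text \<open>The curvature acts by derivations of the Wick product; evaluating this on \<open>y\<^sup>u \<circ> y\<^sup>v\<close> shows
  that it is skew with respect to both inverse tensors.\<close>

lemma R_L:
  "(\<Sum>t\<in>UNIV. of_real (Rc p u t k l) * L p t v) + (\<Sum>t\<in>UNIV. of_real (Rc p v t k l) * L p u t) = 0"
proof -
  let ?F = "fib_vf (\<lambda>s t. of_real (Rc p s t k l))"
  let ?a = "\<lambda>q::'m. yvar u" and ?b = "\<lambda>q::'m. yvar v"
  have sm: "smooth_section ?a" "smooth_section ?b" by (rule smooth_section_const)+
  have c: "cov k (cov l (\<lambda>q. wick (L q) (?a q) (?b q))) p =
     wick (L p) (cov k (cov l ?a) p) (?b p) + wick (L p) (cov l ?a p) (cov k ?b p) +
     (wick (L p) (cov k ?a p) (cov l ?b p) + wick (L p) (?a p) (cov k (cov l ?b) p))" for k l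
  proof -
    have "cov k (cov l (\<lambda>q. wick (L q) (?a q) (?b q))) p =
      cov k (\<lambda>q. wick (L q) (cov l ?a q) (?b q) + wick (L q) (?a q) (cov l ?b q)) p"
      by (rule cov_cong[OF p]) (simp add: cov_wick sm)
    then show ?thesis
      by (simp add: cov_add cov_wick p sm smooth_section_wick_L smooth_section_cov)
  qed
  have "?F (wick (L p) (yvar u) (yvar v)) =
      - (cov k (cov l (\<lambda>q. wick (L q) (?a q) (?b q))) p - cov l (cov k (\<lambda>q. wick (L q) (?a q) (?b q))) p)"
    by (simp only: cov_commutator[OF p smooth_section_wick_L[OF sm]] minus_minus)
  also have "\<dots> = - (wick (L p) (cov k (cov l ?a) p - cov l (cov k ?a) p) (yvar v)
      + wick (L p) (yvar u) (cov k (cov l ?b) p - cov l (cov k ?b) p))"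
    unfolding c wick_left.diff wick_right.diff by (simp add: algebra_simps)
  also have "\<dots> = wick (L p) (?F (yvar u)) (yvar v) + wick (L p) (yvar u) (?F (yvar v))"
    unfolding cov_commutator[OF p sm(1)] cov_commutator[OF p sm(2)] by (simp add: wick_simps)
  finally have "?F (wick (L p) (yvar u) (yvar v)) = wick (L p) (?F (yvar u)) (yvar v) + wick (L p) (yvar u) (?F (yvar v))" .
  moreover have "wick (L p) (yvar u) (yvar v) = y_mult u (yvar v) + nu_mult (wscale (\<i> / 2 * L p u v) wone)" for u v
    by (simp add: wick_yvar(1) dy_yvar if_distrib additive_simps cong: if_cong)
  moreover have F: "?F (yvar u) = (\<Sum>t\<in>UNIV. wscale (of_real (Rc p u t k l)) (yvar t))" for u
    by (simp add: fib_vf_def dy_yvar if_distrib additive_simps cong: if_cong)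
  \<comment> \<open>Coefficient of \<nu> at y = 0: the curvature field annihilates constants and
    gives 0 on the left, and on the right only the \<Lambda>-terms of the products remain.\<close>
  ultimately have "?F (y_mult u (yvar v) + nu_mult (wscale (\<i> / 2 * L p u v) wone)) 1 (\<lambda>_. 0) {} =
     ((\<Sum>t\<in>UNIV. wscale (of_real (Rc p u t k l)) (y_mult t (yvar v) + nu_mult (wscale (\<i> / 2 * L p t v) wone))) +
     (\<Sum>t\<in>UNIV. wscale (of_real (Rc p v t k l)) (y_mult u (yvar t) + nu_mult (wscale (\<i> / 2 * L p u t) wone)))) 1 (\<lambda>_. 0) {}"
    by (simp add: wick_simps)
  then have "0 = \<i> / 2 * ((\<Sum>t\<in>UNIV. of_real (Rc p u t k l) * L p t v) + (\<Sum>t\<in>UNIV. of_real (Rc p v t k l) * L p u t))"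
    by (simp add: fib_vf_def sum_apply pointwise wscale_def y_mult_def nu_mult_def wone_def sum_distrib_left
        distrib_left mult_ac)
  then show ?thesis by simp
qed

text \<open>The curvature lies in the symplectic Lie algebra. Antisymmetrising \<open>R_L\<close> in
  the indices of \<Lambda> isolates the inverse H of \<omega> and says that RH is symmetric;
  multiplying by \<omega> on both sides keeps symmetry and turns RH into \<omega>R.\<close>

lemma R_W_sym:
  "(\<Sum>\<alpha>\<in>UNIV. W p $ s $ \<alpha> * Rc p \<alpha> t k l) = (\<Sum>\<alpha>\<in>UNIV. W p $ t $ \<alpha> * Rc p \<alpha> s k l)"
proof -
  define RM :: "((real, 'n) vec, 'n) vec" where "RM = (\<chi> a b. Rc p a b k l)"
  let ?H = "matrix_inv (W p)"
  have "(RM ** ?H) $ u $ v = transpose (RM ** ?H) $ u $ v" for u v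
  proof -
    have "(\<Sum>t\<in>UNIV. of_real (Rc p u t k l) * (L p t v - L p v t)) + (\<Sum>t\<in>UNIV. of_real (Rc p v t k l) * (L p u t - L p t u))
      = ((\<Sum>t\<in>UNIV. of_real (Rc p u t k l) * L p t v) + (\<Sum>t\<in>UNIV. of_real (Rc p v t k l) * L p u t))
      - ((\<Sum>t\<in>UNIV. of_real (Rc p v t k l) * L p t u) + (\<Sum>t\<in>UNIV. of_real (Rc p u t k l) * L p v t))"
      by (simp add: right_diff_distrib sum_subtractf)
    then have "(\<Sum>t\<in>UNIV. of_real (Rc p u t k l) * (L p t v - L p v t)) + (\<Sum>t\<in>UNIV. of_real (Rc p v t k l) * (L p u t - L p t u)) = 0"
      by (simp only: R_L diff_self)
    then have "(\<Sum>t\<in>UNIV. of_real (Rc p u t k l) * (2 * complex_of_real (?H $ t $ v)))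
        + (\<Sum>t\<in>UNIV. of_real (Rc p v t k l) * (2 * complex_of_real (?H $ u $ t))) = 0"
      by (simp only: L_antisym[OF p])
    then have "complex_of_real (2 * ((\<Sum>t\<in>UNIV. Rc p u t k l * ?H $ t $ v) + (\<Sum>t\<in>UNIV. Rc p v t k l * ?H $ u $ t))) = 0"
      by (simp add: sum_distrib_left distrib_left mult_ac)
    then have "(\<Sum>t\<in>UNIV. Rc p u t k l * ?H $ t $ v) + (\<Sum>t\<in>UNIV. Rc p v t k l * ?H $ u $ t) = 0"
      unfolding of_real_eq_0_iff by simp
    moreover have "(\<Sum>t\<in>UNIV. Rc p v t k l * ?H $ u $ t) = - (\<Sum>t\<in>UNIV. Rc p v t k l * ?H $ t $ u)"
      unfolding sum_negf[symmetric]
      by (intro sum.cong refl) (simp add: matrix_inv_antisym[OF inv_W[OF p] anti_W[OF p], of u])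
    ultimately show ?thesis
      by (simp add: RM_def matrix_matrix_mult_def transpose_def)
  qed
  then have RH: "RM ** ?H = transpose (RM ** ?H)" by (simp add: vec_eq_iff)
  have tW: "transpose (W p) = - W p"
  proof -
    have "transpose (W p) $ a $ b = (- W p) $ a $ b" for a b using anti_W[OF p, of a b] by (simp add: transpose_def)
    then show ?thesis by (simp add: vec_eq_iff)
  qed
  have neg: "(- A) ** B = - (A ** B)" "A ** (- B) = - (A ** B)" for A B :: "((real, 'n) vec, 'n) vec"
    by (simp_all add: vec_eq_iff matrix_matrix_mult_def sum_negf)
  have "W p ** RM = W p ** (RM ** ?H) ** W p"
    by (simp add: matrix_inv_inverse[OF inv_W[OF p]] flip: matrix_mul_assoc)
  also have "\<dots> = W p ** transpose (RM ** ?H) ** W p" using RH by simp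
  also have "\<dots> = transpose (W p ** (RM ** ?H) ** W p)"
    by (simp add: matrix_transpose_mul tW neg matrix_mul_assoc)
  also have "W p ** (RM ** ?H) ** W p = W p ** RM"
    by (simp add: matrix_inv_inverse[OF inv_W[OF p]] flip: matrix_mul_assoc)
  finally have "(W p ** RM) $ s $ t = transpose (W p ** RM) $ s $ t" by simp
  then show ?thesis by (simp add: RM_def matrix_matrix_mult_def transpose_def)
qed

end

end

section \<open>Curvature as a commutator, and the Bianchi identities\<close>

context kaehler_chart
begin

definition Z :: "('m \<Rightarrow> 'n wform) \<Rightarrow> 'm \<Rightarrow> 'n wform" where
  "Z r p = fib_delta (r p) - T p - R p - nab r p + wscale \<i> (nu_shift (wick (L p) (r p) (r p)))"

definition D :: "('m \<Rightarrow> 'n wform) \<Rightarrow> ('m \<Rightarrow> 'n wform) \<Rightarrow> 'm \<Rightarrow> 'n wform" where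
  "D r a p = - fib_delta (a p) + nab a p - wscale \<i> (nu_shift (odd_comm (L p) (r p) (a p)))"

lemma smooth_section_fib_delta: "smooth_section a \<Longrightarrow> smooth_section (\<lambda>q. fib_delta (a q))"
  unfolding fib_delta_def by (intro smooth_section_intros)

lemma smooth_section_odd_comm:
  "smooth_section a \<Longrightarrow> smooth_section b \<Longrightarrow> smooth_section (\<lambda>q. odd_comm (L q) (a q) (b q))"
  unfolding odd_comm_def by (intro smooth_secs)

lemma smooth_section_wick_comm:
  "smooth_section a \<Longrightarrow> smooth_section b \<Longrightarrow> smooth_section (\<lambda>q. wick_comm (L q) (a q) (b q))"
  unfolding wick_comm_def by (intro smooth_secs)

lemmas smooth_D = smooth_secs smooth_section_fib_delta smooth_section_odd_comm smooth_section_wick_comm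
  smooth_section_nab smooth_T smooth_R

context
  fixes p assumes p: "p \<in> dom_of c"
begin

text \<open>A quadratic Hamiltonian generates a linear field. \<open>A\<close> and \<open>B\<close>
  are the two halves of the commutator with y^s y^t, matched by the symmetry of \<omega>R; in their
  sum \<open>C\<close> the second derivatives cancel. The constant is 1/4 times -i times 2.\<close>

lemma wick_comm_quadratic:
  "(\<Sum>s\<in>UNIV. \<Sum>\<alpha>\<in>UNIV. \<Sum>t\<in>UNIV. wscale (of_real (1/4 * W p $ s $ \<alpha> * Rc p \<alpha> t k l)) (wick_comm (L p) (y_mult s (yvar t)) b)) =
     wscale (- \<i> / 2) (nu_mult (fib_vf (\<lambda>s t. of_real (Rc p s t k l)) b))"
proof -
  let ?w = "\<lambda>s \<alpha>. complex_of_real (W p $ s $ \<alpha>)" and ?r = "\<lambda>\<alpha> t. complex_of_real (Rc p \<alpha> t k l)"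
  let ?c = "\<lambda>s. wick_comm (L p) (yvar s) b" and ?F = "fib_vf (\<lambda>s t. of_real (Rc p s t k l))"
  have M: "(\<Sum>\<alpha>\<in>UNIV. ?w s \<alpha> * ?r \<alpha> t) = (\<Sum>\<alpha>\<in>UNIV. ?w t \<alpha> * ?r \<alpha> s)" for s t
    using R_W_sym[OF p, of s t k l] by (simp flip: of_real_mult of_real_sum)
  have A: "(\<Sum>s\<in>UNIV. \<Sum>\<alpha>\<in>UNIV. \<Sum>t\<in>UNIV. wscale (?w s \<alpha> * ?r \<alpha> t) (wick (L p) (?c s) (yvar t))) =
     wscale (- \<i>) (nu_mult (\<Sum>\<alpha>\<in>UNIV. \<Sum>t\<in>UNIV. wscale (?r \<alpha> t) (wick (L p) (dy \<alpha> b) (yvar t))))"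
  proof -
    have "(\<Sum>s\<in>UNIV. \<Sum>\<alpha>\<in>UNIV. \<Sum>t\<in>UNIV. wscale (?w s \<alpha> * ?r \<alpha> t) (wick (L p) (?c s) (yvar t))) =
      (\<Sum>\<alpha>\<in>UNIV. \<Sum>t\<in>UNIV. \<Sum>s\<in>UNIV. wscale (?w s \<alpha> * ?r \<alpha> t) (wick (L p) (?c s) (yvar t)))"
      by (rule sum_rotate[symmetric])
    also have "\<dots> = (\<Sum>\<alpha>\<in>UNIV. \<Sum>t\<in>UNIV. wscale (?r \<alpha> t) (wick (L p) (\<Sum>s\<in>UNIV. wscale (?w s \<alpha>) (?c s)) (yvar t)))"
      by (simp add: wick_simps additive_simps mult.commute)
    finally show ?thesis
      by (simp add: wick_comm_W p wick_simps wick_nu_mult additive_simps wscale_simps(1) mult.commute)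
  qed
  have "(\<Sum>s\<in>UNIV. \<Sum>\<alpha>\<in>UNIV. \<Sum>t\<in>UNIV. wscale (?w s \<alpha> * ?r \<alpha> t) (wick (L p) (yvar s) (?c t))) =
      (\<Sum>s\<in>UNIV. \<Sum>t\<in>UNIV. wscale (\<Sum>\<alpha>\<in>UNIV. ?w s \<alpha> * ?r \<alpha> t) (wick (L p) (yvar s) (?c t)))"
    unfolding wscale_sum_left by (rule sum.cong[OF refl], rule sum.swap)
  also have "\<dots> = (\<Sum>s\<in>UNIV. \<Sum>t\<in>UNIV. \<Sum>\<alpha>\<in>UNIV. wscale (?w t \<alpha> * ?r \<alpha> s) (wick (L p) (yvar s) (?c t)))"
    by (intro sum.cong refl) (subst M, rule wscale_sum_left)
  also have "\<dots> = (\<Sum>t\<in>UNIV. \<Sum>\<alpha>\<in>UNIV. \<Sum>s\<in>UNIV. wscale (?w t \<alpha> * ?r \<alpha> s) (wick (L p) (yvar s) (?c t)))"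
    by (rule sum_rotate[symmetric])
  also have "\<dots> = (\<Sum>\<alpha>\<in>UNIV. \<Sum>s\<in>UNIV. \<Sum>t\<in>UNIV. wscale (?w t \<alpha> * ?r \<alpha> s) (wick (L p) (yvar s) (?c t)))"
    by (rule sum_rotate[symmetric])
  also have "\<dots> = (\<Sum>\<alpha>\<in>UNIV. \<Sum>s\<in>UNIV. wscale (?r \<alpha> s) (wick (L p) (yvar s) (\<Sum>t\<in>UNIV. wscale (?w t \<alpha>) (?c t))))"
    by (simp add: wick_simps additive_simps mult.commute)
  finally have B: "(\<Sum>s\<in>UNIV. \<Sum>\<alpha>\<in>UNIV. \<Sum>t\<in>UNIV. wscale (?w s \<alpha> * ?r \<alpha> t) (wick (L p) (yvar s) (?c t))) =
     wscale (- \<i>) (nu_mult (\<Sum>\<alpha>\<in>UNIV. \<Sum>s\<in>UNIV. wscale (?r \<alpha> s) (wick (L p) (yvar s) (dy \<alpha> b))))"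
    by (simp add: wick_comm_W p wick_simps wick_nu_mult additive_simps wscale_simps(1) mult.commute)
  \<comment> \<open>Besides 2 y \<partial>/\<partial>y, the symmetrised product has a \<nu>-term in
    which R is contracted with the symmetric part of \<Lambda>. \<open>R_L\<close> makes its
    coefficient antisymmetric, while the two derivatives commute.\<close>
  have C: "(\<Sum>\<alpha>\<in>UNIV. \<Sum>s\<in>UNIV. wscale (?r \<alpha> s) (wick (L p) (yvar s) (dy \<alpha> b)))
     + (\<Sum>\<alpha>\<in>UNIV. \<Sum>t\<in>UNIV. wscale (?r \<alpha> t) (wick (L p) (dy \<alpha> b) (yvar t))) = wscale 2 (?F b)"
  proof -
    let ?E = "\<lambda>\<alpha>. \<Sum>s\<in>UNIV. \<Sum>m\<in>UNIV. wscale (?r \<alpha> s * (L p s m + L p m s)) (dy m (dy \<alpha> b))"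
    have "wick (L p) (yvar s) (dy \<alpha> b) + wick (L p) (dy \<alpha> b) (yvar s) =
      wscale 2 (y_mult s (dy \<alpha> b)) + wscale (\<i> / 2) (nu_mult (\<Sum>m\<in>UNIV. wscale (L p s m + L p m s) (dy m (dy \<alpha> b))))" for s \<alpha>
    proof -
      have "wscale 2 d = d + d" for d :: "'n wform" using wscale_add_left[of 1 1 d] by simp
      then show ?thesis
        by (simp add: wick_yvar additive_simps wscale_add_left wscale_simps(1) sum.distrib)
    qed
    then have "(\<Sum>\<alpha>\<in>UNIV. \<Sum>s\<in>UNIV. wscale (?r \<alpha> s) (wick (L p) (yvar s) (dy \<alpha> b)))
     + (\<Sum>\<alpha>\<in>UNIV. \<Sum>t\<in>UNIV. wscale (?r \<alpha> t) (wick (L p) (dy \<alpha> b) (yvar t))) =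
      (\<Sum>\<alpha>\<in>UNIV. \<Sum>s\<in>UNIV. wscale (?r \<alpha> s) (wscale 2 (y_mult s (dy \<alpha> b))
         + wscale (\<i> / 2) (nu_mult (\<Sum>m\<in>UNIV. wscale (L p s m + L p m s) (dy m (dy \<alpha> b))))))"
      by (simp only: sum.distrib[symmetric] wscale.add[symmetric])
    also have "\<dots> = wscale 2 (\<Sum>\<alpha>\<in>UNIV. \<Sum>s\<in>UNIV. wscale (?r \<alpha> s) (y_mult s (dy \<alpha> b))) + wscale (\<i> / 2) (nu_mult (\<Sum>\<alpha>\<in>UNIV. ?E \<alpha>))"
      by (simp add: additive_simps sum.distrib wscale_simps(1) mult_ac)
    also have "(\<Sum>\<alpha>\<in>UNIV. ?E \<alpha>) = (\<Sum>\<alpha>\<in>UNIV. \<Sum>m\<in>UNIV. wscale (\<Sum>s\<in>UNIV. ?r \<alpha> s * (L p s m + L p m s)) (dy m (dy \<alpha> b)))"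
      unfolding wscale_sum_left by (rule sum.cong[OF refl], rule sum.swap)
    also have "\<dots> = 0"
    proof (rule sum_antisymmetric_zero)
      fix \<alpha> m
      have "(\<Sum>s\<in>UNIV. ?r \<alpha> s * (L p s m + L p m s)) + (\<Sum>s\<in>UNIV. ?r m s * (L p s \<alpha> + L p \<alpha> s)) =
        ((\<Sum>t\<in>UNIV. ?r \<alpha> t * L p t m) + (\<Sum>t\<in>UNIV. ?r m t * L p \<alpha> t)) +
        ((\<Sum>t\<in>UNIV. ?r m t * L p t \<alpha>) + (\<Sum>t\<in>UNIV. ?r \<alpha> t * L p m t))"
        by (simp add: distrib_left sum.distrib)
      then have "(\<Sum>s\<in>UNIV. ?r \<alpha> s * (L p s m + L p m s)) = - (\<Sum>s\<in>UNIV. ?r m s * (L p s \<alpha> + L p \<alpha> s))"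
        by (simp only: R_L[OF p] add_0 eq_neg_iff_add_eq_0)
      then show "wscale (\<Sum>s\<in>UNIV. ?r \<alpha> s * (L p s m + L p m s)) (dy m (dy \<alpha> b)) =
        - wscale (\<Sum>s\<in>UNIV. ?r m s * (L p s \<alpha> + L p \<alpha> s)) (dy \<alpha> (dy m b))"
        by (simp only: wscale_uminus_left dy_commute[of m \<alpha>])
    qed
    also have "(\<Sum>\<alpha>\<in>UNIV. \<Sum>s\<in>UNIV. wscale (?r \<alpha> s) (y_mult s (dy \<alpha> b))) = ?F b"
      unfolding fib_vf_def by (rule sum.swap)
    finally show ?thesis by (simp add: additive_simps)
  qed
  have "(\<Sum>s\<in>UNIV. \<Sum>\<alpha>\<in>UNIV. \<Sum>t\<in>UNIV. wscale (of_real (1/4 * W p $ s $ \<alpha> * Rc p \<alpha> t k l)) (wick_comm (L p) (y_mult s (yvar t)) b)) =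
     wscale (1/4) ((\<Sum>s\<in>UNIV. \<Sum>\<alpha>\<in>UNIV. \<Sum>t\<in>UNIV. wscale (?w s \<alpha> * ?r \<alpha> t) (wick (L p) (yvar s) (?c t))) +
       (\<Sum>s\<in>UNIV. \<Sum>\<alpha>\<in>UNIV. \<Sum>t\<in>UNIV. wscale (?w s \<alpha> * ?r \<alpha> t) (wick (L p) (?c s) (yvar t))))"
    by (simp add: wick_comm_yvar_yvar additive_simps sum.distrib)
  also have "\<dots> = wscale (1/4 * - \<i>) (nu_mult (wscale 2 (?F b)))"
    unfolding A B C[symmetric] by (simp only: additive_simps wscale_wscale)
  finally show ?thesis by (simp add: wscale_simps(1))
qed

lemma ad_R:
  "wscale \<i> (nu_shift (wick_comm (L p) (R p) b)) =
    (\<Sum>k\<in>UNIV. \<Sum>l\<in>UNIV. dx_wedge k (dx_wedge l (wscale (1/2) (fib_vf (\<lambda>s t. of_real (Rc p s t k l)) b))))"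
proof -
  have "wick_comm (L p) (R p) b = (\<Sum>s\<in>UNIV. \<Sum>\<alpha>\<in>UNIV. \<Sum>t\<in>UNIV. \<Sum>k\<in>UNIV. \<Sum>l\<in>UNIV.
       dx_wedge k (dx_wedge l (wscale (of_real (1/4 * W p $ s $ \<alpha> * Rc p \<alpha> t k l)) (wick_comm (L p) (y_mult s (yvar t)) b))))"
    unfolding R_def by (simp add: wick_comm_simps dx_dy_commute wick_comm_dx_dx wscale_simps)
  also have "\<dots> = (\<Sum>k\<in>UNIV. \<Sum>l\<in>UNIV. \<Sum>s\<in>UNIV. \<Sum>\<alpha>\<in>UNIV. \<Sum>t\<in>UNIV.
       dx_wedge k (dx_wedge l (wscale (of_real (1/4 * W p $ s $ \<alpha> * Rc p \<alpha> t k l)) (wick_comm (L p) (y_mult s (yvar t)) b))))"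
    by (rule sum_rotate5)
  also have "\<dots> = (\<Sum>k\<in>UNIV. \<Sum>l\<in>UNIV. dx_wedge k (dx_wedge l (wscale (- \<i> / 2) (nu_mult (fib_vf (\<lambda>s t. of_real (Rc p s t k l)) b)))))"
    by (simp only: dx_wedge.sum[symmetric] wick_comm_quadratic)
  finally show ?thesis
    by (simp add: additive_simps wscale_simps nu_commute_dx)
qed

text \<open>\<open>cov\<close> does not differentiate the dx^l, so antisymmetrising second covariant
  derivatives gives their bare commutator, without a torsion term. Its factor 1/2 matches that of
  \<open>ad_R\<close>.\<close>

lemma nab_nab:
  assumes a: "smooth_section a"
  shows "nab (nab a) p = - wscale \<i> (nu_shift (wick_comm (L p) (R p) (a p)))"
proof -
  have "nab (nab a) p = (\<Sum>k\<in>UNIV. \<Sum>l\<in>UNIV. dx_wedge k (dx_wedge l (cov k (cov l a) p)))"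
  proof -
    have "cov k (nab a) p = (\<Sum>l\<in>UNIV. dx_wedge l (cov k (cov l a) p))" for k
    proof -
      have "cov k (nab a) p = cov k (\<lambda>q. \<Sum>l\<in>UNIV. dx_wedge l (cov l a q)) p"
        by (rule cov_cong[OF p]) (simp add: nab_def)
      also have "\<dots> = (\<Sum>l\<in>UNIV. dx_wedge l (cov k (cov l a) p))"
        by (subst cov_sum[OF p]) (simp_all add: smooth_section_dx_wedge smooth_section_cov a cov_dx_wedge[OF p])
      finally show ?thesis .
    qed
    then show ?thesis unfolding nab_def[of "nab a"] by (simp add: additive_simps)
  qed
  also have "\<dots> = (\<Sum>k\<in>UNIV. \<Sum>l\<in>UNIV. dx_wedge k (dx_wedge l (wscale (1/2) (cov k (cov l a) p - cov l (cov k a) p))))"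
    by (rule sum_dx_dx_antisym)
  also have "\<dots> = - wscale \<i> (nu_shift (wick_comm (L p) (R p) (a p)))"
    unfolding cov_commutator[OF p a] ad_R by (simp add: additive_simps sum_negf)
  finally show ?thesis .
qed

text \<open>The commutator with \<open>y\<^sup>u\<close> is \<open>\<nu>\<close> times a nondegenerate combination of the \<open>\<partial>/\<partial>y\<^sup>m\<close>. Hence both Bianchi
  identities follow from identities between operators, applied to the \<open>y\<^sup>u\<close>.\<close>

lemma odd_comm_central:
  assumes "\<And>u. nu_shift (odd_comm (L p) Y (yvar u)) = 0"
  shows "dy m Y = 0"
proof -
  have par: "parity (yvar u) = yvar u" for u :: 'n
    by (subst parity_is_form[of 0]) (auto intro: is_form_y_mult is_form_wone)
  have "odd_comm (L p) Y (yvar u) = - wick_comm (L p) (yvar u) Y" for u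
    by (simp add: odd_comm_def wick_comm_def par)
  then have "wick_comm (L p) (yvar u) Y = 0" for u
    using assms[of u] by (simp add: additive_simps wick_comm_yvar)
  then have "wscale (- \<i>) (nu_mult (dy m Y)) = 0"
    by (simp add: wick_comm_W[OF p, symmetric] additive_simps)
  then have "nu_shift (wscale (- \<i>) (nu_mult (dy m Y))) = 0" by (simp add: additive_simps)
  then show ?thesis
    using wscale_cancel[of "- \<i>" "dy m Y" 0] by (simp add: wscale_simps additive_simps)
qed

end

context
  fixes p assumes p: "p \<in> dom_of c"
begin

text \<open>Evaluating \<nabla>^3 on y^u as \<nabla> after \<nabla>^2 and as \<nabla>^2 after
  \<nabla> shows that the commutator of \<nabla>R with every y^u vanishes.\<close>

lemma bianchi_2: "nab R p = 0"
proof (rule dy_all_zero)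
  have "no_constant (R q)" for q
    unfolding R_def by (intro no_constant_sum no_constant_intros)
  then show "no_constant (nab R p)" by (intro no_constant_nab p)
  show "dy m (nab R p) = 0" for m
  proof (rule odd_comm_central[OF p])
    fix u
    let ?a = "\<lambda>q::'m. yvar u :: 'n wform"
    have a: "smooth_section ?a" by (rule smooth_section_const)
    have "nab (nab (nab ?a)) p = nab (\<lambda>q. wscale (- \<i>) (nu_shift (wick_comm (L q) (R q) (?a q)))) p"
      by (rule nab_cong[OF p]) (simp add: nab_nab a wscale_uminus_left)
    also have "\<dots> = wscale (- \<i>) (nu_shift (odd_comm (L p) (nab R p) (yvar u) + wick_comm (L p) (R p) (nab ?a p)))"
      by (simp add: nab_cscale p nab_nu_shift nab_wick_comm smooth_D a parity_R)
    finally have "wscale (- \<i>) (nu_shift (odd_comm (L p) (nab R p) (yvar u))) = 0"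
      using nab_nab[OF p smooth_section_nab[OF a]]
      by (simp add: additive_simps wscale_uminus_left)
    then show "nu_shift (odd_comm (L p) (nab R p) (yvar u)) = 0"
      using wscale_cancel[of "- \<i>" "nu_shift (odd_comm (L p) (nab R p) (yvar u))" 0] by (simp add: additive_simps)
  qed
qed

text \<open>\<open>delta_nab\<close> is used at \<nabla>y^u and, differentiated by \<nabla>, at y^u.
  Eliminating \<nabla>\<delta>\<nabla>y^u between the two leaves equal commutators of \<nabla>T and
  \<delta>R with y^u.\<close>

lemma bianchi_1: "fib_delta (R p) = nab T p"
proof -
  have "fib_delta (R p) - nab T p = 0"
  proof (rule dy_all_zero)
    have "no_constant (T q)" for q
      unfolding T_def by (intro no_constant_sum no_constant_intros)
    \<comment> \<open>R is quadratic in y, so \<delta> leaves one factor y.\<close>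
    moreover have "no_constant (fib_delta (R p))"
      unfolding R_def fib_delta_def additive_simps wscale_simps dx_dy_commute dy_y_mult
      by (intro no_constant_sum no_constant_intros) (auto simp: additive_simps intro!: no_constant_intros)
    ultimately show "no_constant (fib_delta (R p) - nab T p)" by (intro no_constant_intros no_constant_nab p)
    show "dy m (fib_delta (R p) - nab T p) = 0" for m
    proof (rule odd_comm_central[OF p])
      fix u
      let ?a = "\<lambda>q::'m. yvar u :: 'n wform"
      let ?d = "\<lambda>q::'m. fib_delta (yvar u) :: 'n wform"
      let ?X = "wscale \<i> (nu_shift (wick_comm (L p) (T p) (nab ?a p)))"
      let ?Y = "wscale \<i> (nu_shift (wick_comm (L p) (R p) (fib_delta (yvar u))))"
      have a: "smooth_section ?a" "smooth_section ?d" by (rule smooth_section_const)+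
      have "nab (\<lambda>q. fib_delta (nab ?a q)) p = nab (\<lambda>q. wscale \<i> (nu_shift (wick_comm (L q) (T q) (?a q))) - nab ?d q) p"
        by (rule nab_cong[OF p]) (use delta_nab[OF _ a(1)] in \<open>simp add: eq_diff_eq\<close>)
      also have "\<dots> = wscale \<i> (nu_shift (odd_comm (L p) (nab T p) (yvar u))) + ?X + ?Y"
        by (simp add: nab_diff p nab_cscale nab_nu_shift nab_wick_comm smooth_D a parity_T nab_nab additive_simps)
      finally have 1: "nab (\<lambda>q. fib_delta (nab ?a q)) p = wscale \<i> (nu_shift (odd_comm (L p) (nab T p) (yvar u))) + ?X + ?Y" .
      have "fib_delta (nab (nab ?a) p) = - wscale \<i> (nu_shift (odd_comm (L p) (fib_delta (R p)) (yvar u))) - ?Y"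
        unfolding nab_nab[OF p a(1)]
        by (simp add: fib_delta.minus fib_delta_wscale fib_delta_nu_shift fib_delta_wick_comm parity_R additive_simps)
      with delta_nab[OF p smooth_section_nab[OF a(1)]] 1
      have "wscale \<i> (nu_shift (odd_comm (L p) (nab T p) (yvar u))) = wscale \<i> (nu_shift (odd_comm (L p) (fib_delta (R p)) (yvar u)))"
        by (simp add: algebra_simps)
      then show "nu_shift (odd_comm (L p) (fib_delta (R p) - nab T p) (yvar u)) = 0"
        using wscale_cancel[of \<i> "nu_shift (odd_comm (L p) (nab T p) (yvar u))" "nu_shift (odd_comm (L p) (fib_delta (R p)) (yvar u))"]
        by (simp add: odd_comm_def wick_simps additive_simps algebra_simps)
    qed
  qed
  then show ?thesis by simp
qed

text \<open>Parallelism expresses the derivatives of \<omega> by \<Gamma>, so d\<omega> = 0 becomes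
  a relation between the lowered symbols \<open>t\<close>. Wedged with three dx by \<open>P\<close>
  it says that 6 P t = 0, and \<delta>T is P t.\<close>

lemma delta_T: "fib_delta (T p) = 0"
proof -
  define t where "t s k l = (\<Sum>\<alpha>\<in>UNIV. W p $ s $ \<alpha> * \<Gamma> p \<alpha> k l)" for s k l
  define P where "P f = (\<Sum>j\<in>UNIV. \<Sum>k\<in>UNIV. \<Sum>l\<in>UNIV. wscale (of_real (f j k l)) (dx_wedge j (dx_wedge k (dx_wedge l (wone :: 'n wform)))))"
    for f :: "'n \<Rightarrow> 'n \<Rightarrow> 'n \<Rightarrow> real"
  have P12: "P (\<lambda>j k l. f k j l) = - P f" for f
  proof -
    have "P (\<lambda>j k l. f k j l) = (\<Sum>k\<in>UNIV. \<Sum>j\<in>UNIV. \<Sum>l\<in>UNIV. wscale (of_real (f k j l)) (dx_wedge j (dx_wedge k (dx_wedge l wone))))"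
      unfolding P_def by (rule sum.swap)
    also have "\<dots> = (\<Sum>k\<in>UNIV. \<Sum>j\<in>UNIV. \<Sum>l\<in>UNIV. wscale (of_real (f k j l)) (- dx_wedge k (dx_wedge j (dx_wedge l wone))))"
      by (subst dx_wedge_anticommute) (rule refl)
    finally show ?thesis by (simp add: P_def additive_simps sum_negf)
  qed
  have P23: "P (\<lambda>j k l. f j l k) = - P f" for f
  proof -
    have "P (\<lambda>j k l. f j l k) = (\<Sum>j\<in>UNIV. \<Sum>l\<in>UNIV. \<Sum>k\<in>UNIV. wscale (of_real (f j l k)) (dx_wedge j (dx_wedge k (dx_wedge l wone))))"
      unfolding P_def by (rule sum.cong[OF refl], rule sum.swap)
    also have "\<dots> = (\<Sum>j\<in>UNIV. \<Sum>l\<in>UNIV. \<Sum>k\<in>UNIV. wscale (of_real (f j l k)) (dx_wedge j (- dx_wedge l (dx_wedge k wone))))"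
      by (intro sum.cong refl arg_cong[where f = "wscale _"] arg_cong[where f = "dx_wedge _"] dx_wedge_anticommute)
    finally show ?thesis by (simp add: P_def additive_simps sum_negf)
  qed
  have P_add: "P (\<lambda>j k l. f j k l + g j k l) = P f + P g" and P_diff: "P (\<lambda>j k l. f j k l - g j k l) = P f - P g" for f g
    by (simp_all add: P_def wscale_add_left wscale_diff_left sum.distrib sum_subtractf)
  have "pd c j (\<lambda>q. W q $ k $ l) p = t k j l - t l j k" for j k l
  proof -
    have "W p $ m $ l = - W p $ l $ m" for m by (rule anti_W[OF p])
    then show ?thesis using parallel_W[OF p, of j k l]
      by (simp add: t_def sum_negf mult.commute)
  qed
  then have "t k j l - t l j k + (t l k j - t j k l) + (t j l k - t k l j) = 0" for j k l
    using closed_W[OF p, of j k l] by simp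
  then have "P (\<lambda>j k l. t k j l - t l j k + (t l k j - t j k l) + (t j l k - t k l j)) = 0"
    by (simp add: P_def)
  \<comment> \<open>\<open>P\<close> picks up the sign of the permutation; with the signs in the
    closedness relation all six terms become the same.\<close>
  moreover have "P (\<lambda>j k l. t l j k) = P t" "P (\<lambda>j k l. t l k j) = - P t" "P (\<lambda>j k l. t k l j) = P t"
    using P23[of "\<lambda>j k l. t k j l"] P12[of t] P12[of "\<lambda>j k l. t l j k"] P12[of "\<lambda>j k l. t j l k"] P23[of t] by simp_all
  ultimately have "P t + P t + P t + P t + P t + P t = 0"
    unfolding P_add P_diff by (simp add: P12[of t] P23[of t] algebra_simps)
  then have "wscale 6 (P t) = 0"
    using wscale_add_left[of 1 1 "P t"] wscale_add_left[of 2 1 "P t"] wscale_add_left[of 3 1 "P t"]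
      wscale_add_left[of 4 1 "P t"] wscale_add_left[of 5 1 "P t"] by simp
  then have "P t = 0" using wscale_cancel[of 6 "P t" 0] by (simp add: additive_simps)
  moreover have "fib_delta (T p) = P (\<lambda>s k l. t s k l * (1/2) - t s l k * (1/2))"
  proof -
    have "fib_delta (T p) = (\<Sum>s\<in>UNIV. \<Sum>\<alpha>\<in>UNIV. \<Sum>k\<in>UNIV. \<Sum>l\<in>UNIV.
       wscale (of_real (1/2 * W p $ s $ \<alpha> * (\<Gamma> p \<alpha> k l - \<Gamma> p \<alpha> l k)))
         (fib_delta (y_mult s (dx_wedge k (dx_wedge l wone)))))"
      unfolding T_def fib_delta.sum fib_delta_wscale ..
    also have "\<dots> = (\<Sum>s\<in>UNIV. \<Sum>\<alpha>\<in>UNIV. \<Sum>k\<in>UNIV. \<Sum>l\<in>UNIV.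
       wscale (of_real (1/2 * W p $ s $ \<alpha> * (\<Gamma> p \<alpha> k l - \<Gamma> p \<alpha> l k)))
         (dx_wedge s (dx_wedge k (dx_wedge l wone))))"
      by (simp add: fib_delta_def dy_y_mult dx_dy_commute additive_simps if_distrib cong: if_cong)
    also have "\<dots> = (\<Sum>s\<in>UNIV. \<Sum>k\<in>UNIV. \<Sum>l\<in>UNIV. \<Sum>\<alpha>\<in>UNIV.
       wscale (of_real (1/2 * W p $ s $ \<alpha> * (\<Gamma> p \<alpha> k l - \<Gamma> p \<alpha> l k)))
         (dx_wedge s (dx_wedge k (dx_wedge l wone))))"
      by (rule sum.cong[OF refl], rule sum_rotate[symmetric])
    finally show ?thesis
      unfolding P_def t_def
      by (simp add: wscale_sum_left[symmetric] sum_distrib_left sum_distrib_right sum_subtractf[symmetric] algebra_simps)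
  qed
  moreover have "P (\<lambda>s k l. t s k l * (1/2)) = wscale (1/2) (P t)"
    by (simp add: P_def additive_simps)
  ultimately show ?thesis
    unfolding P_diff using P23[of "\<lambda>s k l. t s k l * (1/2)"] by (simp add: additive_simps)
qed

end

text \<open>\<open>Z r\<close> is the curvature of the Fedosov connection: \<open>D\<^sup>2 = (i/\<nu>) ad (Z r)\<close>.\<close>

context
  fixes r :: "'m \<Rightarrow> 'n wform"
  assumes r: "smooth_section r" and form_r: "\<And>q. is_form 1 (r q)"
begin

lemma parity_r: "parity (r q) = - r q"
  using parity_is_form[OF form_r] by simp

lemma wick_r_r_0: "wick (L q) (r q) (r q) 0 = 0"
  by (rule wick_self_0[OF form_r])

lemma is_form_Z: "p \<in> dom_of c \<Longrightarrow> is_form 2 (Z r p)"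
proof -
  assume p: "p \<in> dom_of c"
  have "is_form (Suc 1) (fib_delta (r p))"
    unfolding fib_delta_def by (intro is_form_sum is_form_dx_wedge is_form_dy form_r)
  moreover have "is_form (Suc 1) (nab r p)" by (rule is_form_nab[OF p form_r])
  moreover have "is_form (1 + 1) (wick (L p) (r p) (r p))" by (intro is_form_wick form_r)
  ultimately show ?thesis
    unfolding Z_def by (intro is_form_add is_form_diff is_form_wscale is_form_nu_shift is_form_T is_form_R) (simp_all add: numeral_2_eq_2)
qed

lemma odd_comm_nu_shift: "a 0 = 0 \<Longrightarrow> odd_comm (L q) (r q) (nu_shift a) = nu_shift (odd_comm (L q) (r q) a)"
proof -
  assume a: "a 0 = 0"
  then have "parity a 0 = 0" by (simp add: parity_def fun_eq_iff pointwise)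
  with a show ?thesis by (simp add: odd_comm_def nu_shift_wick additive_simps nu_commute(3)[symmetric])
qed

text \<open>\<delta> squares to zero; the squares of \<nabla> and of the commutator with r
  contribute R and r \<circ> r, and the mixed terms contribute T, \<delta>r and \<nabla>r. With
  their signs these are the five summands of Z.\<close>

lemma D_squared:
  assumes p: "p \<in> dom_of c" and a: "smooth_section a"
  shows "D r (D r a) p = wscale \<i> (nu_shift (wick_comm (L p) (Z r p) (a p)))"
proof -
  let ?oc = "\<lambda>b. odd_comm (L p) (r p) b" and ?c = "\<lambda>X. wscale \<i> (nu_shift (wick_comm (L p) X (a p)))"
  let ?q = "\<lambda>b. wscale \<i> (nu_shift (?oc b))"
  have oc0: "odd_comm (L p) (r p) (a p) 0 = 0"
    using wick_graded_commute_0(1)[OF form_r, of "L p" p "a p"] by (simp add: odd_comm_def)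
  have oc_add: "?oc (b + d) = ?oc b + ?oc d" "?oc (- b) = - ?oc b" "?oc (b - d) = ?oc b - ?oc d" "?oc (wscale z b) = wscale z (?oc b)" for b d z
    by (simp_all add: odd_comm_def wick_simps additive_simps wscale_simps)
  have d: "fib_delta (D r a p) = fib_delta (nab a p) - (?c (fib_delta (r p)) - ?q (fib_delta (a p)))"
    by (simp add: D_def fib_delta.add fib_delta.diff fib_delta.minus fib_delta_fib_delta fib_delta_wscale
        fib_delta_nu_shift fib_delta_odd_comm parity_r additive_simps)
  have n: "nab (D r a) p = - nab (\<lambda>q. fib_delta (a q)) p + nab (nab a) p - (?c (nab r p) - ?q (nab a p))"
  proof -
    have "nab (D r a) p = nab (\<lambda>q. - fib_delta (a q) + nab a q - wscale \<i> (nu_shift (odd_comm (L q) (r q) (a q)))) p"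
      by (rule nab_cong[OF p]) (simp add: D_def)
    then show ?thesis
      by (simp add: nab_add nab_diff nab_minus nab_cscale nab_nu_shift nab_odd_comm p smooth_D a r parity_r additive_simps)
  qed
  have "wick_comm (L p) (nu_shift (wick (L p) (r p) (r p))) (a p) = nu_shift (wick_comm (L p) (wick (L p) (r p) (r p)) (a p))"
    by (simp add: wick_comm_def nu_shift_wick[where a = "wick (L p) (r p) (r p)", OF wick_r_r_0] additive_simps)
  then have q: "?q (D r a p) = - ?q (fib_delta (a p)) + ?q (nab a p)
      - ?c (wscale \<i> (nu_shift (wick (L p) (r p) (r p))))"
    by (simp add: D_def oc_add odd_comm_nu_shift[where a = "odd_comm (L p) (r p) (a p)", OF oc0] odd_comm_odd_comm parity_r additive_simps
        wick_comm_simps wscale_simps wscale_uminus_left)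
  have c: "?c (Z r p) = ?c (fib_delta (r p)) - ?c (T p) - ?c (R p) - ?c (nab r p) + ?c (wscale \<i> (nu_shift (wick (L p) (r p) (r p))))"
    by (simp add: Z_def wick_comm_def wick_simps additive_simps algebra_simps)
  have "D r (D r a) p = - (fib_delta (nab a p) - (?c (fib_delta (r p)) - ?q (fib_delta (a p))))
      + (- nab (\<lambda>q. fib_delta (a q)) p + nab (nab a) p - (?c (nab r p) - ?q (nab a p)))
      - (- ?q (fib_delta (a p)) + ?q (nab a p) - ?c (wscale \<i> (nu_shift (wick (L p) (r p) (r p)))))"
    unfolding D_def[of r "D r a"] d n q ..
  also have "\<dots> = - (fib_delta (nab a p) + nab (\<lambda>q. fib_delta (a q)) p) + nab (nab a) p
     + ?c (fib_delta (r p)) - ?c (nab r p) + ?c (wscale \<i> (nu_shift (wick (L p) (r p) (r p))))"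
    by (simp add: algebra_simps)
  also have "\<dots> = ?c (Z r p)"
    unfolding c delta_nab[OF p a] nab_nab[OF p a] by (simp add: algebra_simps)
  finally show ?thesis .
qed

text \<open>The Bianchi identity of D, namely DZ = 0. After the identities for T and R the remaining
  terms cancel, and the cubic term is zero since r commutes with r \<circ> r by
  associativity.\<close>

lemma delta_Z:
  assumes p: "p \<in> dom_of c"
  shows "fib_delta (Z r p) = nab (Z r) p - wscale \<i> (nu_shift (odd_comm (L p) (r p) (Z r p)))"
proof -
  let ?c = "\<lambda>X. wscale \<i> (nu_shift (wick_comm (L p) X (r p)))"
  let ?rr = "wick (L p) (r p) (r p)"
  have pd: "parity (fib_delta (r p)) = fib_delta (r p)"
    using fib_delta_parity[of "r p"] by (simp add: parity_r fib_delta.minus)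
  have pn: "parity (nab r p) = nab r p"
  proof -
    have "nab (\<lambda>q. parity (r q)) p = - nab r p" by (simp add: parity_r nab_minus p r)
    then show ?thesis using nab_parity[OF p r] by simp
  qed
  have "fib_delta ?rr = wick_comm (L p) (fib_delta (r p)) (r p)"
    by (simp add: fib_delta_wick parity_r wick_simps wick_comm_def)
  then have d: "fib_delta (Z r p) = - nab T p - fib_delta (nab r p) + ?c (fib_delta (r p))"
    by (simp add: Z_def fib_delta.add fib_delta.diff fib_delta_fib_delta delta_T bianchi_1 p fib_delta_wscale fib_delta_nu_shift)
  have "nab (\<lambda>q. wick (L q) (r q) (r q)) p = wick_comm (L p) (nab r p) (r p)"
    by (simp add: nab_wick p r parity_r wick_simps wick_comm_def)
  moreover have "nab (Z r) p = nab (\<lambda>q. fib_delta (r q) - T q - R q - nab r q + wscale \<i> (nu_shift (wick (L q) (r q) (r q)))) p"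
    by (rule nab_cong[OF p]) (simp add: Z_def)
  ultimately have n: "nab (Z r) p = nab (\<lambda>q. fib_delta (r q)) p - nab T p + ?c (R p) + ?c (nab r p)"
    by (simp add: nab_add nab_diff p r smooth_D nab_cscale nab_nu_shift nab_nab bianchi_2)
  have oc: "odd_comm (L p) (r p) X = - wick_comm (L p) X (r p)" if "parity X = X" for X
    using that by (simp add: odd_comm_def wick_comm_def)
  have prr: "parity ?rr = ?rr" by (simp add: parity_wick parity_r wick_simps)
  have "odd_comm (L p) (r p) (nu_shift ?rr) = 0"
    by (simp add: odd_comm_nu_shift[where a = "wick (L p) (r p) (r p)", OF wick_r_r_0] oc[OF prr] additive_simps)
       (simp add: wick_comm_def wick_assoc additive_simps)
  moreover have "odd_comm (L p) (r p) (Z r p) = odd_comm (L p) (r p) (fib_delta (r p)) - odd_comm (L p) (r p) (T p)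
     - odd_comm (L p) (r p) (R p) - odd_comm (L p) (r p) (nab r p) + wscale \<i> (odd_comm (L p) (r p) (nu_shift ?rr))"
    by (simp add: Z_def odd_comm_def wick_simps additive_simps wscale_simps algebra_simps)
  ultimately have q: "wscale \<i> (nu_shift (odd_comm (L p) (r p) (Z r p))) = - ?c (fib_delta (r p)) + ?c (T p) + ?c (R p) + ?c (nab r p)"
    by (simp add: oc pd pn parity_T parity_R additive_simps)
  show ?thesis
    unfolding d n q using delta_nab[OF p r] by (simp add: algebra_simps)
qed

lemma Z_eq_0:
  assumes low_r: "\<And>q. low 2 (r q)"
    and eq: "\<And>q. q \<in> dom_of c \<Longrightarrow>
      r q = fib_delta_inv (T q + R q + nab r q - wscale \<i> (nu_shift (wick (L q) (r q) (r q))))"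
    and p: "p \<in> dom_of c"
  shows "Z r p = 0"
proof -
  have Z: "Z r q = fib_delta_inv (nab (Z r) q - wscale \<i> (nu_shift (odd_comm (L q) (r q) (Z r q))))" if q: "q \<in> dom_of c" for q
  proof -
    have "fib_delta_inv (r q) = 0" by (subst eq[OF q]) (rule fib_delta_inv_twice)
    then have "fib_delta_inv (fib_delta (r q)) = r q"
      using hodge[of 0 "r q"] form_r[of q] by (simp add: form_part_is_form fib_delta.zero)
    then have "fib_delta_inv (Z r q) = r q - fib_delta_inv (T q + R q + nab r q - wscale \<i> (nu_shift (wick (L q) (r q) (r q))))"
      by (simp add: Z_def fib_delta_inv.add fib_delta_inv.diff algebra_simps)
    then have "fib_delta_inv (Z r q) = 0" using eq[OF q] by simp
    then show ?thesis
      using hodge[of 1 "Z r q"] is_form_Z[OF q] by (simp add: form_part_is_form numeral_2_eq_2 fib_delta.zero delta_Z[OF q])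
  qed
  have "\<forall>q\<in>dom_of c. low n (Z r q)" for n
  proof (induct n)
    case 0
    then show ?case by (simp add: low_def)
  next
    case (Suc n)
    show ?case
    proof
      fix q assume q: "q \<in> dom_of c"
      have "low n (parity (Z r q))" using Suc q by (auto simp: low_iff parity_def)
      \<comment> \<open>The product with r gains two degrees, which the division by \<nu> takes
        back; the net gain of one comes from \<delta>^-1.\<close>
      then have "low (2 + n) (odd_comm (L q) (r q) (Z r q))"
        unfolding odd_comm_def using low_wick[OF low_r, of n _ "L q" q] low_wick[OF _ low_r, of n _ "L q" q] Suc q
        by (intro low_diff) (auto simp: add.commute)
      then show "low (Suc n) (Z r q)"
        by (subst Z[OF q]) (intro low_fib_delta_inv low_diff low_wscale low_nu_shift low_nab[OF q], use Suc in auto)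
    qed
  qed
  then show ?thesis using p by (intro low_all) auto
qed

end

end

section \<open>Change of coordinates\<close>

lemma Ck_on_subset: "Ck_on k S f \<Longrightarrow> S' \<subseteq> S \<Longrightarrow> Ck_on k S' f"
  by (induct k arbitrary: f) (auto intro: continuous_on_subset differentiable_on_subset)

lemma Ck_on_sum:
  "open S \<Longrightarrow> (\<And>x. x \<in> X \<Longrightarrow> Ck_on k S (f x)) \<Longrightarrow> Ck_on k S (\<lambda>y. \<Sum>x\<in>X. f x y)"
  by (induct X rule: infinite_finite_induct) (auto intro: Ck_on_add Ck_on_const)

lemma partial_deriv_compose:
  fixes f :: "real^'n::finite \<Rightarrow> 'b::real_normed_vector" and \<phi> :: "real^'m::finite \<Rightarrow> real^'n"
  assumes "\<phi> differentiable (at x)" "f differentiable (at (\<phi> x))"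
  shows "partial_deriv j (\<lambda>x. f (\<phi> x)) x = (\<Sum>a\<in>UNIV. partial_deriv j (\<lambda>x. \<phi> x $ a) x *\<^sub>R partial_deriv a f (\<phi> x))"
    and "(\<lambda>x. f (\<phi> x)) differentiable (at x)"
proof -
  let ?F = "frechet_derivative f (at (\<phi> x))"
  have d: "(\<phi> has_derivative frechet_derivative \<phi> (at x)) (at x)" "(f has_derivative ?F) (at (\<phi> x))"
    using assms by (simp_all add: frechet_derivative_works)
  note * = has_derivative_compose[OF d]
  show "(\<lambda>x. f (\<phi> x)) differentiable (at x)" using * by (rule differentiableI)
  have "partial_deriv j (\<lambda>x. f (\<phi> x)) x = ?F (partial_deriv j \<phi> x)"
    using partial_deriv_eq[OF *] by (simp add: partial_deriv_def[of j \<phi>])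
  also have "partial_deriv j \<phi> x = (\<Sum>a\<in>UNIV. partial_deriv j \<phi> x $ a *\<^sub>R axis a 1)"
    by (simp add: vec_eq_iff axis_def if_distrib cong: if_cong)
  also have "?F \<dots> = (\<Sum>a\<in>UNIV. partial_deriv j \<phi> x $ a *\<^sub>R ?F (axis a 1))"
    using has_derivative_linear[OF d(2)] by (simp add: linear_sum linear_scale)
  finally show "partial_deriv j (\<lambda>x. f (\<phi> x)) x = (\<Sum>a\<in>UNIV. partial_deriv j (\<lambda>x. \<phi> x $ a) x *\<^sub>R partial_deriv a f (\<phi> x))"
    by (simp add: partial_deriv_def[of _ f] partial_deriv_linear(1)[OF bounded_linear_vec_nth assms(1)])
qed

text \<open>By the chain rule the partial derivatives of the composite are sums of composites with
  \<phi>, multiplied by derivatives of \<phi>; hence the induction is over all f with \<phi>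
  fixed.\<close>

lemma Ck_on_compose:
  fixes f :: "real^'n::finite \<Rightarrow> 'b::real_normed_vector" and \<phi> :: "real^'m::finite \<Rightarrow> real^'n"
  assumes S: "open S" "open S'" "\<phi> ` S \<subseteq> S'" and \<phi>: "\<And>k. Ck_on k S \<phi>"
  shows "Ck_on k S' f \<Longrightarrow> Ck_on k S (\<lambda>x. f (\<phi> x))"
proof (induct k arbitrary: f)
  case 0
  have "continuous_on S \<phi>" using \<phi>[of 0] by simp
  then show ?case using 0 S(3) by (auto intro: continuous_on_compose2)
next
  case (Suc k)
  have d: "\<phi> differentiable (at x)" "f differentiable (at (\<phi> x))" if "x \<in> S" for x
    using Ck_on_differentiable[OF S(1) that \<phi>] Ck_on_differentiable[OF S(2) _ Suc.prems] that S(3) by auto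
  have "Ck_on k S (\<lambda>x. \<Sum>a\<in>UNIV. partial_deriv j (\<lambda>x. \<phi> x $ a) x *\<^sub>R partial_deriv a f (\<phi> x))" for j
  proof (intro Ck_on_sum S Ck_on_bilinear[OF bounded_bilinear_scaleR S(1)])
    fix a
    have "Ck_on (Suc k) S (\<lambda>x. \<phi> x $ a)" by (rule Ck_on_linear[OF bounded_linear_vec_nth S(1) \<phi>])
    then show "Ck_on k S (partial_deriv j (\<lambda>x. \<phi> x $ a))" by simp
    show "Ck_on k S (\<lambda>x. partial_deriv a f (\<phi> x))" by (rule Suc.hyps) (use Suc.prems in simp)
  qed
  then have "Ck_on k S (partial_deriv j (\<lambda>x. f (\<phi> x)))" for j
    by (subst Ck_on_cong[OF S(1) partial_deriv_compose(1)[OF d]])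
  then show ?case using partial_deriv_compose(2)[OF d]
    by (auto simp: differentiable_on_def differentiable_at_withinI)
qed

locale chart_pair = C1: chart c + C2: chart c'
  for c c' :: "('m, 'n::{finite, linorder}) chart" +
  assumes open_overlap: "open (coords c ` (dom_of c \<inter> dom_of c'))"
    and smooth_transition: "smooth_on (coords c ` (dom_of c \<inter> dom_of c')) (\<lambda>x. coords c' (chart_inv c x))"
begin

text \<open>The overlap with the coordinates of \<open>c\<close>, as a chart of its own: the
  Jacobian entries have a meaning only there, and the calculus of the locale \<open>chart\<close>
  applies to them.\<close>

abbreviation cU :: "('m, 'n) chart" where "cU \<equiv> (dom_of c \<inter> dom_of c', coords c)"

sublocale CU: chart cU
  by unfold_locales (use open_overlap C1.inj in \<open>auto simp: chart_image_def inj_on_def\<close>)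

lemma chart_inv_cU: "x \<in> chart_image cU \<Longrightarrow> chart_inv cU x = chart_inv c x"
  using CU.chart_inv_dom CU.coords_chart_inv C1.chart_inv_coords by (metis IntD1 fst_conv snd_conv)

context
  fixes p assumes p: "p \<in> dom_of c \<inter> dom_of c'"
begin

lemma pd_cU: "pd cU j f p = pd c j f p"
proof -
  have "coords c p \<in> chart_image cU" using p by (auto simp: chart_image_def)
  then have "partial_deriv j (\<lambda>x. f (chart_inv cU x)) (coords c p) = partial_deriv j (\<lambda>x. f (chart_inv c x)) (coords c p)"
    by (intro partial_deriv_cong[OF CU.open_image]) (simp_all add: chart_inv_cU)
  then show ?thesis by (simp add: pd_def)
qed

lemma smooth_transition_differentiable: "(\<lambda>x. coords c' (chart_inv c x)) differentiable (at (coords c p))"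
  using p smooth_transition open_overlap
  by (intro Ck_on_differentiable[OF open_overlap]) (auto simp: smooth_on_def)

lemma pd_chain:
  fixes f :: "'m \<Rightarrow> 'b::real_normed_vector"
  assumes "smooth_in_chart c' f"
  shows "pd c j f p = (\<Sum>a\<in>UNIV. jac c c' p $ a $ j *\<^sub>R pd c' a f p)"
proof -
  let ?\<phi> = "\<lambda>x. coords c' (chart_inv c x)" and ?g = "\<lambda>y. f (chart_inv c' y)"
  have \<phi>p: "?\<phi> (coords c p) = coords c' p" using p by simp
  have "pd c j f p = partial_deriv j (\<lambda>x. ?g (?\<phi> x)) (coords c p)"
    unfolding pd_def using p by (intro partial_deriv_cong[OF open_overlap]) auto
  also have "\<dots> = (\<Sum>a\<in>UNIV. partial_deriv j (\<lambda>x. ?\<phi> x $ a) (coords c p) *\<^sub>R partial_deriv a ?g (?\<phi> (coords c p)))"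
    using C2.smooth_differentiable[OF assms, of p] p
    by (intro partial_deriv_compose(1) smooth_transition_differentiable) simp
  finally show ?thesis unfolding \<phi>p by (simp add: jac_def pd_def)
qed

end

lemma smooth_cU: "smooth_in_chart c f \<Longrightarrow> smooth_in_chart cU f"
proof -
  assume f: "smooth_in_chart c f"
  have "chart_image cU \<subseteq> chart_image c" by (auto simp: chart_image_def)
  with f have "smooth_on (chart_image cU) (\<lambda>x. f (chart_inv c x))"
    unfolding smooth_in_chart_def smooth_on_def using Ck_on_subset by metis
  then show ?thesis
    unfolding smooth_in_chart_def
    by (subst smooth_on_cong[OF CU.open_image, of _ "\<lambda>x. f (chart_inv c x)"]) (simp_all add: chart_inv_cU)
qed

lemma smooth_cU_other: "smooth_in_chart c' f \<Longrightarrow> smooth_in_chart cU f"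
proof -
  assume f: "smooth_in_chart c' f"
  let ?\<phi> = "\<lambda>x. coords c' (chart_inv c x)"
  have "smooth_on (chart_image cU) (\<lambda>x. f (chart_inv c' (?\<phi> x)))"
    unfolding smooth_on_def
  proof
    fix k
    show "Ck_on k (chart_image cU) (\<lambda>x. f (chart_inv c' (?\<phi> x)))"
      by (rule Ck_on_compose[OF CU.open_image C2.open_image])
         (use f smooth_transition in \<open>auto simp: smooth_in_chart_def smooth_on_def chart_image_def\<close>)
  qed
  moreover have "f (chart_inv cU x) = f (chart_inv c' (?\<phi> x))" if "x \<in> chart_image cU" for x
  proof -
    have "chart_inv c x \<in> dom_of c'" using CU.chart_inv_dom[OF that] chart_inv_cU[OF that] by simp
    then show ?thesis by (simp add: chart_inv_cU[OF that])
  qed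
  ultimately show ?thesis
    unfolding smooth_in_chart_def by (subst smooth_on_cong[OF CU.open_image])
qed

abbreviation S :: "'m \<Rightarrow> 'n \<Rightarrow> 'n \<Rightarrow> real" where "S q a j \<equiv> jac c c' q $ a $ j"

lemma S_pd: "S q a j = pd c j (\<lambda>q. coords c' q $ a) q"
  by (simp add: jac_def)

lemma smooth_transition_component: "smooth_in_chart cU (\<lambda>q. coords c' q $ a)"
proof -
  have "smooth_on (chart_image cU) (\<lambda>x. coords c' (chart_inv c x) $ a)"
    using smooth_transition CU.open_image
    by (simp add: smooth_on_def chart_image_def Ck_on_linear[OF bounded_linear_vec_nth])
  then show ?thesis
    unfolding smooth_in_chart_def
    by (subst smooth_on_cong[OF CU.open_image, of _ "\<lambda>x. coords c' (chart_inv c x) $ a"]) (simp_all add: chart_inv_cU)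
qed

lemma S_pd_cU: "q \<in> dom_of c \<inter> dom_of c' \<Longrightarrow> S q a j = pd cU j (\<lambda>q. coords c' q $ a) q"
  by (simp add: S_pd pd_cU)

lemma smooth_S: "smooth_in_chart cU (\<lambda>q. S q a j)"
  by (rule CU.smooth_in_chart_cong[THEN iffD2, OF _ CU.smooth_pd[OF smooth_transition_component]])
     (simp add: S_pd_cU)

text \<open>The Jacobian consists of first derivatives of the transition map, whose second
  derivatives commute.\<close>

lemma pd_S_sym:
  assumes "p \<in> dom_of c \<inter> dom_of c'"
  shows "pd cU i (\<lambda>q. S q a j) p = pd cU j (\<lambda>q. S q a i) p"
proof -
  have "pd cU i (\<lambda>q. S q a j) p = pd cU i (pd cU j (\<lambda>q. coords c' q $ a)) p" for i j
    by (rule CU.pd_cong) (use assms in \<open>auto simp: S_pd_cU\<close>)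
  then show ?thesis using assms by (simp add: CU.pd_commute smooth_transition_component)
qed

end

section \<open>Values on tangent vectors\<close>

definition ymonom :: "('n::finite \<Rightarrow> nat) \<Rightarrow> real^'n \<Rightarrow> real" where
  "ymonom \<alpha> v = (\<Prod>i\<in>UNIV. v $ i ^ \<alpha> i)"

definition val0 :: "'n::finite wform \<Rightarrow> nat \<Rightarrow> nat \<Rightarrow> real^'n \<Rightarrow> complex" where
  "val0 f r k v = (\<Sum>\<alpha> | ydeg \<alpha> = k. f r \<alpha> {} * of_real (ymonom \<alpha> v))"

text \<open>The derivative of \<open>val0\<close> along the m-th axis, indexed by the degree k
  before differentiation; \<open>dval0_dy\<close> accounts for the shift by one.\<close>

definition dval0 :: "'n::finite \<Rightarrow> 'n wform \<Rightarrow> nat \<Rightarrow> nat \<Rightarrow> real^'n \<Rightarrow> complex" where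
  "dval0 m f r k v = (\<Sum>\<alpha> | ydeg \<alpha> = k. f r \<alpha> {} * of_real (real (\<alpha> m) * ymonom (\<alpha>(m := \<alpha> m - 1)) v))"

lemma finite_ydeg: "finite {\<alpha> :: 'n::finite \<Rightarrow> nat. ydeg \<alpha> = k}"
proof (rule finite_subset)
  show "{\<alpha> :: 'n \<Rightarrow> nat. ydeg \<alpha> = k} \<subseteq> {\<alpha>. \<forall>i. \<alpha> i \<le> k}"
    by (auto simp: ydeg_def intro: member_le_sum)
  show "finite {\<alpha> :: 'n \<Rightarrow> nat. \<forall>i. \<alpha> i \<le> k}" by (rule finite_le_fun)
qed

lemma val0_add: "val0 (f + g) r k v = val0 f r k v + val0 g r k v"
  and val0_diff: "val0 (f - g) r k v = val0 f r k v - val0 g r k v"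
  and val0_wscale: "val0 (wscale z f) r k v = z * val0 f r k v"
  and val0_zero: "val0 0 r k v = 0"
  and val0_nu_shift: "val0 (nu_shift f) r k v = val0 f (Suc r) k v"
  by (simp_all add: val0_def pointwise wscale_def nu_shift_def sum.distrib sum_subtractf algebra_simps sum_distrib_left)

lemma val0_sum: "val0 (\<Sum>x\<in>X. f x) r k v = (\<Sum>x\<in>X. val0 (f x) r k v)"
  by (induct X rule: infinite_finite_induct) (simp_all add: val0_add val0_zero)

lemma sum_shift_exponent:
  assumes "\<And>\<beta>. ydeg \<beta> = k \<Longrightarrow> F (\<beta>(m := Suc (\<beta> m))) = G \<beta>"
  shows "(\<Sum>\<alpha>\<in>{\<alpha>. ydeg \<alpha> = Suc k \<and> \<alpha> m \<noteq> 0}. F \<alpha>) = (\<Sum>\<beta> | ydeg \<beta> = k. G \<beta>)"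
proof (rule sum.reindex_bij_witness[where i = "\<lambda>\<alpha>. \<alpha>(m := Suc (\<alpha> m))" and j = "\<lambda>\<alpha>. \<alpha>(m := \<alpha> m - 1)"])
  fix \<alpha> :: "'a \<Rightarrow> nat" assume \<alpha>: "\<alpha> \<in> {\<alpha>. ydeg \<alpha> = Suc k \<and> \<alpha> m \<noteq> 0}"
  then show 1: "(\<alpha>(m := \<alpha> m - 1))(m := Suc ((\<alpha>(m := \<alpha> m - 1)) m)) = \<alpha>" by simp
  show 2: "\<alpha>(m := \<alpha> m - 1) \<in> {\<alpha>. ydeg \<alpha> = k}"
    using \<alpha> ydeg_update_minus[of \<alpha> m] by simp
  show "G (\<alpha>(m := \<alpha> m - 1)) = F \<alpha>"
    using assms[of "\<alpha>(m := \<alpha> m - 1)"] 1 2 by simp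
qed (simp_all add: ydeg_update)

lemma dval0_dy: "dval0 m f r (Suc k) v = val0 (dy m f) r k v"
proof -
  have "dval0 m f r (Suc k) v = (\<Sum>\<alpha>\<in>{\<alpha>. ydeg \<alpha> = Suc k \<and> \<alpha> m \<noteq> 0}. f r \<alpha> {} * of_real (real (\<alpha> m) * ymonom (\<alpha>(m := \<alpha> m - 1)) v))"
    unfolding dval0_def by (rule sum.mono_neutral_right) (auto simp: finite_ydeg)
  also have "\<dots> = val0 (dy m f) r k v"
    unfolding val0_def dy_def
    by (rule sum_shift_exponent) (simp add: mult_ac)
  finally show ?thesis .
qed

lemma dval0_0: "dval0 m f r 0 v = 0"
  by (auto simp: dval0_def ydeg_def)

lemma val0_y_mult: "val0 (y_mult m f) r (Suc k) v = of_real (v $ m) * val0 f r k v"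
proof -
  have mon: "ymonom (\<alpha>(m := Suc (\<alpha> m))) v = v $ m * ymonom \<alpha> v" for \<alpha>
  proof -
    have "ymonom (\<alpha>(m := Suc (\<alpha> m))) v = (\<Prod>i\<in>UNIV. (if i = m then v $ m else 1) * v $ i ^ \<alpha> i)"
      unfolding ymonom_def by (intro prod.cong) auto
    then show ?thesis by (simp add: prod.distrib ymonom_def)
  qed
  have "val0 (y_mult m f) r (Suc k) v = (\<Sum>\<alpha>\<in>{\<alpha>. ydeg \<alpha> = Suc k \<and> \<alpha> m \<noteq> 0}. y_mult m f r \<alpha> {} * of_real (ymonom \<alpha> v))"
    unfolding val0_def by (rule sum.mono_neutral_right) (auto simp: finite_ydeg y_mult_def)
  also have "\<dots> = (\<Sum>\<beta> | ydeg \<beta> = k. f r \<beta> {} * of_real (v $ m * ymonom \<beta> v))"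
    by (rule sum_shift_exponent) (simp add: y_mult_def mon)
  finally show ?thesis by (simp add: val0_def sum_distrib_left mult_ac)
qed

lemma val0_y_mult_0: "val0 (y_mult m f) r 0 v = 0"
  by (auto simp: val0_def ydeg_def y_mult_def)

lemma val0_fib_vf: "val0 (fib_vf M f) r k v = (\<Sum>m\<in>UNIV. \<Sum>l\<in>UNIV. M l m * of_real (v $ m) * dval0 l f r k v)"
  by (cases k) (simp_all add: fib_vf_def val0_sum val0_wscale val0_y_mult val0_y_mult_0 dval0_0 dval0_dy mult.assoc)

lemma ymonom_has_derivative:
  "(ymonom \<alpha> has_derivative (\<lambda>h. \<Sum>m\<in>UNIV. h $ m * (real (\<alpha> m) * ymonom (\<alpha>(m := \<alpha> m - 1)) v))) (at v)"
proof -
  have "((\<lambda>v. \<Prod>i\<in>UNIV. v $ i ^ \<alpha> i) has_derivative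
      (\<lambda>h. \<Sum>i\<in>UNIV. (of_nat (\<alpha> i) * (h $ i) * (v $ i) ^ (\<alpha> i - 1)) * (\<Prod>j\<in>UNIV - {i}. v $ j ^ \<alpha> j))) (at v)"
    by (intro has_derivative_prod has_derivative_power bounded_linear.has_derivative[OF bounded_linear_vec_nth] has_derivative_ident)
  moreover have "(v $ i) ^ (\<alpha> i - 1) * (\<Prod>j\<in>UNIV - {i}. v $ j ^ \<alpha> j) = ymonom (\<alpha>(i := \<alpha> i - 1)) v" for i
    unfolding ymonom_def by (subst prod.remove[of UNIV i]) auto
  ultimately show ?thesis by (simp add: ymonom_def[abs_def] mult_ac)
qed

lemma val0_has_derivative:
  "(val0 f r k has_derivative (\<lambda>h. \<Sum>m\<in>UNIV. of_real (h $ m) * dval0 m f r k v)) (at v)"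
proof -
  have "((\<lambda>v. \<Sum>\<alpha> | ydeg \<alpha> = k. f r \<alpha> {} * complex_of_real (ymonom \<alpha> v)) has_derivative
     (\<lambda>h. \<Sum>\<alpha> | ydeg \<alpha> = k. f r \<alpha> {} * complex_of_real (\<Sum>m\<in>UNIV. h $ m * (real (\<alpha> m) * ymonom (\<alpha>(m := \<alpha> m - 1)) v)))) (at v)"
    by (intro has_derivative_sum has_derivative_mult_right has_derivative_of_real ymonom_has_derivative)
  moreover have "(\<Sum>\<alpha> | ydeg \<alpha> = k. f r \<alpha> {} * complex_of_real (\<Sum>m\<in>UNIV. h $ m * (real (\<alpha> m) * ymonom (\<alpha>(m := \<alpha> m - 1)) v)))
     = (\<Sum>m\<in>UNIV. of_real (h $ m) * dval0 m f r k v)" for h :: "real^'a"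
    unfolding dval0_def sum_distrib_left of_real_sum by (subst sum.swap) (simp add: mult_ac)
  ultimately show ?thesis by (simp add: val0_def[abs_def])
qed

lemma wmult_no_form: "wmult f g r \<alpha> {} = (\<Sum>s\<le>r. \<Sum>\<beta> | \<forall>i. \<beta> i \<le> \<alpha> i. f s \<beta> {} * g (r - s) (\<lambda>i. \<alpha> i - \<beta> i) {})"
  by (simp add: wmult_def)

lemma ymonom_mult: "ymonom \<alpha> v * ymonom \<beta> v = ymonom (\<alpha> + \<beta>) v"
  by (simp add: ymonom_def prod.distrib[symmetric] power_add pointwise)

text \<open>Evaluation at v merges all monomials of one degree, and the product becomes a
  convolution over the two degrees alone.\<close>

lemma val0_wmult:
  "val0 (wmult f g) r k v = (\<Sum>s\<le>r. \<Sum>l\<le>k. val0 f s l v * val0 g (r - s) (k - l) v)"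
proof -
  let ?F = "\<lambda>s \<beta>. f s \<beta> {} * complex_of_real (ymonom \<beta> v)" and ?G = "\<lambda>s \<beta>. g (r - s) \<beta> {} * complex_of_real (ymonom \<beta> v)"
  have *: "(\<Sum>\<alpha> | ydeg \<alpha> = k. \<Sum>\<beta> | \<forall>i. \<beta> i \<le> \<alpha> i. f s \<beta> {} * g (r - s) (\<lambda>i. \<alpha> i - \<beta> i) {} * complex_of_real (ymonom \<alpha> v)) =
     (\<Sum>l\<le>k. val0 f s l v * val0 g (r - s) (k - l) v)" for s
  proof -
    have "(\<Sum>\<alpha> | ydeg \<alpha> = k. \<Sum>\<beta> | \<forall>i. \<beta> i \<le> \<alpha> i. f s \<beta> {} * g (r - s) (\<lambda>i. \<alpha> i - \<beta> i) {} * complex_of_real (ymonom \<alpha> v)) =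
      (\<Sum>(\<alpha>, \<beta>)\<in>(SIGMA \<alpha>:{\<alpha>. ydeg \<alpha> = k}. {\<beta>. \<forall>i. \<beta> i \<le> \<alpha> i}). f s \<beta> {} * g (r - s) (\<lambda>i. \<alpha> i - \<beta> i) {} * complex_of_real (ymonom \<alpha> v))"
      by (subst sum.Sigma) (auto simp: finite_ydeg finite_le_fun)
    also have "\<dots> = (\<Sum>(l, \<beta>, \<gamma>)\<in>(SIGMA l:{..k}. {\<beta>. ydeg \<beta> = l} \<times> {\<gamma>. ydeg \<gamma> = k - l}). ?F s \<beta> * ?G s \<gamma>)"
    proof (rule sum.reindex_bij_witness[where i = "\<lambda>(l, \<beta>, \<gamma>). (\<beta> + \<gamma>, \<beta>)" and j = "\<lambda>(\<alpha>, \<beta>). (ydeg \<beta>, \<beta>, (\<lambda>i. \<alpha> i - \<beta> i))"], goal_cases)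
      case (1 x)
      then show ?case by (auto simp: fun_eq_iff pointwise)
    next
      case (2 x)
      then obtain \<alpha> \<beta> where x: "x = (\<alpha>, \<beta>)" "ydeg \<alpha> = k" "\<forall>i. \<beta> i \<le> \<alpha> i" by auto
      then have "\<beta> + (\<lambda>i. \<alpha> i - \<beta> i) = \<alpha>" by (auto simp: fun_eq_iff pointwise)
      then have "ydeg \<beta> + ydeg (\<lambda>i. \<alpha> i - \<beta> i) = k" using x(2) ydeg_add[of \<beta> "\<lambda>i. \<alpha> i - \<beta> i"] by simp
      then show ?case using x by auto
    next
      case (3 y)
      then show ?case by (auto simp: fun_eq_iff pointwise)
    next
      case (4 y)
      then show ?case by (auto simp: ydeg_add pointwise)
    next
      case (5 x)
      then obtain \<alpha> \<beta> where x: "x = (\<alpha>, \<beta>)" "ydeg \<alpha> = k" "\<forall>i. \<beta> i \<le> \<alpha> i" by auto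
      then have "\<beta> + (\<lambda>i. \<alpha> i - \<beta> i) = \<alpha>" by (auto simp: fun_eq_iff pointwise)
      then show ?case using x ymonom_mult[of \<beta> v "\<lambda>i. \<alpha> i - \<beta> i"] by (simp flip: of_real_mult)
    qed
    also have "\<dots> = (\<Sum>l\<le>k. \<Sum>(\<beta>, \<gamma>)\<in>{\<beta>. ydeg \<beta> = l} \<times> {\<gamma>. ydeg \<gamma> = k - l}. ?F s \<beta> * ?G s \<gamma>)"
      by (subst sum.Sigma) (auto simp: finite_ydeg)
    also have "\<dots> = (\<Sum>l\<le>k. val0 f s l v * val0 g (r - s) (k - l) v)"
      by (simp add: val0_def sum_product sum.cartesian_product)
    finally show ?thesis .
  qed
  have "val0 (wmult f g) r k v =
    (\<Sum>\<alpha> | ydeg \<alpha> = k. \<Sum>s\<le>r. \<Sum>\<beta> | \<forall>i. \<beta> i \<le> \<alpha> i. f s \<beta> {} * g (r - s) (\<lambda>i. \<alpha> i - \<beta> i) {} * complex_of_real (ymonom \<alpha> v))"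
    by (simp add: val0_def wmult_no_form sum_distrib_right)
  also have "\<dots> = (\<Sum>s\<le>r. \<Sum>l\<le>k. val0 f s l v * val0 g (r - s) (k - l) v)"
    by (subst sum.swap) (simp only: *)
  finally show ?thesis .
qed

section \<open>Values of one-forms and two-forms\<close>

lemma sum_axis: "(\<Sum>m\<in>UNIV. of_real ((axis j 1 :: (real, 'n::finite) vec) $ m) * F m) = (F j :: complex)"
proof -
  have "(\<Sum>m\<in>UNIV. of_real ((axis j 1 :: (real, 'n) vec) $ m) * F m) = (\<Sum>m\<in>UNIV. if m = j then F m else 0)"
    by (intro sum.cong) (auto simp: axis_def)
  then show ?thesis by simp
qed

definition val1 :: "'n::{finite, linorder} wform \<Rightarrow> nat \<Rightarrow> nat \<Rightarrow> (real, 'n) vec \<Rightarrow> (real, 'n) vec \<Rightarrow> complex" where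
  "val1 a r k v w = (\<Sum>j\<in>UNIV. of_real (w $ j) * val0 (dx_contract j a) r k v)"

definition dval1 :: "'n::{finite, linorder} \<Rightarrow> 'n wform \<Rightarrow> nat \<Rightarrow> nat \<Rightarrow> (real, 'n) vec \<Rightarrow> (real, 'n) vec \<Rightarrow> complex" where
  "dval1 m a r k v w = (\<Sum>j\<in>UNIV. of_real (w $ j) * dval0 m (dx_contract j a) r k v)"

definition val2 :: "'n::{finite, linorder} wform \<Rightarrow> nat \<Rightarrow> nat \<Rightarrow> (real, 'n) vec \<Rightarrow> (real, 'n) vec \<Rightarrow> (real, 'n) vec \<Rightarrow> complex" where
  "val2 X r k v w1 w2 = (\<Sum>i\<in>UNIV. of_real (w1 $ i) * val1 (dx_contract i X) r k v w2)"

lemma val2_add: "val2 (X + Y) r k v w1 w2 = val2 X r k v w1 w2 + val2 Y r k v w1 w2"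
  and val2_diff: "val2 (X - Y) r k v w1 w2 = val2 X r k v w1 w2 - val2 Y r k v w1 w2"
  and val2_wscale: "val2 (wscale z X) r k v w1 w2 = z * val2 X r k v w1 w2"
  and val2_nu_shift: "val2 (nu_shift X) r k v w1 w2 = val2 X (Suc r) k v w1 w2"
  by (simp_all add: val2_def val1_def additive_simps wscale_simps val0_add val0_diff val0_wscale
      nu_commute_dx[symmetric] val0_nu_shift distrib_left right_diff_distrib sum.distrib sum_subtractf
      sum_distrib_left mult_ac)

lemma dx_contract_no_form: "is_form 0 B \<Longrightarrow> dx_contract i B = 0"
  by (auto simp: is_form_def dx_contract_def fun_eq_iff pointwise)

lemma val2_dx_dx:
  assumes "\<And>k l. is_form 0 (B k l)"
  shows "val2 (\<Sum>k\<in>UNIV. \<Sum>l\<in>UNIV. dx_wedge k (dx_wedge l (B k l))) r n v w1 w2 =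
    (\<Sum>k\<in>UNIV. \<Sum>l\<in>UNIV. of_real (w1 $ k * w2 $ l) * val0 (B k l) r n v) -
    (\<Sum>k\<in>UNIV. \<Sum>l\<in>UNIV. of_real (w2 $ k * w1 $ l) * val0 (B k l) r n v)"
proof -
  have *: "dx_contract j (dx_contract i (dx_wedge k (dx_wedge l (B k l)))) =
    (if i = k then if j = l then B k l else 0 else 0) - (if i = l then if j = k then B k l else 0 else 0)" for i j k l
    by (simp add: dx_contract_wedge dx_contract_no_form[OF assms] additive_simps)
  have "val2 (\<Sum>k\<in>UNIV. \<Sum>l\<in>UNIV. dx_wedge k (dx_wedge l (B k l))) r n v w1 w2 =
    (\<Sum>i\<in>UNIV. \<Sum>j\<in>UNIV. \<Sum>k\<in>UNIV. \<Sum>l\<in>UNIV. of_real (w1 $ i * w2 $ j) * val0 (dx_contract j (dx_contract i (dx_wedge k (dx_wedge l (B k l))))) r n v)"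
    by (simp add: val2_def val1_def additive_simps val0_sum sum_distrib_left mult.assoc)
  also have "\<dots> = (\<Sum>i\<in>UNIV. \<Sum>j\<in>UNIV. of_real (w1 $ i * w2 $ j) * val0 (B i j) r n v)
    - (\<Sum>i\<in>UNIV. \<Sum>j\<in>UNIV. of_real (w1 $ i * w2 $ j) * val0 (B j i) r n v)"
  proof -
    have "(\<Sum>k\<in>UNIV. \<Sum>l\<in>UNIV. of_real (w1 $ i * w2 $ j) * val0 (dx_contract j (dx_contract i (dx_wedge k (dx_wedge l (B k l))))) r n v)
      = of_real (w1 $ i * w2 $ j) * val0 (B i j) r n v - of_real (w1 $ i * w2 $ j) * val0 (B j i) r n v" for i j
    proof -
      have "(\<Sum>k\<in>UNIV. \<Sum>l\<in>UNIV. of_real (w1 $ i * w2 $ j) * val0 (dx_contract j (dx_contract i (dx_wedge k (dx_wedge l (B k l))))) r n v)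
        = (\<Sum>k\<in>UNIV. \<Sum>l\<in>UNIV. if l = j then if k = i then of_real (w1 $ i * w2 $ j) * val0 (B k l) r n v else 0 else 0)
        - (\<Sum>k\<in>UNIV. \<Sum>l\<in>UNIV. if l = i then if k = j then of_real (w1 $ i * w2 $ j) * val0 (B k l) r n v else 0 else 0)"
        unfolding * sum_subtractf[symmetric]
        by (intro sum.cong refl) (auto simp: val0_diff val0_zero right_diff_distrib)
      then show ?thesis by simp
    qed
    then show ?thesis by (simp add: sum_subtractf)
  qed
  also have "(\<Sum>i\<in>UNIV. \<Sum>j\<in>UNIV. of_real (w1 $ i * w2 $ j) * val0 (B j i) r n v) =
    (\<Sum>k\<in>UNIV. \<Sum>l\<in>UNIV. of_real (w2 $ k * w1 $ l) * val0 (B k l) r n v)"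
    by (subst sum.swap) (simp add: mult.commute)
  finally show ?thesis .
qed

text \<open>\<delta>^-1 inserts the fibre point v itself as a tangent vector, which makes it visibly
  invariant. The divisor is the y-degree k plus the form degree 2.\<close>

lemma val1_fib_delta_inv:
  assumes "is_form 2 X"
  shows "val1 (fib_delta_inv X) r (Suc k) v w = val2 X r k v v w / of_nat (k + 2)"
proof -
  have *: "val0 (dx_contract i (dx_contract j (deg_inv X))) r k v = val0 (dx_contract i (dx_contract j X)) r k v / of_nat (k + 2)" for i j
    unfolding val0_def sum_divide_distrib
    by (intro sum.cong refl) (auto simp: dx_contract_def deg_inv_def card_insert_if)
  have "val1 (fib_delta_inv X) r (Suc k) v w =
    (\<Sum>i\<in>UNIV. \<Sum>j\<in>UNIV. of_real (w $ i) * (of_real (v $ j) * val0 (dx_contract i (dx_contract j (deg_inv X))) r k v))"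
    by (simp add: val1_def fib_delta_inv_altdef koszul_def additive_simps dx_dy_commute(4)[symmetric] val0_sum val0_y_mult sum_distrib_left)
  also have "\<dots> = val2 X r k v v w / of_nat (k + 2)"
    unfolding val2_def val1_def * sum_divide_distrib sum_distrib_left by (subst sum.swap) (simp add: mult_ac)
  finally show ?thesis .
qed

lemma val1_fib_delta_inv_0: "val1 (fib_delta_inv X) r 0 v w = 0"
  by (simp add: val1_def fib_delta_inv_altdef koszul_def additive_simps dx_dy_commute(4)[symmetric] val0_sum val0_y_mult_0)

lemma one_form_decomp: "is_form 1 a \<Longrightarrow> a = (\<Sum>j\<in>UNIV. dx_wedge j (dx_contract j a))"
  unfolding form_degree_sum by (force simp: is_form_def fun_eq_iff)

section \<open>Naturality under changes of charts\<close>

definition pull_rel :: "((real, 'n) vec, 'n) vec \<Rightarrow> 'n::{finite, linorder} wform \<Rightarrow> 'n wform \<Rightarrow> bool" where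
  "pull_rel A f f' \<longleftrightarrow> (\<forall>r k v. val0 f r k v = val0 f' r k (A *v v))"

lemma pull_rel_intros:
  "pull_rel A f f' \<Longrightarrow> pull_rel A g g' \<Longrightarrow> pull_rel A (f + g) (f' + g')"
  "pull_rel A f f' \<Longrightarrow> pull_rel A (wscale z f) (wscale z f')"
  "pull_rel A 0 0"
  "pull_rel A f f' \<Longrightarrow> pull_rel A g g' \<Longrightarrow> pull_rel A (wmult f g) (wmult f' g')"
  by (simp_all add: pull_rel_def val0_add val0_wscale val0_zero val0_wmult)

lemma pull_rel_sum: "(\<And>x. x \<in> X \<Longrightarrow> pull_rel A (f x) (f' x)) \<Longrightarrow> pull_rel A (\<Sum>x\<in>X. f x) (\<Sum>x\<in>X. f' x)"
  by (simp add: pull_rel_def val0_sum)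

lemma pull_rel_nu_series:
  assumes "\<And>m. pull_rel A (X m) (X' m)"
  shows "pull_rel A (nu_series X) (nu_series X')"
proof -
  have "val0 (nu_series X) r k v = (\<Sum>m\<le>r. val0 (X m) (r - m) k v)" for X r k and v :: "(real, 'a) vec"
    unfolding val0_def nu_series_def sum_distrib_right by (rule sum.swap)
  then show ?thesis using assms by (simp add: pull_rel_def)
qed

text \<open>The relation is an identity between functions of v and may be differentiated along the
  j-th axis; the chain rule and uniqueness of derivatives give the formula without touching
  monomials.\<close>

lemma pull_rel_dval0:
  assumes "pull_rel A f f'"
  shows "dval0 j f r k v = (\<Sum>a\<in>UNIV. of_real (A $ a $ j) * dval0 a f' r k (A *v v))"
proof -
  have eq: "val0 f r k = (\<lambda>v. val0 f' r k (A *v v))" using assms by (simp add: pull_rel_def fun_eq_iff)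
  have "((\<lambda>v. val0 f' r k (A *v v)) has_derivative (\<lambda>h. \<Sum>m\<in>UNIV. of_real ((A *v h) $ m) * dval0 m f' r k (A *v v))) (at v)"
    by (rule has_derivative_compose[OF bounded_linear_imp_has_derivative[OF matrix_vector_mul_bounded_linear] val0_has_derivative])
  from has_derivative_unique[OF this val0_has_derivative[of f r k v, unfolded eq]]
  have "(\<Sum>m\<in>UNIV. of_real ((A *v axis j 1) $ m) * dval0 m f' r k (A *v v)) = (\<Sum>m\<in>UNIV. of_real ((axis j 1 :: (real, 'a) vec) $ m) * dval0 m f r k v)"
    by (rule fun_cong)
  then show ?thesis
    by (simp add: sum_axis matrix_vector_mult_basis column_def)
qed

lemma pull_rel_dy:
  assumes "pull_rel A f f'"
  shows "pull_rel A (dy j f) (\<Sum>a\<in>UNIV. wscale (of_real (A $ a $ j)) (dy a f'))"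
  using pull_rel_dval0[OF assms, of j _ "Suc _"]
  by (simp add: pull_rel_def val0_sum val0_wscale dval0_dy)

text \<open>Each pair of derivatives contributes two Jacobian factors by \<open>pull_rel_dy\<close>,
  and the contravariance of L absorbs them.\<close>

lemma pull_rel_bidiff:
  assumes L: "\<And>a b. L' a b = (\<Sum>j\<in>UNIV. \<Sum>k\<in>UNIV. of_real (A $ a $ j * A $ b $ k) * L j k)"
  shows "pull_rel A f f' \<Longrightarrow> pull_rel A g g' \<Longrightarrow> pull_rel A (bidiff L m f g) (bidiff L' m f' g')"
proof (induct m arbitrary: f f' g g')
  case 0
  then show ?case by (simp add: pull_rel_intros)
next
  case (Suc m)
  let ?B = "\<lambda>a b. bidiff L' m (dy a f') (dy b g')"
  have "pull_rel A (bidiff L (Suc m) f g) (\<Sum>j\<in>UNIV. \<Sum>k\<in>UNIV. wscale (L j k)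
      (bidiff L' m (\<Sum>a\<in>UNIV. wscale (of_real (A $ a $ j)) (dy a f')) (\<Sum>b\<in>UNIV. wscale (of_real (A $ b $ k)) (dy b g'))))"
    unfolding bidiff.simps by (intro pull_rel_sum pull_rel_intros Suc pull_rel_dy)
  also have "(\<Sum>j\<in>UNIV. \<Sum>k\<in>UNIV. wscale (L j k)
      (bidiff L' m (\<Sum>a\<in>UNIV. wscale (of_real (A $ a $ j)) (dy a f')) (\<Sum>b\<in>UNIV. wscale (of_real (A $ b $ k)) (dy b g')))) =
     (\<Sum>j\<in>UNIV. \<Sum>k\<in>UNIV. \<Sum>b\<in>UNIV. \<Sum>a\<in>UNIV. wscale (of_real (A $ a $ j * A $ b $ k) * L j k) (?B a b))"
    by (simp add: bidiff_simps additive_simps mult_ac)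
  also have "\<dots> = (\<Sum>b\<in>UNIV. \<Sum>a\<in>UNIV. \<Sum>k\<in>UNIV. \<Sum>j\<in>UNIV. wscale (of_real (A $ a $ j * A $ b $ k) * L j k) (?B a b))"
    by (rule sum_rotate4)
  also have "\<dots> = (\<Sum>a\<in>UNIV. \<Sum>b\<in>UNIV. \<Sum>j\<in>UNIV. \<Sum>k\<in>UNIV. wscale (of_real (A $ a $ j * A $ b $ k) * L j k) (?B a b))"
    by (rule trans[OF sum.swap], rule sum.cong[OF refl], rule sum.cong[OF refl], rule sum.swap)
  also have "\<dots> = bidiff L' (Suc m) f' g'"
    by (simp add: L wscale_sum_left)
  finally show ?case .
qed

lemma pull_rel_wick:
  assumes "\<And>a b. L' a b = (\<Sum>j\<in>UNIV. \<Sum>k\<in>UNIV. of_real (A $ a $ j * A $ b $ k) * L j k)"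
    "pull_rel A f f'" "pull_rel A g g'"
  shows "pull_rel A (wick L f g) (wick L' f' g')"
  unfolding wick_nu_series bidiff_exp_def
  by (intro pull_rel_nu_series pull_rel_intros pull_rel_bidiff assms)

definition pull_rel1 :: "((real, 'n) vec, 'n) vec \<Rightarrow> 'n::{finite, linorder} wform \<Rightarrow> 'n wform \<Rightarrow> bool" where
  "pull_rel1 A a a' \<longleftrightarrow> (\<forall>r k v w. val1 a r k v w = val1 a' r k (A *v v) (A *v w))"

definition pull_rel2 :: "((real, 'n) vec, 'n) vec \<Rightarrow> 'n::{finite, linorder} wform \<Rightarrow> 'n wform \<Rightarrow> bool" where
  "pull_rel2 A X X' \<longleftrightarrow> (\<forall>r k v w1 w2. val2 X r k v w1 w2 = val2 X' r k (A *v v) (A *v w1) (A *v w2))"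

lemma pull_rel2_intros:
  "pull_rel2 A X X' \<Longrightarrow> pull_rel2 A Y Y' \<Longrightarrow> pull_rel2 A (X + Y) (X' + Y')"
  "pull_rel2 A X X' \<Longrightarrow> pull_rel2 A Y Y' \<Longrightarrow> pull_rel2 A (X - Y) (X' - Y')"
  "pull_rel2 A X X' \<Longrightarrow> pull_rel2 A (wscale z X) (wscale z X')"
  "pull_rel2 A X X' \<Longrightarrow> pull_rel2 A (nu_shift X) (nu_shift X')"
  by (simp_all add: pull_rel2_def val2_add val2_diff val2_wscale val2_nu_shift)

lemma pull_rel1_fib_delta_inv:
  assumes "is_form 2 X" "is_form 2 X'" "pull_rel2 A X X'"
  shows "pull_rel1 A (fib_delta_inv X) (fib_delta_inv X')"
  unfolding pull_rel1_def
proof (intro allI)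
  fix r k v w
  show "val1 (fib_delta_inv X) r k v w = val1 (fib_delta_inv X') r k (A *v v) (A *v w)"
    using assms(3) by (cases k) (simp_all add: val1_fib_delta_inv_0 val1_fib_delta_inv assms(1,2) pull_rel2_def)
qed

lemma pull_rel1_component:
  assumes "pull_rel1 A a a'"
  shows "pull_rel A (dx_contract j a) (\<Sum>b\<in>UNIV. wscale (of_real (A $ b $ j)) (dx_contract b a'))"
  unfolding pull_rel_def
proof (intro allI)
  fix r k v
  have "val1 a r k v (axis j 1) = val1 a' r k (A *v v) (A *v axis j 1)" using assms by (simp add: pull_rel1_def)
  then show "val0 (dx_contract j a) r k v = val0 (\<Sum>b\<in>UNIV. wscale (of_real (A $ b $ j)) (dx_contract b a')) r k (A *v v)"
    by (simp add: val1_def sum_axis matrix_vector_mult_basis column_def val0_sum val0_wscale)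
qed

text \<open>Values of two-forms alternate in w1 and w2, so the coefficients may transform up to a
  symmetric error E. It is zero for T, R and the Wick square; for \<nabla> it holds second
  derivatives of the transition map.\<close>

lemma pull_rel2_dx_dx:
  assumes B: "\<And>k l. is_form 0 (B k l)" and B': "\<And>k l. is_form 0 (B' k l)"
    and eq: "\<And>r n v w1 w2. (\<Sum>k\<in>UNIV. \<Sum>l\<in>UNIV. of_real (w1 $ k * w2 $ l) * val0 (B k l) r n v) =
      (\<Sum>k\<in>UNIV. \<Sum>l\<in>UNIV. of_real ((A *v w1) $ k * (A *v w2) $ l) * val0 (B' k l) r n (A *v v)) + E r n v w1 w2"
    and E: "\<And>r n v w1 w2. E r n v w1 w2 = E r n v w2 w1"
  shows "pull_rel2 A (\<Sum>k\<in>UNIV. \<Sum>l\<in>UNIV. dx_wedge k (dx_wedge l (B k l))) (\<Sum>k\<in>UNIV. \<Sum>l\<in>UNIV. dx_wedge k (dx_wedge l (B' k l)))"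
  unfolding pull_rel2_def val2_dx_dx[OF B] val2_dx_dx[OF B'] eq using E by simp

lemma pull_rel1_dval1:
  assumes "pull_rel1 A a a'"
  shows "dval1 u a r k v w = (\<Sum>b\<in>UNIV. of_real (A $ b $ u) * dval1 b a' r k (A *v v) (A *v w))"
proof -
  have dsum: "dval0 b (\<Sum>x\<in>X. wscale (z x) (f x)) r k v = (\<Sum>x\<in>X. z x * dval0 b (f x) r k v)"
    for b z and f :: "'a \<Rightarrow> 'a wform" and X r k v
    by (cases k) (simp_all add: dval0_0 dval0_dy additive_simps wscale_simps val0_sum val0_wscale)
  have "dval1 u a r k v w = (\<Sum>j\<in>UNIV. \<Sum>b\<in>UNIV. \<Sum>d\<in>UNIV. of_real (w $ j * A $ b $ u * A $ d $ j) * dval0 b (dx_contract d a') r k (A *v v))"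
    unfolding dval1_def pull_rel_dval0[OF pull_rel1_component[OF assms]] dsum
    by (simp add: sum_distrib_left mult_ac)
  also have "\<dots> = (\<Sum>b\<in>UNIV. \<Sum>d\<in>UNIV. \<Sum>j\<in>UNIV. of_real (w $ j * A $ b $ u * A $ d $ j) * dval0 b (dx_contract d a') r k (A *v v))"
    by (rule sum_rotate[symmetric])
  also have "\<dots> = (\<Sum>b\<in>UNIV. of_real (A $ b $ u) * dval1 b a' r k (A *v v) (A *v w))"
    by (simp add: dval1_def matrix_vector_mult_def sum_distrib_left sum_distrib_right mult_ac)
  finally show ?thesis .
qed

text \<open>The components of a one-form are zero-forms, on which \<open>parity\<close> is trivial.
  The square is therefore a two-form whose coefficients are Wick products of functions, to which
  \<open>pull_rel_wick\<close> applies.\<close>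

lemma pull_rel2_wick:
  assumes L: "\<And>a b. L' a b = (\<Sum>j\<in>UNIV. \<Sum>k\<in>UNIV. of_real (A $ a $ j * A $ b $ k) * L j k)"
    and a: "is_form 1 a" "is_form 1 a'" and rel: "pull_rel1 A a a'"
  shows "pull_rel2 A (wick L a a) (wick L' a' a')"
proof -
  have f0: "is_form 0 (dx_contract j b)" if "is_form 1 b" for b :: "'a wform" and j
    by (rule is_form_dx_contract) (use that in simp)
  have decomp: "wick L b b = (\<Sum>k\<in>UNIV. \<Sum>l\<in>UNIV. dx_wedge k (dx_wedge l (wick L (dx_contract k b) (dx_contract l b))))"
    if b: "is_form 1 b" for L and b :: "'a wform"
  proof -
    have par: "parity (dx_contract k b) = dx_contract k b" for k
      using parity_is_form[OF f0[OF b]] by simp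
    have "wick L b b = wick L (\<Sum>k\<in>UNIV. dx_wedge k (dx_contract k b)) (\<Sum>l\<in>UNIV. dx_wedge l (dx_contract l b))"
      using one_form_decomp[OF b] by simp
    also have "\<dots> = (\<Sum>k\<in>UNIV. \<Sum>l\<in>UNIV. wick L (dx_wedge k (dx_contract k b)) (dx_wedge l (dx_contract l b)))"
      by (simp only: wick_left.sum) (simp only: wick_right.sum)
    finally show ?thesis
      by (simp only: wick_dx_wedge_left) (simp only: wick_dx_wedge_right par)
  qed
  show ?thesis
    unfolding decomp[OF a(1)] decomp[OF a(2)]
  proof (rule pull_rel2_dx_dx[where E = "\<lambda>_ _ _ _ _. 0"])
    show "is_form 0 (wick L (dx_contract k a) (dx_contract l a))" "is_form 0 (wick L' (dx_contract k a') (dx_contract l a'))" for k l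
      using is_form_wick[OF f0[OF a(1)] f0[OF a(1)]] is_form_wick[OF f0[OF a(2)] f0[OF a(2)]] by simp_all
    fix r n v w1 w2
    let ?v = "\<lambda>b d. val0 (wick L' (dx_contract b a') (dx_contract d a')) r n (A *v v)"
    have 1: "val0 (wick L (dx_contract k a) (dx_contract l a)) r n v = (\<Sum>d\<in>UNIV. \<Sum>b\<in>UNIV. of_real (A $ b $ k * A $ d $ l) * ?v b d)" for k l
      using pull_rel_wick[OF L pull_rel1_component[OF rel, of k] pull_rel1_component[OF rel, of l]]
      by (simp add: pull_rel_def wick_simps val0_sum val0_wscale sum_distrib_left mult_ac)
    have "(\<Sum>k\<in>UNIV. \<Sum>l\<in>UNIV. of_real (w1 $ k * w2 $ l) * val0 (wick L (dx_contract k a) (dx_contract l a)) r n v) =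
      (\<Sum>k\<in>UNIV. \<Sum>l\<in>UNIV. \<Sum>d\<in>UNIV. \<Sum>b\<in>UNIV. of_real (w1 $ k * A $ b $ k * (w2 $ l * A $ d $ l)) * ?v b d)"
      unfolding 1 by (simp add: sum_distrib_left mult_ac)
    also have "\<dots> = (\<Sum>d\<in>UNIV. \<Sum>b\<in>UNIV. \<Sum>l\<in>UNIV. \<Sum>k\<in>UNIV. of_real (w1 $ k * A $ b $ k * (w2 $ l * A $ d $ l)) * ?v b d)"
      by (rule sum_rotate4)
    also have "\<dots> = (\<Sum>d\<in>UNIV. \<Sum>b\<in>UNIV. of_real ((A *v w1) $ b * (A *v w2) $ d) * ?v b d)"
      by (simp add: matrix_vector_mult_def sum_distrib_left sum_distrib_right mult_ac)
    also have "\<dots> = (\<Sum>b\<in>UNIV. \<Sum>d\<in>UNIV. of_real ((A *v w1) $ b * (A *v w2) $ d) * ?v b d)"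
      by (rule sum.swap)
    finally show "(\<Sum>k\<in>UNIV. \<Sum>l\<in>UNIV. of_real (w1 $ k * w2 $ l) * val0 (wick L (dx_contract k a) (dx_contract l a)) r n v) =
      (\<Sum>k\<in>UNIV. \<Sum>l\<in>UNIV. of_real ((A *v w1) $ k * (A *v w2) $ l) * ?v k l) + 0" by simp
  qed simp
qed

section \<open>Values of the generators, and derivatives of values along the base\<close>

lemma val0_wone: "val0 (wone :: 'n::{finite, linorder} wform) r n v = val0 (wone :: 'n wform) r n 0"
  unfolding val0_def by (intro sum.cong refl) (auto simp: wone_def ymonom_def)

text \<open>Equal to 1 for r = 0 and n = d, and to 0 otherwise. It is kept opaque because all that
  counts is its independence of the tangent vector.\<close>

definition val0_wone_shift :: "'n::{finite, linorder} itself \<Rightarrow> nat \<Rightarrow> nat \<Rightarrow> nat \<Rightarrow> complex" where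
  "val0_wone_shift _ d r n = (if d \<le> n then val0 (wone :: 'n wform) r (n - d) 0 else 0)"

lemma val0_yvar: fixes s :: "'n::{finite, linorder}" shows "val0 (yvar s) r n v = of_real (v $ s) * val0_wone_shift TYPE('n) 1 r n"
  by (cases n) (simp_all add: val0_y_mult val0_y_mult_0 val0_wone_shift_def val0_wone[of _ _ v])

lemma val0_yvar_yvar:
  fixes s t :: "'n::{finite, linorder}"
  shows "val0 (y_mult s (yvar t)) r n v = of_real (v $ s * v $ t) * val0_wone_shift TYPE('n) 2 r n"
  by (cases n) (simp_all add: val0_y_mult val0_y_mult_0 val0_yvar val0_wone_shift_def mult.assoc)

lemma dx_contract_fib_vf: "dx_contract l (fib_vf M b) = fib_vf M (dx_contract l b)"
  by (simp add: fib_vf_def additive_simps wscale_simps dx_dy_commute(2,4)[symmetric] flip: dx_dy_commute(2,4))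

lemma dx_contract_empty: "dx_contract l a r \<alpha> {} = a r \<alpha> {l}"
  by (simp add: dx_contract_def)

lemma partial_deriv_monom:
  "partial_deriv a (ymonom \<alpha>) v = real (\<alpha> a) * ymonom (\<alpha>(a := \<alpha> a - 1)) v"
proof -
  have "partial_deriv a (ymonom \<alpha>) v = (\<Sum>m\<in>UNIV. if m = a then real (\<alpha> m) * ymonom (\<alpha>(m := \<alpha> m - 1)) v else 0)"
    unfolding partial_deriv_eq[OF ymonom_has_derivative] by (intro sum.cong) (auto simp: axis_def)
  then show ?thesis by simp
qed

lemma val1_cong_form: "val1 a r k v w = (\<Sum>b\<in>UNIV. \<Sum>\<alpha> | ydeg \<alpha> = k. of_real (w $ b) * (a r \<alpha> {b} * of_real (ymonom \<alpha> v)))"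
  by (simp add: val1_def val0_def dx_contract_empty sum_distrib_left)

lemma dval1_cong_form:
  "dval1 m a r k v w = (\<Sum>b\<in>UNIV. \<Sum>\<alpha> | ydeg \<alpha> = k. of_real (w $ b) * (a r \<alpha> {b} * of_real (real (\<alpha> m) * ymonom (\<alpha>(m := \<alpha> m - 1)) v)))"
  by (simp add: dval1_def dval0_def dx_contract_empty sum_distrib_left)

context chart
begin

lemma smooth_power: "smooth_in_chart c f \<Longrightarrow> smooth_in_chart c (\<lambda>p. f p ^ k)" for f :: "'m \<Rightarrow> real"
  by (induct k) (auto intro: smooth_const smooth_mult)

lemma smooth_monom:
  assumes "\<And>a. smooth_in_chart c (\<lambda>q. u q $ a)" shows "smooth_in_chart c (\<lambda>q. ymonom \<alpha> (u q))"
  unfolding ymonom_def by (intro smooth_prod smooth_power assms)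

lemma pd_monom:
  fixes u :: "'m \<Rightarrow> real^'k::finite"
  assumes u: "\<And>a. smooth_in_chart c (\<lambda>q. u q $ a)" and p: "p \<in> dom_of c"
  shows "pd c i (\<lambda>q. ymonom \<alpha> (u q)) p = (\<Sum>m\<in>UNIV. pd c i (\<lambda>q. u q $ m) p * (real (\<alpha> m) * ymonom (\<alpha>(m := \<alpha> m - 1)) (u p)))"
proof -
  have "u = (\<lambda>q. \<Sum>a\<in>UNIV. u q $ a *\<^sub>R axis a 1)"
    by (simp add: fun_eq_iff vec_eq_iff axis_def if_distrib cong: if_cong)
  moreover have "smooth_in_chart c (\<lambda>q. \<Sum>a\<in>UNIV. u q $ a *\<^sub>R axis a (1::real))"
    by (intro smooth_sum smooth_linear[OF bounded_linear_scaleR_left] u)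
  ultimately have "smooth_in_chart c u" by simp
  then have "(\<lambda>x. u (chart_inv c x)) differentiable (at (coords c p))" by (rule smooth_differentiable[OF _ p])
  moreover have "ymonom \<alpha> differentiable (at v)" for v by (rule differentiableI[OF ymonom_has_derivative])
  ultimately show ?thesis
    unfolding pd_def by (subst partial_deriv_compose(1)) (simp_all add: partial_deriv_monom p)
qed

text \<open>Product rule for arguments that move with the point, as the images of fixed vectors
  under the Jacobian do: the section, the fibre point and the form argument are differentiated in
  turn.\<close>

lemma pd_val1:
  fixes u w :: "'m \<Rightarrow> (real, 'k::{finite, linorder}) vec"
  assumes a: "smooth_section a" and u: "\<And>m. smooth_in_chart c (\<lambda>q. u q $ m)"
    and w: "\<And>m. smooth_in_chart c (\<lambda>q. w q $ m)" and p: "p \<in> dom_of c"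
  shows "pd c i (\<lambda>q. val1 (a q) r k (u q) (w q)) p =
    pd c i (\<lambda>q. val1 (a q) r k (u p) (w p)) p
    + (\<Sum>m\<in>UNIV. of_real (pd c i (\<lambda>q. u q $ m) p) * dval1 m (a p) r k (u p) (w p))
    + (\<Sum>b\<in>UNIV. of_real (pd c i (\<lambda>q. w q $ b) p) * val0 (dx_contract b (a p)) r k (u p))"
proof -
  let ?X = "\<lambda>(b::'k) \<alpha>. pd c i (\<lambda>q. a q r \<alpha> {b}) p"
  have sa: "smooth_in_chart c (\<lambda>p. a p r \<alpha> I)" for r \<alpha> I using a by (simp add: smooth_section_def)
  have sm: "smooth_in_chart c (\<lambda>q. ymonom \<alpha> (u q))" for \<alpha> by (rule smooth_monom[OF u])
  have t: "pd c i (\<lambda>q. complex_of_real (w q $ b) * (a q r \<alpha> {b} * complex_of_real (ymonom \<alpha> (u q)))) p =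
    of_real (w p $ b) * (?X b \<alpha> * of_real (ymonom \<alpha> (u p)))
    + (\<Sum>m\<in>UNIV. of_real (pd c i (\<lambda>q. u q $ m) p) * (of_real (w p $ b) * (a p r \<alpha> {b} * of_real (real (\<alpha> m) * ymonom (\<alpha>(m := \<alpha> m - 1)) (u p)))))
    + of_real (pd c i (\<lambda>q. w q $ b) p) * (a p r \<alpha> {b} * of_real (ymonom \<alpha> (u p)))" for b \<alpha>
    by (simp add: pd_mult pd_of_real smooth_intros w sa sm p pd_monom[OF u] sum_distrib_left distrib_left mult_ac)
  have "pd c i (\<lambda>q. val1 (a q) r k (u q) (w q)) p =
    (\<Sum>b\<in>UNIV. \<Sum>\<alpha> | ydeg \<alpha> = k. pd c i (\<lambda>q. complex_of_real (w q $ b) * (a q r \<alpha> {b} * complex_of_real (ymonom \<alpha> (u q)))) p)"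
    unfolding val1_cong_form
    by (subst pd_sum[OF _ p], intro smooth_intros w sa sm, intro sum.cong refl pd_sum smooth_intros w sa sm p)
  also have "\<dots> = (\<Sum>b\<in>UNIV. \<Sum>\<alpha> | ydeg \<alpha> = k. of_real (w p $ b) * (?X b \<alpha> * of_real (ymonom \<alpha> (u p))))
    + (\<Sum>b\<in>UNIV. \<Sum>\<alpha> | ydeg \<alpha> = k. \<Sum>m\<in>UNIV. of_real (pd c i (\<lambda>q. u q $ m) p) * (of_real (w p $ b) * (a p r \<alpha> {b} * of_real (real (\<alpha> m) * ymonom (\<alpha>(m := \<alpha> m - 1)) (u p)))))
    + (\<Sum>b\<in>UNIV. of_real (pd c i (\<lambda>q. w q $ b) p) * val0 (dx_contract b (a p)) r k (u p))"
    unfolding t by (simp add: sum.distrib val0_def dx_contract_empty sum_distrib_left)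
  also have "(\<Sum>b\<in>UNIV. \<Sum>\<alpha> | ydeg \<alpha> = k. \<Sum>m\<in>UNIV. of_real (pd c i (\<lambda>q. u q $ m) p) * (of_real (w p $ b) * (a p r \<alpha> {b} * of_real (real (\<alpha> m) * ymonom (\<alpha>(m := \<alpha> m - 1)) (u p)))))
    = (\<Sum>m\<in>UNIV. of_real (pd c i (\<lambda>q. u q $ m) p) * dval1 m (a p) r k (u p) (w p))"
    unfolding dval1_cong_form sum_distrib_left by (rule sum_rotate)
  also have "(\<Sum>b\<in>UNIV. \<Sum>\<alpha> | ydeg \<alpha> = k. of_real (w p $ b) * (?X b \<alpha> * of_real (ymonom \<alpha> (u p)))) =
    pd c i (\<lambda>q. val1 (a q) r k (u p) (w p)) p"
    unfolding val1_cong_form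
    by (subst pd_sum[OF _ p], intro smooth_intros sa, intro sum.cong refl, subst pd_sum[OF _ p], intro smooth_intros sa,
        simp add: pd_mult smooth_intros sa p mult_ac)
  finally show ?thesis .
qed

end

section \<open>T, R and \<nabla> evaluated on tangent vectors\<close>

context kaehler_chart
begin

lemma T_dx_dx:
  "T p = (\<Sum>k\<in>UNIV. \<Sum>l\<in>UNIV. dx_wedge k (dx_wedge l (\<Sum>\<alpha>\<in>UNIV. \<Sum>s\<in>UNIV.
     wscale (of_real (1/2 * W p $ s $ \<alpha> * (\<Gamma> p \<alpha> k l - \<Gamma> p \<alpha> l k))) (yvar s))))"
proof -
  have "T p = (\<Sum>s\<in>UNIV. \<Sum>\<alpha>\<in>UNIV. \<Sum>k\<in>UNIV. \<Sum>l\<in>UNIV.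
       dx_wedge k (dx_wedge l (wscale (of_real (1/2 * W p $ s $ \<alpha> * (\<Gamma> p \<alpha> k l - \<Gamma> p \<alpha> l k))) (yvar s))))"
    unfolding T_def by (simp add: dx_dy_commute wscale_simps)
  also have "\<dots> = (\<Sum>k\<in>UNIV. \<Sum>l\<in>UNIV. \<Sum>\<alpha>\<in>UNIV. \<Sum>s\<in>UNIV.
       dx_wedge k (dx_wedge l (wscale (of_real (1/2 * W p $ s $ \<alpha> * (\<Gamma> p \<alpha> k l - \<Gamma> p \<alpha> l k))) (yvar s))))"
    by (rule sum_rotate4)
  finally show ?thesis by (simp only: dx_wedge.sum)
qed

lemma R_dx_dx:
  "R p = (\<Sum>k\<in>UNIV. \<Sum>l\<in>UNIV. dx_wedge k (dx_wedge l (\<Sum>s\<in>UNIV. \<Sum>\<alpha>\<in>UNIV. \<Sum>t\<in>UNIV.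
     wscale (of_real (1/4 * W p $ s $ \<alpha> * Rc p \<alpha> t k l)) (y_mult s (yvar t)))))"
proof -
  have "R p = (\<Sum>s\<in>UNIV. \<Sum>\<alpha>\<in>UNIV. \<Sum>t\<in>UNIV. \<Sum>k\<in>UNIV. \<Sum>l\<in>UNIV.
       dx_wedge k (dx_wedge l (wscale (of_real (1/4 * W p $ s $ \<alpha> * Rc p \<alpha> t k l)) (y_mult s (yvar t)))))"
    unfolding R_def by (simp add: dx_dy_commute wscale_simps)
  also have "\<dots> = (\<Sum>k\<in>UNIV. \<Sum>l\<in>UNIV. \<Sum>s\<in>UNIV. \<Sum>\<alpha>\<in>UNIV. \<Sum>t\<in>UNIV.
       dx_wedge k (dx_wedge l (wscale (of_real (1/4 * W p $ s $ \<alpha> * Rc p \<alpha> t k l)) (y_mult s (yvar t)))))"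
    by (rule sum_rotate5)
  finally show ?thesis by (simp only: dx_wedge.sum)
qed

lemma is_form_cov:
  assumes p: "p \<in> dom_of c" and a: "\<And>q. is_form n (a q)" shows "is_form n (cov j a p)"
proof -
  have "is_form n (pdw j a p)"
    unfolding is_form_def pdw_def
    using pd_cong[of "\<lambda>q. a q r \<alpha> I" "\<lambda>q. 0" p j for r \<alpha> I] a p by (auto simp: is_form_def)
  then show ?thesis
    unfolding cov_def fib_vf_def
    by (intro is_form_sum is_form_diff is_form_wscale is_form_y_mult is_form_dy a)
qed

lemma nab_dx_dx:
  assumes p: "p \<in> dom_of c" and a: "\<And>q. is_form 1 (a q)"
  shows "nab a p = (\<Sum>k\<in>UNIV. \<Sum>l\<in>UNIV. dx_wedge k (dx_wedge l (dx_contract l (cov k a p))))"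
proof -
  have "nab a p = (\<Sum>k\<in>UNIV. dx_wedge k (\<Sum>l\<in>UNIV. dx_wedge l (dx_contract l (cov k a p))))"
    unfolding nab_def by (intro sum.cong refl arg_cong[where f = "dx_wedge _"] one_form_decomp is_form_cov[OF p a])
  then show ?thesis by (simp only: dx_wedge.sum)
qed

definition torsion_vec :: "'m \<Rightarrow> (real, 'n) vec \<Rightarrow> (real, 'n) vec \<Rightarrow> (real, 'n) vec" where
  "torsion_vec p w1 w2 = (\<chi> \<alpha>. \<Sum>k\<in>UNIV. \<Sum>l\<in>UNIV. w1 $ k * w2 $ l * (\<Gamma> p \<alpha> k l - \<Gamma> p \<alpha> l k))"

definition curv_mat :: "'m \<Rightarrow> 'n \<Rightarrow> 'n \<Rightarrow> ((real, 'n) vec, 'n) vec" where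
  "curv_mat p k l = (\<chi> \<alpha> t. Rc p \<alpha> t k l)"

definition curv_vec :: "'m \<Rightarrow> (real, 'n) vec \<Rightarrow> (real, 'n) vec \<Rightarrow> (real, 'n) vec \<Rightarrow> (real, 'n) vec" where
  "curv_vec p v w1 w2 = (\<Sum>k\<in>UNIV. \<Sum>l\<in>UNIV. (w1 $ k * w2 $ l) *\<^sub>R (curv_mat p k l *v v))"

text \<open>The invariant shape 1/2 \<omega>(v, T(w1, w2)) reduces the naturality of the element T
  to that of \<omega> and of the torsion.\<close>

lemma T_bilinear:
  "(\<Sum>k\<in>UNIV. \<Sum>l\<in>UNIV. of_real (w1 $ k * w2 $ l) * val0 (\<Sum>\<alpha>\<in>UNIV. \<Sum>s\<in>UNIV.
     wscale (of_real (1/2 * W p $ s $ \<alpha> * (\<Gamma> p \<alpha> k l - \<Gamma> p \<alpha> l k))) (yvar s)) r n v) =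
   of_real (1/2 * (v \<bullet> (W p *v torsion_vec p w1 w2))) * val0_wone_shift TYPE('n) 1 r n"
proof -
  have "(\<Sum>k\<in>UNIV. \<Sum>l\<in>UNIV. of_real (w1 $ k * w2 $ l) * val0 (\<Sum>\<alpha>\<in>UNIV. \<Sum>s\<in>UNIV.
     wscale (of_real (1/2 * W p $ s $ \<alpha> * (\<Gamma> p \<alpha> k l - \<Gamma> p \<alpha> l k))) (yvar s)) r n v) =
    of_real (\<Sum>k\<in>UNIV. \<Sum>l\<in>UNIV. \<Sum>\<alpha>\<in>UNIV. \<Sum>s\<in>UNIV. w1 $ k * w2 $ l * (1/2 * W p $ s $ \<alpha> * (\<Gamma> p \<alpha> k l - \<Gamma> p \<alpha> l k) * v $ s)) * val0_wone_shift TYPE('n) 1 r n"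
    by (simp add: val0_sum val0_wscale val0_yvar sum_distrib_left sum_distrib_right mult_ac)
  also have "(\<Sum>k\<in>UNIV. \<Sum>l\<in>UNIV. \<Sum>\<alpha>\<in>UNIV. \<Sum>s\<in>UNIV. w1 $ k * w2 $ l * (1/2 * W p $ s $ \<alpha> * (\<Gamma> p \<alpha> k l - \<Gamma> p \<alpha> l k) * v $ s)) =
    (\<Sum>s\<in>UNIV. \<Sum>\<alpha>\<in>UNIV. \<Sum>k\<in>UNIV. \<Sum>l\<in>UNIV. w1 $ k * w2 $ l * (1/2 * W p $ s $ \<alpha> * (\<Gamma> p \<alpha> k l - \<Gamma> p \<alpha> l k) * v $ s))"
    by (rule sum_rotate4[symmetric])
  also have "\<dots> = 1/2 * (v \<bullet> (W p *v torsion_vec p w1 w2))"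
    by (simp add: inner_vec_def matrix_vector_mult_def torsion_vec_def sum_distrib_left mult_ac)
  finally show ?thesis .
qed

text \<open>The invariant shape is 1/4 \<omega>(v, R(w1, w2) v), quadratic in the fibre
  point.\<close>

lemma R_bilinear:
  "(\<Sum>k\<in>UNIV. \<Sum>l\<in>UNIV. of_real (w1 $ k * w2 $ l) * val0 (\<Sum>s\<in>UNIV. \<Sum>\<alpha>\<in>UNIV. \<Sum>t\<in>UNIV.
     wscale (of_real (1/4 * W p $ s $ \<alpha> * Rc p \<alpha> t k l)) (y_mult s (yvar t))) r n v) =
   of_real (1/4 * (v \<bullet> (W p *v curv_vec p v w1 w2))) * val0_wone_shift TYPE('n) 2 r n"
proof -
  have "(\<Sum>k\<in>UNIV. \<Sum>l\<in>UNIV. of_real (w1 $ k * w2 $ l) * val0 (\<Sum>s\<in>UNIV. \<Sum>\<alpha>\<in>UNIV. \<Sum>t\<in>UNIV.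
     wscale (of_real (1/4 * W p $ s $ \<alpha> * Rc p \<alpha> t k l)) (y_mult s (yvar t))) r n v) =
    of_real (\<Sum>k\<in>UNIV. \<Sum>l\<in>UNIV. \<Sum>s\<in>UNIV. \<Sum>\<alpha>\<in>UNIV. \<Sum>t\<in>UNIV. w1 $ k * w2 $ l * (1/4 * W p $ s $ \<alpha> * Rc p \<alpha> t k l * (v $ s * v $ t))) * val0_wone_shift TYPE('n) 2 r n"
    by (simp add: val0_sum val0_wscale val0_yvar_yvar sum_distrib_left sum_distrib_right mult_ac)
  also have "(\<Sum>k\<in>UNIV. \<Sum>l\<in>UNIV. \<Sum>s\<in>UNIV. \<Sum>\<alpha>\<in>UNIV. \<Sum>t\<in>UNIV. w1 $ k * w2 $ l * (1/4 * W p $ s $ \<alpha> * Rc p \<alpha> t k l * (v $ s * v $ t))) =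
    (\<Sum>s\<in>UNIV. \<Sum>\<alpha>\<in>UNIV. \<Sum>t\<in>UNIV. \<Sum>k\<in>UNIV. \<Sum>l\<in>UNIV. w1 $ k * w2 $ l * (1/4 * W p $ s $ \<alpha> * Rc p \<alpha> t k l * (v $ s * v $ t)))"
    by (rule sum_rotate5[symmetric])
  also have "\<dots> = (\<Sum>s\<in>UNIV. \<Sum>\<alpha>\<in>UNIV. \<Sum>k\<in>UNIV. \<Sum>l\<in>UNIV. \<Sum>t\<in>UNIV. w1 $ k * w2 $ l * (1/4 * W p $ s $ \<alpha> * Rc p \<alpha> t k l * (v $ s * v $ t)))"
    by (rule sum.cong[OF refl], rule sum.cong[OF refl], rule sum_rotate[symmetric])
  also have "\<dots> = 1/4 * (v \<bullet> (W p *v curv_vec p v w1 w2))"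
    by (simp add: inner_vec_def matrix_vector_mult_def curv_vec_def curv_mat_def sum_distrib_left mult_ac)
  finally show ?thesis .
qed

text \<open>\<open>cov\<close> treats the dx^l as constants, so w2 receives no Christoffel term;
  only the fibre argument v does.\<close>

lemma nab_bilinear:
  assumes p: "p \<in> dom_of c" and a: "smooth_section a"
  shows "(\<Sum>k\<in>UNIV. \<Sum>l\<in>UNIV. of_real (w1 $ k * w2 $ l) * val0 (dx_contract l (cov k a p)) r n v) =
    (\<Sum>i\<in>UNIV. of_real (w1 $ i) * (pd c i (\<lambda>q. val1 (a q) r n v w2) p
      - (\<Sum>m\<in>UNIV. \<Sum>u\<in>UNIV. of_real (\<Gamma> p u i m * v $ m) * dval1 u (a p) r n v w2)))"
proof -
  have sa: "smooth_in_chart c (\<lambda>p. a p r \<alpha> I)" for r \<alpha> I using a by (simp add: smooth_section_def)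
  have "val0 (dx_contract l (cov k a p)) r n v =
    (\<Sum>\<alpha> | ydeg \<alpha> = n. pd c k (\<lambda>q. a q r \<alpha> {l}) p * of_real (ymonom \<alpha> v))
     - (\<Sum>m\<in>UNIV. \<Sum>u\<in>UNIV. of_real (\<Gamma> p u k m * v $ m) * dval0 u (dx_contract l (a p)) r n v)" for k l
    unfolding cov_def additive_simps dx_contract_fib_vf val0_diff val0_fib_vf
    by (simp add: val0_def dx_contract_empty pdw_def Gam_def)
  moreover have "(\<Sum>l\<in>UNIV. of_real (w2 $ l) * (\<Sum>\<alpha> | ydeg \<alpha> = n. pd c k (\<lambda>q. a q r \<alpha> {l}) p * of_real (ymonom \<alpha> v))) =
     pd c k (\<lambda>q. val1 (a q) r n v w2) p" for k
    unfolding val1_cong_form sum_distrib_left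
    by (rule sym, subst pd_sum[OF _ p], intro smooth_intros sa, intro sum.cong refl, subst pd_sum[OF _ p], intro smooth_intros sa,
        simp add: pd_mult smooth_intros sa p mult_ac)
  moreover have "(\<Sum>l\<in>UNIV. of_real (w2 $ l) * (\<Sum>m\<in>UNIV. \<Sum>u\<in>UNIV. of_real (\<Gamma> p u k m * v $ m) * dval0 u (dx_contract l (a p)) r n v)) =
      (\<Sum>m\<in>UNIV. \<Sum>u\<in>UNIV. of_real (\<Gamma> p u k m * v $ m) * dval1 u (a p) r n v w2)" for k
    unfolding dval1_def sum_distrib_left by (subst sum_rotate[symmetric]) (simp add: mult_ac)
  ultimately have "(\<Sum>l\<in>UNIV. of_real (w2 $ l) * val0 (dx_contract l (cov k a p)) r n v) =
     pd c k (\<lambda>q. val1 (a q) r n v w2) p - (\<Sum>m\<in>UNIV. \<Sum>u\<in>UNIV. of_real (\<Gamma> p u k m * v $ m) * dval1 u (a p) r n v w2)" for k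
    by (simp only: right_diff_distrib sum_subtractf)
  then show ?thesis by (simp add: sum_distrib_left[symmetric] mult.assoc)
qed

end

section \<open>Transformation laws on the overlap of two charts\<close>

lemma inner_congruence:
  assumes "(B :: ((real, 'n::finite) vec, 'n) vec) = transpose A ** B' ** A"
  shows "v \<bullet> (B *v x) = (A *v v) \<bullet> (B' *v (A *v x))"
proof -
  have "B *v x = transpose A *v (B' *v (A *v x))"
    by (simp add: assms matrix_vector_mul_assoc matrix_mul_assoc)
  then show ?thesis
    by (metis dot_lmul_matrix vector_transpose_matrix)
qed

lemma matrix_inv_congruence:
  fixes A B B' :: "((real, 'n::finite) vec, 'n) vec"
  assumes B: "B = transpose A ** B' ** A"
    and inv: "invertible B" "invertible B'"
  shows "matrix_inv B' = A ** matrix_inv B ** transpose A"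
proof -
  have "transpose A ** (B' ** A ** matrix_inv B) = mat 1"
    using matrix_inv_inverse(1)[OF inv(1)] by (simp add: B matrix_mul_assoc)
  then have "(B' ** A ** matrix_inv B) ** transpose A = mat 1"
    by (rule matrix_left_right_inverse[THEN iffD1])
  then have "matrix_inv B' ** (B' ** A ** matrix_inv B ** transpose A) = matrix_inv B'" by simp
  then show ?thesis
    by (simp add: matrix_mul_assoc matrix_inv_inverse[OF inv(2)])
qed

lemma congruence_entry:
  "(transpose A ** B ** A) $ j $ k = (\<Sum>a\<in>UNIV. \<Sum>b\<in>UNIV. A $ a $ j * A $ b $ k * (B :: ((real, 'n::finite) vec, 'n) vec) $ a $ b)"
proof -
  have "(transpose A ** B ** A) $ j $ k = (\<Sum>b\<in>UNIV. \<Sum>a\<in>UNIV. A $ a $ j * A $ b $ k * B $ a $ b)"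
    by (simp add: matrix_matrix_mult_def transpose_def sum_distrib_left sum_distrib_right mult_ac)
  also have "\<dots> = (\<Sum>a\<in>UNIV. \<Sum>b\<in>UNIV. A $ a $ j * A $ b $ k * B $ a $ b)" by (rule sum.swap)
  finally show ?thesis .
qed

locale kaehler_chart_pair = chart_pair c c' + K1: kaehler_chart c W G \<Gamma> + K2: kaehler_chart c' W' G' \<Gamma>'
  for c c' :: "('m, 'n::{finite, linorder}) chart" and W G \<Gamma> W' G' \<Gamma>' +
  assumes trans_W: "p \<in> dom_of c \<inter> dom_of c' \<Longrightarrow>
      W p $ j $ k = (\<Sum>a\<in>UNIV. \<Sum>b\<in>UNIV. S p a j * S p b k * W' p $ a $ b)"
    and trans_G: "p \<in> dom_of c \<inter> dom_of c' \<Longrightarrow>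
      G p $ j $ k = (\<Sum>a\<in>UNIV. \<Sum>b\<in>UNIV. S p a j * S p b k * G' p $ a $ b)"
    and trans_\<Gamma>: "p \<in> dom_of c \<inter> dom_of c' \<Longrightarrow>
      (\<Sum>l\<in>UNIV. \<Gamma> p l j k * S p a l) = pd c j (\<lambda>q. S q a k) p +
        (\<Sum>b\<in>UNIV. \<Sum>d\<in>UNIV. \<Gamma>' p a b d * S p b j * S p d k)"
begin

context
  fixes p assumes p: "p \<in> dom_of c \<inter> dom_of c'"
begin

abbreviation (input) SM where "SM \<equiv> jac c c'"

lemma trans_W_matrix: "W p = transpose (SM p) ** W' p ** SM p"
  and trans_G_matrix: "G p = transpose (SM p) ** G' p ** SM p"
  by (simp_all add: vec_eq_iff congruence_entry trans_W[OF p] trans_G[OF p])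

text \<open>Inverting B = A^T B' A gives B'^-1 = A B^-1 A^T, so both parts of \<Lambda> transform
  contravariantly.\<close>

lemma trans_L: "K2.L p a b = (\<Sum>j\<in>UNIV. \<Sum>k\<in>UNIV. of_real (S p a j * S p b k) * K1.L p j k)"
proof -
  have *: "(A ** H ** transpose A) $ a $ b = (\<Sum>j\<in>UNIV. \<Sum>k\<in>UNIV. A $ a $ j * A $ b $ k * H $ j $ k)"
    for A H :: "((real, 'n) vec, 'n) vec"
    using congruence_entry[of "transpose A" H a b] by (simp add: transpose_def)
  have 1: "matrix_inv (W' p) $ a $ b = (\<Sum>j\<in>UNIV. \<Sum>k\<in>UNIV. S p a j * S p b k * matrix_inv (W p) $ j $ k)"
    using matrix_inv_congruence[OF trans_W_matrix] K1.inv_W K2.inv_W p by (simp add: *)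
  have 2: "matrix_inv (G' p) $ a $ b = (\<Sum>j\<in>UNIV. \<Sum>k\<in>UNIV. S p a j * S p b k * matrix_inv (G p) $ j $ k)"
    using matrix_inv_congruence[OF trans_G_matrix] K1.inv_G K2.inv_G p by (simp add: *)
  show ?thesis
    unfolding K1.L_def K2.L_def 1 2
    by (simp add: right_diff_distrib sum_subtractf sum_distrib_left mult_ac)
qed

lemma pd_S_commute: "pd c j (\<lambda>q. S q a k) p = pd c k (\<lambda>q. S q a j) p"
  using pd_S_sym[OF p, of j a k] by (simp add: pd_cU[OF p])

text \<open>The inhomogeneous term in the law for \<Gamma> is a second derivative, symmetric in the
  lower indices, and cancels in the difference.\<close>

lemma trans_torsion: "SM p *v K1.torsion_vec p w1 w2 = K2.torsion_vec p (SM p *v w1) (SM p *v w2)"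
proof -
  have tor: "(\<Sum>\<alpha>\<in>UNIV. S p b \<alpha> * (\<Gamma> p \<alpha> k l - \<Gamma> p \<alpha> l k)) =
     (\<Sum>m\<in>UNIV. \<Sum>n\<in>UNIV. (\<Gamma>' p b m n - \<Gamma>' p b n m) * S p m k * S p n l)" for b k l
  proof -
    have "(\<Sum>m\<in>UNIV. \<Sum>n\<in>UNIV. \<Gamma>' p b m n * S p m l * S p n k) = (\<Sum>m\<in>UNIV. \<Sum>n\<in>UNIV. \<Gamma>' p b n m * S p m k * S p n l)"
      by (subst sum.swap) (simp add: mult_ac)
    then show ?thesis
      using trans_\<Gamma>[OF p, of k l b] trans_\<Gamma>[OF p, of l k b] pd_S_commute[of k b l]
      by (simp add: right_diff_distrib left_diff_distrib sum_subtractf mult.commute)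
  qed
  have "(SM p *v K1.torsion_vec p w1 w2) $ b = K2.torsion_vec p (SM p *v w1) (SM p *v w2) $ b" for b
  proof -
    have "(SM p *v K1.torsion_vec p w1 w2) $ b = (\<Sum>k\<in>UNIV. \<Sum>l\<in>UNIV. \<Sum>\<alpha>\<in>UNIV. w1 $ k * w2 $ l * (S p b \<alpha> * (\<Gamma> p \<alpha> k l - \<Gamma> p \<alpha> l k)))"
      unfolding matrix_vector_mult_def K1.torsion_vec_def
      by (simp add: sum_distrib_left) (subst sum_rotate[symmetric], simp add: mult_ac)
    also have "\<dots> = (\<Sum>k\<in>UNIV. \<Sum>l\<in>UNIV. \<Sum>m\<in>UNIV. \<Sum>n\<in>UNIV. (w1 $ k * S p m k) * (w2 $ l * S p n l) * (\<Gamma>' p b m n - \<Gamma>' p b n m))"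
      unfolding sum_distrib_left[symmetric] tor by (simp add: sum_distrib_left mult_ac)
    also have "\<dots> = (\<Sum>m\<in>UNIV. \<Sum>n\<in>UNIV. \<Sum>l\<in>UNIV. \<Sum>k\<in>UNIV. (w1 $ k * S p m k) * (w2 $ l * S p n l) * (\<Gamma>' p b m n - \<Gamma>' p b n m))"
      by (rule sum_rotate4)
    also have "\<dots> = K2.torsion_vec p (SM p *v w1) (SM p *v w2) $ b"
      by (simp add: K2.torsion_vec_def matrix_vector_mult_def sum_distrib_left sum_distrib_right mult_ac)
    finally show ?thesis .
  qed
  then show ?thesis by (simp add: vec_eq_iff)
qed

lemma trans_T: "pull_rel2 (SM p) (K1.T p) (K2.T p)"
  unfolding K1.T_dx_dx K2.T_dx_dx
proof (rule pull_rel2_dx_dx[where E = "\<lambda>_ _ _ _ _. 0"])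
  show "is_form 0 (\<Sum>\<alpha>\<in>UNIV. \<Sum>s\<in>UNIV. wscale (complex_of_real (1 / 2 * W p $ s $ \<alpha> * (\<Gamma> p \<alpha> k l - \<Gamma> p \<alpha> l k))) (yvar s))"
    "is_form 0 (\<Sum>\<alpha>\<in>UNIV. \<Sum>s\<in>UNIV. wscale (complex_of_real (1 / 2 * W' p $ s $ \<alpha> * (\<Gamma>' p \<alpha> k l - \<Gamma>' p \<alpha> l k))) (yvar s))" for k l
    by (intro is_form_sum is_form_wscale is_form_y_mult is_form_wone)+
qed (simp_all only: K1.T_bilinear K2.T_bilinear inner_congruence[OF trans_W_matrix] trans_torsion add_0_right)

text \<open>With the connection written as matrices, the law
  \<open>S \<Gamma>_l = dS_l + A_l S\<close> is a gauge transformation. Differentiating,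
  antisymmetrising and substituting the law again removes all derivatives of S and leaves the
  curvature of A.\<close>

lemma trans_curvature:
  "SM p ** K1.curv_mat p k l = (\<Sum>m\<in>UNIV. \<Sum>n\<in>UNIV. (S p m k * S p n l) *\<^sub>R K2.curv_mat p m n) ** SM p"
proof -
  have sm: "smooth_in_chart cU (\<lambda>q. S q a j)" "smooth_in_chart cU (\<lambda>q. \<Gamma> q a j d)" "smooth_in_chart cU (\<lambda>q. \<Gamma>' q a j d)" for a j d
    by (rule smooth_S) (rule smooth_cU[OF K1.smooth_\<Gamma>], rule smooth_cU_other[OF K2.smooth_\<Gamma>])
  have pU: "p \<in> dom_of cU" using p by simp
  define Gm where "Gm l = (\<chi> \<alpha> t. \<Gamma> p \<alpha> l t)" for l
  \<comment> \<open>The connection of the second chart, pulled back to the l-th coordinate direction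
    of the first.\<close>
  define Am where "Am l = (\<chi> b d. \<Sum>n\<in>UNIV. \<Gamma>' p b n d * S p n l)" for l
  define dS where "dS l = (\<chi> b t. pd cU l (\<lambda>q. S q b t) p)" for l
  define dG where "dG k l = (\<chi> \<alpha> t. pd cU k (\<lambda>q. \<Gamma> q \<alpha> l t) p)" for k l
  define dA where "dA k l = (\<chi> b d. pd cU k (\<lambda>q. \<Sum>n\<in>UNIV. \<Gamma>' q b n d * S q n l) p)" for k l
  define ddS where "ddS k l = (\<chi> b t. pd cU k (pd cU l (\<lambda>q. S q b t)) p)" for k l
  have law: "SM p ** Gm l = dS l + Am l ** SM p" for l
  proof -
    have "(\<Sum>n\<in>UNIV. \<Sum>d\<in>UNIV. \<Gamma>' p b n d * S p n l * S p d t) = (\<Sum>d\<in>UNIV. (\<Sum>n\<in>UNIV. \<Gamma>' p b n d * S p n l) * S p d t)" for b t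
      by (subst sum.swap) (simp add: sum_distrib_right)
    then show ?thesis
      using trans_\<Gamma>[OF p, of l] by (simp add: vec_eq_iff matrix_matrix_mult_def Gm_def Am_def dS_def pd_cU[OF p] mult.commute)
  qed
  have dlaw: "dS k ** Gm l + SM p ** dG k l = ddS k l + dA k l ** SM p + Am l ** dS k" for k l
  proof -
    have "(dS k ** Gm l + SM p ** dG k l) $ b $ t = (ddS k l + dA k l ** SM p + Am l ** dS k) $ b $ t" for b t
    proof -
      have "(dS k ** Gm l + SM p ** dG k l) $ b $ t = pd cU k (\<lambda>q. \<Sum>\<alpha>\<in>UNIV. \<Gamma> q \<alpha> l t * S q b \<alpha>) p"
      proof -
        have "pd cU k (\<lambda>q. \<Sum>\<alpha>\<in>UNIV. \<Gamma> q \<alpha> l t * S q b \<alpha>) p = (\<Sum>\<alpha>\<in>UNIV. pd cU k (\<lambda>q. \<Gamma> q \<alpha> l t * S q b \<alpha>) p)"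
          by (intro CU.pd_sum CU.smooth_mult sm pU)
        then show ?thesis
          by (simp add: CU.pd_mult[OF sm(2,1) pU] matrix_matrix_mult_def dS_def Gm_def dG_def sum.distrib mult.commute)
      qed
      also have "\<dots> = pd cU k (\<lambda>q. pd cU l (\<lambda>q. S q b t) q + (\<Sum>d\<in>UNIV. (\<Sum>n\<in>UNIV. \<Gamma>' q b n d * S q n l) * S q d t)) p"
      proof (rule CU.pd_cong[OF _ pU])
        fix q assume q: "q \<in> dom_of cU"
        then have q': "q \<in> dom_of c \<inter> dom_of c'" by simp
        have "(\<Sum>n\<in>UNIV. \<Sum>d\<in>UNIV. \<Gamma>' q b n d * S q n l * S q d t) = (\<Sum>d\<in>UNIV. (\<Sum>n\<in>UNIV. \<Gamma>' q b n d * S q n l) * S q d t)"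
          by (subst sum.swap) (simp add: sum_distrib_right)
        then show "(\<Sum>\<alpha>\<in>UNIV. \<Gamma> q \<alpha> l t * S q b \<alpha>) = pd cU l (\<lambda>q. S q b t) q + (\<Sum>d\<in>UNIV. (\<Sum>n\<in>UNIV. \<Gamma>' q b n d * S q n l) * S q d t)"
          by (simp add: trans_\<Gamma>[OF q'] pd_cU[OF q'])
      qed
      also have "\<dots> = (ddS k l + dA k l ** SM p + Am l ** dS k) $ b $ t"
      proof -
        have sA: "smooth_in_chart cU (\<lambda>q. \<Sum>n\<in>UNIV. \<Gamma>' q b n d * S q n l)" for d
          by (intro CU.smooth_sum CU.smooth_mult sm)
        show ?thesis
          by (subst CU.pd_add, intro CU.smooth_pd sm, intro CU.smooth_sum CU.smooth_mult sA sm, rule pU, subst CU.pd_sum,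
              intro CU.smooth_mult sA sm, rule pU)
             (simp add: CU.pd_mult[OF sA sm(1) pU] matrix_matrix_mult_def ddS_def dA_def Am_def dS_def sum.distrib add_ac)
      qed
      finally show ?thesis .
    qed
    then show ?thesis by (simp add: vec_eq_iff)
  qed
  have ddS: "ddS k l = ddS l k" for k l
  proof -
    have "pd cU k (pd cU l (\<lambda>q. S q b t)) p = pd cU l (pd cU k (\<lambda>q. S q b t)) p" for b t
      by (rule CU.pd_commute[OF sm(1) pU])
    then show ?thesis by (simp add: ddS_def)
  qed
  \<comment> \<open>The curvature of the pulled-back connection is the pulled-back curvature; the
    terms with derivatives of the Jacobian cancel by \<open>pd_S_sym\<close>.\<close>
  have F: "dA k l - dA l k + Am k ** Am l - Am l ** Am k = (\<Sum>m\<in>UNIV. \<Sum>n\<in>UNIV. (S p m k * S p n l) *\<^sub>R K2.curv_mat p m n)" for k l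
  proof -
    have "(dA k l - dA l k + Am k ** Am l - Am l ** Am k) $ b $ d = (\<Sum>m\<in>UNIV. \<Sum>n\<in>UNIV. (S p m k * S p n l) * K2.Rc p b d m n)" for b d
    proof -
      have chain: "pd cU k (\<lambda>q. \<Gamma>' q b n d) p = (\<Sum>m\<in>UNIV. S p m k * pd c' m (\<lambda>q. \<Gamma>' q b n d) p)" for n k
        using pd_chain[OF p K2.smooth_\<Gamma>] by (simp add: pd_cU[OF p])
      have dA: "dA k l $ b $ d = (\<Sum>n\<in>UNIV. \<Sum>m\<in>UNIV. S p m k * S p n l * pd c' m (\<lambda>q. \<Gamma>' q b n d) p)
         + (\<Sum>n\<in>UNIV. \<Gamma>' p b n d * pd cU k (\<lambda>q. S q n l) p)" for k l
      proof -
        have "pd cU k (\<lambda>q. \<Sum>n\<in>UNIV. \<Gamma>' q b n d * S q n l) p = (\<Sum>n\<in>UNIV. pd cU k (\<lambda>q. \<Gamma>' q b n d * S q n l) p)"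
          by (intro CU.pd_sum CU.smooth_mult sm pU)
        then show ?thesis
          by (simp add: dA_def CU.pd_mult[OF sm(3,1) pU] sum.distrib chain sum_distrib_left sum_distrib_right mult_ac)
      qed
      have AA: "(Am k ** Am l) $ b $ d = (\<Sum>m\<in>UNIV. \<Sum>n\<in>UNIV. S p m k * S p n l * (\<Sum>\<alpha>\<in>UNIV. \<Gamma>' p b m \<alpha> * \<Gamma>' p \<alpha> n d))" for k l
      proof -
        have "(Am k ** Am l) $ b $ d = (\<Sum>\<alpha>\<in>UNIV. \<Sum>m\<in>UNIV. \<Sum>n\<in>UNIV. S p m k * S p n l * (\<Gamma>' p b m \<alpha> * \<Gamma>' p \<alpha> n d))"
          by (simp add: matrix_matrix_mult_def Am_def sum_product mult_ac)
        also have "\<dots> = (\<Sum>m\<in>UNIV. \<Sum>n\<in>UNIV. \<Sum>\<alpha>\<in>UNIV. S p m k * S p n l * (\<Gamma>' p b m \<alpha> * \<Gamma>' p \<alpha> n d))"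
          by (rule sum_rotate[symmetric])
        finally show ?thesis by (simp add: sum_distrib_left)
      qed
      have 1: "(\<Sum>n\<in>UNIV. \<Sum>m\<in>UNIV. S p m k * S p n l * pd c' m (\<lambda>q. \<Gamma>' q b n d) p) =
          (\<Sum>m\<in>UNIV. \<Sum>n\<in>UNIV. S p m k * S p n l * pd c' m (\<lambda>q. \<Gamma>' q b n d) p)" for k l
        by (rule sum.swap)
      have 2: "(\<Sum>n\<in>UNIV. \<Sum>m\<in>UNIV. S p m l * S p n k * pd c' m (\<lambda>q. \<Gamma>' q b n d) p) =
          (\<Sum>m\<in>UNIV. \<Sum>n\<in>UNIV. S p m k * S p n l * pd c' n (\<lambda>q. \<Gamma>' q b m d) p)"
        by (simp add: mult_ac)
      have 3: "(Am l ** Am k) $ b $ d = (\<Sum>m\<in>UNIV. \<Sum>n\<in>UNIV. S p m k * S p n l * (\<Sum>\<alpha>\<in>UNIV. \<Gamma>' p b n \<alpha> * \<Gamma>' p \<alpha> m d))"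
        unfolding AA by (subst sum.swap) (simp add: mult_ac)
      show ?thesis
        unfolding vector_add_component vector_minus_component dA[of k l] dA[of l k] AA[of k l] 3 1[of k l] 2 K2.Rc_def pd_S_sym[OF p, of k _ l]
        by (simp add: distrib_left right_diff_distrib sum.distrib sum_subtractf)
    qed
    then show ?thesis by (simp add: vec_eq_iff K2.curv_mat_def)
  qed
  have cm: "K1.curv_mat p k l = dG k l - dG l k + Gm k ** Gm l - Gm l ** Gm k"
    by (simp add: vec_eq_iff K1.curv_mat_def K1.Rc_def dG_def Gm_def matrix_matrix_mult_def pd_cU[OF p])
  have sub: "A ** (B - C) = A ** B - A ** C" "(A - B) ** C = A ** C - B ** C" for A B C :: "((real, 'n) vec, 'n) vec"
    by (simp_all add: vec_eq_iff matrix_matrix_mult_def algebra_simps sum_subtractf)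
  have a1: "SM p ** dG k l = ddS k l + dA k l ** SM p + Am l ** dS k - dS k ** Gm l" for k l
    using dlaw[of k l] by (simp add: algebra_simps)
  have a2: "SM p ** (Gm k ** Gm l) = dS k ** Gm l + Am k ** (dS l + Am l ** SM p)" for k l
    by (simp add: matrix_mul_assoc law matrix_add_rdistrib) (simp add: law flip: matrix_mul_assoc)
  have "SM p ** K1.curv_mat p k l = (dA k l - dA l k + Am k ** Am l - Am l ** Am k) ** SM p"
  proof -
    have "SM p ** K1.curv_mat p k l = SM p ** dG k l - SM p ** dG l k + SM p ** (Gm k ** Gm l) - SM p ** (Gm l ** Gm k)"
      by (simp only: cm sub matrix_add_ldistrib)
    also have "\<dots> = (ddS k l + dA k l ** SM p + Am l ** dS k - dS k ** Gm l) - (ddS k l + dA l k ** SM p + Am k ** dS l - dS l ** Gm k)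
      + (dS k ** Gm l + Am k ** (dS l + Am l ** SM p)) - (dS l ** Gm k + Am l ** (dS k + Am k ** SM p))"
      unfolding a1 a2 ddS[of l k] ..
    finally show ?thesis
      by (simp add: sub matrix_add_ldistrib matrix_add_rdistrib matrix_mul_assoc)
  qed
  then show ?thesis by (simp add: F)
qed

lemma trans_curv_vec:
  "SM p *v K1.curv_vec p v w1 w2 = K2.curv_vec p (SM p *v v) (SM p *v w1) (SM p *v w2)"
proof -
  let ?x = "\<lambda>m n. K2.curv_mat p m n *v (SM p *v v)"
  have lin: "A *v (\<Sum>x\<in>X. f x) = (\<Sum>x\<in>X. A *v f x)" "A *v (z *\<^sub>R y) = z *\<^sub>R (A *v y)"
    for A :: "((real, 'n) vec, 'n) vec" and f :: "'n \<Rightarrow> (real, 'n) vec" and X z y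
    by (simp_all add: matrix_vector_mul_linear linear_sum linear_scale)
  have lin2: "(\<Sum>x\<in>X. B x) *v y = (\<Sum>x\<in>X. B x *v y)" "(z *\<^sub>R A) *v y = z *\<^sub>R (A *v y)"
    for A :: "((real, 'n) vec, 'n) vec" and B :: "'n \<Rightarrow> ((real, 'n) vec, 'n) vec" and X z y
  proof -
    show "(\<Sum>x\<in>X. B x) *v y = (\<Sum>x\<in>X. B x *v y)"
      by (induct X rule: infinite_finite_induct) (simp_all add: matrix_vector_mult_add_rdistrib)
    show "(z *\<^sub>R A) *v y = z *\<^sub>R (A *v y)" by (simp add: scaleR_matrix_vector_assoc)
  qed
  have "SM p *v (K1.curv_mat p k l *v v) = (\<Sum>m\<in>UNIV. \<Sum>n\<in>UNIV. (S p m k * S p n l) *\<^sub>R ?x m n)" for k l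
    by (simp add: matrix_vector_mul_assoc trans_curvature) (simp add: lin2 flip: matrix_vector_mul_assoc)
  then have "SM p *v K1.curv_vec p v w1 w2 = (\<Sum>k\<in>UNIV. \<Sum>l\<in>UNIV. \<Sum>m\<in>UNIV. \<Sum>n\<in>UNIV. ((w1 $ k * S p m k) * (w2 $ l * S p n l)) *\<^sub>R ?x m n)"
    by (simp add: K1.curv_vec_def lin scaleR_sum_right mult_ac)
  also have "\<dots> = (\<Sum>m\<in>UNIV. \<Sum>n\<in>UNIV. \<Sum>l\<in>UNIV. \<Sum>k\<in>UNIV. ((w1 $ k * S p m k) * (w2 $ l * S p n l)) *\<^sub>R ?x m n)"
    by (rule sum_rotate4)
  also have "\<dots> = K2.curv_vec p (SM p *v v) (SM p *v w1) (SM p *v w2)"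
    by (simp add: K2.curv_vec_def matrix_vector_mult_def sum_distrib_left sum_distrib_right scaleR_sum_left[symmetric] mult_ac)
  finally show ?thesis .
qed

lemma trans_R: "pull_rel2 (SM p) (K1.R p) (K2.R p)"
  unfolding K1.R_dx_dx K2.R_dx_dx
proof (rule pull_rel2_dx_dx[where E = "\<lambda>_ _ _ _ _. 0"])
  show "is_form 0 (\<Sum>s\<in>UNIV. \<Sum>\<alpha>\<in>UNIV. \<Sum>t\<in>UNIV. wscale (complex_of_real (1 / 4 * W p $ s $ \<alpha> * K1.Rc p \<alpha> t k l)) (y_mult s (yvar t)))"
    "is_form 0 (\<Sum>s\<in>UNIV. \<Sum>\<alpha>\<in>UNIV. \<Sum>t\<in>UNIV. wscale (complex_of_real (1 / 4 * W' p $ s $ \<alpha> * K2.Rc p \<alpha> t k l)) (y_mult s (yvar t)))" for k l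
    by (intro is_form_sum is_form_wscale is_form_y_mult is_form_wone)+
qed (simp_all only: K1.R_bilinear K2.R_bilinear inner_congruence[OF trans_W_matrix] trans_curv_vec add_0_right)

text \<open>In the second chart the arguments become S v and S w2, which depend on the point. The
  derivative of S v is absorbed by the inhomogeneous term in the law for \<Gamma>; that of S w2
  remains as an error symmetric in w1 and w2.\<close>

lemma trans_nab:
  assumes sm: "C1.smooth_section r" "C2.smooth_section r'"
    and form: "\<And>q. is_form 1 (r q)" "\<And>q. is_form 1 (r' q)"
    and rel: "\<And>q. q \<in> dom_of c \<inter> dom_of c' \<Longrightarrow> pull_rel1 (SM q) (r q) (r' q)"
  shows "pull_rel2 (SM p) (K1.nab r p) (K2.nab r' p)"
proof -
  have p12: "p \<in> dom_of c" "p \<in> dom_of c'" and pU: "p \<in> dom_of cU" using p by auto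
  have f0: "is_form 0 (dx_contract j b)" if "is_form 1 b" for b :: "'n wform" and j
    by (rule is_form_dx_contract) (use that in simp)
  have smU: "CU.smooth_section r'"
    using sm(2) by (auto simp: C2.smooth_section_def CU.smooth_section_def intro: smooth_cU_other)
  define E where "E \<rho> n v w1 w2 = (\<Sum>i\<in>UNIV. \<Sum>j\<in>UNIV. \<Sum>b\<in>UNIV. of_real (w1 $ i * w2 $ j * pd cU i (\<lambda>q. S q b j) p) *
      val0 (dx_contract b (r' p)) \<rho> n (SM p *v v))" for \<rho> n v w1 w2
  show ?thesis
    unfolding K1.nab_dx_dx[OF p12(1) form(1)] K2.nab_dx_dx[OF p12(2) form(2)]
  proof (rule pull_rel2_dx_dx[where E = E])
    show "is_form 0 (dx_contract l (K1.cov k r p))" "is_form 0 (dx_contract l (K2.cov k r' p))" for k l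
      by (intro f0 K1.is_form_cov K2.is_form_cov p12 form)+
    show "E \<rho> n v w1 w2 = E \<rho> n v w2 w1" for \<rho> n v w1 w2
      unfolding E_def by (subst sum.swap) (simp add: pd_S_sym[OF p, of _ _ _] mult_ac)
    fix \<rho> n v w1 w2
    let ?u = "SM p *v v" and ?w = "SM p *v w2"
    define PD where "PD b = pd c' b (\<lambda>q. val1 (r' q) \<rho> n ?u ?w) p" for b
    define DV where "DV a = dval1 a (r' p) \<rho> n ?u ?w" for a
    define V0 where "V0 b = val0 (dx_contract b (r' p)) \<rho> n ?u" for b
    have comp: "(SM q *v x) $ m = (\<Sum>j\<in>UNIV. x $ j * S q m j)" for q x m
      by (simp add: matrix_vector_mult_def mult.commute)
    have sc: "smooth_in_chart cU (\<lambda>q. (SM q *v x) $ m)" for x m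
      unfolding comp by (intro CU.smooth_sum CU.smooth_mult CU.smooth_const smooth_S)
    have pdc: "pd cU i (\<lambda>q. (SM q *v x) $ m) p = (\<Sum>j\<in>UNIV. x $ j * pd cU i (\<lambda>q. S q m j) p)" for i x m
    proof -
      have "pd cU i (\<lambda>q. \<Sum>j\<in>UNIV. x $ j * S q m j) p = (\<Sum>j\<in>UNIV. pd cU i (\<lambda>q. x $ j * S q m j) p)"
        by (intro CU.pd_sum CU.smooth_mult CU.smooth_const smooth_S pU)
      then show ?thesis unfolding comp by (simp add: CU.pd_cmult[OF smooth_S pU])
    qed
    have s': "smooth_in_chart c' (\<lambda>q. val1 (r' q) \<rho> n x y)" for x y
      unfolding val1_cong_form using sm(2) by (auto simp: C2.smooth_section_def intro!: C2.smooth_intros)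
    have A: "pd c i (\<lambda>q. val1 (r q) \<rho> n v w2) p = (\<Sum>b\<in>UNIV. of_real (S p b i) * PD b)
       + (\<Sum>a\<in>UNIV. of_real (\<Sum>m\<in>UNIV. v $ m * pd cU i (\<lambda>q. S q a m) p) * DV a)
       + (\<Sum>b\<in>UNIV. of_real (\<Sum>j\<in>UNIV. w2 $ j * pd cU i (\<lambda>q. S q b j) p) * V0 b)" for i
    proof -
      have "pd c i (\<lambda>q. val1 (r q) \<rho> n v w2) p = pd cU i (\<lambda>q. val1 (r' q) \<rho> n (SM q *v v) (SM q *v w2)) p"
        unfolding pd_cU[OF p, symmetric]
        by (rule CU.pd_cong[OF _ pU]) (use rel in \<open>simp add: pull_rel1_def\<close>)
      also have "\<dots> = pd c i (\<lambda>q. val1 (r' q) \<rho> n ?u ?w) p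
         + (\<Sum>a\<in>UNIV. of_real (\<Sum>m\<in>UNIV. v $ m * pd cU i (\<lambda>q. S q a m) p) * DV a)
         + (\<Sum>b\<in>UNIV. of_real (\<Sum>j\<in>UNIV. w2 $ j * pd cU i (\<lambda>q. S q b j) p) * V0 b)"
        by (subst CU.pd_val1[OF smU sc sc pU]) (simp only: pdc pd_cU[OF p] DV_def V0_def)
      also have "pd c i (\<lambda>q. val1 (r' q) \<rho> n ?u ?w) p = (\<Sum>b\<in>UNIV. of_real (S p b i) * PD b)"
        by (simp add: pd_chain[OF p s'] PD_def scaleR_conv_of_real)
      finally show ?thesis .
    qed
    \<comment> \<open>The inhomogeneous part of \<open>trans_\<Gamma>\<close> reproduces the second
      summand of \<open>A\<close>, which therefore cancels in the covariant derivative.\<close>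
    have B: "(\<Sum>m\<in>UNIV. \<Sum>u\<in>UNIV. of_real (\<Gamma> p u i m * v $ m) * dval1 u (r p) \<rho> n v w2) =
      (\<Sum>a\<in>UNIV. of_real (\<Sum>m\<in>UNIV. v $ m * pd cU i (\<lambda>q. S q a m) p) * DV a)
      + (\<Sum>b\<in>UNIV. of_real (S p b i) * (\<Sum>d\<in>UNIV. \<Sum>a\<in>UNIV. of_real (\<Gamma>' p a b d * ?u $ d) * DV a))" for i
    proof -
      have "(\<Sum>m\<in>UNIV. \<Sum>u\<in>UNIV. of_real (\<Gamma> p u i m * v $ m) * dval1 u (r p) \<rho> n v w2) =
        (\<Sum>m\<in>UNIV. \<Sum>u\<in>UNIV. \<Sum>a\<in>UNIV. of_real (v $ m * (\<Gamma> p u i m * S p a u)) * DV a)"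
        using pull_rel1_dval1[OF rel[OF p]] by (simp add: DV_def sum_distrib_left mult_ac)
      also have "\<dots> = (\<Sum>a\<in>UNIV. \<Sum>m\<in>UNIV. \<Sum>u\<in>UNIV. of_real (v $ m * (\<Gamma> p u i m * S p a u)) * DV a)"
        by (rule sum_rotate)
      also have "\<dots> = (\<Sum>a\<in>UNIV. \<Sum>m\<in>UNIV. of_real (v $ m * (\<Sum>u\<in>UNIV. \<Gamma> p u i m * S p a u)) * DV a)"
        by (simp add: sum_distrib_left sum_distrib_right)
      also have "\<dots> = (\<Sum>a\<in>UNIV. of_real (\<Sum>m\<in>UNIV. v $ m * pd cU i (\<lambda>q. S q a m) p) * DV a)
        + (\<Sum>a\<in>UNIV. \<Sum>m\<in>UNIV. \<Sum>b\<in>UNIV. \<Sum>d\<in>UNIV. of_real (S p b i * (\<Gamma>' p a b d * (v $ m * S p d m))) * DV a)"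
        unfolding trans_\<Gamma>[OF p] pd_cU[OF p]
        by (simp add: distrib_left distrib_right sum.distrib sum_distrib_left sum_distrib_right mult_ac)
      also have "(\<Sum>a\<in>UNIV. \<Sum>m\<in>UNIV. \<Sum>b\<in>UNIV. \<Sum>d\<in>UNIV. of_real (S p b i * (\<Gamma>' p a b d * (v $ m * S p d m))) * DV a) =
        (\<Sum>b\<in>UNIV. \<Sum>d\<in>UNIV. \<Sum>m\<in>UNIV. \<Sum>a\<in>UNIV. of_real (S p b i * (\<Gamma>' p a b d * (v $ m * S p d m))) * DV a)"
        by (rule sum_rotate4)
      also have "\<dots> = (\<Sum>b\<in>UNIV. \<Sum>d\<in>UNIV. \<Sum>a\<in>UNIV. \<Sum>m\<in>UNIV. of_real (S p b i * (\<Gamma>' p a b d * (v $ m * S p d m))) * DV a)"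
        by (rule sum.cong[OF refl], rule sum.cong[OF refl], rule sum.swap)
      also have "\<dots> = (\<Sum>b\<in>UNIV. of_real (S p b i) * (\<Sum>d\<in>UNIV. \<Sum>a\<in>UNIV. of_real (\<Gamma>' p a b d * ?u $ d) * DV a))"
        by (simp add: comp sum_distrib_left sum_distrib_right mult_ac)
      finally show ?thesis .
    qed
    define Q where "Q b = PD b - (\<Sum>d\<in>UNIV. \<Sum>a\<in>UNIV. of_real (\<Gamma>' p a b d * ?u $ d) * DV a)" for b
    have "(\<Sum>k\<in>UNIV. \<Sum>l\<in>UNIV. of_real (w1 $ k * w2 $ l) * val0 (dx_contract l (K1.cov k r p)) \<rho> n v) =
      (\<Sum>i\<in>UNIV. of_real (w1 $ i) * ((\<Sum>b\<in>UNIV. of_real (S p b i) * Q b)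
         + (\<Sum>b\<in>UNIV. of_real (\<Sum>j\<in>UNIV. w2 $ j * pd cU i (\<lambda>q. S q b j) p) * V0 b)))"
      unfolding K1.nab_bilinear[OF p12(1) sm(1)] A B Q_def
      by (intro sum.cong refl arg_cong[where f = "(*) _"]) (simp add: right_diff_distrib sum_subtractf)
    also have "\<dots> = (\<Sum>i\<in>UNIV. \<Sum>b\<in>UNIV. of_real (w1 $ i * S p b i) * Q b)
         + (\<Sum>i\<in>UNIV. \<Sum>b\<in>UNIV. \<Sum>j\<in>UNIV. of_real (w1 $ i * w2 $ j * pd cU i (\<lambda>q. S q b j) p) * V0 b)"
      by (simp add: distrib_left sum.distrib sum_distrib_left sum_distrib_right mult_ac)
    also have "(\<Sum>i\<in>UNIV. \<Sum>b\<in>UNIV. of_real (w1 $ i * S p b i) * Q b) = (\<Sum>b\<in>UNIV. of_real ((SM p *v w1) $ b) * Q b)"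
      unfolding comp by (subst sum.swap) (simp add: sum_distrib_right)
    also have "\<dots> = (\<Sum>k\<in>UNIV. \<Sum>l\<in>UNIV. of_real ((SM p *v w1) $ k * (SM p *v w2) $ l) * val0 (dx_contract l (K2.cov k r' p)) \<rho> n ?u)"
      unfolding K2.nab_bilinear[OF p12(2) sm(2)] Q_def PD_def DV_def ..
    also have "(\<Sum>i\<in>UNIV. \<Sum>b\<in>UNIV. \<Sum>j\<in>UNIV. of_real (w1 $ i * w2 $ j * pd cU i (\<lambda>q. S q b j) p) * V0 b) = E \<rho> n v w1 w2"
      unfolding E_def V0_def by (rule sum.cong[OF refl], rule sum.swap)
    finally show "(\<Sum>k\<in>UNIV. \<Sum>l\<in>UNIV. of_real (w1 $ k * w2 $ l) * val0 (dx_contract l (K1.cov k r p)) \<rho> n v) =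
      (\<Sum>k\<in>UNIV. \<Sum>l\<in>UNIV. of_real ((SM p *v w1) $ k * (SM p *v w2) $ l) * val0 (dx_contract l (K2.cov k r' p)) \<rho> n ?u) + E \<rho> n v w1 w2" .
  qed
qed

lemma trans_fedosov_step:
  assumes sm: "C1.smooth_section r" "C2.smooth_section r'"
    and form: "\<And>q. is_form 1 (r q)" "\<And>q. is_form 1 (r' q)"
    and rel: "\<And>q. q \<in> dom_of c \<inter> dom_of c' \<Longrightarrow> pull_rel1 (SM q) (r q) (r' q)"
  shows "pull_rel1 (SM p)
    (fib_delta_inv (K1.T p + K1.R p + K1.nab r p - wscale \<i> (nu_shift (wick (K1.L p) (r p) (r p)))))
    (fib_delta_inv (K2.T p + K2.R p + K2.nab r' p - wscale \<i> (nu_shift (wick (K2.L p) (r' p) (r' p)))))"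
proof (rule pull_rel1_fib_delta_inv)
  have f2: "is_form 2 (wick L a a)" if "is_form 1 a" for L and a :: "'n wform"
    using is_form_wick[OF that that] by (simp add: numeral_2_eq_2)
  have n: "is_form 2 (K1.nab r p)" "is_form 2 (K2.nab r' p)"
    using K1.is_form_nab[OF _ form(1)] K2.is_form_nab[OF _ form(2)] p by (simp_all add: numeral_2_eq_2)
  show "is_form 2 (K1.T p + K1.R p + K1.nab r p - wscale \<i> (nu_shift (wick (K1.L p) (r p) (r p))))"
    "is_form 2 (K2.T p + K2.R p + K2.nab r' p - wscale \<i> (nu_shift (wick (K2.L p) (r' p) (r' p))))"
    by (intro is_form_diff is_form_add is_form_wscale is_form_nu_shift f2 form K1.is_form_T K1.is_form_R K2.is_form_T K2.is_form_R n)+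
  show "pull_rel2 (SM p) (K1.T p + K1.R p + K1.nab r p - wscale \<i> (nu_shift (wick (K1.L p) (r p) (r p))))
     (K2.T p + K2.R p + K2.nab r' p - wscale \<i> (nu_shift (wick (K2.L p) (r' p) (r' p))))"
    by (intro pull_rel2_intros trans_T trans_R trans_nab sm form rel pull_rel2_wick trans_L p)
qed

end

end

section \<open>The Fedosov iteration\<close>

lemma is_form_fib_delta_inv: "is_form (Suc q) a \<Longrightarrow> is_form q (fib_delta_inv a)"
  unfolding fib_delta_inv_altdef koszul_def
  by (intro is_form_sum is_form_y_mult is_form_dx_contract) (simp add: is_form_def deg_inv_def)

lemma Deg_part_dx_wedge: "Deg_part k (dx_wedge j a) = dx_wedge j (Deg_part k a)"
  by (auto simp: Deg_part_def dx_wedge_def fun_eq_iff)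

lemma Deg_part_wone: "Deg_part k wone = (if k = 0 then wone else 0)"
  by (auto simp: Deg_part_def wone_def fun_eq_iff ydeg_def pointwise)

lemma Deg_part_y_mult_dy: "Deg_part k (y_mult m (dy l a)) = y_mult m (dy l (Deg_part k a))"
  by (cases k) (simp_all add: Deg_part_y_mult dy_Deg_part dy_Deg_part_0 additive_simps)

lemma Deg_part_low: "low n a \<Longrightarrow> k < n \<Longrightarrow> Deg_part k a = 0"
  by (simp add: low_def)

context kaehler_chart
begin

lemma Deg_part_nab: "Deg_part k (nab a p) = nab (\<lambda>q. Deg_part k (a q)) p"
proof -
  have "pdw j (\<lambda>q. Deg_part k (a q)) p = Deg_part k (pdw j a p)" for j
    by (auto simp: pdw_def Deg_part_def fun_eq_iff)
  then show ?thesis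
    by (simp add: nab_def cov_def fib_vf_def additive_simps wscale_simps Deg_part_dx_wedge Deg_part_y_mult_dy)
qed

lemma Deg_part_T: "Deg_part k (T p) = (if k = 1 then T p else 0)"
  unfolding T_def additive_simps wscale_simps
  by (cases k) (simp_all add: Deg_part_y_mult Deg_part_dx_wedge Deg_part_wone additive_simps)

lemma Deg_part_R: "Deg_part k (R p) = (if k = 2 then R p else 0)"
proof (cases "k = 0 \<or> k = 1")
  case True
  then show ?thesis unfolding R_def additive_simps wscale_simps
    by (auto simp: Deg_part_y_mult additive_simps)
next
  case False
  then obtain m where "k = Suc (Suc m)" by (metis One_nat_def not0_implies_Suc)
  then show ?thesis unfolding R_def additive_simps wscale_simps
    by (simp add: Deg_part_y_mult Deg_part_dx_wedge Deg_part_wone additive_simps)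
qed

end

text \<open>With a single argument the determinant \<open>dx_eval\<close> has one permutation and is
  a coordinate of the vector.\<close>

lemma is_form_1_wvalue:
  fixes a :: "'n::{finite, linorder} wform"
  assumes a: "is_form 1 a"
  shows "wvalue a r k v ws = (if length ws = 1 then val1 a r k v (hd ws) else 0)"
proof (cases "length ws = 1")
  case True
  then obtain w where ws: "ws = [w]" by (auto simp: length_Suc_conv)
  have e: "dx_eval {j} [w] = w $ j" for j :: 'n
  proof -
    have "{\<pi>. \<pi> permutes {..<1::nat}} = {id}" by (auto simp: lessThan_Suc permutes_sing)
    then show ?thesis by (simp add: dx_eval_def)
  qed
  have s: "{I :: 'n set. card I = length ws} = (\<lambda>j. {j}) ` UNIV" by (auto simp: ws card_1_singleton_iff)
  have "wvalue a r k v ws = (\<Sum>\<alpha> | ydeg \<alpha> = k. \<Sum>j\<in>UNIV. a r \<alpha> {j} * of_real (ymonom \<alpha> v * w $ j))"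
    unfolding wvalue_def s by (simp add: ws sum.reindex inj_on_def e ymonom_def)
  also have "\<dots> = val1 a r k v w"
    unfolding val1_cong_form by (subst sum.swap) (simp add: mult_ac)
  finally show ?thesis by (simp add: ws)
next
  case False
  then have "a r \<alpha> I = 0" if "card I = length ws" for \<alpha> I
    using a that by (simp add: is_form_def)
  then show ?thesis using False by (simp add: wvalue_def)
qed

section \<open>The manifold, its sections and the iteration map\<close>

locale kaehler_manifold =
  fixes A :: "('m::{t2_space, second_countable_topology}, 'n::{finite, linorder}) chart set"
    and J \<omega> :: "('m, 'n) tensor2" and \<Gamma> :: "('m, 'n) christoffel"
  assumes kaehler: "almost_kaehler A J \<omega>"
    and connection: "affine_connection A \<Gamma>"
    and respects: "respects_almost_kaehler A J \<omega> \<Gamma>"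
begin

lemma chart_A: "c \<in> A \<Longrightarrow> chart c"
proof
  assume "c \<in> A"
  then have c: "open (chart_image c)" "homeomorphism (dom_of c) (chart_image c) (coords c) (chart_inv c)"
    using kaehler by (auto simp: almost_kaehler_def smooth_atlas_def)
  then show "open (chart_image c)" by simp
  show "inj_on (coords c) (dom_of c)"
    using c(2) by (intro inj_on_inverseI[of _ "chart_inv c"]) (simp add: homeomorphism_def)
qed

lemma kaehler_chart_A: "c \<in> A \<Longrightarrow> kaehler_chart c (\<omega> c) (metric J \<omega> c) (\<Gamma> c)"
proof -
  assume c: "c \<in> A"
  interpret chart c by (rule chart_A[OF c])
  have s: "symplectic_form A \<omega>" and g: "pseudo_riemannian A (metric J \<omega>)"
    using kaehler unfolding almost_kaehler_def by blast+
  show ?thesis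
  proof
    fix j k l m p
    show "smooth_in_chart c (\<lambda>p. \<omega> c p $ j $ k)"
      using s c unfolding symplectic_form_def covariant_tensor2_def by blast
    show "smooth_in_chart c (\<lambda>p. metric J \<omega> c p $ j $ k)"
      using g c unfolding pseudo_riemannian_def covariant_tensor2_def by blast
    show "smooth_in_chart c (\<lambda>p. \<Gamma> c p l j k)"
      using connection c unfolding affine_connection_def by blast
    assume p: "p \<in> dom_of c"
    show "invertible (\<omega> c p)" "\<omega> c p $ k $ j = - \<omega> c p $ j $ k"
      "pd c j (\<lambda>q. \<omega> c q $ k $ l) p + pd c k (\<lambda>q. \<omega> c q $ l $ j) p + pd c l (\<lambda>q. \<omega> c q $ j $ k) p = 0"
      using s c p unfolding symplectic_form_def by blast+
    show "invertible (metric J \<omega> c p)" "metric J \<omega> c p $ k $ j = metric J \<omega> c p $ j $ k"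
      using g c p unfolding pseudo_riemannian_def by blast+
    show "pd c j (\<lambda>q. \<omega> c q $ k $ l) p - (\<Sum>m\<in>UNIV. \<Gamma> c p m j k * \<omega> c p $ m $ l) - (\<Sum>m\<in>UNIV. \<Gamma> c p m j l * \<omega> c p $ k $ m) = 0"
      "pd c j (\<lambda>q. metric J \<omega> c q $ k $ l) p - (\<Sum>m\<in>UNIV. \<Gamma> c p m j k * metric J \<omega> c p $ m $ l)
        - (\<Sum>m\<in>UNIV. \<Gamma> c p m j l * metric J \<omega> c p $ k $ m) = 0"
      using respects c p unfolding respects_almost_kaehler_def parallel_tensor2_def by blast+
  qed
qed

lemma kaehler_chart_pair_A:
  assumes c: "c \<in> A" "c' \<in> A"
  shows "kaehler_chart_pair c c' (\<omega> c) (metric J \<omega> c) (\<Gamma> c) (\<omega> c') (metric J \<omega> c') (\<Gamma> c')"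
proof -
  interpret K1: kaehler_chart c "\<omega> c" "metric J \<omega> c" "\<Gamma> c" by (rule kaehler_chart_A[OF c(1)])
  interpret K2: kaehler_chart c' "\<omega> c'" "metric J \<omega> c'" "\<Gamma> c'" by (rule kaehler_chart_A[OF c(2)])
  have at: "open (dom_of c)" "open (dom_of c')" "open (chart_image c)"
    "homeomorphism (dom_of c) (chart_image c) (coords c) (chart_inv c)"
    and tr: "smooth_on (coords c ` (dom_of c \<inter> dom_of c')) (\<lambda>x. coords c' (chart_inv c x))"
    using kaehler c by (auto simp: almost_kaehler_def smooth_atlas_def)
  have "openin (top_of_set (chart_image c)) (coords c ` (dom_of c \<inter> dom_of c'))"
    by (rule homeomorphism_imp_open_map[OF at(4)]) (use at in \<open>auto simp: openin_open_eq\<close>)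
  then have op: "open (coords c ` (dom_of c \<inter> dom_of c'))"
    using at(3) openin_open_trans by blast
  have s: "covariant_tensor2 A \<omega>" and g: "covariant_tensor2 A (metric J \<omega>)"
    using kaehler unfolding almost_kaehler_def symplectic_form_def pseudo_riemannian_def by blast+
  show ?thesis
  proof
    show "open (coords c ` (dom_of c \<inter> dom_of c'))"
      "smooth_on (coords c ` (dom_of c \<inter> dom_of c')) (\<lambda>x. coords c' (chart_inv c x))"
      by (rule op tr)+
    fix p a j k assume p: "p \<in> dom_of c \<inter> dom_of c'"
    show "\<omega> c p $ j $ k = (\<Sum>a\<in>UNIV. \<Sum>b\<in>UNIV. jac c c' p $ a $ j * jac c c' p $ b $ k * \<omega> c' p $ a $ b)"
      using s c p unfolding covariant_tensor2_def by blast
    show "metric J \<omega> c p $ j $ k = (\<Sum>a\<in>UNIV. \<Sum>b\<in>UNIV. jac c c' p $ a $ j * jac c c' p $ b $ k * metric J \<omega> c' p $ a $ b)"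
      using g c p unfolding covariant_tensor2_def by blast
    show "(\<Sum>l\<in>UNIV. \<Gamma> c p l j k * jac c c' p $ a $ l) = pd c j (\<lambda>q. jac c c' q $ a $ k) p +
        (\<Sum>b\<in>UNIV. \<Sum>d\<in>UNIV. \<Gamma> c' p a b d * jac c c' p $ b $ j * jac c c' p $ d $ k)"
      using connection c p unfolding affine_connection_def by blast
  qed
qed

definition rhs :: "('m, 'n) wsection \<Rightarrow> ('m, 'n) wsection" where
  "rhs a = T_elem A \<omega> \<Gamma> + R_elem A \<omega> \<Gamma> + nabla A \<Gamma> a - i_over_nu (wick_prod J \<omega> a a)"

definition iter :: "('m, 'n) wsection \<Rightarrow> ('m, 'n) wsection" where
  "iter a = delta_inv (rhs a)"

text \<open>Conditions preserved by \<open>iter\<close> under which it contracts. Starting in degree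
  two keeps the quadratic term, after division by \<nu>, in degrees at least two.\<close>

definition admissible :: "('m, 'n) wsection \<Rightarrow> bool" where
  "admissible a \<longleftrightarrow> a \<in> wick_forms A \<and> (\<forall>c p. is_form 1 (a c p) \<and> low 2 (a c p))"

lemma admissibleD:
  assumes "admissible a"
  shows "is_form 1 (a c p)" "low 2 (a c p)" "c \<in> A \<Longrightarrow> chart.smooth_section c (a c)"
    "c \<notin> A \<or> p \<notin> dom_of c \<Longrightarrow> a c p = 0"
proof -
  have a: "on_charts A a = a" using assms by (simp add: admissible_def wick_forms_def)
  show "is_form 1 (a c p)" "low 2 (a c p)" using assms unfolding admissible_def by blast+
  show "c \<in> A \<Longrightarrow> chart.smooth_section c (a c)"
    using assms by (simp add: admissible_def wick_forms_def chart.smooth_section_def[OF chart_A])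
  show "c \<notin> A \<or> p \<notin> dom_of c \<Longrightarrow> a c p = 0"
    using fun_cong[OF fun_cong[OF a], of c p] by (auto simp: on_charts_def)
qed

lemma admissible_pull_rel1:
  assumes a: "admissible a" and c: "c \<in> A" "c' \<in> A" "p \<in> dom_of c \<inter> dom_of c'"
  shows "pull_rel1 (jac c c' p) (a c p) (a c' p)"
  unfolding pull_rel1_def
proof (intro allI)
  fix r k v w
  have "wvalue (a c p) r k v [w] = wvalue (a c' p) r k (jac c c' p *v v) (map (\<lambda>w. jac c c' p *v w) [w])"
    using a c by (simp only: admissible_def wick_forms_def mem_Collect_eq)
  then show "val1 (a c p) r k v w = val1 (a c' p) r k (jac c c' p *v v) (jac c c' p *v w)"
    by (simp add: is_form_1_wvalue[OF admissibleD(1)[OF a]])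
qed

lemma nu_div_wick_self: "is_form 1 a \<Longrightarrow> nu_div (wick L a a) = nu_shift (wick L a a)"
  by (rule nu_div_nu_shift) (rule wick_self_0)

lemma off_charts:
  assumes "c \<notin> A \<or> p \<notin> dom_of c"
  shows "T_elem A \<omega> \<Gamma> c p = 0" "R_elem A \<omega> \<Gamma> c p = 0" "nabla A \<Gamma> a c p = 0"
  using assms by (auto simp: T_elem_def R_elem_def nabla_def on_charts_def)

lemma on_charts_locale:
  assumes c: "c \<in> A" and p: "p \<in> dom_of c"
  shows "T_elem A \<omega> \<Gamma> c p = kaehler_chart.T (\<omega> c) (\<Gamma> c) p"
    and "R_elem A \<omega> \<Gamma> c p = kaehler_chart.R c (\<omega> c) (\<Gamma> c) p"
    and "nabla A \<Gamma> a c p = kaehler_chart.nab c (\<Gamma> c) (a c) p"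
    and "Lam J \<omega> c p = kaehler_chart.L (\<omega> c) (metric J \<omega> c) p"
proof -
  interpret K: kaehler_chart c "\<omega> c" "metric J \<omega> c" "\<Gamma> c" by (rule kaehler_chart_A[OF c])
  show "T_elem A \<omega> \<Gamma> c p = K.T p" "R_elem A \<omega> \<Gamma> c p = K.R p"
    using c p by (simp_all add: T_elem_def R_elem_def on_charts_def K.T_def K.R_def K.Rc_def torsion_def curvature_def)
  show "nabla A \<Gamma> a c p = K.nab (a c) p"
    using c p by (simp add: nabla_def on_charts_def K.nab_def K.cov_def K.pdw_def fib_vf_def K.Gam_def)
  show "Lam J \<omega> c p = K.L p" by (simp add: Lam_def fun_eq_iff K.L_def)
qed

lemma rhs_apply:
  assumes "admissible a"
  shows "rhs a c p = T_elem A \<omega> \<Gamma> c p + R_elem A \<omega> \<Gamma> c p + nabla A \<Gamma> a c p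
    - wscale \<i> (nu_shift (wick (Lam J \<omega> c p) (a c p) (a c p)))"
  by (simp add: rhs_def pointwise i_over_nu_def wick_prod_def nu_div_wick_self[OF admissibleD(1)[OF assms]])

lemma rhs_off_charts: "admissible a \<Longrightarrow> c \<notin> A \<or> p \<notin> dom_of c \<Longrightarrow> rhs a c p = 0"
  by (simp add: rhs_apply off_charts admissibleD(4) wick_simps additive_simps)

lemma iter_on_charts:
  assumes a: "admissible a" and c: "c \<in> A" and p: "p \<in> dom_of c"
  shows "iter a c p = fib_delta_inv (kaehler_chart.T (\<omega> c) (\<Gamma> c) p + kaehler_chart.R c (\<omega> c) (\<Gamma> c) p
    + kaehler_chart.nab c (\<Gamma> c) (a c) p
    - wscale \<i> (nu_shift (wick (kaehler_chart.L (\<omega> c) (metric J \<omega> c) p) (a c p) (a c p))))"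
  by (simp add: iter_def delta_inv_def rhs_apply[OF a] on_charts_locale[OF c p])

lemma is_form_rhs: "admissible a \<Longrightarrow> is_form 2 (rhs a c p)"
proof (cases "c \<in> A \<and> p \<in> dom_of c")
  case True
  assume a: "admissible a"
  interpret K: kaehler_chart c "\<omega> c" "metric J \<omega> c" "\<Gamma> c" by (rule kaehler_chart_A) (use True in simp)
  note f = admissibleD(1)[OF a]
  have "is_form 2 (wick L (a c p) (a c p))" for L using is_form_wick[OF f f] by (simp add: numeral_2_eq_2)
  moreover have "is_form 2 (K.nab (a c) p)" using K.is_form_nab[OF _ f] True by (simp add: numeral_2_eq_2)
  ultimately show ?thesis
    unfolding rhs_apply[OF a] using True
    by (auto simp: on_charts_locale intro!: is_form_add is_form_diff is_form_wscale is_form_nu_shift K.is_form_T K.is_form_R)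
qed (auto simp: rhs_off_charts is_form_zero)

text \<open>1/\<nu> lowers \<open>Deg\<close> by two, so the part of degree k draws on degree k + 2
  of the square; T and R are homogeneous of degrees 1 and 2.\<close>

lemma Deg_part_rhs:
  assumes a: "admissible a"
  shows "Deg_part k (rhs a c p) = (if k = 1 then T_elem A \<omega> \<Gamma> c p else 0) + (if k = 2 then R_elem A \<omega> \<Gamma> c p else 0)
    + nabla A \<Gamma> (Deg_comp k a) c p
    - wscale \<i> (nu_shift (\<Sum>i\<le>k + 2. wick (Lam J \<omega> c p) (Deg_part i (a c p)) (Deg_part (k + 2 - i) (a c p))))"
proof (cases "c \<in> A \<and> p \<in> dom_of c")
  case True
  interpret K: kaehler_chart c "\<omega> c" "metric J \<omega> c" "\<Gamma> c" by (rule kaehler_chart_A) (use True in simp)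
  have "Deg_part k (nu_shift (wick L b b)) = nu_shift (\<Sum>i\<le>k + 2. wick L (Deg_part i b) (Deg_part (k + 2 - i) b))" for L and b :: "'n wform"
    by (simp only: Deg_part_nu_shift Deg_part_wick add_2_eq_Suc')
  then show ?thesis
    using True by (simp add: rhs_apply[OF a] on_charts_locale additive_simps wscale_simps K.Deg_part_T K.Deg_part_R
        K.Deg_part_nab Deg_comp_def)
next
  case False
  then have "a c p = 0" using admissibleD(4)[OF a] by auto
  then show ?thesis using False rhs_off_charts[OF a]
    by (auto simp: off_charts additive_simps wick_simps)
qed

text \<open>In degree zero T and R are absent, and every product in the sum has a factor of degree
  below two. Together with the gain from \<delta>^-1 this brings \<open>iter\<close> back to degrees
  at least two.\<close>

lemma low_rhs: "admissible a \<Longrightarrow> low 1 (rhs a c p)"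
proof -
  assume a: "admissible a"
  have z: "Deg_comp 0 a = 0"
    using Deg_part_low[OF admissibleD(2)[OF a], of 0] by (simp add: Deg_comp_def fun_eq_iff pointwise)
  have "nabla A \<Gamma> 0 c p = 0"
  proof (cases "c \<in> A \<and> p \<in> dom_of c")
    case True
    interpret K: kaehler_chart c "\<omega> c" "metric J \<omega> c" "\<Gamma> c" by (rule kaehler_chart_A) (use True in simp)
    have "K.nab (\<lambda>q. 0 :: 'n wform) p = 0"
      by (simp add: K.nab_def K.cov_def K.pdw_const True additive_simps fib_vf.zero)
    then show ?thesis using True by (simp add: on_charts_locale zero_fun_def)
  qed (auto simp: off_charts)
  moreover have "(\<Sum>i\<le>0 + 2. wick (Lam J \<omega> c p) (Deg_part i (a c p)) (Deg_part (0 + 2 - i) (a c p))) = 0"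
  proof (rule sum.neutral, rule ballI)
    fix i :: nat assume "i \<in> {..0 + 2}"
    then have "i < 2 \<or> 0 + 2 - i < 2" by auto
    then show "wick (Lam J \<omega> c p) (Deg_part i (a c p)) (Deg_part (0 + 2 - i) (a c p)) = 0"
      using Deg_part_low[OF admissibleD(2)[OF a, of c p]] by (auto simp: wick_simps)
  qed
  ultimately have "Deg_part 0 (rhs a c p) = 0"
    by (simp only: Deg_part_rhs[OF a] z) (simp add: additive_simps)
  then show ?thesis by (simp add: low_def)
qed

lemma admissible_iter:
  assumes a: "admissible a" shows "admissible (iter a)"
proof -
  have form: "is_form 1 (iter a c p)" for c p
    using is_form_fib_delta_inv[of 1 "rhs a c p"] is_form_rhs[OF a] by (simp add: iter_def delta_inv_def numeral_2_eq_2)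
  have low: "low 2 (iter a c p)" for c p
    using low_fib_delta_inv[OF low_rhs[OF a]] by (simp add: iter_def delta_inv_def numeral_2_eq_2)
  have "on_charts A (iter a) = iter a"
  proof (rule ext, rule ext)
    fix c p
    show "on_charts A (iter a) c p = iter a c p"
      using rhs_off_charts[OF a, of c p]
      by (cases "c \<in> A \<and> p \<in> dom_of c") (auto simp: on_charts_def iter_def delta_inv_def fib_delta_inv.zero)
  qed
  moreover have "smooth_in_chart c (\<lambda>p. iter a c p r \<alpha> I)" if c: "c \<in> A" for c r \<alpha> I
  proof -
    interpret K: kaehler_chart c "\<omega> c" "metric J \<omega> c" "\<Gamma> c" by (rule kaehler_chart_A[OF c])
    have "K.smooth_section (\<lambda>p. fib_delta_inv (K.T p + K.R p + K.nab (a c) p - wscale \<i> (nu_shift (wick (K.L p) (a c p) (a c p)))))"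
      unfolding fib_delta_inv_altdef koszul_def
      by (intro K.smooth_D admissibleD(3)[OF a c])
    then have "K.smooth_section (iter a c)"
      by (subst K.smooth_section_cong) (simp_all add: iter_on_charts[OF a c])
    then show ?thesis by (simp add: K.smooth_section_def)
  qed
  moreover have "wvalue (iter a c p) r k v ws = wvalue (iter a c' p) r k (jac c c' p *v v) (map (\<lambda>w. jac c c' p *v w) ws)"
    if c: "c \<in> A" "c' \<in> A" and p: "p \<in> dom_of c \<inter> dom_of c'" for c c' p r k v ws
  proof -
    interpret P: kaehler_chart_pair c c' "\<omega> c" "metric J \<omega> c" "\<Gamma> c" "\<omega> c'" "metric J \<omega> c'" "\<Gamma> c'"
      by (rule kaehler_chart_pair_A[OF c])
    have "pull_rel1 (jac c c' p) (iter a c p) (iter a c' p)"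
      using P.trans_fedosov_step[OF p admissibleD(3)[OF a c(1)] admissibleD(3)[OF a c(2)] admissibleD(1)[OF a] admissibleD(1)[OF a]]
        admissible_pull_rel1[OF a c] p
      by (simp add: iter_on_charts[OF a c(1)] iter_on_charts[OF a c(2)])
    then show ?thesis
      by (cases ws) (auto simp: is_form_1_wvalue[OF form] pull_rel1_def)
  qed
  ultimately show ?thesis using form low unfolding admissible_def wick_forms_def by blast
qed

section \<open>The fixed point of the iteration\<close>

lemma Deg_part_iter: "Deg_part (Suc k) (iter a c p) = fib_delta_inv (Deg_part k (rhs a c p))"
  by (simp add: iter_def delta_inv_def Deg_part_fib_delta_inv_Suc)

lemma iter_contraction:
  assumes a: "admissible a" and b: "admissible b"
    and eq: "\<And>k c p. k \<le> n \<Longrightarrow> Deg_part k (a c p) = Deg_part k (b c p)"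
  shows "k \<le> Suc n \<Longrightarrow> Deg_part k (iter a c p) = Deg_part k (iter b c p)"
proof (cases k)
  case 0
  then show ?thesis by (simp add: iter_def delta_inv_def Deg_part_fib_delta_inv_0)
next
  case (Suc m)
  assume "k \<le> Suc n"
  then have m: "m \<le> n" using Suc by simp
  have "wick L (Deg_part i (a c p)) (Deg_part (m + 2 - i) (a c p)) = wick L (Deg_part i (b c p)) (Deg_part (m + 2 - i) (b c p))"
    if "i \<le> m + 2" for i L
  proof -
    \<comment> \<open>If one index exceeds n, the other is at most m + 1 - n, hence below two, and
      that factor vanishes.\<close>
    consider "i < 2" | "m + 2 - i < 2" | "i \<le> n" "m + 2 - i \<le> n" using m that by linarith
    then show ?thesis
      using eq Deg_part_low[OF admissibleD(2)[OF a]] Deg_part_low[OF admissibleD(2)[OF b]]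
      by cases (simp_all add: wick_simps)
  qed
  moreover have "Deg_comp m a = Deg_comp m b" using eq[OF m] by (simp add: Deg_comp_def fun_eq_iff)
  ultimately show ?thesis
    unfolding Suc Deg_part_iter Deg_part_rhs[OF a] Deg_part_rhs[OF b] by simp
qed

lemma iter_fixed_unique:
  assumes a: "admissible a" "iter a = a" and b: "admissible b" "iter b = b"
  shows "a = b"
proof -
  have agree: "\<forall>k\<le>n. \<forall>c p. Deg_part k (a c p) = Deg_part k (b c p)" for n
  proof (induct n)
    case 0
    then show ?case
      using Deg_part_low[OF admissibleD(2)[OF a(1)], of 0] Deg_part_low[OF admissibleD(2)[OF b(1)], of 0] by simp
  next
    case (Suc n)
    then show ?case using iter_contraction[OF a(1) b(1), of n] unfolding a(2) b(2) by blast
  qed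
  have "a c p = b c p" for c p
  proof (rule Deg_part_eqI)
    fix k
    show "Deg_part k (a c p) = Deg_part k (b c p)" using agree[of k, rule_format, of k c p] by simp
  qed
  then show ?thesis by (simp add: fun_eq_iff)
qed

lemma admissible_zero: "admissible 0"
proof -
  have "smooth_in_chart c (\<lambda>p. 0 :: complex)" for c :: "('m, 'n) chart"
    by (simp add: smooth_in_chart_def smooth_on_def Ck_on_const)
  moreover have "wvalue 0 r k v ws = 0" for r k v and ws :: "(real, 'n) vec list"
    by (simp add: wvalue_def pointwise)
  ultimately show ?thesis
    by (auto simp: admissible_def wick_forms_def on_charts_def pointwise is_form_zero low_def additive_simps fun_eq_iff)
qed

lemma iter_fixed_exists: "\<exists>r. admissible r \<and> iter r = r"
proof -
  define s where "s N = (iter ^^ N) 0" for N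
  have adm: "admissible (s N)" for N
    by (induct N) (simp_all add: s_def admissible_zero admissible_iter)
  have step: "\<forall>k\<le>N. \<forall>c p. Deg_part k (s N c p) = Deg_part k (s (Suc N) c p)" for N
  proof (induct N)
    case 0
    then show ?case
      using Deg_part_low[OF admissibleD(2)[OF adm], of 0] by simp
  next
    case (Suc N)
    have "s (Suc M) = iter (s M)" for M by (simp add: s_def)
    then show ?case using iter_contraction[OF adm adm, of N N "Suc N"] Suc by auto
  qed
  have stable: "Deg_part k (s (k + d) c p) = Deg_part k (s k c p)" for k d c p
  proof (induct d)
    case (Suc d)
    then show ?case using step[of "k + d", rule_format, of k c p] by simp
  qed simp
  \<comment> \<open>A coefficient of degree d is read off at the d-th iterate, from which on it no
    longer changes.\<close>
  define r where "r c p = (\<lambda>\<rho> \<alpha> I. s (2 * \<rho> + ydeg \<alpha>) c p \<rho> \<alpha> I)" for c p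
  have rs: "r c p \<rho> \<alpha> I = s (2 * \<rho> + ydeg \<alpha>) c p \<rho> \<alpha> I" for c p \<rho> \<alpha> I by (simp add: r_def)
  have Deg_r: "Deg_part k (r c p) = Deg_part k (s k c p)" for k c p
    by (auto simp: Deg_part_def fun_eq_iff rs)
  have form: "is_form 1 (r c p)" for c p
    using admissibleD(1)[OF adm] by (auto simp: is_form_def rs)
  have low: "low 2 (r c p)" for c p
    using admissibleD(2)[OF adm] by (auto simp: low_def Deg_r)
  have "on_charts A r = r"
    using admissibleD(4)[OF adm] by (auto simp: on_charts_def fun_eq_iff rs pointwise)
  moreover have "smooth_in_chart c (\<lambda>p. r c p \<rho> \<alpha> I)" if "c \<in> A" for c \<rho> \<alpha> I
    using adm that by (auto simp: rs admissible_def wick_forms_def)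
  moreover have "wvalue (r c p) \<rho> k v ws = wvalue (r c' p) \<rho> k (jac c c' p *v v) (map (\<lambda>w. jac c c' p *v w) ws)"
    if c: "c \<in> A" "c' \<in> A" and p: "p \<in> dom_of c \<inter> dom_of c'" for c c' p \<rho> k v ws
  proof -
    \<comment> \<open>A value with given degrees \<rho> in \<nu> and k in y involves only
      coefficients of one total degree, so it is that of a single iterate and inherits its
      transformation law.\<close>
    have "wvalue (r c p) \<rho> k v ws = wvalue (s (2 * \<rho> + k) c p) \<rho> k v ws" for c p v ws
      unfolding wvalue_def by (intro sum.cong refl) (auto simp: rs)
    then show ?thesis
      using adm[of "2 * \<rho> + k"] c p by (simp only: admissible_def wick_forms_def mem_Collect_eq)
  qed
  ultimately have r: "admissible r" using form low unfolding admissible_def wick_forms_def by blast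
  have "iter r c p = r c p" for c p
  proof (rule Deg_part_eqI)
    fix k
    show "Deg_part k (iter r c p) = Deg_part k (r c p)"
    proof (cases k)
      case 0
      then show ?thesis
        using Deg_part_low[OF low, of 0] Deg_part_low[OF admissibleD(2)[OF admissible_iter[OF r]], of 0] by simp
    next
      case (Suc m)
      have "Deg_part j (r c p) = Deg_part j (s m c p)" if "j \<le> m" for j c p
        using stable[of j "m - j" c p] that by (simp add: Deg_r)
      from iter_contraction[OF r adm this, where k = k and c = c and p = p] Suc
      have "Deg_part k (iter r c p) = Deg_part k (s k c p)" by (simp add: s_def)
      then show ?thesis by (simp add: Deg_r)
    qed
  qed
  then have "iter r = r" by (simp add: fun_eq_iff)
  with r show ?thesis by blast
qed

lemma fedosov_solution_iff: "fedosov_solution A J \<omega> \<Gamma> r \<longleftrightarrow> admissible r \<and> iter r = r"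
proof
  assume sol: "fedosov_solution A J \<omega> \<Gamma> r"
  have form: "is_form 1 (r c p)" for c p
    using sol unfolding fedosov_solution_def has_deg_a_def form_part_is_form by blast
  have "Deg_part 0 (r c p) = 0" "Deg_part 1 (r c p) = 0" for c p
  proof -
    have "Deg_comp 0 r c p = 0" "Deg_comp 1 r c p = 0" using sol by (simp_all add: fedosov_solution_def pointwise)
    then show "Deg_part 0 (r c p) = 0" "Deg_part 1 (r c p) = 0" by (simp_all only: Deg_comp_def)
  qed
  then have "low 2 (r c p)" for c p by (auto simp: low_def less_2_cases_iff)
  with sol form have r: "admissible r" by (simp add: admissible_def fedosov_solution_def)
  have "iter r c p = r c p" for c p
  proof -
    have "delta r = rhs r" "delta_inv r = 0" using sol by (simp_all add: fedosov_solution_def rhs_def)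
    then have "delta r c p = rhs r c p" "delta_inv r c p = 0 c p" by simp_all
    then have "rhs r c p = fib_delta (r c p)" "fib_delta_inv (r c p) = 0"
      by (simp_all only: delta_def delta_inv_def pointwise)
    then show ?thesis
      using hodge[of 0 "r c p"] form by (simp add: iter_def delta_inv_def form_part_is_form fib_delta.zero)
  qed
  then show "admissible r \<and> iter r = r" using r by (simp add: fun_eq_iff)
next
  assume *: "admissible r \<and> iter r = r"
  then have r: "admissible r" and fixed: "iter r = r" by simp_all
  have "delta r = rhs r"
  proof (intro ext)
    fix c p
    show "delta r c p \<rho> \<alpha> I = rhs r c p \<rho> \<alpha> I" for \<rho> \<alpha> I
    proof (cases "c \<in> A \<and> p \<in> dom_of c")
      case True
      then have c: "c \<in> A" and p: "p \<in> dom_of c" by simp_all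
      interpret K: kaehler_chart c "\<omega> c" "metric J \<omega> c" "\<Gamma> c" by (rule kaehler_chart_A[OF c])
      \<comment> \<open>A fixed point solves a priori only the image of the equation under
        \<delta>^-1; the vanishing of Z gives the equation itself.\<close>
      have "K.Z (r c) p = 0"
        by (rule K.Z_eq_0[OF admissibleD(3)[OF r c] admissibleD(1)[OF r] admissibleD(2)[OF r] _ p])
           (simp add: iter_on_charts[OF r c, symmetric] fixed)
      then have "fib_delta (r c p) = rhs r c p"
        by (simp add: K.Z_def rhs_apply[OF r] on_charts_locale[OF c p] algebra_simps)
      then show ?thesis by (simp add: delta_def)
    next
      case False
      then have "r c p = 0" "rhs r c p = 0" using admissibleD(4)[OF r] rhs_off_charts[OF r] by auto
      then show ?thesis by (simp add: delta_def fib_delta.zero)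
    qed
  qed
  moreover have "delta_inv r = 0"
    by (subst fixed[symmetric]) (simp add: iter_def delta_inv_def fun_eq_iff fib_delta_inv_twice pointwise)
  moreover have "Deg_comp 0 r = 0" "Deg_comp 1 r = 0"
    using Deg_part_low[OF admissibleD(2)[OF r]] by (simp_all add: Deg_comp_def fun_eq_iff pointwise)
  ultimately show "fedosov_solution A J \<omega> \<Gamma> r"
    using r admissibleD(1)[OF r]
    by (simp add: fedosov_solution_def has_deg_a_def form_part_is_form rhs_def admissible_def)
qed

section \<open>The recursion and the flatness of D\<close>

lemma nabla_zero: "nabla A \<Gamma> 0 = 0"
proof (intro ext)
  fix c p r \<alpha> I
  have "nabla A \<Gamma> 0 c p = 0"
  proof (cases "c \<in> A \<and> p \<in> dom_of c")
    case True
    interpret K: kaehler_chart c "\<omega> c" "metric J \<omega> c" "\<Gamma> c" by (rule kaehler_chart_A) (use True in simp)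
    have "K.nab (\<lambda>q. 0 :: 'n wform) p = 0"
      by (simp add: K.nab_def K.cov_def K.pdw_const True additive_simps fib_vf.zero)
    then show ?thesis using True by (simp add: on_charts_locale zero_fun_def)
  qed (auto simp: off_charts)
  then show "nabla A \<Gamma> 0 c p r \<alpha> I = 0 c p r \<alpha> I" by (simp add: pointwise)
qed

lemma Deg_comp_low: "admissible a \<Longrightarrow> k < 2 \<Longrightarrow> Deg_comp k a = 0"
  by (intro ext) (simp add: Deg_comp_def Deg_part_low[OF admissibleD(2)] pointwise)

text \<open>This is the fixed point equation in degree k + 3; the case distinction covers k = 0,
  where R enters, together with k \<ge> 1.\<close>

lemma recursion:
  assumes r: "admissible r" "iter r = r"
  shows "Deg_comp (k + 3) r = delta_inv ((if k = 0 then R_elem A \<omega> \<Gamma> else 0) + nabla A \<Gamma> (Deg_comp (k + 2) r)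
      - i_over_nu (\<Sum>l=0..k. wick_prod J \<omega> (Deg_comp (l + 2) r) (Deg_comp (k - l + 2) r)))"
proof (rule ext, rule ext)
  fix c p
  let ?w = "\<lambda>i j. wick (Lam J \<omega> c p) (Deg_part i (r c p)) (Deg_part j (r c p))"
  let ?S = "\<Sum>l=0..k. ?w (l + 2) (k - l + 2)"
  have low: "Deg_part i (r c p) = 0" if "i < 2" for i using that by (rule Deg_part_low[OF admissibleD(2)[OF r(1)]])
  have S: "(\<Sum>i\<le>k + 2 + 2. ?w i (k + 2 + 2 - i)) = ?S"
  proof -
    \<comment> \<open>The parts of degree below two vanish, which cuts off both ends of the
      sum.\<close>
    have "(\<Sum>i\<le>k + 2 + 2. ?w i (k + 2 + 2 - i)) = (\<Sum>i\<in>{2..k + 2}. ?w i (k + 2 + 2 - i))"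
    proof (rule sum.mono_neutral_right)
      show "\<forall>i\<in>{..k + 2 + 2} - {2..k + 2}. ?w i (k + 2 + 2 - i) = 0"
      proof
        fix i assume "i \<in> {..k + 2 + 2} - {2..k + 2}"
        then have "i < 2 \<or> k + 2 + 2 - i < 2" by auto
        then show "?w i (k + 2 + 2 - i) = 0" using low by (auto simp: wick_simps)
      qed
    qed auto
    also have "\<dots> = (\<Sum>l\<in>{0..k}. ?w (l + 2) (k + 2 + 2 - (l + 2)))"
      using sum.shift_bounds_cl_nat_ivl[of "\<lambda>i. ?w i (k + 2 + 2 - i)" 0 2 k] by (simp only: add_0)
    also have "\<dots> = ?S" by (intro sum.cong refl arg_cong2[where f = ?w]) auto
    finally show ?thesis .
  qed
  \<comment> \<open>A single product of two parts need not be divisible by \<nu>; the whole sum is,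
    being a homogeneous part of r \<circ> r.\<close>
  have "?S = Deg_part (k + 2 + 2) (wick (Lam J \<omega> c p) (r c p) (r c p))"
    unfolding S[symmetric] by (rule Deg_part_wick[symmetric])
  then have "?S 0 = 0"
    using wick_self_0[OF admissibleD(1)[OF r(1)], of "Lam J \<omega> c p" c p]
    by (simp add: Deg_part_def fun_eq_iff pointwise)
  then have nu: "nu_div ?S = nu_shift ?S" by (rule nu_div_nu_shift)
  have "Deg_part (Suc (k + 2)) (r c p) = fib_delta_inv (Deg_part (k + 2) (rhs r c p))"
    using Deg_part_iter[of "k + 2" r c p] by (simp only: r(2))
  also have "Deg_part (k + 2) (rhs r c p) = (if k = 0 then R_elem A \<omega> \<Gamma> c p else 0) + nabla A \<Gamma> (Deg_comp (k + 2) r) c p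
     - wscale \<i> (nu_shift ?S)"
    unfolding Deg_part_rhs[OF r(1)] S by simp
  also have "\<dots> = ((if k = 0 then R_elem A \<omega> \<Gamma> else 0) + nabla A \<Gamma> (Deg_comp (k + 2) r)
      - i_over_nu (\<Sum>l=0..k. wick_prod J \<omega> (Deg_comp (l + 2) r) (Deg_comp (k - l + 2) r))) c p"
  proof -
    have "i_over_nu (\<Sum>l=0..k. wick_prod J \<omega> (Deg_comp (l + 2) r) (Deg_comp (k - l + 2) r)) c p = wscale \<i> (nu_div ?S)"
      by (simp only: i_over_nu_def sum_apply wick_prod_def Deg_comp_def)
    then show ?thesis unfolding nu by (cases "k = 0") (simp_all only: pointwise if_True if_False simp_thms)
  qed
  finally show "Deg_comp (k + 3) r c p = delta_inv ((if k = 0 then R_elem A \<omega> \<Gamma> else 0) + nabla A \<Gamma> (Deg_comp (k + 2) r)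
      - i_over_nu (\<Sum>l=0..k. wick_prod J \<omega> (Deg_comp (l + 2) r) (Deg_comp (k - l + 2) r))) c p"
    by (simp only: Deg_comp_def delta_inv_def) (simp only: numeral_3_eq_3 numeral_2_eq_2 add_Suc_right add_0_right)
qed

lemma recursion_2:
  assumes r: "admissible r" "iter r = r"
  shows "Deg_comp 2 r = delta_inv (T_elem A \<omega> \<Gamma>)"
proof (rule ext, rule ext)
  fix c p
  have low: "Deg_part i (r c p) = 0" if "i < 2" for i using that by (rule Deg_part_low[OF admissibleD(2)[OF r(1)]])
  have S: "(\<Sum>i\<le>1 + 2. wick (Lam J \<omega> c p) (Deg_part i (r c p)) (Deg_part (1 + 2 - i) (r c p))) = 0"
  proof (rule sum.neutral, rule ballI)
    fix i :: nat assume "i \<in> {..1 + 2}"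
    then have "i < 2 \<or> 1 + 2 - i < 2" by auto
    then show "wick (Lam J \<omega> c p) (Deg_part i (r c p)) (Deg_part (1 + 2 - i) (r c p)) = 0"
      using low by (auto simp: wick_simps)
  qed
  have "Deg_part (Suc 1) (r c p) = fib_delta_inv (Deg_part 1 (rhs r c p))"
    using Deg_part_iter[of 1 r c p] by (simp only: r(2))
  also have "Deg_part 1 (rhs r c p) = T_elem A \<omega> \<Gamma> c p"
    unfolding Deg_part_rhs[OF r(1)] S using Deg_comp_low[OF r(1), of 1]
    by (simp add: nabla_zero additive_simps pointwise)
  finally show "Deg_comp 2 r c p = delta_inv (T_elem A \<omega> \<Gamma>) c p"
    by (simp add: Deg_comp_def delta_inv_def numeral_2_eq_2)
qed

text \<open>As r is a one-form, the graded commutator is \<open>odd_comm\<close>; its \<nu>^0 part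
  vanishes, so \<open>nu_div\<close> and \<open>nu_shift\<close> agree on it.\<close>

lemma fedosov_D_on_charts:
  assumes r: "admissible r" and c: "c \<in> A" and p: "p \<in> dom_of c"
  shows "fedosov_D A J \<omega> \<Gamma> r a c p = kaehler_chart.D c (\<omega> c) (metric J \<omega> c) (\<Gamma> c) (r c) (a c) p"
proof -
  interpret K: kaehler_chart c "\<omega> c" "metric J \<omega> c" "\<Gamma> c" by (rule kaehler_chart_A[OF c])
  have "odd_comm L (r c p) (a c p) 0 = 0" for L
    using wick_graded_commute_0(1)[OF admissibleD(1)[OF r]] by (simp add: odd_comm_def)
  moreover have "graded_commutator L (r c p) (a c p) = odd_comm L (r c p) (a c p)" for L
    using graded_commutator_odd[OF admissibleD(1)[OF r]] by (simp add: odd_comm_def)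
  ultimately show ?thesis
    by (simp add: fedosov_D_def K.D_def delta_def i_over_nu_def ad_wick_def pointwise nu_div_nu_shift
        on_charts_locale[OF c p])
qed

lemma fedosov_D_flat:
  assumes r: "admissible r" "iter r = r" and a: "a \<in> wick_forms A"
  shows "fedosov_D A J \<omega> \<Gamma> r (fedosov_D A J \<omega> \<Gamma> r a) = 0"
proof (rule ext, rule ext)
  fix c p
  show "fedosov_D A J \<omega> \<Gamma> r (fedosov_D A J \<omega> \<Gamma> r a) c p = 0 c p"
  proof (cases "c \<in> A \<and> p \<in> dom_of c")
    case True
    then have c: "c \<in> A" and p: "p \<in> dom_of c" by simp_all
    interpret K: kaehler_chart c "\<omega> c" "metric J \<omega> c" "\<Gamma> c" by (rule kaehler_chart_A[OF c])
    have sm: "K.smooth_section (a c)"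
      using a c by (simp add: wick_forms_def K.smooth_section_def)
    have "K.Z (r c) p = 0"
      by (rule K.Z_eq_0[OF admissibleD(3)[OF r(1) c] admissibleD(1)[OF r(1)] admissibleD(2)[OF r(1)] _ p])
         (simp add: iter_on_charts[OF r(1) c, symmetric] r(2))
    then have "K.D (r c) (K.D (r c) (a c)) p = 0"
      by (simp add: K.D_squared[OF admissibleD(3)[OF r(1) c] admissibleD(1)[OF r(1)] p sm] wick_comm_def wick_simps additive_simps)
    \<comment> \<open>The inner section agrees with its local expression on the chart domain only,
      which suffices because \<nabla> at p depends just on the values there.\<close>
    moreover have "K.D (r c) (fedosov_D A J \<omega> \<Gamma> r a c) p = K.D (r c) (K.D (r c) (a c)) p"
      unfolding K.D_def[of "r c" "fedosov_D A J \<omega> \<Gamma> r a c"] K.D_def[of "r c" "K.D (r c) (a c)"]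
      using K.nab_cong[OF p fedosov_D_on_charts[OF r(1) c, of _ a]] by (simp add: fedosov_D_on_charts[OF r(1) c p])
    ultimately show ?thesis by (simp add: fedosov_D_on_charts[OF r(1) c p] pointwise)
  next
    case False
    have "on_charts A a = a" using a by (simp add: wick_forms_def)
    then have "a c p = on_charts A a c p" by simp
    then have "a c p = 0" using False by (auto simp: on_charts_def)
    moreover have "r c p = 0" using admissibleD(4)[OF r(1)] False by auto
    \<comment> \<open>Zero is a multiple of \<nu>, so its quotient is specified.\<close>
    moreover have "nu_div 0 = (0 :: 'n wform)" by (subst nu_div_nu_shift) (simp_all add: additive_simps pointwise)
    moreover have "graded_commutator L 0 b = 0" for L and b :: "'n wform"
      using graded_commutator_odd[OF is_form_zero] by (simp add: wick_simps)
    moreover have "nabla A \<Gamma> b c p = 0" for b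
      using False by (auto simp: off_charts)
    ultimately show ?thesis
      by (simp add: fedosov_D_def pointwise delta_def fib_delta.zero fib_delta.add fib_delta.diff fib_delta.minus i_over_nu_def ad_wick_def additive_simps)
  qed
qed

end

theorem theorem3p1:
  fixes A :: "('m::{t2_space, second_countable_topology}, 'n::{finite, linorder}) chart set"
    and J \<omega> :: "('m, 'n) tensor2"
    and \<Gamma> :: "('m, 'n) christoffel"
  assumes "almost_kaehler A J \<omega>"
    and "affine_connection A \<Gamma>"
    and "respects_almost_kaehler A J \<omega> \<Gamma>"
  shows "(\<exists>!r. fedosov_solution A J \<omega> \<Gamma> r) \<and>
    (\<forall>r. fedosov_solution A J \<omega> \<Gamma> r \<longrightarrow>
       Deg_comp 2 r = delta_inv (T_elem A \<omega> \<Gamma>) \<and>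
       Deg_comp 3 r =
         delta_inv (R_elem A \<omega> \<Gamma> + nabla A \<Gamma> (Deg_comp 2 r)
                    - i_over_nu (wick_prod J \<omega> (Deg_comp 2 r) (Deg_comp 2 r))) \<and>
       (\<forall>k\<ge>1. Deg_comp (k + 3) r =
         delta_inv (nabla A \<Gamma> (Deg_comp (k + 2) r)
                    - i_over_nu (\<Sum>l=0..k. wick_prod J \<omega> (Deg_comp (l + 2) r)
                                                       (Deg_comp (k - l + 2) r)))) \<and>
       (\<forall>a\<in>wick_forms A. fedosov_D A J \<omega> \<Gamma> r (fedosov_D A J \<omega> \<Gamma> r a) = 0))"
proof -
  interpret kaehler_manifold A J \<omega> \<Gamma> using assms by unfold_locales
  have "\<exists>!r. fedosov_solution A J \<omega> \<Gamma> r"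
    unfolding fedosov_solution_iff using iter_fixed_exists iter_fixed_unique by blast
  moreover have "Deg_comp 2 r = delta_inv (T_elem A \<omega> \<Gamma>) \<and>
       Deg_comp 3 r =
         delta_inv (R_elem A \<omega> \<Gamma> + nabla A \<Gamma> (Deg_comp 2 r)
                    - i_over_nu (wick_prod J \<omega> (Deg_comp 2 r) (Deg_comp 2 r))) \<and>
       (\<forall>k\<ge>1. Deg_comp (k + 3) r =
         delta_inv (nabla A \<Gamma> (Deg_comp (k + 2) r)
                    - i_over_nu (\<Sum>l=0..k. wick_prod J \<omega> (Deg_comp (l + 2) r) (Deg_comp (k - l + 2) r)))) \<and>
       (\<forall>a\<in>wick_forms A. fedosov_D A J \<omega> \<Gamma> r (fedosov_D A J \<omega> \<Gamma> r a) = 0)"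
    if "fedosov_solution A J \<omega> \<Gamma> r" for r
  proof -
    have r: "admissible r" "iter r = r" using that by (simp_all add: fedosov_solution_iff)
    show ?thesis
      proof (intro conjI allI impI ballI)
      show "Deg_comp 2 r = delta_inv (T_elem A \<omega> \<Gamma>)" by (rule recursion_2[OF r])
      show "Deg_comp 3 r = delta_inv (R_elem A \<omega> \<Gamma> + nabla A \<Gamma> (Deg_comp 2 r)
                    - i_over_nu (wick_prod J \<omega> (Deg_comp 2 r) (Deg_comp 2 r)))"
        using recursion[OF r, of 0] by (simp add: numeral_2_eq_2)
      show "Deg_comp (k + 3) r = delta_inv (nabla A \<Gamma> (Deg_comp (k + 2) r)
                    - i_over_nu (\<Sum>l=0..k. wick_prod J \<omega> (Deg_comp (l + 2) r) (Deg_comp (k - l + 2) r)))"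
        if "1 \<le> k" for k using recursion[OF r, of k] that by simp
    qed (rule fedosov_D_flat[OF r])
  qed
  ultimately show ?thesis by blast
qed

end
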